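(* Let $k$ be a complete, non-trivially valued non-Archimedean field and $\mu$ a probability measure with countable support on $\mathrm{SL}(2,k)$ such that the group $\Gamma$ generated by $\mathrm{supp}(\mu)$ is non-elementary. Then there exists a unique $\mu$-stationary probability measure $\nu$ on $\mathbb{P}^{1,an}_k$; it has no atoms, is supported on the limit set of $\Gamma$, and gives full mass to $\mathbb{P}^1(k)$ (so $\nu(\mathbb{H}_k)=0$). If moreover $\int\log\|\gamma\|\,d\mu(\gamma)<\infty$, then the Lyapunov exponent $\chi(\mu)$ is positive and $$\chi(\mu)=\int\sigma(\gamma,v)\,d\mu(\gamma)\,d\nu(v),$$ and for $\mathsf{P}$-a.e. $\omega$ and $\nu$-a.e. $v$, $\chi(\mu)=\lim_{n\to\infty}\frac1n\sigma(\ell_n(\omega),v)$.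
   Context: $\mathbb{P}^{1,an}_k$ is the Berkovich projective line, $\mathbb{P}^1(k)\subset\mathbb{P}^{1,an}_k$, and $\mathbb{H}_k=\overline{\mathrm{Conv}(\mathbb{P}^1(k))}\setminus\mathbb{P}^1(k)$. For $A\in\mathrm{SL}(2,k)$, $\|A\|$ is the max of the absolute values of its entries; for $\gamma\in\mathrm{PGL}(2,k)$ use a lift to $\mathrm{SL}(2,K)$, $K/k$ at most quadratic. $\Gamma$ is non-elementary if its image in $\mathrm{PGL}(2,k)$ contains a hyperbolic element (lift with $|\mathrm{tr}|>1$) and has no finite orbit on $\mathbb{P}^1(k)$. The limit set of $\Gamma$ is the smallest non-empty closed $\Gamma$-invariant subset of $\mathbb{P}^{1,an}_k$. $\nu$ is $\mu$-stationary if $\nu=\int\gamma_*\nu\,d\mu(\gamma)$. $\mu^n$ is the $n$-th convolution power, $\chi(\mu)=\lim_n\frac1n\int\log\|\gamma\|\,d\mu^n(\gamma)$. $(\Omega,\mathsf{P})=(\mathrm{SL}(2,k)^{\mathbb{N}^*},\mu^{\mathbb{N}^*})$, $\ell_n(\omega)=\gamma_n\cdots\gamma_1$ for $\omega=(\gamma_i)$. For $v\in\mathbb{P}^1(k)$ with representative $V=(x,y)\in k^2$ of max norm $1$, $\sigma(\gamma,v)=\log\max(|ax+by|,|cx+dy|)$ for $\gamma=\begin{pmatrix}a&b\\c&d\end{pmatrix}$; this extends continuously to $\mathbb{P}^{1,an}_k$. *)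

theory Defs
  imports "HOL-Probability.Probability" "HOL-Computational_Algebra.Polynomial"
begin

definition nonarch_abs :: "('k::field \<Rightarrow> real) \<Rightarrow> bool" where
  "nonarch_abs absv \<longleftrightarrow>
     (\<forall>x. absv x \<ge> 0) \<and> (\<forall>x. absv x = 0 \<longleftrightarrow> x = 0) \<and>
     (\<forall>x y. absv (x * y) = absv x * absv y) \<and>
     (\<forall>x y. absv (x + y) \<le> max (absv x) (absv y))"

definition nontrivial_abs :: "('k::field \<Rightarrow> real) \<Rightarrow> bool" where
  "nontrivial_abs absv \<longleftrightarrow> (\<exists>x. absv x \<noteq> 0 \<and> absv x \<noteq> 1)"

definition complete_abs :: "('k::field \<Rightarrow> real) \<Rightarrow> bool" where
  "complete_abs absv \<longleftrightarrow>
     (\<forall>X :: nat \<Rightarrow> 'k.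
        (\<forall>e>0. \<exists>N. \<forall>m\<ge>N. \<forall>n\<ge>N. absv (X m - X n) < e) \<longrightarrow>
        (\<exists>L. \<forall>e>0. \<exists>N. \<forall>n\<ge>N. absv (X n - L) < e))"

text \<open>A matrix (a b; c d) is encoded as the quadruple (a,b,c,d).\<close>
type_synonym 'k mat2 = "'k \<times> 'k \<times> 'k \<times> 'k"

fun mat2_mult :: "'k::field mat2 \<Rightarrow> 'k mat2 \<Rightarrow> 'k mat2" where
  "mat2_mult (a,b,c,d) (a',b',c',d') =
     (a*a' + b*c', a*b' + b*d', c*a' + d*c', c*b' + d*d')"

definition mat2_id :: "'k::field mat2" where
  "mat2_id = (1,0,0,1)"

fun mat2_inv_SL :: "'k::field mat2 \<Rightarrow> 'k mat2" where
  "mat2_inv_SL (a,b,c,d) = (d, -b, -c, a)"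

fun mat2_det :: "'k::field mat2 \<Rightarrow> 'k" where
  "mat2_det (a,b,c,d) = a*d - b*c"

fun mat2_tr :: "'k::field mat2 \<Rightarrow> 'k" where
  "mat2_tr (a,b,c,d) = a + d"

definition SL2 :: "'k::field mat2 set" where
  "SL2 = {g. mat2_det g = 1}"

fun mat2_norm :: "('k::field \<Rightarrow> real) \<Rightarrow> 'k mat2 \<Rightarrow> real" where
  "mat2_norm absv (a,b,c,d) = max (max (absv a) (absv b)) (max (absv c) (absv d))"

inductive_set gen_group :: "'k::field mat2 set \<Rightarrow> 'k mat2 set" for S where
  gen_id: "mat2_id \<in> gen_group S"
| gen_mult: "g \<in> S \<Longrightarrow> h \<in> gen_group S \<Longrightarrow> mat2_mult g h \<in> gen_group S"
| gen_inv: "g \<in> S \<Longrightarrow> h \<in> gen_group S \<Longrightarrow> mat2_mult (mat2_inv_SL g) h \<in> gen_group S"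

text \<open>Points of the Berkovich affine line: multiplicative seminorms on k[T]
  extending the absolute value of k. The Berkovich projective line is the
  affine line together with a point at infinity (None).\<close>

definition berk_aff :: "('k::field \<Rightarrow> real) \<Rightarrow> ('k poly \<Rightarrow> real) set" where
  "berk_aff absv = {s. (\<forall>c. s [:c:] = absv c) \<and> (\<forall>f. s f \<ge> 0) \<and>
      (\<forall>f g. s (f * g) = s f * s g) \<and> (\<forall>f g. s (f + g) \<le> s f + s g)}"

text \<open>Topology on the affine line: weakest topology making all evaluations
  \<open>s \<mapsto> s f\<close> continuous (= subspace of the product topology).\<close>
definition berk_aff_top :: "('k::field \<Rightarrow> real) \<Rightarrow> ('k poly \<Rightarrow> real) topology" where
  "berk_aff_top absv = subtopology euclidean (berk_aff absv)"

text \<open>The Berkovich projective line as the one-point compactification of the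
  (locally compact Hausdorff) Berkovich affine line.\<close>
definition berk_top :: "('k::field \<Rightarrow> real) \<Rightarrow> ('k poly \<Rightarrow> real) option topology" where
  "berk_top absv = topology (\<lambda>U. U \<subseteq> insert None (Some ` berk_aff absv) \<and>
       openin (berk_aff_top absv) (Some -` U) \<and>
       (None \<in> U \<longrightarrow> compactin (berk_aff_top absv) (berk_aff absv - Some -` U)))"

definition P1an :: "('k::field \<Rightarrow> real) \<Rightarrow> ('k poly \<Rightarrow> real) option set" where
  "P1an absv = insert None (Some ` berk_aff absv)"

definition berk_borel :: "('k::field \<Rightarrow> real) \<Rightarrow> ('k poly \<Rightarrow> real) option measure" where
  "berk_borel absv = sigma (P1an absv) {U. openin (berk_top absv) U}"

definition typeI :: "('k::field \<Rightarrow> real) \<Rightarrow> 'k \<Rightarrow> ('k poly \<Rightarrow> real) option" where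
  "typeI absv z = Some (\<lambda>f. absv (poly f z))"

definition P1k :: "('k::field \<Rightarrow> real) \<Rightarrow> ('k poly \<Rightarrow> real) option set" where
  "P1k absv = insert None (range (typeI absv))"

text \<open>Action of (a b; c d) on P^{1,an}, extending the Moebius map
  z \<mapsto> (a z + b)/(c z + d): the image of a seminorm x is f \<mapsto> x(f \<circ> \<phi>),
  where f \<circ> \<phi> = F/(cT+d)^deg f with F the homogenised polynomial below.\<close>
definition mob_hom :: "'k::field mat2 \<Rightarrow> 'k poly \<Rightarrow> 'k poly" where
  "mob_hom g f = (case g of (a,b,c,d) \<Rightarrow>
     (\<Sum>i\<le>degree f. smult (coeff f i) ([:b,a:] ^ i * [:d,c:] ^ (degree f - i))))"

fun berk_act :: "('k::field \<Rightarrow> real) \<Rightarrow> 'k mat2 \<Rightarrow> ('k poly \<Rightarrow> real) option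
                 \<Rightarrow> ('k poly \<Rightarrow> real) option" where
  "berk_act absv (a,b,c,d) None = (if c = 0 then None else typeI absv (a / c))"
| "berk_act absv (a,b,c,d) (Some s) =
     (if s [:d,c:] = 0 then None
      else Some (\<lambda>f. s (mob_hom (a,b,c,d) f) / s [:d,c:] ^ degree f))"

definition non_elementary :: "('k::field \<Rightarrow> real) \<Rightarrow> 'k mat2 set \<Rightarrow> bool" where
  "non_elementary absv G \<longleftrightarrow>
     (\<exists>g\<in>G. absv (mat2_tr g) > 1) \<and>
     (\<forall>v\<in>P1k absv. infinite {berk_act absv g v | g. g \<in> G})"

text \<open>Limit set: the smallest non-empty closed G-invariant subset of P^{1,an},
  written as the intersection of all such sets.\<close>
definition limit_set :: "('k::field \<Rightarrow> real) \<Rightarrow> 'k mat2 set \<Rightarrow> ('k poly \<Rightarrow> real) option set" where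
  "limit_set absv G = \<Inter> {L. L \<noteq> {} \<and> closedin (berk_top absv) L \<and>
                            (\<forall>g\<in>G. berk_act absv g ` L \<subseteq> L)}"

definition stationary :: "('k::field \<Rightarrow> real) \<Rightarrow> 'k mat2 pmf \<Rightarrow> ('k poly \<Rightarrow> real) option measure \<Rightarrow> bool" where
  "stationary absv \<mu> \<nu> \<longleftrightarrow>
     prob_space \<nu> \<and> sets \<nu> = sets (berk_borel absv) \<and> space \<nu> = P1an absv \<and>
     (\<forall>A\<in>sets \<nu>. emeasure \<nu> A =
        (\<integral>\<^sup>+ g. emeasure \<nu> (berk_act absv g -` A \<inter> space \<nu>) \<partial>measure_pmf \<mu>))"

fun conv_pow :: "'k::field mat2 pmf \<Rightarrow> nat \<Rightarrow> 'k mat2 pmf" where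
  "conv_pow \<mu> 0 = return_pmf mat2_id"
| "conv_pow \<mu> (Suc n) = bind_pmf (conv_pow \<mu> n) (\<lambda>h. map_pmf (\<lambda>g. mat2_mult g h) \<mu>)"

text \<open>Left random walk \<open>\<ell>_n(\<omega>) = \<gamma>_n \<cdots> \<gamma>_1\<close>, where \<omega> i stands for \<gamma>_{i+1}.\<close>
fun lwalk :: "(nat \<Rightarrow> 'k::field mat2) \<Rightarrow> nat \<Rightarrow> 'k mat2" where
  "lwalk \<omega> 0 = mat2_id"
| "lwalk \<omega> (Suc n) = mat2_mult (\<omega> n) (lwalk \<omega> n)"

text \<open>Cocycle \<sigma>(\<gamma>,v), continuously extended to P^{1,an}.\<close>
fun sigma_coc :: "('k::field \<Rightarrow> real) \<Rightarrow> 'k mat2 \<Rightarrow> ('k poly \<Rightarrow> real) option \<Rightarrow> real" where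
  "sigma_coc absv (a,b,c,d) None = ln (max (absv a) (absv c))"
| "sigma_coc absv (a,b,c,d) (Some s) =
     ln (max (s [:b,a:]) (s [:d,c:])) - ln (max (s [:0,1:]) 1)"

end

theory Submission
  imports Defs
begin

text \<open>
  A point \<open>x\<close> of the Berkovich line is identified with the norm it induces on the plane of linear forms;
  \<open>\<sigma>(g,x)\<close> is then the logarithm of the dilation of that norm by \<open>g\<close>, and the distance from \<open>x\<close> to a
  \<open>k\<close>-point is ultrametric. Non-elementarity produces, in the semigroup generated by the support, elements
  of large norm and elements that spread any point of the projective line. This forces the norms of the walk to
  escape to infinity in probability and prevents its images from concentrating on small balls, uniformly in the
  starting point; as \<open>\<delta>(gx,gv)\<close> is \<open>\<delta>(x,v)\<close> divided by the two dilations, long products contract uniformly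
  in probability. Hence the right random walk converges almost surely to a \<open>k\<close>-point, by completeness, and the
  law \<open>\<nu>\<close> of the limit is the only stationary measure, without atoms.

  For the exponent, let \<open>a\<^sub>n\<close> be the mean of \<open>log \<parallel>\<ell>\<^sub>n\<parallel>\<close> and \<open>\<chi>\<close> the \<open>\<nu>\<close>-mean of the cocycle. Outside a small
  ball around the repelling direction \<open>\<sigma>(g,x)\<close> is within a constant of \<open>log \<parallel>g\<parallel>\<close>, and \<open>\<nu>\<close> gives uniformly
  little mass to small balls, so \<open>a\<^sub>n / n \<longlongrightarrow> \<chi>\<close>. Positivity of \<open>\<chi>\<close> is contraction again: \<open>\<sigma>(g,u) + \<sigma>(g,v)\<close> is
  minus the logarithm of the distance of \<open>gu\<close> and \<open>gv\<close>, up to a constant. Since \<open>\<sigma>(\<ell>\<^sub>n,v)\<close> has mean \<open>n\<chi>\<close> and lies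
  below \<open>log \<parallel>\<ell>\<^sub>n\<parallel>\<close>, whose positive deviations above \<open>n\<chi>\<close> are controlled by a law of large numbers for
  blocks, \<open>\<sigma>(\<ell>\<^sub>n,v) / n\<close> converges to \<open>\<chi>\<close> in mean; the maximal ergodic inequality for the skew product upgrades
  this to almost everywhere convergence.
\<close>


section \<open>Plane linear algebra over a valued field\<close>

text \<open>The field need not be locally compact, so the projective line over \<open>k\<close> need
  not be compact, and the Borel sets of \<open>P1an\<close> come from a topology that need not have
  a countable base. Two substitutes run through the proof. Compactness is replaced by counting: the
  supremum, over all starting data, of the probability of a bad event decreases in time; if it did
  not become small, many separated translates of one bad event would keep a fixed probability
  although they are disjoint. Separability is replaced by the countable orbit of one vector under
  the semigroup: the stationary measure lives on its ultrametric closure, where open sets are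
  countable unions of balls.

  Non-elementarity concerns the group, while the walk only sees the semigroup, so a hyperbolic
  element and points in general position must first be found there. Over a field that is not
  algebraically closed, linear forms do not separate the points of the Berkovich line, so the
  composition law of the action is proved on norms and used on sets that depend on the norm
  alone.\<close>

fun mv :: "'k::field mat2 \<Rightarrow> 'k \<times> 'k \<Rightarrow> 'k \<times> 'k" where
  "mv (a,b,c,d) (x,y) = (a*x + b*y, c*x + d*y)"

fun wedge :: "'k::field \<times> 'k \<Rightarrow> 'k \<times> 'k \<Rightarrow> 'k" where
  "wedge (x,y) (x',y') = x*y' - y*x'"

fun vsc :: "'k::field \<Rightarrow> 'k \<times> 'k \<Rightarrow> 'k \<times> 'k" where
  "vsc c (x,y) = (c*x, c*y)"

lemma mat2_mult_assoc: "mat2_mult (mat2_mult f g) h = mat2_mult f (mat2_mult g h)"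
  by (cases f; cases g; cases h) (auto simp: algebra_simps)

lemma mat2_mult_id [simp]: "mat2_mult mat2_id g = g" "mat2_mult g mat2_id = g"
  by (cases g; simp add: mat2_id_def)+

lemma mat2_det_mult: "mat2_det (mat2_mult g h) = mat2_det g * mat2_det h"
  by (cases g; cases h) (simp add: algebra_simps)

lemma SL2_id [simp]: "mat2_id \<in> SL2"
  by (simp add: SL2_def mat2_id_def)

lemma SL2_mult [simp]: "g \<in> SL2 \<Longrightarrow> h \<in> SL2 \<Longrightarrow> mat2_mult g h \<in> SL2"
  by (simp add: SL2_def mat2_det_mult)

lemma SL2_inv [simp]: "mat2_inv_SL g \<in> SL2 \<longleftrightarrow> g \<in> SL2"
  by (cases g) (simp add: SL2_def algebra_simps)

lemma mat2_inv_inv [simp]: "mat2_inv_SL (mat2_inv_SL g) = g"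
  by (cases g) simp

lemma mat2_inv_id [simp]: "mat2_inv_SL mat2_id = mat2_id"
  by (simp add: mat2_id_def)

lemma mat2_inv_mult: "mat2_inv_SL (mat2_mult g h) = mat2_mult (mat2_inv_SL h) (mat2_inv_SL g)"
  by (cases g; cases h) (simp add: algebra_simps)

lemma mat2_inv_left: "g \<in> SL2 \<Longrightarrow> mat2_mult (mat2_inv_SL g) g = mat2_id"
  and mat2_inv_right: "g \<in> SL2 \<Longrightarrow> mat2_mult g (mat2_inv_SL g) = mat2_id"
  by (cases g; simp add: SL2_def mat2_id_def algebra_simps)+

lemma mat2_tr_commute: "mat2_tr (mat2_mult g h) = mat2_tr (mat2_mult h g)"
  by (cases g; cases h) (simp add: algebra_simps)

lemma mat2_tr_conj:
  "P \<in> SL2 \<Longrightarrow> mat2_tr (mat2_mult P (mat2_mult g (mat2_inv_SL P))) = mat2_tr g"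
  by (metis mat2_tr_commute mat2_mult_assoc mat2_inv_left mat2_mult_id(2))

lemma mv_mult: "mv (mat2_mult g h) v = mv g (mv h v)"
  by (cases g; cases h; cases v) (simp add: algebra_simps)

lemma mv_id [simp]: "mv mat2_id v = v"
  by (cases v) (simp add: mat2_id_def)

lemma mv_inv_left [simp]: "g \<in> SL2 \<Longrightarrow> mv (mat2_inv_SL g) (mv g v) = v"
  and mv_inv_right [simp]: "g \<in> SL2 \<Longrightarrow> mv g (mv (mat2_inv_SL g) v) = v"
  by (simp_all add: mv_mult[symmetric] mat2_inv_left mat2_inv_right)

lemma mv_zero [simp]: "mv g (0,0) = (0,0)"
  by (cases g) simp

lemma mv_eq_0_iff [simp]: "g \<in> SL2 \<Longrightarrow> mv g v = (0,0) \<longleftrightarrow> v = (0,0)"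
  by (metis mv_inv_left mv_zero)

lemma mv_vsc: "mv g (vsc c v) = vsc c (mv g v)"
  by (cases g; cases v) (simp add: algebra_simps)

lemma mv_add: "mv g (u + v) = mv g u + mv g v"
  by (cases g; cases u; cases v) (simp add: algebra_simps)

lemma vsc_vsc: "vsc c (vsc d v) = vsc (c * d) v"
  by (cases v) (simp add: algebra_simps)

lemma vsc_eq_0_iff [simp]: "vsc c v = (0,0) \<longleftrightarrow> c = 0 \<or> v = (0,0)"
  by (cases v) auto

lemma wedge_mv_det: "wedge (mv g u) (mv g v) = mat2_det g * wedge u v"
  by (cases g; cases u; cases v) (simp add: algebra_simps)

lemma wedge_mv: "g \<in> SL2 \<Longrightarrow> wedge (mv g u) (mv g v) = wedge u v"
  by (simp add: wedge_mv_det SL2_def)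

lemma wedge_self [simp]: "wedge v v = 0"
  by (cases v) simp

lemma wedge_vsc: "wedge (vsc c u) v = c * wedge u v" "wedge u (vsc c v) = c * wedge u v"
  by (cases u; cases v; simp add: algebra_simps)+

lemma wedge_zero [simp]: "wedge (0,0) v = 0" "wedge v (0,0) = 0"
  by (cases v; simp)+

lemma wedge_skew: "wedge u v = - wedge v u"
  by (cases u; cases v) (simp add: algebra_simps)

lemma wedge_eq_0_imp_parallel:
  assumes "wedge u v = 0" "u \<noteq> (0,0)"
  obtains c where "v = vsc c u"
proof (cases u; cases v)
  fix x y x' y' assume uv: "u = (x,y)" "v = (x',y')"
  show thesis
  proof (cases "x = 0")
    case True
    with assms uv have "y \<noteq> 0" "x' = 0" by auto
    with uv True that[of "y'/y"] show thesis by simp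
  next
    case False
    have "y' = x' / x * y" using assms(1) uv False by (simp add: field_simps)
    with uv False that[of "x'/x"] show thesis by simp
  qed
qed

text \<open>Cramer's rule in the plane, a Pluecker relation. The ultrametric inequalities for
  \<open>chord\<close> and \<open>delta\<close> are this identity with norms taken.\<close>

lemma wedge_plucker: "vsc (wedge u w) v = vsc (wedge u v) w + vsc (wedge v w) u"
  by (cases u; cases v; cases w) (simp add: algebra_simps)

lemma gen_group_sub_SL2: "g \<in> gen_group S \<Longrightarrow> S \<subseteq> SL2 \<Longrightarrow> g \<in> SL2"
  by (induction rule: gen_group.induct) (blast intro: SL2_id SL2_mult SL2_inv[THEN iffD2] dest: subsetD)+

section \<open>Valued field, max norm and chordal distance\<close>

locale nonarch_field =
  fixes absv :: "'k::field \<Rightarrow> real"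
  assumes nonarch: "nonarch_abs absv"
begin

lemma absv_nonneg [simp]: "0 \<le> absv x"
  and absv_eq_0_iff [simp]: "absv x = 0 \<longleftrightarrow> x = 0"
  and absv_mult: "absv (x * y) = absv x * absv y"
  and absv_add_le: "absv (x + y) \<le> max (absv x) (absv y)"
  using nonarch by (auto simp: nonarch_abs_def)

lemma absv_0 [simp]: "absv 0 = 0" by simp

lemma absv_pos_iff [simp]: "0 < absv x \<longleftrightarrow> x \<noteq> 0"
  using absv_nonneg[of x] absv_eq_0_iff[of x] by linarith

lemma absv_1 [simp]: "absv 1 = 1"
  using absv_mult[of 1 1] absv_pos_iff[of 1] by simp

lemma absv_minus [simp]: "absv (- x) = absv x"
proof -
  have "absv (-1) * absv (-1) = 1" using absv_mult[of "-1" "-1"] by simp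
  then have "absv (-1) = 1" using absv_nonneg[of "-1"] by (simp add: square_eq_1_iff)
  then show ?thesis using absv_mult[of "-1" x] by simp
qed

lemma absv_diff_commute: "absv (x - y) = absv (y - x)"
  using absv_minus[of "x - y"] by simp

lemma absv_diff_le: "absv (x - y) \<le> max (absv x) (absv y)"
  using absv_add_le[of x "-y"] by simp

lemma absv_inverse: "absv (inverse x) = inverse (absv x)"
proof (cases "x = 0")
  case False
  then have "absv x * absv (inverse x) = 1" by (simp add: absv_mult[symmetric])
  with False show ?thesis by (simp add: field_simps)
qed simp

lemma absv_divide: "absv (x / y) = absv x / absv y"
  by (simp add: divide_inverse absv_mult absv_inverse)

lemma absv_power: "absv (x ^ n) = absv x ^ n"
  by (induction n) (simp_all add: absv_mult)

lemma absv_of_nat_le: "absv (of_nat n) \<le> 1"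
proof (induction n)
  case (Suc n)
  then show ?case using absv_add_le[of 1 "of_nat n"] by simp
qed simp

lemma absv_add_eq: "absv x < absv y \<Longrightarrow> absv (x + y) = absv y"
  using absv_add_le[of x y] absv_diff_le[of "x + y" x] by simp

lemma absv_add_eq': "absv x < absv y \<Longrightarrow> absv (y + x) = absv y"
  using absv_add_eq[of x y] by (simp add: add.commute)

lemma absv_diff_eq: "absv x < absv y \<Longrightarrow> absv (x - y) = absv y"
  using absv_add_eq[of x "-y"] by simp

lemma absv_diff_eq': "absv x < absv y \<Longrightarrow> absv (y - x) = absv y"
  using absv_add_eq'[of "-x" y] by simp

fun vn :: "'k \<times> 'k \<Rightarrow> real" where
  "vn (x,y) = max (absv x) (absv y)"

text \<open>The chordal metric of the projective line, on representatives: invariant under scaling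
  either vector by a nonzero constant. A zero vector gives 0 through division by zero, so the
  ultrametric inequality is stated for nonzero vectors.\<close>

definition chord :: "'k \<times> 'k \<Rightarrow> 'k \<times> 'k \<Rightarrow> real" where
  "chord u v = absv (wedge u v) / (vn u * vn v)"

lemma vn_nonneg [simp]: "0 \<le> vn v"
  by (cases v) (simp add: le_max_iff_disj)

lemma vn_pos_iff [simp]: "0 < vn v \<longleftrightarrow> v \<noteq> (0,0)"
  by (cases v) (auto simp: less_max_iff_disj)

lemma vn_eq_0_iff [simp]: "vn v = 0 \<longleftrightarrow> v = (0,0)"
  using vn_pos_iff[of v] vn_nonneg[of v] by (metis less_le)

lemma vn_vsc: "vn (vsc c v) = absv c * vn v"
  by (cases v) (simp add: absv_mult max_mult_distrib_left)

lemma vn_add_le: "vn (u + v) \<le> max (vn u) (vn v)"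
proof (cases u; cases v)
  fix x y x' y' assume uv: "u = (x,y)" "v = (x',y')"
  show ?thesis using uv absv_add_le[of x x'] absv_add_le[of y y'] by auto
qed

lemma norm_nonneg [simp]: "0 \<le> mat2_norm absv g"
  by (cases g) (simp add: le_max_iff_disj)

lemma norm_entry_le:
  "absv a \<le> mat2_norm absv (a,b,c,d)" "absv b \<le> mat2_norm absv (a,b,c,d)"
  "absv c \<le> mat2_norm absv (a,b,c,d)" "absv d \<le> mat2_norm absv (a,b,c,d)"
  by auto

lemma vn_mv_le: "vn (mv g v) \<le> mat2_norm absv g * vn v"
proof (cases g; cases v)
  fix a b c d x y assume gv: "g = (a,b,c,d)" "v = (x,y)"
  have *: "absv (p * x + q * y) \<le> mat2_norm absv g * vn v"
    if "absv p \<le> mat2_norm absv g" "absv q \<le> mat2_norm absv g" for p q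
  proof -
    have "absv (p * x) \<le> mat2_norm absv g * vn v" "absv (q * y) \<le> mat2_norm absv g * vn v"
      using that gv(2) by (auto simp: absv_mult intro!: mult_mono)
    then show ?thesis using absv_add_le[of "p*x" "q*y"] by linarith
  qed
  have "absv (a * x + b * y) \<le> mat2_norm absv g * vn v" "absv (c * x + d * y) \<le> mat2_norm absv g * vn v"
    by (rule *; (unfold gv, rule norm_entry_le))+
  then show ?thesis using gv by simp
qed

lemma norm_mult_le: "mat2_norm absv (mat2_mult g h) \<le> mat2_norm absv g * mat2_norm absv h"
proof (cases g; cases h)
  fix a b c d a' b' c' d' assume gh: "g = (a,b,c,d)" "h = (a',b',c',d')"
  have "vn (a',c') \<le> mat2_norm absv h" "vn (b',d') \<le> mat2_norm absv h"
    using gh by auto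
  then have "vn (mv g (a',c')) \<le> mat2_norm absv g * mat2_norm absv h"
     "vn (mv g (b',d')) \<le> mat2_norm absv g * mat2_norm absv h"
    by (meson vn_mv_le mult_left_mono norm_nonneg order_trans)+
  then show ?thesis using gh by simp
qed

lemma norm_inv [simp]: "mat2_norm absv (mat2_inv_SL g) = mat2_norm absv g"
  by (cases g) (simp add: max.commute max.left_commute)

lemma norm_id [simp]: "mat2_norm absv mat2_id = 1"
  by (simp add: mat2_id_def)

lemma tr_le_norm: "absv (mat2_tr g) \<le> mat2_norm absv g"
proof (cases g)
  case (fields a b c d)
  then show ?thesis using absv_add_le[of a d] by auto
qed

text \<open>The inverse has the same norm, so submultiplicativity applied to \<open>g\<close> times
  its inverse gives 1 as a lower bound for the squared norm.\<close>

lemma norm_ge_1: "g \<in> SL2 \<Longrightarrow> 1 \<le> mat2_norm absv g"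
proof -
  assume g: "g \<in> SL2"
  have "1 \<le> mat2_norm absv g * mat2_norm absv g"
    using norm_mult_le[of g "mat2_inv_SL g"] g by (simp add: mat2_inv_right)
  then show ?thesis
    using power_less_one_iff[of "mat2_norm absv g" 2] by (auto simp: power2_eq_square not_le[symmetric])
qed

lemma vn_mv_ge: "g \<in> SL2 \<Longrightarrow> vn v \<le> mat2_norm absv g * vn (mv g v)"
  using vn_mv_le[of "mat2_inv_SL g" "mv g v"] by simp

lemma chord_nonneg [simp]: "0 \<le> chord u v"
  by (simp add: chord_def)

lemma wedge_le: "absv (wedge u v) \<le> vn u * vn v"
proof (cases u; cases v)
  fix x y x' y' assume uv: "u = (x,y)" "v = (x',y')"
  have "absv (x * y') \<le> vn u * vn v" "absv (y * x') \<le> vn u * vn v"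
    using uv by (auto simp: absv_mult le_max_iff_disj intro!: mult_mono)
  then show ?thesis using uv absv_diff_le[of "x*y'" "y*x'"] by simp
qed

lemma chord_le_1 [simp]: "chord u v \<le> 1"
  using wedge_le[of u v] by (auto simp: chord_def divide_le_eq_1 less_le)

lemma chord_commute: "chord u v = chord v u"
  by (metis chord_def wedge_skew absv_minus mult.commute)

lemma chord_self [simp]: "chord v v = 0"
  by (simp add: chord_def)

lemma chord_ultra:
  assumes "u \<noteq> (0,0)" "v \<noteq> (0,0)" "w \<noteq> (0,0)"
  shows "chord u w \<le> max (chord u v) (chord v w)"
proof -
  have "absv (wedge u w) * vn v \<le> max (absv (wedge u v) * vn w) (absv (wedge v w) * vn u)"
    by (metis vn_vsc wedge_plucker vn_add_le)
  then have "absv (wedge u w) * vn v / (vn u * vn v * vn w)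
     \<le> max (absv (wedge u v) * vn w) (absv (wedge v w) * vn u) / (vn u * vn v * vn w)"
    by (rule divide_right_mono) simp
  also have "\<dots> = max (absv (wedge u v) * vn w / (vn u * vn v * vn w)) (absv (wedge v w) * vn u / (vn u * vn v * vn w))"
    by (rule max_divide_distrib_right[THEN trans]) (auto simp: less_le)
  finally show ?thesis
    using assms by (simp add: chord_def mult.commute mult.left_commute)
qed

lemma chord_mv_eq:
  "g \<in> SL2 \<Longrightarrow> chord (mv g u) (mv g v) = absv (wedge u v) / (vn (mv g u) * vn (mv g v))"
  by (simp add: chord_def wedge_mv)

text \<open>The wedge is invariant under \<open>SL2\<close> and each vector shrinks at most by the
  factor \<open>mat2_norm absv g\<close>, hence the square.\<close>

lemma chord_mv_le:
  assumes "g \<in> SL2"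
  shows "chord (mv g u) (mv g v) \<le> (mat2_norm absv g)\<^sup>2 * chord u v"
proof (cases "u = (0,0) \<or> v = (0,0)")
  case True
  then show ?thesis by (auto simp: chord_def)
next
  case False
  have 1: "vn u * vn v \<le> (mat2_norm absv g * vn (mv g u)) * (mat2_norm absv g * vn (mv g v))"
    using vn_mv_ge[OF assms] by (intro mult_mono) auto
  have "absv (wedge u v) * (vn u * vn v)
     \<le> absv (wedge u v) * ((mat2_norm absv g * vn (mv g u)) * (mat2_norm absv g * vn (mv g v)))"
    by (intro mult_left_mono 1) simp
  then show ?thesis using False assms
    by (simp add: chord_def wedge_mv field_simps power2_eq_square)
qed

end

section \<open>Points of the Berkovich line as norms on the plane\<close>

text \<open>For \<open>n\<close> at least \<open>degree f\<close> this is B^n f(A/B). At a fixed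
  \<open>n\<close> the substitution is additive, whereas \<open>mob_hom\<close>, which uses the
  exact degree, is not, since degrees may drop in a sum.\<close>

definition hom_subst :: "'k::field poly \<Rightarrow> 'k poly \<Rightarrow> nat \<Rightarrow> 'k poly \<Rightarrow> 'k poly" where
  "hom_subst A B n f = (\<Sum>i\<le>n. smult (coeff f i) (A ^ i * B ^ (n - i)))"

lemma mob_hom_eq: "mob_hom (a,b,c,d) f = hom_subst [:b,a:] [:d,c:] (degree f) f"
  by (simp add: mob_hom_def hom_subst_def)

lemma hom_subst_0 [simp]: "hom_subst A B n 0 = 0"
  by (simp add: hom_subst_def)

lemma hom_subst_add: "hom_subst A B n (f + g) = hom_subst A B n f + hom_subst A B n g"
  by (simp add: hom_subst_def smult_add_left sum.distrib)

lemma hom_subst_smult: "hom_subst A B n (smult c f) = smult c (hom_subst A B n f)"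
proof -
  have c: "smult c p = [:c:] * p" for p :: "'a poly" by simp
  show ?thesis by (simp only: hom_subst_def c sum_distrib_left) (simp add: mult.commute)
qed

lemma hom_subst_pCons:
  "hom_subst A B (Suc n) (pCons a f) = smult a (B ^ Suc n) + A * hom_subst A B n f"
proof -
  have "hom_subst A B (Suc n) (pCons a f) = smult a (B ^ Suc n)
      + (\<Sum>i\<le>n. smult (coeff f i) (A ^ Suc i * B ^ (n - i)))"
    unfolding hom_subst_def by (subst sum.atMost_Suc_shift) simp
  also have "(\<Sum>i\<le>n. smult (coeff f i) (A ^ Suc i * B ^ (n - i))) = A * hom_subst A B n f"
    by (simp add: hom_subst_def sum_distrib_left mult.assoc)
  finally show ?thesis .
qed

lemma hom_subst_lift:
  assumes "degree f \<le> n"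
  shows "hom_subst A B (n + m) f = hom_subst A B n f * B ^ m"
proof -
  have "hom_subst A B (n + m) f = (\<Sum>i\<le>n. smult (coeff f i) (A ^ i * B ^ (n + m - i)))"
    unfolding hom_subst_def
    by (rule sum.mono_neutral_right) (use assms in \<open>auto simp: coeff_eq_0\<close>)
  also have "\<dots> = (\<Sum>i\<le>n. smult (coeff f i) (A ^ i * B ^ (n - i)) * B ^ m)"
  proof (rule sum.cong)
    fix i assume "i \<in> {..n}"
    then have "n + m - i = (n - i) + m" by simp
    then show "smult (coeff f i) (A ^ i * B ^ (n + m - i)) = smult (coeff f i) (A ^ i * B ^ (n - i)) * B ^ m"
      by (simp add: power_add mult.assoc)
  qed simp
  finally show ?thesis by (simp add: hom_subst_def sum_distrib_right)
qed

lemma hom_subst_const: "hom_subst A B n [:c:] = smult c (B ^ n)"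
  using hom_subst_lift[of "[:c:]" 0 A B n] by (simp add: hom_subst_def)

lemma hom_subst_mult:
  assumes "degree f \<le> n" "degree g \<le> m"
  shows "hom_subst A B (n + m) (f * g) = hom_subst A B n f * hom_subst A B m g"
  using assms(1)
proof (induction f arbitrary: n)
  case 0
  then show ?case by simp
next
  case (pCons a f)
  have lg: "hom_subst A B (n + m) g = B ^ n * hom_subst A B m g" for n
    using hom_subst_lift[OF assms(2), of A B n] by (simp add: add.commute mult.commute)
  show ?case
  proof (cases "f = 0")
    case True
    then show ?thesis by (simp add: hom_subst_const hom_subst_smult lg)
  next
    case False
    then obtain n' where n': "n = Suc n'" "degree f \<le> n'"
      using pCons.prems by (cases n) auto
    have "hom_subst A B (Suc (n' + m)) (pCons a f * g)
       = hom_subst A B (Suc n' + m) (smult a g) + hom_subst A B (Suc (n' + m)) (pCons 0 (f * g))"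
      by (simp add: hom_subst_add)
    also have "\<dots> = smult a (B ^ Suc n' * hom_subst A B m g) + A * hom_subst A B (n' + m) (f * g)"
      by (simp only: hom_subst_smult lg hom_subst_pCons) simp
    also have "\<dots> = hom_subst A B (Suc n') (pCons a f) * hom_subst A B m g"
      using pCons.IH[OF n'(2)] by (simp only: hom_subst_pCons) (simp add: algebra_simps)
    finally show ?thesis using n' by simp
  qed
qed

lemma max_divide: "0 \<le> c \<Longrightarrow> max a b / c = max (a / c) (b / (c::real))"
  by (simp add: max_divide_distrib_right)

text \<open>A factor of linear growth disappears in the n-th root.\<close>

lemma le_of_power_le_linear:
  fixes x m :: real
  assumes "\<And>n. x ^ n \<le> (real n + 1) * m ^ n" "0 \<le> m"
  shows "x \<le> m"
proof (rule ccontr)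
  assume "\<not> x \<le> m"
  then have xm: "m < x" by simp
  show False
  proof (cases "m = 0")
    case True
    then show False using assms(1)[of 1] xm by simp
  next
    case False
    define e where "e = x / m - 1"
    have e: "e > 0" using xm False assms(2) by (simp add: e_def field_simps)
    have t: "(1 + e) ^ n \<le> real n + 1" for n
    proof -
      have "(1 + e) ^ n = x ^ n / m ^ n" by (simp add: e_def power_divide)
      also have "\<dots> \<le> real n + 1" using assms(1)[of n] False assms(2) by (simp add: field_simps)
      finally show ?thesis .
    qed
    obtain n :: nat where n: "2 / e\<^sup>2 < real n" using reals_Archimedean2 by blast
    have "n > 0" using n e by (metis divide_pos_pos of_nat_0_less_iff zero_less_numeral zero_less_power less_trans)
    have "1 + real n * e \<le> (1 + e) ^ n" using Bernoulli_inequality[of e n] e by simp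
    \<comment> \<open>Bernoulli alone grows linearly, which the hypothesis permits; squaring it and
      using the exponent 2n sets quadratic growth against linear growth.\<close>
    then have "(1 + real n * e)\<^sup>2 \<le> ((1 + e) ^ n)\<^sup>2" using e by (intro power_mono) auto
    also have "\<dots> = (1 + e) ^ (2 * n)" by (simp add: power_mult[symmetric] mult.commute)
    also have "\<dots> \<le> 2 * real n + 1" using t[of "2 * n"] by simp
    finally have "real n * (2 * e + real n * e\<^sup>2) \<le> real n * 2"
      by (simp add: power2_eq_square algebra_simps)
    then have "2 * e + real n * e\<^sup>2 \<le> 2" using \<open>n > 0\<close> by simp
    moreover have "2 < real n * e\<^sup>2" using n e by (simp add: field_simps)
    ultimately show False using e by simp
  qed
qed

context nonarch_field
begin

lemma
  assumes "s \<in> berk_aff absv"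
  shows berk_const: "s [:c:] = absv c" and berk_nonneg: "0 \<le> s f"
    and berk_mult: "s (f * g) = s f * s g" and berk_add_le: "s (f + g) \<le> s f + s g"
  using assms by (auto simp: berk_aff_def)

context
  fixes s assumes s: "s \<in> berk_aff absv"
begin

lemma berk_0 [simp]: "s 0 = 0"
  using berk_const[OF s, of 0] by simp

lemma berk_1 [simp]: "s 1 = 1"
  using berk_const[OF s, of 1] by (simp add: one_pCons)

lemma berk_smult: "s (smult c f) = absv c * s f"
  using berk_mult[OF s, of "[:c:]" f] berk_const[OF s, of c] by simp

lemma berk_minus [simp]: "s (- f) = s f"
  using berk_smult[of "-1" f] by simp

lemma berk_power: "s (f ^ n) = s f ^ n"
  by (induction n) (simp_all add: berk_mult[OF s])

lemma berk_sum_le: "finite I \<Longrightarrow> s (sum f I) \<le> (\<Sum>i\<in>I. s (f i))"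
proof (induction I rule: finite_induct)
  case (insert i I)
  then show ?case using berk_add_le[OF s, of "f i" "sum f I"] by simp
qed simp

text \<open>\<open>berk_aff\<close> only asks for the triangle inequality. Binomial coefficients
  have norm at most 1, so the binomial expansion bounds the n-th power of the left side by n + 1
  times the n-th power of the maximum.\<close>

lemma berk_ultra: "s (f + g) \<le> max (s f) (s g)"
proof (rule le_of_power_le_linear)
  fix n
  let ?m = "max (s f) (s g)"
  have nn: "s of_nat_j \<le> 1" if "of_nat_j = of_nat j" for j of_nat_j
    using absv_of_nat_le[of j] berk_const[OF s, of "of_nat j"] that by (simp add: of_nat_poly)
  have "s (f + g) ^ n = s (\<Sum>k\<le>n. of_nat (n choose k) * f ^ k * g ^ (n - k))"
    by (simp add: berk_power[symmetric] binomial_ring)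
  also have "\<dots> \<le> (\<Sum>k\<le>n. s (of_nat (n choose k) * f ^ k * g ^ (n - k)))"
    by (rule berk_sum_le) simp
  also have "\<dots> \<le> (\<Sum>k\<le>n. ?m ^ n)"
  proof (rule sum_mono)
    fix k assume k: "k \<in> {..n}"
    have "s (of_nat (n choose k) * f ^ k * g ^ (n - k)) \<le> 1 * ?m ^ k * ?m ^ (n - k)"
      unfolding berk_mult[OF s] berk_power
      by (intro mult_mono power_mono nn[OF refl])
         (auto simp: berk_nonneg[OF s] le_max_iff_disj intro!: mult_nonneg_nonneg zero_le_power)
    also have "\<dots> = ?m ^ n" using k by (simp add: power_add[symmetric])
    finally show "s (of_nat (n choose k) * f ^ k * g ^ (n - k)) \<le> ?m ^ n" .
  qed
  finally show "s (f + g) ^ n \<le> (real n + 1) * ?m ^ n" by (simp add: add.commute)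
qed (simp add: berk_nonneg[OF s] le_max_iff_disj)

lemma berk_diff_le: "s (f - g) \<le> max (s f) (s g)"
  using berk_ultra[of f "- g"] by simp

lemma berk_add_null: "s g = 0 \<Longrightarrow> s (f + g) = s f"
  using berk_ultra[of f g] berk_diff_le[of "f + g" g] berk_nonneg[OF s, of f] berk_nonneg[OF s, of "f + g"] by simp

end

text \<open>\<open>bnorm x (p,q)\<close> is the norm at \<open>x\<close> of the linear form \<open>qT - p\<close> vanishing at \<open>[p:q]\<close>,
  normalised so that the larger of the norms of \<open>T\<close> and \<open>1\<close> equals one.\<close>

fun bnorm :: "('k poly \<Rightarrow> real) option \<Rightarrow> 'k \<times> 'k \<Rightarrow> real" where
  "bnorm None (p,q) = absv q"
| "bnorm (Some s) (p,q) = s [:-p,q:] / max (s [:0,1:]) 1"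

text \<open>A seminorm rather than a norm, since at a type I point it vanishes on a line; the
  condition on the two basis vectors fixes the scale.\<close>

definition norm_like :: "('k \<times> 'k \<Rightarrow> real) \<Rightarrow> bool" where
  "norm_like f \<longleftrightarrow> (\<forall>v. 0 \<le> f v) \<and> (\<forall>c v. f (vsc c v) = absv c * f v) \<and>
     (\<forall>u v. f (u + v) \<le> max (f u) (f v)) \<and> max (f (1,0)) (f (0,1)) = 1"

text \<open>The composite of \<open>f\<close> with the inverse of \<open>g\<close> is again a
  seminorm but no longer normalised; \<open>dil f g\<close> is the factor by which it misses. For
  \<open>f = bnorm x\<close> its logarithm is the cocycle (\<open>sigma_eq_ln_dil\<close>).\<close>

definition dil :: "('k \<times> 'k \<Rightarrow> real) \<Rightarrow> 'k mat2 \<Rightarrow> real" where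
  "dil f g = max (f (mv (mat2_inv_SL g) (1,0))) (f (mv (mat2_inv_SL g) (0,1)))"

definition pnorm :: "'k \<times> 'k \<Rightarrow> 'k \<times> 'k \<Rightarrow> real" where
  "pnorm v w = absv (wedge v w) / vn v"

text \<open>The zero vector is sent to infinity as well, which is why the identification of points
  with directions carries \<open>v \<noteq> (0,0)\<close>.\<close>

fun pt :: "'k \<times> 'k \<Rightarrow> ('k poly \<Rightarrow> real) option" where
  "pt (p,q) = (if q = 0 then None else typeI absv (p / q))"

lemma norm_like_bnorm:
  assumes "x \<in> P1an absv"
  shows "norm_like (bnorm x)"
proof (cases x)
  case None
  then show ?thesis
    by (auto simp: norm_like_def absv_mult absv_add_le)
next
  case (Some s)
  with assms have s: "s \<in> berk_aff absv" by (auto simp: P1an_def)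
  let ?m = "max (s [:0,1:]) 1"
  have m: "?m > 0" by simp
  have 1: "bnorm x (vsc c v) = absv c * bnorm x v" for c v
    using Some berk_smult[OF s, of c] by (cases v) (metis (no_types) bnorm.simps(2) mult_minus_right smult_0_right smult_pCons vsc.simps times_divide_eq_right)
  have 2: "bnorm x (u + v) \<le> max (bnorm x u) (bnorm x v)" for u v
  proof (cases u; cases v)
    fix p q p' q' assume uv: "u = (p,q)" "v = (p',q')"
    have "s ([:-p,q:] + [:-p',q':]) \<le> max (s [:-p,q:]) (s [:-p',q':])" by (rule berk_ultra[OF s])
    then have "s ([:-p,q:] + [:-p',q':]) / ?m \<le> max (s [:-p,q:] / ?m) (s [:-p',q':] / ?m)"
      using m by (subst max_divide[symmetric]) (auto intro: divide_right_mono)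
    then show ?thesis using uv Some by simp
  qed
  have 3: "max (bnorm x (1,0)) (bnorm x (0,1)) = 1"
  proof -
    have "s [:-1:] = 1" using berk_const[OF s, of "-1"] by simp
    then show ?thesis using Some by (auto simp: max_def)
  qed
  have 4: "0 \<le> bnorm x v" for v
    using Some berk_nonneg[OF s] by (cases v) (auto intro!: divide_nonneg_nonneg)
  show ?thesis using 1 2 3 4 by (simp add: norm_like_def)
qed

context
  fixes f assumes f: "norm_like f"
begin

lemma nl_nonneg [simp]: "0 \<le> f v"
  and nl_vsc: "f (vsc c v) = absv c * f v"
  and nl_add: "f (u + v) \<le> max (f u) (f v)"
  and nl_one: "max (f (1,0)) (f (0,1)) = 1"
  using f unfolding norm_like_def by blast+

lemma nl_le_vn: "f v \<le> vn v"
proof (cases v)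
  case (Pair x y)
  have "v = vsc x (1,0) + vsc y (0,1)" using Pair by simp
  then have "f v \<le> max (absv x * f (1,0)) (absv y * f (0,1))" by (metis nl_add nl_vsc)
  also have "\<dots> \<le> max (absv x * 1) (absv y * 1)"
    using nl_one by (intro max.mono mult_left_mono) (auto simp: max_def split: if_splits)
  finally show ?thesis using Pair by simp
qed

text \<open>A normalised seminorm is not small in two independent directions at once: by Cramer's
  rule both basis vectors are combinations of \<open>u\<close> and \<open>v\<close>, and
  \<open>f\<close> equals 1 on one of them.\<close>

lemma nl_wedge_le: "absv (wedge u v) \<le> max (f u * vn v) (f v * vn u)"
proof (cases u; cases v)
  fix p q p' q' assume uv: "u = (p,q)" "v = (p',q')"
  have *: "absv (wedge u v) * f e \<le> max (f u * vn v) (f v * vn u)"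
    if "vsc (wedge u v) e = vsc c u + vsc c' v" "absv c \<le> vn v" "absv c' \<le> vn u" for e c c'
  proof -
    have "absv (wedge u v) * f e \<le> max (absv c * f u) (absv c' * f v)"
      by (metis that(1) nl_add nl_vsc)
    also have "\<dots> \<le> max (f u * vn v) (f v * vn u)"
      using that by (intro max.mono) (auto simp: mult.commute[of "f _"] intro: mult_right_mono)
    finally show ?thesis .
  qed
  have 1: "absv (wedge u v) * f (1,0) \<le> max (f u * vn v) (f v * vn u)"
    by (rule *[of _ q' "-q"]) (auto simp: uv algebra_simps)
  have 2: "absv (wedge u v) * f (0,1) \<le> max (f u * vn v) (f v * vn u)"
    by (rule *[of _ "-p'" "p"]) (auto simp: uv algebra_simps)
  show ?thesis using 1 2 nl_one by (cases "f (1,0) \<le> f (0,1)") (auto simp: max_def split: if_splits)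
qed

lemma dil_bound: "f (mv (mat2_inv_SL g) v) \<le> dil f g * vn v"
proof (cases v)
  case (Pair x y)
  have "v = vsc x (1,0) + vsc y (0,1)" using Pair by simp
  then have "mv (mat2_inv_SL g) v = vsc x (mv (mat2_inv_SL g) (1,0)) + vsc y (mv (mat2_inv_SL g) (0,1))"
    by (metis mv_add mv_vsc)
  then have "f (mv (mat2_inv_SL g) v) \<le> max (absv x * f (mv (mat2_inv_SL g) (1,0))) (absv y * f (mv (mat2_inv_SL g) (0,1)))"
    by (metis nl_add nl_vsc)
  also have "\<dots> \<le> max (absv x * dil f g) (absv y * dil f g)"
    by (intro max.mono mult_left_mono) (auto simp: dil_def)
  also have "\<dots> = dil f g * vn v" using Pair
    by (simp add: max_mult_distrib_right dil_def le_max_iff_disj mult.commute)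
  finally show ?thesis .
qed

lemma dil_nonneg: "0 \<le> dil f g"
  by (simp add: dil_def le_max_iff_disj)

text \<open>Undo \<open>g\<close>: \<open>dil_bound\<close> at \<open>mv g v\<close> bounds
  \<open>f v\<close>, and \<open>f\<close> equals 1 on some basis vector.\<close>

lemma dil_ge:
  assumes "g \<in> SL2"
  shows "1 \<le> mat2_norm absv g * dil f g"
proof -
  have "f v \<le> mat2_norm absv g * dil f g * vn v" for v
  proof -
    have "f v = f (mv (mat2_inv_SL g) (mv g v))" using assms by simp
    also have "\<dots> \<le> dil f g * vn (mv g v)" by (rule dil_bound)
    also have "\<dots> \<le> dil f g * (mat2_norm absv g * vn v)"
      by (intro mult_left_mono vn_mv_le dil_nonneg)
    finally show ?thesis by (simp add: mult_ac)
  qed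
  from this[of "(1,0)"] this[of "(0,1)"] nl_one show ?thesis by (auto simp: max_def split: if_splits)
qed

lemma dil_pos: "g \<in> SL2 \<Longrightarrow> 0 < dil f g"
  using dil_ge[of g] dil_nonneg[of g] by (cases "dil f g = 0") auto

lemma dil_le: "dil f g \<le> mat2_norm absv g"
proof -
  have "f (mv (mat2_inv_SL g) e) \<le> mat2_norm absv g" if "vn e = 1" for e
    using nl_le_vn[of "mv (mat2_inv_SL g) e"] vn_mv_le[of "mat2_inv_SL g" e] that by simp
  then show ?thesis by (simp add: dil_def)
qed

lemma abs_ln_dil_le:
  assumes "g \<in> SL2"
  shows "\<bar>ln (dil f g)\<bar> \<le> ln (mat2_norm absv g)"
proof -
  have n: "0 < mat2_norm absv g" using norm_ge_1[OF assms] by simp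
  have "ln (dil f g) \<le> ln (mat2_norm absv g)"
    using dil_le[of g] dil_pos[OF assms] by simp
  moreover have "ln 1 \<le> ln (mat2_norm absv g * dil f g)"
    using dil_ge[OF assms] by simp
  then have "0 \<le> ln (mat2_norm absv g) + ln (dil f g)"
    using n dil_pos[OF assms] by (simp add: ln_mult)
  ultimately show ?thesis by simp
qed

lemma dil_cocycle:
  assumes "g \<in> SL2"
  shows "dil f (mat2_mult h g) = dil (\<lambda>v. f (mv (mat2_inv_SL g) v) / dil f g) h * dil f g"
proof -
  have d: "dil f g > 0" by (rule dil_pos[OF assms])
  then show ?thesis
    by (simp add: dil_def[of _ h] dil_def[of _ "mat2_mult h g"] mat2_inv_mult mv_mult max_mult_distrib_right)
qed

end

lemma norm_like_pnorm: "v \<noteq> (0,0) \<Longrightarrow> norm_like (pnorm v)"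
proof -
  assume v: "v \<noteq> (0,0)"
  then have vp: "vn v > 0" by simp
  have w: "absv (wedge v (a + b)) \<le> max (absv (wedge v a)) (absv (wedge v b))" for a b
  proof -
    have "wedge v (a + b) = wedge v a + wedge v b"
      by (cases v; cases a; cases b) (simp add: algebra_simps)
    then show ?thesis by (simp add: absv_add_le)
  qed
  have "pnorm v (a + b) \<le> max (pnorm v a) (pnorm v b)" for a b
    using divide_right_mono[OF w[of a b], of "vn v"] vp
    by (simp add: pnorm_def max_divide)
  moreover have "max (pnorm v (1,0)) (pnorm v (0,1)) = 1"
    using v by (cases v) (auto simp: pnorm_def max_def not_le less_le)
  ultimately show ?thesis by (simp add: norm_like_def pnorm_def wedge_vsc absv_mult)
qed

lemma dil_pnorm:
  assumes "g \<in> SL2"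
  shows "dil (pnorm v) g = vn (mv g v) / vn v"
proof -
  have "wedge v (mv (mat2_inv_SL g) e) = wedge (mv g v) e" for e
    using wedge_mv[OF assms, of v "mv (mat2_inv_SL g) e"] assms by simp
  moreover have "max (absv (wedge u (1,0))) (absv (wedge u (0,1))) = vn u" for u
    by (cases u) (simp add: max.commute)
  moreover have "max (a / vn v) (b / vn v) = max a b / vn v" for a b
    by (simp add: max_divide)
  ultimately show ?thesis by (simp add: dil_def pnorm_def)
qed

lemma typeI_berk: "(\<lambda>f. absv (poly f z)) \<in> berk_aff absv"
proof -
  have "absv (a + b) \<le> absv a + absv b" for a b
    using absv_add_le[of a b] absv_nonneg[of a] absv_nonneg[of b] by linarith
  then show ?thesis by (auto simp: berk_aff_def absv_mult)
qed

lemma pt_P1k [simp]: "pt v \<in> P1k absv"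
  by (cases v) (auto simp: P1k_def)

lemma P1k_sub_P1an: "P1k absv \<subseteq> P1an absv"
  using typeI_berk by (auto simp: P1k_def P1an_def typeI_def)

lemma pt_P1an [simp]: "pt v \<in> P1an absv"
  using pt_P1k P1k_sub_P1an by blast

lemma P1k_pt: "x \<in> P1k absv \<Longrightarrow> \<exists>v. v \<noteq> (0,0) \<and> x = pt v"
proof -
  assume "x \<in> P1k absv"
  then consider "x = None" | z where "x = typeI absv z" by (auto simp: P1k_def)
  then show ?thesis
  proof cases
    case 1
    then show ?thesis by (intro exI[of _ "(1,0)"]) simp
  next
    case 2
    then show ?thesis by (intro exI[of _ "(z,1)"]) simp
  qed
qed

lemma bnorm_pt:
  assumes "v \<noteq> (0,0)"
  shows "bnorm (pt v) = pnorm v"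
proof
  fix w :: "'k \<times> 'k"
  obtain p q where v: "v = (p,q)" by (cases v)
  obtain x y where w: "w = (x,y)" by (cases w)
  show "bnorm (pt v) w = pnorm v w"
  proof (cases "q = 0")
    case True
    then show ?thesis using v w assms by (simp add: pnorm_def absv_mult)
  next
    case False
    have "max (absv p / absv q) 1 = max (absv p) (absv q) / absv q"
      using False by (auto simp: max_def field_simps)
    moreover have "p / q * y - x = (p * y - q * x) / q" using False by (simp add: field_simps)
    ultimately show ?thesis using v w False
      by (simp add: pnorm_def typeI_def absv_divide add.commute[of "-x"])
  qed
qed

text \<open>If \<open>T - z\<close> lies in the kernel of the seminorm, then \<open>f\<close> may be
  replaced by its remainder \<open>poly f z\<close>.\<close>

lemma eval_of_zero:
  assumes s: "s \<in> berk_aff absv" and z: "s [:-z,1:] = 0"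
  shows "s f = absv (poly f z)"
proof -
  have "[:-z,1:] dvd (f - [:poly f z:])"
    by (simp add: poly_eq_0_iff_dvd[symmetric])
  then obtain h where "f - [:poly f z:] = [:-z,1:] * h" by (auto elim: dvdE)
  then have f: "f = [:poly f z:] + [:-z,1:] * h" by (simp add: algebra_simps)
  have "s ([:-z,1:] * h) = 0" unfolding berk_mult[OF s] using z by simp
  then show ?thesis
    using berk_add_null[OF s, of "[:-z,1:] * h" "[:poly f z:]"] berk_const[OF s, of "poly f z"] f by simp
qed

text \<open>A \<open>k\<close>-point is recognised by a single vanishing linear form; identities
  between points of the projective line over \<open>k\<close> are checked this way later.\<close>

lemma eq_pt_of_bnorm_0:
  assumes "x \<in> P1an absv" "v \<noteq> (0,0)" "bnorm x v = 0"
  shows "x = pt v"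
proof -
  obtain p q where v: "v = (p,q)" by (cases v)
  show ?thesis
  proof (cases x)
    case None
    then show ?thesis using assms v by simp
  next
    case (Some s)
    then have s: "s \<in> berk_aff absv" using assms(1) by (auto simp: P1an_def)
    have 0: "s [:-p,q:] = 0" using assms(3) Some v by (auto simp: max_def split: if_splits)
    have q: "q \<noteq> 0"
    proof
      assume "q = 0"
      then have "absv (-p) = 0" using 0 berk_const[OF s, of "-p"] by simp
      then show False using assms(2) v \<open>q = 0\<close> by simp
    qed
    have "s (smult q [:-(p/q),1:]) = 0" using 0 q by simp
    then have "s [:-(p/q),1:] = 0" using q by (simp only: berk_smult[OF s]) simp
    then have "s = (\<lambda>f. absv (poly f (p/q)))" using eval_of_zero[OF s] by blast
    then show ?thesis using Some q v by (simp add: typeI_def)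
  qed
qed

lemma pt_eq_iff: "u \<noteq> (0,0) \<Longrightarrow> v \<noteq> (0,0) \<Longrightarrow> pt u = pt v \<longleftrightarrow> wedge u v = 0"
proof
  assume uv: "u \<noteq> (0,0)" "v \<noteq> (0,0)"
  { assume "pt u = pt v"
    then have "pnorm u v = pnorm v v" using bnorm_pt uv by metis
    then show "wedge u v = 0" using uv by (simp add: pnorm_def) }
  { assume "wedge u v = 0"
    then have "bnorm (pt u) v = 0" by (simp add: bnorm_pt uv pnorm_def)
    then show "pt u = pt v" using eq_pt_of_bnorm_0[of "pt u" v] uv by simp }
qed

section \<open>The projective action read on norms\<close>

lemma berk_act_Some_berk:
  assumes s: "s \<in> berk_aff absv" and nz: "s [:d,c:] \<noteq> 0"
  shows "(\<lambda>f. s (mob_hom (a,b,c,d) f) / s [:d,c:] ^ degree f) \<in> berk_aff absv"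
proof -
  let ?h = "hom_subst [:b,a:] [:d,c:]"
  let ?s = "\<lambda>f. s (mob_hom (a,b,c,d) f) / s [:d,c:] ^ degree f"
  \<comment> \<open>The value may be computed at any degree \<open>n\<close> above
    \<open>degree f\<close>, so a sum or a product can be evaluated at one common degree.\<close>
  have eq: "?s f = s (?h n f) / s [:d,c:] ^ n" if n: "degree f \<le> n" for f n
  proof -
    obtain m where m: "n = degree f + m" using le_Suc_ex[OF n] by blast
    have "?h n f = ?h (degree f) f * [:d,c:] ^ m"
      unfolding m by (rule hom_subst_lift) simp
    then show ?thesis using nz
      by (simp add: m mob_hom_eq berk_mult[OF s] berk_power[OF s] power_add)
  qed
  have "?s [:e:] = absv e" for e
    using eq[of "[:e:]" 0] berk_const[OF s, of e] hom_subst_const[of "[:b,a:]" "[:d,c:]" 0 e] by simp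
  moreover have "0 \<le> ?s f" for f using berk_nonneg[OF s] by simp
  moreover have "?s (f * g) = ?s f * ?s g" for f g
  proof -
    have "?s (f * g) = s (?h (degree f) f * ?h (degree g) g) / s [:d,c:] ^ (degree f + degree g)"
      using eq[OF degree_mult_le] hom_subst_mult[of f "degree f" g "degree g"] by simp
    then show ?thesis
      by (simp only: berk_mult[OF s] power_add times_divide_times_eq mob_hom_eq)
  qed
  moreover have "?s (f + g) \<le> ?s f + ?s g" for f g
  proof -
    let ?n = "max (degree f) (degree g)"
    have "?s (f + g) = s (?h ?n f + ?h ?n g) / s [:d,c:] ^ ?n"
      using eq[of "f + g" ?n] degree_add_le_max[of f g] by (simp add: hom_subst_add)
    also have "\<dots> \<le> (s (?h ?n f) + s (?h ?n g)) / s [:d,c:] ^ ?n"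
      by (intro divide_right_mono berk_add_le[OF s] zero_le_power berk_nonneg[OF s])
    also have "\<dots> = ?s f + ?s g" using eq[of f ?n] eq[of g ?n] by (simp add: add_divide_distrib)
    finally show ?thesis .
  qed
  ultimately show ?thesis unfolding berk_aff_def by blast
qed

lemma berk_act_P1an [simp]:
  assumes "x \<in> P1an absv"
  shows "berk_act absv g x \<in> P1an absv"
proof (cases g; cases x)
  fix a b c d assume g: "g = (a,b,c,d)"
  { assume "x = None"
    then show ?thesis using g typeI_berk by (auto simp: P1an_def typeI_def) }
  { fix s assume x: "x = Some s"
    with assms have s: "s \<in> berk_aff absv" by (auto simp: P1an_def)
    show ?thesis using berk_act_Some_berk[OF s] by (auto simp: g x P1an_def) }
qed

text \<open>On norms the Moebius action becomes linear: precompose with the inverse and renormalise.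
  The cases follow the definition of \<open>berk_act\<close> (infinity, the pole, any other
  seminorm), and one formula covers them all.\<close>

lemma bnorm_berk_act:
  assumes x: "x \<in> P1an absv" and g: "g \<in> SL2"
  shows "bnorm (berk_act absv g x) v = bnorm x (mv (mat2_inv_SL g) v) / dil (bnorm x) g"
proof -
  obtain a b c d where G: "g = (a,b,c,d)" by (cases g)
  obtain p q where v: "v = (p,q)" by (cases v)
  have det: "a * d - b * c = 1" using g G by (simp add: SL2_def)
  show ?thesis
  proof (cases x)
    case None
    show ?thesis
    proof (cases "c = 0")
      case True
      then have "a \<noteq> 0" using det by auto
      then show ?thesis using None G v True by (simp add: dil_def absv_mult max_def less_le)
    next
      case False
      have "max (absv a / absv c) 1 = max (absv c) (absv a) / absv c"
        using False by (auto simp: max_def field_simps)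
      moreover have "a / c * q - p = (a * q - c * p) / c" using False by (simp add: field_simps)
      ultimately show ?thesis using None G v False
        by (simp add: dil_def typeI_def absv_divide add.commute[of "-p"] mult.commute[of q] add.commute[of "-(c*p)"])
    qed
  next
    case (Some s)
    then have s: "s \<in> berk_aff absv" using x by (auto simp: P1an_def)
    let ?m = "max (s [:0,1:]) 1"
    have m: "?m > 0" by simp
    have dil: "dil (bnorm x) g = max (s [:d,c:]) (s [:b,a:]) / ?m"
    proof -
      have "[:-d,-c:] = - [:d,c:]" by simp
      then have "s [:-d,-c:] = s [:d,c:]" using berk_minus[OF s] by metis
      then have "dil (bnorm x) g = max (s [:d,c:] / ?m) (s [:b,a:] / ?m)"
        by (simp add: dil_def G Some)
      then show ?thesis using m max_divide[of ?m] by (simp add: less_imp_le)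
    qed
    have num: "bnorm x (mv (mat2_inv_SL g) v) = s (smult q [:b,a:] + smult (-p) [:d,c:]) / ?m"
    proof -
      have "[: -(d*p - b*q), -(c*p) + a*q :] = smult q [:b,a:] + smult (-p) [:d,c:]"
        by (simp add: algebra_simps)
      then show ?thesis by (simp add: G v Some algebra_simps)
    qed
    show ?thesis
    proof (cases "s [:d,c:] = 0")
      case True
      have "s (smult (-p) [:d,c:]) = 0" unfolding berk_smult[OF s] using True by simp
      then have "s (smult q [:b,a:] + smult (-p) [:d,c:]) = s (smult q [:b,a:])"
        by (rule berk_add_null[OF s])
      also have "\<dots> = absv q * s [:b,a:]" by (rule berk_smult[OF s])
      finally have n: "bnorm x (mv (mat2_inv_SL g) v) = absv q * s [:b,a:] / ?m" using num by simp
      have d: "dil (bnorm x) g = s [:b,a:] / ?m" using dil True berk_nonneg[OF s, of "[:b,a:]"] by simp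
      have "dil (bnorm x) g > 0" by (rule dil_pos[OF norm_like_bnorm[OF x] g])
      then have "s [:b,a:] \<noteq> 0" using d by auto
      moreover have "berk_act absv g x = None" using True by (simp add: G Some)
      ultimately show ?thesis using n d v m by (simp add: less_le)
    next
      case False
      define s' where "s' = (\<lambda>f. s (mob_hom (a,b,c,d) f) / s [:d,c:] ^ degree f)"
      have act: "berk_act absv g x = Some s'" using False by (simp add: G Some s'_def)
      have lin: "s' [:-p,q:] = s (smult q [:b,a:] + smult (-p) [:d,c:]) / s [:d,c:]" for p q
      proof (cases "q = 0")
        case True
        have "s (smult (-p) [:d,c:]) = absv p * s [:d,c:]"
          by (simp only: berk_smult[OF s]) simp
        moreover have "s' [:-p:] = absv p"
          using berk_act_Some_berk[OF s False, of a b] berk_const[of s' "-p"] by (simp add: s'_def)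
        ultimately show ?thesis using True False by simp
      next
        case False
        then show ?thesis
          by (simp add: s'_def mob_hom_eq hom_subst_def add.commute)
      qed
      have "s' [:0,1:] = s [:b,a:] / s [:d,c:]" using lin[of 0 1] by simp
      then have "max (s' [:0,1:]) 1 = max (s [:d,c:]) (s [:b,a:]) / s [:d,c:]"
        using False berk_nonneg[OF s, of "[:d,c:]"]
          max_divide[of "s [:d,c:]" "s [:d,c:]" "s [:b,a:]"] by (simp add: max.commute)
      then show ?thesis using act lin[of p q] num dil v False m by (simp add: less_le)
    qed
  qed
qed

text \<open>Both sides are identified by the vector on which their norm vanishes, which treats the
  pole and infinity together with the other points.\<close>

lemma berk_act_pt:
  assumes "g \<in> SL2" "v \<noteq> (0,0)"
  shows "berk_act absv g (pt v) = pt (mv g v)"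
proof (rule eq_pt_of_bnorm_0)
  show "mv g v \<noteq> (0,0)" using assms by simp
  show "bnorm (berk_act absv g (pt v)) (mv g v) = 0"
    using assms by (simp add: bnorm_berk_act bnorm_pt pnorm_def)
qed simp

lemma dil_berk_act:
  assumes "x \<in> P1an absv" "g \<in> SL2"
  shows "dil (bnorm x) (mat2_mult h g) = dil (bnorm (berk_act absv g x)) h * dil (bnorm x) g"
proof -
  have "bnorm (berk_act absv g x) = (\<lambda>v. bnorm x (mv (mat2_inv_SL g) v) / dil (bnorm x) g)"
    using bnorm_berk_act[OF assms] by blast
  then show ?thesis using dil_cocycle[OF norm_like_bnorm[OF assms(1)] assms(2), of h] by simp
qed

lemma sigma_eq_ln_dil:
  assumes "x \<in> P1an absv" "g \<in> SL2"
  shows "sigma_coc absv g x = ln (dil (bnorm x) g)"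
proof (cases g; cases x)
  fix a b c d assume G: "g = (a,b,c,d)"
  { assume "x = None"
    then show ?thesis by (simp add: G dil_def max.commute) }
  { fix s assume X: "x = Some s"
    then have s: "s \<in> berk_aff absv" using assms(1) by (auto simp: P1an_def)
    let ?m = "max (s [:0,1:]) 1"
    have m: "?m > 0" by simp
    have "[:-d,-c:] = - [:d,c:]" by simp
    then have "s [:-d,-c:] = s [:d,c:]" using berk_minus[OF s] by metis
    then have "dil (bnorm x) g = max (s [:d,c:] / ?m) (s [:b,a:] / ?m)"
      by (simp add: dil_def G X)
    then have e: "dil (bnorm x) g = max (s [:b,a:]) (s [:d,c:]) / ?m"
      using m max_divide[of ?m] by (simp add: less_imp_le max.commute)
    moreover have "dil (bnorm x) g > 0" by (rule dil_pos[OF norm_like_bnorm[OF assms(1)] assms(2)])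
    ultimately have "max (s [:b,a:]) (s [:d,c:]) > 0" using m by (simp add: zero_less_divide_iff)
    then show ?thesis using e m by (simp add: G X ln_div) }
qed

lemma sigma_cocycle:
  assumes "x \<in> P1an absv" "g \<in> SL2" "h \<in> SL2"
  shows "sigma_coc absv (mat2_mult h g) x = sigma_coc absv h (berk_act absv g x) + sigma_coc absv g x"
proof -
  have "0 < dil (bnorm x) g" "0 < dil (bnorm (berk_act absv g x)) h"
    using assms by (auto intro!: dil_pos norm_like_bnorm)
  then show ?thesis using assms by (simp add: sigma_eq_ln_dil dil_berk_act ln_mult)
qed

text \<open>Extends \<open>chord\<close> in its first argument to the whole Berkovich line
  (\<open>delta_pt\<close>). For \<open>v \<noteq> (0,0)\<close> it vanishes only at
  \<open>x = pt v\<close>, by \<open>eq_pt_of_bnorm_0\<close>.\<close>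

definition delta :: "('k poly \<Rightarrow> real) option \<Rightarrow> 'k \<times> 'k \<Rightarrow> real" where
  "delta x v = bnorm x v / vn v"

lemma delta_nonneg: "x \<in> P1an absv \<Longrightarrow> 0 \<le> delta x v"
  by (simp add: delta_def nl_nonneg[OF norm_like_bnorm])

lemma delta_le_1: "x \<in> P1an absv \<Longrightarrow> delta x v \<le> 1"
  using nl_le_vn[OF norm_like_bnorm, of x v] by (auto simp: delta_def divide_le_eq_1 less_le)

lemma delta_pt: "u \<noteq> (0,0) \<Longrightarrow> delta (pt u) v = chord u v"
  by (simp add: delta_def bnorm_pt pnorm_def chord_def)

lemma chord_le_max_delta:
  assumes "x \<in> P1an absv" "u \<noteq> (0,0)" "v \<noteq> (0,0)"
  shows "chord u v \<le> max (delta x u) (delta x v)"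
proof -
  have p: "vn u > 0" "vn v > 0" using assms by simp_all
  have "absv (wedge u v) / (vn u * vn v) \<le> max (bnorm x u * vn v) (bnorm x v * vn u) / (vn u * vn v)"
    by (intro divide_right_mono nl_wedge_le norm_like_bnorm assms(1)) simp
  also have "\<dots> = max (bnorm x u * vn v / (vn u * vn v)) (bnorm x v * vn u / (vn u * vn v))"
    using p by (simp add: max_divide)
  finally show ?thesis using p by (simp add: chord_def delta_def)
qed

lemma delta_ultra:
  assumes x: "x \<in> P1an absv" and "u \<noteq> (0,0)" "v \<noteq> (0,0)"
  shows "delta x v \<le> max (delta x u) (chord u v)"
proof -
  have nl: "norm_like (bnorm x)" by (rule norm_like_bnorm[OF x])
  have p: "vn u > 0" "vn v > 0" using assms by simp_all
  \<comment> \<open>\<open>e\<close> is the basis vector whose wedge with \<open>u\<close> picks out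
    the larger coordinate of \<open>u\<close>; it serves as third vector in the Pluecker
    relation.\<close>
  obtain e where e: "vn e = 1" "absv (wedge u e) = vn u"
  proof (cases u)
    case (Pair a b)
    show thesis
      using that[of "(1,0)"] that[of "(0,1)"] Pair by (cases "absv a \<le> absv b") (auto simp: max_def)
  qed
  have "vsc (wedge u e) v = vsc (wedge u v) e + vsc (wedge v e) u" by (rule wedge_plucker)
  then have "absv (wedge u e) * bnorm x v \<le> max (absv (wedge u v) * bnorm x e) (absv (wedge v e) * bnorm x u)"
    by (metis nl_add[OF nl] nl_vsc[OF nl])
  also have "\<dots> \<le> max (absv (wedge u v)) (vn v * bnorm x u)"
    using nl_le_vn[OF nl, of e] wedge_le[of v e] e nl_nonneg[OF nl]
    by (intro max.mono mult_right_mono) (auto intro: mult_left_le)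
  finally have "vn u * bnorm x v / (vn u * vn v) \<le> max (absv (wedge u v)) (vn v * bnorm x u) / (vn u * vn v)"
    using e by (intro divide_right_mono) auto
  also have "\<dots> = max (absv (wedge u v) / (vn u * vn v)) (vn v * bnorm x u / (vn u * vn v))"
    using p by (simp add: max_divide)
  finally show ?thesis using p by (simp add: chord_def delta_def max.commute)
qed

lemma delta_act:
  assumes "x \<in> P1an absv" "g \<in> SL2" "v \<noteq> (0,0)"
  shows "delta (berk_act absv g x) (mv g v) = delta x v / (dil (bnorm x) g * dil (pnorm v) g)"
  using assms by (simp add: delta_def bnorm_berk_act dil_pnorm field_simps)

end

section \<open>Uniform escape of the random walk\<close>

lemma prob_bind_pmf:
  "measure_pmf.prob (bind_pmf M N) A = measure_pmf.expectation M (\<lambda>x. measure_pmf.prob (N x) A)"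
proof -
  have "ennreal (measure_pmf.prob (bind_pmf M N) A) = (\<integral>\<^sup>+x. ennreal (measure_pmf.prob (N x) A) \<partial>measure_pmf M)"
    by (simp add: measure_pmf.emeasure_eq_measure[symmetric])
  also have "\<dots> = ennreal (measure_pmf.expectation M (\<lambda>x. measure_pmf.prob (N x) A))"
    by (intro nn_integral_eq_integral measure_pmf.integrable_const_bound[where B=1]) auto
  finally show ?thesis by (simp add: integral_nonneg_AE)
qed

lemma conv_pow_add:
  "conv_pow \<mu> (m + n) = bind_pmf (conv_pow \<mu> m) (\<lambda>h. map_pmf (\<lambda>g. mat2_mult g h) (conv_pow \<mu> n))"
proof (induction n)
  case 0
  show ?case by (simp add: map_return_pmf bind_return_pmf')
next
  case (Suc n)
  show ?case
    by (simp add: Suc bind_assoc_pmf map_bind_pmf bind_map_pmf map_pmf_comp mat2_mult_assoc)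
qed

text \<open>The two splittings have different uses. Conditioning on the right factor changes the
  starting point and makes suprema over starting points decrease; conditioning on the left factor
  translates the target and produces disjoint events.\<close>

lemma conv_pow_add':
  "conv_pow \<mu> (m + n) = bind_pmf (conv_pow \<mu> n) (\<lambda>g. map_pmf (\<lambda>h. mat2_mult g h) (conv_pow \<mu> m))"
  unfolding conv_pow_add map_pmf_def by (rule bind_commute_pmf)

lemma conv_pow_1: "conv_pow \<mu> (Suc 0) = \<mu>"
  by (simp add: bind_return_pmf)

lemma conv_pow_mult: "conv_pow \<mu> (m * q) = conv_pow (conv_pow \<mu> m) q"
proof (induction q)
  case (Suc q)
  have "conv_pow \<mu> (m * Suc q) = conv_pow \<mu> (m * q + m)" by (simp add: add.commute)
  then show ?case by (simp only: conv_pow_add Suc conv_pow.simps)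
qed simp

text \<open>Inversion reverses the order of the factors, which the law of a product of independent
  identically distributed factors does not see.\<close>

lemma conv_pow_inv: "conv_pow (map_pmf mat2_inv_SL \<mu>) n = map_pmf mat2_inv_SL (conv_pow \<mu> n)"
proof (induction n)
  case (Suc n)
  have "conv_pow (map_pmf mat2_inv_SL \<mu>) (Suc n)
    = bind_pmf (conv_pow \<mu> n) (\<lambda>h. map_pmf (\<lambda>g. mat2_inv_SL (mat2_mult h g)) \<mu>)"
    by (simp add: Suc bind_map_pmf map_pmf_comp mat2_inv_mult)
  also have "\<dots> = map_pmf mat2_inv_SL (bind_pmf (conv_pow \<mu> n) (\<lambda>h. map_pmf (\<lambda>g. mat2_mult h g) \<mu>))"
    by (simp add: map_bind_pmf map_pmf_comp)
  also have "bind_pmf (conv_pow \<mu> n) (\<lambda>h. map_pmf (\<lambda>g. mat2_mult h g) \<mu>) = conv_pow \<mu> (Suc n)"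
    using conv_pow_add'[of \<mu> "Suc 0" n] by (simp add: conv_pow_1 del: conv_pow.simps(2))
  finally show ?case .
qed simp

lemma prob_conv_pow_right:
  "measure_pmf.prob (conv_pow \<mu> (m + n)) A
    = measure_pmf.expectation (conv_pow \<mu> m) (\<lambda>h. measure_pmf.prob (conv_pow \<mu> n) {g. mat2_mult g h \<in> A})"
  unfolding conv_pow_add prob_bind_pmf by (simp add: measure_map_pmf vimage_def)

lemma prob_conv_pow_left:
  "measure_pmf.prob (conv_pow \<mu> (m + n)) A
    = measure_pmf.expectation (conv_pow \<mu> n) (\<lambda>t. measure_pmf.prob (conv_pow \<mu> m) {g. mat2_mult t g \<in> A})"
  unfolding conv_pow_add' prob_bind_pmf by (simp add: measure_map_pmf vimage_def)

lemma set_conv_pow_mult: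
  "g \<in> set_pmf (conv_pow \<mu> m) \<Longrightarrow> h \<in> set_pmf (conv_pow \<mu> n) \<Longrightarrow> mat2_mult g h \<in> set_pmf (conv_pow \<mu> (m + n))"
  unfolding conv_pow_add'[of \<mu> n m, unfolded add.commute[of n m]] by auto

lemma set_conv_pow_sub_SL2:
  assumes "set_pmf \<mu> \<subseteq> SL2"
  shows "set_pmf (conv_pow \<mu> n) \<subseteq> SL2"
proof (induction n)
  case (Suc n)
  then show ?case using assms unfolding conv_pow.simps set_bind_pmf set_map_pmf
    by (blast intro: SL2_mult)
qed simp

lemma expectation_le_const:
  fixes f :: "'a \<Rightarrow> real"
  assumes "\<And>x. x \<in> set_pmf p \<Longrightarrow> f x \<le> c" "\<And>x. x \<in> set_pmf p \<Longrightarrow> 0 \<le> f x"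
  shows "measure_pmf.expectation p f \<le> c"
proof -
  have "integrable (measure_pmf p) f"
    by (rule measure_pmf.integrable_const_bound[where B=c]) (use assms in \<open>auto simp: AE_measure_pmf_iff\<close>)
  then show ?thesis
    by (intro measure_pmf.integral_le_const) (use assms in \<open>auto simp: AE_measure_pmf_iff\<close>)
qed

text \<open>If an average almost attains a bound valid for almost all terms, then every term of
  substantial weight almost attains it.\<close>

lemma expectation_near_max:
  fixes p :: "'a \<Rightarrow> real"
  assumes p: "\<And>t. 0 \<le> p t" "\<And>t. p t \<le> 1"
    and U: "1 - \<delta> \<le> measure_pmf.prob m U" "\<And>t. t \<in> U \<Longrightarrow> p t \<le> c + \<delta>"
    and E: "c - \<delta> \<le> measure_pmf.expectation m p"
    and t0: "t0 \<in> U" "0 < \<alpha>" "\<alpha> \<le> pmf m t0" and c: "0 \<le> c" "0 \<le> \<delta>"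
  shows "c - 3 * \<delta> / \<alpha> \<le> p t0"
proof -
  \<comment> \<open>A majorant of \<open>p\<close>: the bound \<open>c + \<delta>\<close>, raised by
    1 off \<open>U\<close> and lowered at \<open>t0\<close> to the actual value. The three \<delta>
    of the conclusion come from the bound, from the mass off \<open>U\<close> and from the
    assumption on the mean.\<close>
  let ?h = "\<lambda>t. (c + \<delta>) + indicator (- U) t - (c + \<delta> - p t0) * indicator {t0} t"
  have int: "integrable (measure_pmf m) p" "integrable (measure_pmf m) ?h"
    using p by (auto intro!: measure_pmf.integrable_const_bound[where B=1] Bochner_Integration.integrable_add
        Bochner_Integration.integrable_diff simp: less_top[symmetric])
  have "p t \<le> ?h t" for t
    using p[of t] U(2)[of t] t0(1) c by (auto simp: indicator_def)
  then have "measure_pmf.expectation m p \<le> measure_pmf.expectation m ?h"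
    by (intro integral_mono int) 
  also have "\<dots> = (c + \<delta>) + measure_pmf.prob m (- U) - (c + \<delta> - p t0) * pmf m t0"
    by (subst Bochner_Integration.integral_diff Bochner_Integration.integral_add;
        simp add: less_top[symmetric] measure_pmf_single)+
  also have "measure_pmf.prob m (- U) \<le> \<delta>"
    using U(1) measure_pmf.prob_compl[of U m] by (simp add: Compl_eq_Diff_UNIV)
  finally have *: "(c + \<delta> - p t0) * pmf m t0 \<le> 3 * \<delta>" using E by linarith
  have "0 \<le> c + \<delta> - p t0" using U(2)[OF t0(1)] by simp
  then have "(c + \<delta> - p t0) * \<alpha> \<le> 3 * \<delta>"
    using * t0(3) mult_left_mono[of \<alpha> "pmf m t0" "c + \<delta> - p t0"] by linarith
  then have "c + \<delta> - p t0 \<le> 3 * \<delta> / \<alpha>" using t0(2) by (simp add: field_simps)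
  then show ?thesis using c by linarith
qed

lemma sum_prob_disjoint_le_1:
  assumes "finite S" "\<And>s t. s \<in> S \<Longrightarrow> t \<in> S \<Longrightarrow> s \<noteq> t \<Longrightarrow> E s \<inter> E t = {}"
  shows "(\<Sum>s\<in>S. measure_pmf.prob p (E s)) \<le> 1"
proof -
  have "(\<Sum>s\<in>S. measure_pmf.prob p (E s)) = measure_pmf.prob p (\<Union>s\<in>S. E s)"
    using assms by (intro measure_pmf.finite_measure_finite_Union[symmetric]) (auto simp: disjoint_family_on_def)
  then show ?thesis by simp
qed

lemma decreasing_seq_small_or_inf:
  fixes q :: "nat \<Rightarrow> real"
  assumes "\<And>n. 0 \<le> q n" "\<not> (\<exists>n. q n \<le> c)"
  obtains c0 where "c \<le> c0" "\<And>n. c0 \<le> q n" "\<And>d. 0 < d \<Longrightarrow> \<exists>n. q n < c0 + d"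
proof
  have bdd: "bdd_below (range q)" using assms(1) by (auto intro: bdd_belowI[of _ 0])
  show "c \<le> (INF n. q n)" using assms(2) by (intro cINF_greatest) (auto simp: not_le less_imp_le)
  show "(INF n. q n) \<le> q n" for n by (rule cINF_lower[OF bdd]) simp
  show "\<exists>n. q n < (INF n. q n) + d" if "0 < d" for d
    using cInf_lessD[of "range q" "(INF n. q n) + d"] that by auto
qed

section \<open>Escape of norms and non-concentration by disjoint translates\<close>

context nonarch_field
begin

text \<open>The trace rather than the norm, because it is invariant under conjugation: in
  \<open>norm_escape\<close> the quotients appear conjugated by an arbitrary \<open>A\<close>. All
  elements come from one convolution power, so a single law charges them.\<close>

definition trace_spread :: "'k mat2 pmf \<Rightarrow> bool" where
  "trace_spread \<mu> \<longleftrightarrow> (\<forall>J M. \<exists>N S. finite S \<and> S \<subseteq> set_pmf (conv_pow \<mu> N) \<and> J \<le> card S \<and>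
     (\<forall>t\<in>S. \<forall>t'\<in>S. t \<noteq> t' \<longrightarrow> M < absv (mat2_tr (mat2_mult t (mat2_inv_SL t')))))"

text \<open>\<open>S\<close> and \<eta> serve all \<open>v\<close> at once and only the subset
  \<open>S'\<close> depends on \<open>v\<close>: this uniformity stands in for compactness of the
  projective line.\<close>

definition point_spread :: "'k mat2 pmf \<Rightarrow> bool" where
  "point_spread \<mu> \<longleftrightarrow> (\<forall>J. \<exists>N S. \<exists>\<eta>>0. finite S \<and> S \<subseteq> set_pmf (conv_pow \<mu> N) \<and>
     (\<forall>v. v \<noteq> (0,0) \<longrightarrow> (\<exists>S'\<subseteq>S. J \<le> card S' \<and>
       (\<forall>t\<in>S'. \<forall>t'\<in>S'. t \<noteq> t' \<longrightarrow> \<eta> \<le> chord (mv (mat2_inv_SL t) v) (mv (mat2_inv_SL t') v)))))"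

text \<open>The supremum \<open>q n\<close> over \<open>A\<close> and \<open>B\<close> decreases in
  \<open>n\<close>. If it stayed above \<open>c\<close>, with infimum \<open>c0\<close>, a nearly
  optimal pair would force each translate \<open>A t\<close>, for \<open>t\<close> in a spread set
  \<open>S\<close>, to carry mass at least \<open>c0 / 2\<close> at an earlier time, but these
  events are disjoint. The free factors \<open>A\<close> and \<open>B\<close> make the supremum
  stable under splitting the walk.\<close>

lemma norm_escape:
  assumes sl: "set_pmf \<mu> \<subseteq> SL2" and sp: "trace_spread \<mu>" and c: "0 < c"
  shows "\<exists>n0. \<forall>n A B. n0 \<le> n \<longrightarrow> A \<in> SL2 \<longrightarrow> B \<in> SL2 \<longrightarrow>
     measure_pmf.prob (conv_pow \<mu> n) {g. mat2_norm absv (mat2_mult A (mat2_mult g B)) \<le> M} \<le> c"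
proof -
  define E where "E A B = {g. mat2_norm absv (mat2_mult A (mat2_mult g B)) \<le> M}" for A B
  define P where "P n = measure_pmf.prob (conv_pow \<mu> n)" for n
  define q where "q n = (SUP (A,B)\<in>SL2\<times>SL2. P n (E A B))" for n
  have bdd: "bdd_above ((\<lambda>(A,B). P n (E A B)) ` (SL2 \<times> SL2))" for n
    by (rule bdd_aboveI[of _ 1]) (auto simp: P_def)
  have P_le_q: "P n (E A B) \<le> q n" if "A \<in> SL2" "B \<in> SL2" for n A B
    unfolding q_def using that by (intro cSUP_upper2[OF bdd, of "(A,B)"]) auto
  have q_less: "\<exists>A\<in>SL2. \<exists>B\<in>SL2. a < P n (E A B)" if "a < q n" for a n
  proof (rule ccontr)
    assume "\<not> ?thesis"
    then have "q n \<le> a" unfolding q_def using SL2_id by (intro cSUP_least) (fastforce simp: not_less)+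
    with that show False by simp
  qed
  have slN: "set_pmf (conv_pow \<mu> n) \<subseteq> SL2" for n by (rule set_conv_pow_sub_SL2[OF sl])
  have E_right: "{g. mat2_mult g h \<in> E A B} = E A (mat2_mult h B)" for g h A B
    by (simp add: E_def mat2_mult_assoc)
  have E_left: "{g. mat2_mult t g \<in> E A B} = E (mat2_mult A t) B" for t A B
    by (simp add: E_def mat2_mult_assoc)
  have mono: "P (m + n) (E A B) \<le> q n" if "A \<in> SL2" "B \<in> SL2" for m n A B
    unfolding P_def prob_conv_pow_right E_right
    using that slN[of m] by (intro expectation_le_const) (auto intro!: P_le_q[unfolded P_def])
  have "\<exists>n. q n \<le> c"
  proof (rule ccontr)
    assume "\<not> ?thesis"
    moreover have "0 \<le> q n" for n 
      by (rule order_trans[OF _ P_le_q[of mat2_id mat2_id n]]) (simp_all add: P_def)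
    ultimately obtain c0 where c0: "c \<le> c0" "\<And>n. c0 \<le> q n" "\<And>d. 0 < d \<Longrightarrow> \<exists>n. q n < c0 + d"
      using decreasing_seq_small_or_inf[of q c] by blast
    have c0p: "c0 > 0" using c c0 by simp
    obtain J :: nat where J: "2 / c0 < real J" using reals_Archimedean2 by blast
    have Jp: "J > 0" using J c0p by (metis divide_pos_pos of_nat_0_less_iff zero_less_numeral less_trans)
    obtain N S where S: "finite S" "S \<subseteq> set_pmf (conv_pow \<mu> N)" "J \<le> card S"
      and tr: "\<And>t t'. t \<in> S \<Longrightarrow> t' \<in> S \<Longrightarrow> t \<noteq> t' \<Longrightarrow> M * M < absv (mat2_tr (mat2_mult t (mat2_inv_SL t')))"
      using sp[unfolded trace_spread_def, rule_format, of J "M * M"] by metis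
    define \<alpha> where "\<alpha> = Min (pmf (conv_pow \<mu> N) ` S)"
    have "S \<noteq> {}" using S(3) Jp by auto
    then have \<alpha>: "0 < \<alpha>" "\<And>t. t \<in> S \<Longrightarrow> \<alpha> \<le> pmf (conv_pow \<mu> N) t"
      using S(1,2) unfolding \<alpha>_def by (auto simp: Min_gr_iff pmf_positive subset_iff)
    \<comment> \<open>Tuned to the loss \<open>3 * \<delta> / \<alpha>\<close> of
      \<open>expectation_near_max\<close>: half of \<open>c0\<close> survives.\<close>
    define \<delta> where "\<delta> = \<alpha> * c0 / 6"
    have \<delta>: "0 < \<delta>" "3 * \<delta> / \<alpha> = c0 / 2" using \<alpha>(1) c0p by (auto simp: \<delta>_def)
    obtain n1 where n1: "q n1 < c0 + \<delta>" using c0(3)[OF \<delta>(1)] by blast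
    have "c0 - \<delta> < q (n1 + N)" using c0(2)[of "n1 + N"] \<delta>(1) by linarith
    then obtain A B where AB: "A \<in> SL2" "B \<in> SL2" "c0 - \<delta> < P (n1 + N) (E A B)"
      using q_less by blast
    have ge: "c0 / 2 \<le> P n1 (E (mat2_mult A t) B)" if t: "t \<in> S" for t
    proof -
      have "c0 - 3 * \<delta> / \<alpha> \<le> P n1 (E (mat2_mult A t) B)"
      proof (rule expectation_near_max[where m = "conv_pow \<mu> N" and U = "set_pmf (conv_pow \<mu> N)"
            and p = "\<lambda>t. P n1 (E (mat2_mult A t) B)"])
        show "1 - \<delta> \<le> measure_pmf.prob (conv_pow \<mu> N) (set_pmf (conv_pow \<mu> N))"
          using \<delta>(1) measure_Int_set_pmf[of "conv_pow \<mu> N" UNIV] by simp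
        show "P n1 (E (mat2_mult A t) B) \<le> c0 + \<delta>" if "t \<in> set_pmf (conv_pow \<mu> N)" for t
        proof -
          have "mat2_mult A t \<in> SL2" using AB slN[of N] that by auto
          then show ?thesis using P_le_q[of "mat2_mult A t" B n1] AB n1 by linarith
        qed
        show "c0 - \<delta> \<le> measure_pmf.expectation (conv_pow \<mu> N) (\<lambda>t. P n1 (E (mat2_mult A t) B))"
          using AB(3) unfolding P_def prob_conv_pow_left E_left by simp
      qed (use t S \<alpha> c0p \<delta> in \<open>auto simp: P_def\<close>)
      then show ?thesis using \<delta>(2) by simp
    qed
    \<comment> \<open>If \<open>g\<close> lay in both events, \<open>X\<close> and \<open>Y\<close>
      would have norm at most \<open>M\<close>. But \<open>X\<close> times the inverse of
      \<open>Y\<close> is conjugate to \<open>s\<close> times the inverse of \<open>t\<close>, whose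
      trace exceeds \<open>M * M\<close>.\<close>
    have disj: "E (mat2_mult A s) B \<inter> E (mat2_mult A t) B \<inter> SL2 = {}" if st: "s \<in> S" "t \<in> S" "s \<noteq> t" for s t
    proof (rule ccontr)
      assume "\<not> ?thesis"
      then obtain g where g: "g \<in> SL2" "g \<in> E (mat2_mult A s) B" "g \<in> E (mat2_mult A t) B" by auto
      have SL: "s \<in> SL2" "t \<in> SL2" using st S(2) slN[of N] by blast+
      define X where "X = mat2_mult (mat2_mult A s) (mat2_mult g B)"
      define Y where "Y = mat2_mult (mat2_mult A t) (mat2_mult g B)"
      have Yi: "mat2_inv_SL Y = mat2_mult (mat2_inv_SL B) (mat2_mult (mat2_inv_SL g) (mat2_mult (mat2_inv_SL t) (mat2_inv_SL A)))"
        by (simp add: Y_def mat2_inv_mult mat2_mult_assoc)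
      have c1: "mat2_mult B (mat2_mult (mat2_inv_SL B) Z) = Z" for Z
        using AB(2) by (metis mat2_mult_assoc mat2_inv_right mat2_mult_id(1))
      have c2: "mat2_mult g (mat2_mult (mat2_inv_SL g) Z) = Z" for Z
        using g(1) by (metis mat2_mult_assoc mat2_inv_right mat2_mult_id(1))
      have "mat2_mult X (mat2_inv_SL Y)
         = mat2_mult A (mat2_mult (mat2_mult s (mat2_inv_SL t)) (mat2_inv_SL A))"
        by (simp add: Yi X_def mat2_mult_assoc c1 c2)
      then have "absv (mat2_tr (mat2_mult s (mat2_inv_SL t))) \<le> mat2_norm absv (mat2_mult X (mat2_inv_SL Y))"
        using mat2_tr_conj[OF AB(1)] tr_le_norm by metis
      also have "\<dots> \<le> mat2_norm absv X * mat2_norm absv Y"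
        using norm_mult_le[of X "mat2_inv_SL Y"] by simp
      also have "\<dots> \<le> M * M"
        using g(2,3) norm_nonneg[of X] order_trans[OF norm_nonneg[of Y], of M]
        by (intro mult_mono) (auto simp: E_def X_def Y_def)
      finally show False using tr[OF st] by simp
    qed
    have "1 < real J * (c0 / 2)" using J c0p by (simp add: field_simps)
    also have "\<dots> \<le> real (card S) * (c0 / 2)" using S(3) c0p by (intro mult_right_mono) auto
    also have "\<dots> \<le> (\<Sum>t\<in>S. P n1 (E (mat2_mult A t) B))"
      using sum_mono[of S "\<lambda>_. c0/2" "\<lambda>t. P n1 (E (mat2_mult A t) B)"] ge by simp
    also have "\<dots> = (\<Sum>t\<in>S. P n1 (E (mat2_mult A t) B \<inter> SL2))"
    proof (rule sum.cong[OF refl])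
      fix t
      have "P n1 (E (mat2_mult A t) B) = P n1 (E (mat2_mult A t) B \<inter> set_pmf (conv_pow \<mu> n1))"
        by (simp add: P_def measure_Int_set_pmf)
      also have "\<dots> = P n1 ((E (mat2_mult A t) B \<inter> SL2) \<inter> set_pmf (conv_pow \<mu> n1))"
        using slN[of n1] by (intro arg_cong[where f="P n1"]) auto
      finally show "P n1 (E (mat2_mult A t) B) = P n1 (E (mat2_mult A t) B \<inter> SL2)"
        by (simp add: P_def measure_Int_set_pmf)
    qed
    also have "\<dots> \<le> 1" unfolding P_def
      by (rule sum_prob_disjoint_le_1[OF S(1)]) (use disj in blast)
    finally show False by simp
  qed
  then obtain n0 where n0: "q n0 \<le> c" by blast
  show ?thesis
  proof (intro exI[of _ n0] allI impI)
    fix n and A B :: "'k mat2" assume n: "n0 \<le> n" and AB: "A \<in> SL2" "B \<in> SL2"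
    have "P n (E A B) \<le> q n0" using mono[OF AB, of "n - n0" n0] n by simp
    then show "measure_pmf.prob (conv_pow \<mu> n) {g. mat2_norm absv (mat2_mult A (mat2_mult g B)) \<le> M} \<le> c"
      using n0 by (simp add: P_def E_def)
  qed
qed

text \<open>The scheme of \<open>norm_escape\<close> with balls as targets. A left factor
  \<open>t\<close> distorts the target ball by up to the square of its norm, so \<open>t\<close> is
  first confined to bounded norm and the radius is allowed to shrink with time.\<close>

lemma nonconcentration:
  assumes sl: "set_pmf \<mu> \<subseteq> SL2" and sp: "point_spread \<mu>" and c: "0 < c"
  shows "\<exists>n0. \<exists>\<epsilon>>0. \<forall>n v w. n0 \<le> n \<longrightarrow> v \<noteq> (0,0) \<longrightarrow> w \<noteq> (0,0) \<longrightarrow>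
     measure_pmf.prob (conv_pow \<mu> n) {g. chord (mv g v) w < \<epsilon>} \<le> c"
proof -
  \<comment> \<open>Radii tied to the time, so that the one sequence \<open>q\<close> captures late
    times and small balls together.\<close>
  define r where "r k = inverse (real (Suc k))" for k :: nat
  have r: "0 < r k" for k by (simp add: r_def)
  define X where "X = {v :: 'k \<times> 'k. v \<noteq> (0,0)}"
  define P where "P n = measure_pmf.prob (conv_pow \<mu> n)" for n
  define E where "E e v w = {g. chord (mv g v) w < e}" for e v w
  define q where "q n = (SUP (v,w)\<in>X\<times>X. P n (E (r n) v w))" for n
  have bdd: "bdd_above ((\<lambda>(A,B). P n (E (r n) A B)) ` (X \<times> X))" for n
    by (rule bdd_aboveI[of _ 1]) (auto simp: P_def)
  have P_le_q: "P n (E (r n) A B) \<le> q n" if "A \<in> X" "B \<in> X" for n A B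
    unfolding q_def using that by (intro cSUP_upper2[OF bdd, of "(A,B)"]) auto
  have q_less: "\<exists>A\<in>X. \<exists>B\<in>X. a < P n (E (r n) A B)" if "a < q n" for a n
  proof (rule ccontr)
    assume c: "\<not> ?thesis"
    have "(1,0) \<in> X" by (simp add: X_def)
    then have "q n \<le> a" unfolding q_def using c by (intro cSUP_least) (fastforce simp: not_less)+
    with that show False by simp
  qed
  have slN: "set_pmf (conv_pow \<mu> n) \<subseteq> SL2" for n by (rule set_conv_pow_sub_SL2[OF sl])
  have mvX: "mv g v \<in> X" if "g \<in> SL2" "v \<in> X" for g v using that by (simp add: X_def)
  have E_right: "{g. mat2_mult g h \<in> E e v w} = E e (mv h v) w" for h e v w
    by (simp add: E_def mv_mult)
  have mono: "P n (E (r k) v w) \<le> q k" if "v \<in> X" "w \<in> X" "k \<le> n" for k n v w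
  proof -
    have "P ((n - k) + k) (E (r k) v w) \<le> q k"
      unfolding P_def prob_conv_pow_right E_right
      using that slN[of "n - k"] by (intro expectation_le_const) (auto intro!: P_le_q[unfolded P_def] mvX)
    then show ?thesis using that by simp
  qed
  have "\<exists>n. q n \<le> c"
  proof (rule ccontr)
    assume "\<not> ?thesis"
    moreover have "0 \<le> q n" for n

      by (rule order_trans[OF _ P_le_q[of "(1,0)" "(1,0)" n]]) (simp_all add: P_def X_def)
    ultimately obtain c0 where c0: "c \<le> c0" "\<And>n. c0 \<le> q n" "\<And>d. 0 < d \<Longrightarrow> \<exists>n. q n < c0 + d"
      using decreasing_seq_small_or_inf[of q c] by blast
    have c0p: "c0 > 0" using c c0 by simp
    obtain J :: nat where J: "2 / c0 < real J" using reals_Archimedean2 by blast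
    have Jp: "J > 0" using J c0p by (metis divide_pos_pos of_nat_0_less_iff zero_less_numeral less_trans)
    obtain N S \<eta> where \<eta>: "\<eta> > 0" and S: "finite S" "S \<subseteq> set_pmf (conv_pow \<mu> N)"
      and sep: "\<And>v. v \<noteq> (0,0) \<Longrightarrow> \<exists>S'\<subseteq>S. J \<le> card S' \<and>
       (\<forall>t\<in>S'. \<forall>t'\<in>S'. t \<noteq> t' \<longrightarrow> \<eta> \<le> chord (mv (mat2_inv_SL t) v) (mv (mat2_inv_SL t') v))"
      using sp[unfolded point_spread_def, rule_format, of J] by metis
    have "S \<noteq> {}" using sep[of "(1,0)"] Jp S(1) by auto
    define \<alpha> where "\<alpha> = Min (pmf (conv_pow \<mu> N) ` S)"
    have \<alpha>: "0 < \<alpha>" "\<And>t. t \<in> S \<Longrightarrow> \<alpha> \<le> pmf (conv_pow \<mu> N) t"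
      using S \<open>S \<noteq> {}\<close> unfolding \<alpha>_def by (auto simp: Min_gr_iff pmf_positive subset_iff)
    define \<delta> where "\<delta> = \<alpha> * c0 / 6"
    have \<delta>: "0 < \<delta>" "3 * \<delta> / \<alpha> = c0 / 2" using \<alpha>(1) c0p by (auto simp: \<delta>_def)
    \<comment> \<open>Elements of norm at most \<open>R\<close>: for large \<open>R\<close> all but
      \<delta> of the mass, and all of \<open>S\<close>.\<close>
    let ?F = "\<lambda>R::nat. {t. mat2_norm absv t \<le> real R}"
    have "(\<lambda>R. measure_pmf.prob (conv_pow \<mu> N) (?F R)) \<longlonglongrightarrow> measure_pmf.prob (conv_pow \<mu> N) (\<Union>R. ?F R)"
      by (rule measure_pmf.finite_Lim_measure_incseq) (auto simp: incseq_def)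
    moreover have "(\<Union>R. ?F R) = UNIV" using real_arch_simple by auto
    ultimately have "(\<lambda>R. measure_pmf.prob (conv_pow \<mu> N) (?F R)) \<longlonglongrightarrow> 1" by simp
    then have ev: "eventually (\<lambda>R. 1 - \<delta> < measure_pmf.prob (conv_pow \<mu> N) (?F R)) sequentially"
      by (rule order_tendstoD) (use \<delta> in simp)
    obtain R0 :: nat where R0: "Max (mat2_norm absv ` S) \<le> real R0" using real_arch_simple by blast
    obtain R where R: "R0 \<le> R" "1 - \<delta> < measure_pmf.prob (conv_pow \<mu> N) (?F R)"
      using eventually_happens'[OF sequentially_bot eventually_conj[OF ev eventually_ge_at_top[of R0]]] by blast
    have SR: "t \<in> ?F R" if "t \<in> S" for t
    proof -
      have "mat2_norm absv t \<le> Max (mat2_norm absv ` S)" using that S(1) by simp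
      then show ?thesis using R0 R(1) by simp
    qed
    \<comment> \<open>Pulling back by such a \<open>t\<close> multiplies radii by at most the square
      of \<open>R\<close>; the summand 1 keeps \<open>C\<close> positive and the inequality
      strict.\<close>
    define C where "C = (real R)\<^sup>2 + 1"
    have C: "C > 0" by (simp add: C_def add_nonneg_pos)
    obtain n1 where n1: "q n1 < c0 + \<delta>" using c0(3)[OF \<delta>(1)] by blast
    \<comment> \<open>At time \<open>m\<close> the pulled-back balls are smaller than those of time
      \<open>n1\<close>, hence of mass at most \<open>q n1\<close>, and smaller than the separation
      \<eta> of their centres, hence disjoint.\<close>
    obtain m where m: "n1 + N \<le> m" "C * r m < min (r n1) \<eta>"
    proof -
      have "r \<longlonglongrightarrow> 0" unfolding r_def by (rule LIMSEQ_inverse_real_of_nat)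
      then have "(\<lambda>m. C * r m) \<longlonglongrightarrow> C * 0" by (intro tendsto_intros)
      then have "eventually (\<lambda>m. C * r m < min (r n1) \<eta>) sequentially"
        by (rule order_tendstoD) (use r \<eta> in simp)
      then show thesis
        using that eventually_happens'[OF sequentially_bot eventually_conj[OF _ eventually_ge_at_top[of "n1 + N"]]] by blast
    qed
    define n2 where "n2 = m - N"
    have n2: "m = n2 + N" "n1 \<le> n2" using m(1) by (auto simp: n2_def)
    have "c0 - \<delta> < q m" using c0(2)[of m] \<delta>(1) by linarith
    then obtain v w where vw: "v \<in> X" "w \<in> X" "c0 - \<delta> < P m (E (r m) v w)"
      using q_less by blast
    define p where "p t = P n2 {g. mat2_mult t g \<in> E (r m) v w}" for t
    have sub: "{g. mat2_mult t g \<in> E (r m) v w} \<subseteq> E (C * r m) v (mv (mat2_inv_SL t) w)"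
      if t: "t \<in> SL2" "t \<in> ?F R" for t
    proof
      fix g assume "g \<in> {g. mat2_mult t g \<in> E (r m) v w}"
      then have l: "chord (mv t (mv g v)) w < r m" by (simp add: E_def mv_mult)
      have "chord (mv g v) (mv (mat2_inv_SL t) w) = chord (mv (mat2_inv_SL t) (mv t (mv g v))) (mv (mat2_inv_SL t) w)"
        using t by simp
      also have "\<dots> \<le> (mat2_norm absv t)\<^sup>2 * chord (mv t (mv g v)) w"
        using chord_mv_le[of "mat2_inv_SL t" "mv t (mv g v)" w] t by (simp del: mv_inv_left)
      also have "\<dots> \<le> (real R)\<^sup>2 * chord (mv t (mv g v)) w"
        using t by (intro mult_right_mono power_mono) auto
      also have "\<dots> \<le> (real R)\<^sup>2 * r m" using l by (intro mult_left_mono) auto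
      also have "\<dots> < C * r m" using r[of m] by (simp add: C_def algebra_simps)
      finally show "g \<in> E (C * r m) v (mv (mat2_inv_SL t) w)" by (simp add: E_def)
    qed
    have E_mono: "E e v w \<subseteq> E e' v w" if "e \<le> e'" for e e' v w using that by (auto simp: E_def)
    have ge: "c0 / 2 \<le> p t" if t: "t \<in> S" for t
    proof -
      have "c0 - 3 * \<delta> / \<alpha> \<le> p t"
      proof (rule expectation_near_max[where m = "conv_pow \<mu> N" and U = "?F R \<inter> set_pmf (conv_pow \<mu> N)"])
        show "1 - \<delta> \<le> measure_pmf.prob (conv_pow \<mu> N) (?F R \<inter> set_pmf (conv_pow \<mu> N))"
          using R(2) by (simp add: measure_Int_set_pmf)
        show "p t \<le> c0 + \<delta>" if "t \<in> ?F R \<inter> set_pmf (conv_pow \<mu> N)" for t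
        proof -
          have t: "t \<in> SL2" "t \<in> ?F R" using slN[of N] that by auto
          have "p t \<le> P n2 (E (r n1) v (mv (mat2_inv_SL t) w))"
            unfolding p_def P_def
            using order_trans[OF sub[OF t] E_mono[of "C * r m" "r n1"]] m(2)
            by (intro measure_pmf.finite_measure_mono) auto
          also have "\<dots> \<le> q n1" using vw t n2 by (intro mono mvX) auto
          finally show ?thesis using n1 by simp
        qed
        show "c0 - \<delta> \<le> measure_pmf.expectation (conv_pow \<mu> N) p"
          using vw(3) unfolding P_def n2(1) prob_conv_pow_left p_def by simp
      qed (use t S \<alpha> c0p \<delta> SR[OF t] in \<open>auto simp: P_def p_def\<close>)
      then show ?thesis using \<delta>(2) by simp
    qed
    obtain S' where S': "S' \<subseteq> S" "J \<le> card S'"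
      "\<And>t t'. t \<in> S' \<Longrightarrow> t' \<in> S' \<Longrightarrow> t \<noteq> t' \<Longrightarrow> \<eta> \<le> chord (mv (mat2_inv_SL t) w) (mv (mat2_inv_SL t') w)"
      using sep[of w] vw(2) unfolding X_def by blast
    have finS': "finite S'" by (rule finite_subset[OF S'(1) S(1)])
    define F where "F t = E \<eta> v (mv (mat2_inv_SL t) w) \<inter> SL2" for t
    have p_le: "p t \<le> P n2 (F t)" if "t \<in> S'" for t
    proof -
      have t: "t \<in> SL2" "t \<in> ?F R" using that S'(1) S(2) slN[of N] SR by blast+
      have "p t \<le> P n2 (E \<eta> v (mv (mat2_inv_SL t) w))"
        unfolding p_def P_def
        using order_trans[OF sub[OF t] E_mono[of "C * r m" "\<eta>"]] m(2)
        by (intro measure_pmf.finite_measure_mono) auto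
      also have "\<dots> = P n2 (E \<eta> v (mv (mat2_inv_SL t) w) \<inter> set_pmf (conv_pow \<mu> n2))"
        by (simp add: P_def measure_Int_set_pmf)
      also have "\<dots> \<le> P n2 (F t)" unfolding P_def F_def
        using slN[of n2] by (intro measure_pmf.finite_measure_mono) auto
      finally show ?thesis .
    qed
    have disj: "F s \<inter> F t = {}" if st: "s \<in> S'" "t \<in> S'" "s \<noteq> t" for s t
    proof (rule ccontr)
      assume "\<not> ?thesis"
      then obtain g where g: "g \<in> SL2" "chord (mv g v) (mv (mat2_inv_SL s) w) < \<eta>"
        "chord (mv g v) (mv (mat2_inv_SL t) w) < \<eta>" by (auto simp: F_def E_def)
      have SL: "s \<in> SL2" "t \<in> SL2" using st S(2) S'(1) slN[of N] by blast+
      have "chord (mv (mat2_inv_SL s) w) (mv (mat2_inv_SL t) w)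
         \<le> max (chord (mv (mat2_inv_SL s) w) (mv g v)) (chord (mv g v) (mv (mat2_inv_SL t) w))"
        using SL g vw by (intro chord_ultra) (auto simp: X_def)
      also have "\<dots> < \<eta>" using g by (simp add: chord_commute)
      finally show False using S'(3)[OF st] by simp
    qed
    have "1 < real J * (c0 / 2)" using J c0p by (simp add: field_simps)
    also have "\<dots> \<le> real (card S') * (c0 / 2)" using S'(2) c0p by (intro mult_right_mono) auto
    also have "\<dots> \<le> (\<Sum>t\<in>S'. P n2 (F t))"
      by (rule sum_bounded_below) (use ge p_le S'(1) in \<open>meson order_trans subsetD\<close>)
    also have "\<dots> \<le> 1" unfolding P_def
      by (rule sum_prob_disjoint_le_1[OF finS']) (use disj in blast)
    finally show False by simp
  qed
  then obtain n0 where n0: "q n0 \<le> c" by blast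
  show ?thesis
  proof (intro exI[of _ n0] exI[of _ "r n0"] conjI allI impI)
    fix n and v w :: "'k \<times> 'k" assume n: "n0 \<le> n" and vw: "v \<noteq> (0,0)" "w \<noteq> (0,0)"
    have "P n (E (r n0) v w) \<le> q n0" using mono[of v w n0 n] n vw by (simp add: X_def)
    then show "measure_pmf.prob (conv_pow \<mu> n) {g. chord (mv g v) w < r n0} \<le> c"
      using n0 by (simp add: P_def E_def)
  qed (rule r)
qed

lemma norm_eq_max_columns:
  "mat2_norm absv g = max (vn (mv (mat2_inv_SL g) (1,0))) (vn (mv (mat2_inv_SL g) (0,1)))"
  by (cases g) (simp add: max.commute max.left_commute)

text \<open>A large norm makes the image of some basis vector under the inverse of \<open>g\<close>
  long. Then \<open>dil f g\<close> stays bounded only if this image points where \<open>f\<close>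
  is small relative to \<open>vn\<close>, and such directions are rarely hit by the inverse
  walk.\<close>

lemma dil_escape:
  assumes sl: "set_pmf \<mu> \<subseteq> SL2" and sp: "trace_spread \<mu>" "point_spread (map_pmf mat2_inv_SL \<mu>)" and c: "0 < c"
  shows "\<exists>n0. \<forall>n f. n0 \<le> n \<longrightarrow> norm_like f \<longrightarrow>
     measure_pmf.prob (conv_pow \<mu> n) {g. dil f g \<le> M} \<le> c"
proof -
  have sl': "set_pmf (map_pmf mat2_inv_SL \<mu>) \<subseteq> SL2" using sl unfolding set_map_pmf by (blast intro: SL2_inv[THEN iffD2])
  have c3: "0 < c/3" using c by simp
  obtain n1 \<epsilon> where \<epsilon>: "0 < \<epsilon>" and n1: "\<And>n v w. n1 \<le> n \<Longrightarrow> v \<noteq> (0,0) \<Longrightarrow> w \<noteq> (0,0) \<Longrightarrow>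
     measure_pmf.prob (conv_pow (map_pmf mat2_inv_SL \<mu>) n) {g. chord (mv g v) w < \<epsilon>} \<le> c/3"
    using nonconcentration[OF sl' sp(2) c3] by blast
  obtain n2 where n2: "\<And>n A B. n2 \<le> n \<Longrightarrow> A \<in> SL2 \<Longrightarrow> B \<in> SL2 \<Longrightarrow>
     measure_pmf.prob (conv_pow \<mu> n) {g. mat2_norm absv (mat2_mult A (mat2_mult g B)) \<le> \<bar>M\<bar> / \<epsilon>} \<le> c/3"
    using norm_escape[OF sl sp(1) c3] by blast
  show ?thesis
  proof (intro exI[of _ "max n1 n2"] allI impI)
    fix n f assume n: "max n1 n2 \<le> n" and f: "norm_like f"
    let ?P = "measure_pmf.prob (conv_pow \<mu> n)"
    let ?D = "\<lambda>e. {g. g \<in> SL2 \<and> f (mv (mat2_inv_SL g) e) < \<epsilon> * vn (mv (mat2_inv_SL g) e)}"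
    have slN: "set_pmf (conv_pow \<mu> n) \<subseteq> SL2" by (rule set_conv_pow_sub_SL2[OF sl])
    have D: "?P (?D e) \<le> c/3" if e: "e \<noteq> (0,0)" for e
    proof (cases "?D e = {}")
      case True
      then have "?P (?D e) = ?P {}" by (rule arg_cong)
      then show ?thesis using c by simp
    next
      case False
      \<comment> \<open>\<open>f\<close> need not vanish anywhere, so the centre of the small ball
        is taken from the event itself: by \<open>nl_wedge_le\<close> any two directions where
        \<open>f\<close> is small are close to each other.\<close>
      then obtain g0 where g0: "g0 \<in> ?D e" by blast
      let ?w = "mv (mat2_inv_SL g0) e"
      have w: "?w \<noteq> (0,0)" using g0 e by auto
      have "?D e \<subseteq> {g. chord (mv (mat2_inv_SL g) e) ?w < \<epsilon>}"
      proof
        fix g assume g: "g \<in> ?D e"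
        let ?u = "mv (mat2_inv_SL g) e"
        have u: "?u \<noteq> (0,0)" using g e by auto
        have p: "vn ?u > 0" "vn ?w > 0" using u w by simp_all
        have "absv (wedge ?u ?w) \<le> max (f ?u * vn ?w) (f ?w * vn ?u)" by (rule nl_wedge_le[OF f])
        also have "\<dots> < \<epsilon> * (vn ?u * vn ?w)"
          using g g0 p mult_strict_right_mono[of "f ?u" "\<epsilon> * vn ?u" "vn ?w"]
            mult_strict_right_mono[of "f ?w" "\<epsilon> * vn ?w" "vn ?u"] by (simp add: mult_ac)
        finally show "g \<in> {g. chord (mv (mat2_inv_SL g) e) ?w < \<epsilon>}"
          using p by (simp add: chord_def field_simps)
      qed
      then have "?P (?D e) \<le> ?P {g. chord (mv (mat2_inv_SL g) e) ?w < \<epsilon>}"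
        by (intro measure_pmf.finite_measure_mono) auto
      also have "\<dots> \<le> c/3" using n1[of n e ?w] n e w
        by (simp add: conv_pow_inv measure_map_pmf vimage_def)
      finally show ?thesis .
    qed
    have sub: "{g. dil f g \<le> M} \<inter> SL2 \<subseteq> {g. mat2_norm absv g \<le> \<bar>M\<bar> / \<epsilon>} \<union> (?D (1,0) \<union> ?D (0,1))"
    proof
      fix g assume g: "g \<in> {g. dil f g \<le> M} \<inter> SL2"
      then have le: "f (mv (mat2_inv_SL g) (1,0)) \<le> M" "f (mv (mat2_inv_SL g) (0,1)) \<le> M"
        by (auto simp: dil_def)
      show "g \<in> {g. mat2_norm absv g \<le> \<bar>M\<bar> / \<epsilon>} \<union> (?D (1,0) \<union> ?D (0,1))"
      proof (cases "mat2_norm absv g \<le> \<bar>M\<bar> / \<epsilon>")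
        case False
        then have "\<bar>M\<bar> < \<epsilon> * mat2_norm absv g" using \<epsilon> by (simp add: field_simps)
        moreover have "mat2_norm absv g = vn (mv (mat2_inv_SL g) (1,0)) \<or> mat2_norm absv g = vn (mv (mat2_inv_SL g) (0,1))"
          unfolding norm_eq_max_columns by (simp add: max_def)
        ultimately show ?thesis using le g by auto
      qed simp
    qed
    have "?P {g. dil f g \<le> M} = ?P ({g. dil f g \<le> M} \<inter> set_pmf (conv_pow \<mu> n))"
      by (simp add: measure_Int_set_pmf)
    also have "\<dots> \<le> ?P ({g. mat2_norm absv g \<le> \<bar>M\<bar> / \<epsilon>} \<union> (?D (1,0) \<union> ?D (0,1)))"
      using sub slN by (intro measure_pmf.finite_measure_mono) (blast, simp)
    also have "\<dots> \<le> ?P {g. mat2_norm absv g \<le> \<bar>M\<bar> / \<epsilon>} + ?P (?D (1,0) \<union> ?D (0,1))"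
      by (rule measure_Un_le) auto
    also have "?P (?D (1,0) \<union> ?D (0,1)) \<le> ?P (?D (1,0)) + ?P (?D (0,1))"
      by (rule measure_Un_le) auto
    also have "?P {g. mat2_norm absv g \<le> \<bar>M\<bar> / \<epsilon>} + (?P (?D (1,0)) + ?P (?D (0,1))) \<le> c/3 + (c/3 + c/3)"
      using n2[of n mat2_id mat2_id] n D[of "(1,0)"] D[of "(0,1)"] by simp
    finally show "?P {g. dil f g \<le> M} \<le> c" by simp
  qed
qed

end

section \<open>Spread-out elements of the semigroup\<close>

lemma gen_group_inv_sub: "g \<in> gen_group (mat2_inv_SL ` S) \<Longrightarrow> g \<in> gen_group S"
proof (induction rule: gen_group.induct)
  case (gen_inv g h)
  then show ?case by (metis imageE mat2_inv_inv gen_group.gen_mult)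
qed (blast intro: gen_group.intros)+

lemma gen_group_inv: "gen_group (mat2_inv_SL ` S) = gen_group S"
proof -
  have "mat2_inv_SL ` mat2_inv_SL ` S = S" by (simp only: image_image mat2_inv_inv image_ident)
  then show ?thesis using gen_group_inv_sub[of _ S] gen_group_inv_sub[of _ "mat2_inv_SL ` S"] by auto
qed

lemma mat2_tr_inv: "mat2_tr (mat2_inv_SL g) = mat2_tr g"
  by (cases g) simp

text \<open>Cayley-Hamilton: the adjugate \<open>mat2_inv_SL s\<close> is the trace of
  \<open>s\<close> times the identity, minus \<open>s\<close>.\<close>

lemma mat2_tr_inv_mult:
  "mat2_tr (mat2_mult t (mat2_mult (mat2_inv_SL s) h))
     = mat2_tr s * mat2_tr (mat2_mult t h) - mat2_tr (mat2_mult t (mat2_mult s h))"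
  by (cases s; cases t; cases h) (simp add: algebra_simps)

lemma mat2_det_0_kernel:
  assumes "mat2_det g = 0"
  shows "\<exists>v. v \<noteq> (0,0) \<and> mv g v = (0,0)"
proof (cases g)
  case (fields a b c d)
  consider "a \<noteq> 0 \<or> b \<noteq> 0" | "c \<noteq> 0 \<or> d \<noteq> 0" | "a = 0" "b = 0" "c = 0" "d = 0" by blast
  then show ?thesis
  proof cases
    case 1
    then show ?thesis using fields assms by (intro exI[of _ "(-b,a)"]) (auto simp: algebra_simps)
  next
    case 2
    then show ?thesis using fields assms by (intro exI[of _ "(-d,c)"]) (auto simp: algebra_simps)
  next
    case 3
    then show ?thesis using fields by (intro exI[of _ "(1,0)"]) simp
  qed
qed

lemma eigenvector_exists:
  assumes "l * l - mat2_tr g * l + 1 = 0" "g \<in> SL2"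
  shows "\<exists>v. v \<noteq> (0,0) \<and> mv g v = vsc l v"
proof (cases g)
  case (fields a b c d)
  have "a * d - b * c = 1" using assms(2) fields by (simp add: SL2_def)
  moreover have "l * l - (a + d) * l + 1 = 0" using assms(1) fields by simp
  ultimately have "mat2_det (a - l, b, c, d - l) = 0" by (simp add: algebra_simps)
  then obtain v where v: "v \<noteq> (0,0)" "mv (a - l, b, c, d - l) v = (0,0)" using mat2_det_0_kernel by blast
  obtain x y where xy: "v = (x,y)" by (cases v)
  have "mv g v = vsc l v" using v(2) fields xy by (simp add: algebra_simps)
  then show ?thesis using v by blast
qed

fun mpow :: "'k::field mat2 \<Rightarrow> nat \<Rightarrow> 'k mat2" where
  "mpow g 0 = mat2_id"
| "mpow g (Suc n) = mat2_mult g (mpow g n)"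

lemma mpow_in_conv_pow: "g \<in> set_pmf (conv_pow \<mu> m) \<Longrightarrow> mpow g k \<in> set_pmf (conv_pow \<mu> (m * k))"
  by (induction k) (auto simp del: conv_pow.simps(2) intro!: set_conv_pow_mult)

lemma mpow_diag: "mpow (l,0,0,l') k = (l ^ k, 0, 0, l' ^ k)"
  by (induction k) (auto simp: mat2_id_def)

text \<open>The matrix of \<open>g\<close> in the basis formed by the columns of
  \<open>P\<close>.\<close>

definition cj :: "'k::field mat2 \<Rightarrow> 'k mat2 \<Rightarrow> 'k mat2" where
  "cj P g = mat2_mult (mat2_inv_SL P) (mat2_mult g P)"

lemma cj_mult: "P \<in> SL2 \<Longrightarrow> cj P (mat2_mult g h) = mat2_mult (cj P g) (cj P h)"
proof -
  assume P: "P \<in> SL2"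
  have "mat2_mult P (mat2_mult (mat2_inv_SL P) Z) = Z" for Z
    using P by (metis mat2_mult_assoc mat2_inv_right mat2_mult_id(1))
  then show ?thesis by (simp add: cj_def mat2_mult_assoc)
qed

lemma cj_id: "P \<in> SL2 \<Longrightarrow> cj P mat2_id = mat2_id"
  by (simp add: cj_def mat2_inv_left)

lemma cj_mpow: "P \<in> SL2 \<Longrightarrow> cj P (mpow g k) = mpow (cj P g) k"
  by (induction k) (auto simp: cj_id cj_mult)

lemma cj_inv: "P \<in> SL2 \<Longrightarrow> cj P (mat2_inv_SL g) = mat2_inv_SL (cj P g)"
  by (simp add: cj_def mat2_inv_mult mat2_mult_assoc)

lemma cj_tr: "P \<in> SL2 \<Longrightarrow> mat2_tr (cj P g) = mat2_tr g"
  using mat2_tr_conj[of "mat2_inv_SL P" g] by (simp add: cj_def)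

lemma mv_cj: "P \<in> SL2 \<Longrightarrow> mv P (mv (cj P g) v) = mv g (mv P v)"
  by (simp add: cj_def mv_mult)

section \<open>Non-elementarity passes to the semigroup\<close>

locale ne_walk = nonarch_field absv for absv :: "'k::field \<Rightarrow> real" +
  fixes \<mu> :: "'k mat2 pmf"
  assumes complete: "complete_abs absv"
    and sl: "set_pmf \<mu> \<subseteq> SL2"
    and ne: "non_elementary absv (gen_group (set_pmf \<mu>))"
begin

text \<open>The generated group is the same, so everything proved in the locale is available for the
  walk with inverted increments.\<close>

lemma inverse_walk: "ne_walk absv (map_pmf mat2_inv_SL \<mu>)"
proof
  show "set_pmf (map_pmf mat2_inv_SL \<mu>) \<subseteq> SL2"
    using sl unfolding set_map_pmf by (blast intro: SL2_inv[THEN iffD2])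
  show "non_elementary absv (gen_group (set_pmf (map_pmf mat2_inv_SL \<mu>)))"
    using ne by (simp add: gen_group_inv)
qed (rule complete)

lemma slN: "set_pmf (conv_pow \<mu> n) \<subseteq> SL2"
  by (rule set_conv_pow_sub_SL2[OF sl])

definition semi :: "'k mat2 set" where
  "semi = (\<Union>n. set_pmf (conv_pow \<mu> n))"

lemma semi_id: "mat2_id \<in> semi"
  unfolding semi_def by (rule UN_I[of 0]) auto

lemma semi_mult: "g \<in> semi \<Longrightarrow> h \<in> semi \<Longrightarrow> mat2_mult g h \<in> semi"
  unfolding semi_def using set_conv_pow_mult by blast

lemma supp_semi: "set_pmf \<mu> \<subseteq> semi"
proof
  fix g assume "g \<in> set_pmf \<mu>"
  then have "g \<in> set_pmf (conv_pow \<mu> (Suc 0))" by (simp only: conv_pow_1)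
  then show "g \<in> semi" unfolding semi_def by blast
qed

lemma semi_SL2: "g \<in> semi \<Longrightarrow> g \<in> SL2"
  unfolding semi_def using slN by blast

lemma semi_gen_group: "set_pmf (conv_pow \<mu> n) \<subseteq> gen_group (set_pmf \<mu>)"
proof (induction n)
  case 0
  show ?case by (simp add: gen_group.gen_id)
next
  case (Suc n)
  then show ?case unfolding conv_pow.simps set_bind_pmf set_map_pmf
    by (blast intro: gen_group.gen_mult)
qed

text \<open>If all traces on the semigroup were bounded by 1, \<open>mat2_tr_inv_mult\<close> would
  trade each inverse letter of a group word for traces of words with one inverse less, and the
  ultrametric inequality would keep the bound 1 on the whole group. The extra left factor
  \<open>t\<close> carries the induction.\<close>

lemma hyperbolic_in_semi: "\<exists>h\<in>semi. 1 < absv (mat2_tr h)"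
proof (rule ccontr)
  assume "\<not> ?thesis"
  then have le: "absv (mat2_tr t) \<le> 1" if "t \<in> semi" for t using that by (meson not_le)
  have "\<forall>t\<in>semi. absv (mat2_tr (mat2_mult t g)) \<le> 1" if "g \<in> gen_group (set_pmf \<mu>)" for g
    using that
  proof (induction rule: gen_group.induct)
    case gen_id
    then show ?case using le by simp
  next
    case (gen_mult g h)
    then have "g \<in> semi" using supp_semi by blast
    then show ?case using gen_mult.IH semi_mult by (metis mat2_mult_assoc)
  next
    case (gen_inv g h)
    then have g: "g \<in> semi" using supp_semi by blast
    show ?case
    proof
      fix t assume t: "t \<in> semi"
      have "absv (mat2_tr g * mat2_tr (mat2_mult t h)) \<le> 1"
        using le[OF g] gen_inv.IH t by (simp add: absv_mult mult_le_one)
      moreover have "absv (mat2_tr (mat2_mult t (mat2_mult g h))) \<le> 1"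
        using gen_inv.IH semi_mult[OF t g] by (simp add: mat2_mult_assoc[symmetric])
      ultimately show "absv (mat2_tr (mat2_mult t (mat2_mult (mat2_inv_SL g) h))) \<le> 1"
        unfolding mat2_tr_inv_mult using absv_diff_le order_trans max.boundedI by meson
    qed
  qed
  then have "absv (mat2_tr g) \<le> 1" if "g \<in> gen_group (set_pmf \<mu>)" for g
    using semi_id that by (metis mat2_mult_id(1))
  moreover obtain g where "g \<in> gen_group (set_pmf \<mu>)" "1 < absv (mat2_tr g)"
    using ne unfolding non_elementary_def by blast
  ultimately show False by (meson not_le)
qed

text \<open>Otherwise the semigroup orbit has at most two points. Each generator maps this finite
  set injectively into itself, hence onto it, so the inverses preserve it too and the group orbit is
  finite.\<close>

lemma orbit_avoids:
  assumes v: "v \<noteq> (0,0)" "w1 \<noteq> (0,0)" "w2 \<noteq> (0,0)"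
  shows "\<exists>t\<in>semi. wedge (mv t v) w1 \<noteq> 0 \<and> wedge (mv t v) w2 \<noteq> 0"
proof (rule ccontr)
  assume "\<not> ?thesis"
  then have con: "wedge (mv t v) w1 = 0 \<or> wedge (mv t v) w2 = 0" if "t \<in> semi" for t using that by blast
  define F where "F = (\<lambda>t. pt (mv t v)) ` semi"
  have nz: "mv t v \<noteq> (0,0)" if "t \<in> semi" for t using semi_SL2[OF that] v by simp
  have "F \<subseteq> {pt w1, pt w2}"
  proof
    fix x assume "x \<in> F"
    then obtain t where t: "t \<in> semi" "x = pt (mv t v)" unfolding F_def by blast
    show "x \<in> {pt w1, pt w2}" using con[OF t(1)] nz[OF t(1)] v t(2) by (simp add: pt_eq_iff)
  qed
  then have fin: "finite F" by (rule finite_subset) simp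
  have sF: "berk_act absv s ` F \<subseteq> F" if s: "s \<in> set_pmf \<mu>" for s
  proof
    fix y assume "y \<in> berk_act absv s ` F"
    then obtain t where t: "t \<in> semi" "y = berk_act absv s (pt (mv t v))" unfolding F_def by blast
    have "y = pt (mv (mat2_mult s t) v)" using t s sl nz by (simp add: berk_act_pt mv_mult subsetD)
    then show "y \<in> F" unfolding F_def using semi_mult s supp_semi t by blast
  qed
  have inj: "inj_on (berk_act absv s) F" if s: "s \<in> SL2" for s
  proof (rule inj_onI)
    fix x y assume xy: "x \<in> F" "y \<in> F" "berk_act absv s x = berk_act absv s y"
    obtain t t' where t: "t \<in> semi" "x = pt (mv t v)" "t' \<in> semi" "y = pt (mv t' v)"
      using xy unfolding F_def by blast
    have "pt (mv s (mv t v)) = pt (mv s (mv t' v))" using xy t s nz by (simp add: berk_act_pt)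
    then show "x = y" using t s nz by (simp add: pt_eq_iff wedge_mv)
  qed
  have sF': "berk_act absv (mat2_inv_SL s) y \<in> F" if s: "s \<in> set_pmf \<mu>" and y: "y \<in> F" for s y
  proof -
    have s2: "s \<in> SL2" using s sl by blast
    have "berk_act absv s ` F = F" by (rule endo_inj_surj[OF fin sF[OF s] inj[OF s2]])
    then obtain x where x: "x \<in> F" "y = berk_act absv s x" using y by blast
    then obtain t where t: "t \<in> semi" "x = pt (mv t v)" unfolding F_def by blast
    have "berk_act absv (mat2_inv_SL s) y = x" using x t s2 nz by (simp add: berk_act_pt)
    then show ?thesis using x by simp
  qed
  have ptv: "pt v \<in> F" unfolding F_def by (rule image_eqI[OF _ semi_id]) simp
  have "berk_act absv g (pt v) \<in> F" if "g \<in> gen_group (set_pmf \<mu>)" for g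
    using that
  proof (induction rule: gen_group.induct)
    case gen_id
    then show ?case using ptv v by (simp add: berk_act_pt)
  next
    case (gen_mult g h)
    have "h \<in> SL2" "g \<in> SL2" using gen_group_sub_SL2[OF gen_mult.hyps(2) sl] gen_mult.hyps(1) sl by blast+
    then have "berk_act absv (mat2_mult g h) (pt v) = berk_act absv g (berk_act absv h (pt v))"
      using v by (simp add: berk_act_pt mv_mult)
    then show ?case using sF[OF gen_mult.hyps(1)] gen_mult.IH by (metis image_subset_iff)
  next
    case (gen_inv g h)
    have "h \<in> SL2" "g \<in> SL2" using gen_group_sub_SL2[OF gen_inv.hyps(2) sl] gen_inv.hyps(1) sl by blast+
    then have "berk_act absv (mat2_mult (mat2_inv_SL g) h) (pt v) = berk_act absv (mat2_inv_SL g) (berk_act absv h (pt v))"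
      using v by (simp add: berk_act_pt mv_mult)
    then show ?case using sF'[OF gen_inv.hyps(1) gen_inv.IH] by simp
  qed
  then have "{berk_act absv g (pt v) | g. g \<in> gen_group (set_pmf \<mu>)} \<subseteq> F" by blast
  then have "finite {berk_act absv g (pt v) | g. g \<in> gen_group (set_pmf \<mu>)}" using fin finite_subset by blast
  then show False using ne pt_P1k unfolding non_elementary_def by blast
qed

text \<open>The root of larger absolute value is a fixed point of
  \<open>z \<mapsto> \<tau> - 1 / z\<close>, which preserves the sphere of radius
  \<open>absv \<tau>\<close> and contracts it with ratio \<open>r\<close>. Completeness of
  \<open>k\<close> supplies the limit.\<close>

lemma eigenvalue_exists:
  assumes \<tau>: "1 < absv \<tau>"
  shows "\<exists>l. absv l = absv \<tau> \<and> l * l - \<tau> * l + 1 = 0"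
proof -
  define z where "z = rec_nat \<tau> (\<lambda>_ y. \<tau> - 1 / y)"
  have z: "z 0 = \<tau>" "z (Suc n) = \<tau> - 1 / z n" for n by (simp_all add: z_def)
  have az: "absv (z n) = absv \<tau>" for n
  proof (induction n)
    case (Suc n)
    have "absv (1 / z n) < 1" using Suc \<tau> by (simp add: absv_divide divide_less_eq_1)
    then show ?case using \<tau> by (simp add: z absv_diff_eq')
  qed (simp add: z)
  have nz: "z n \<noteq> 0" for n using az[of n] \<tau> by auto
  define r where "r = 1 / (absv \<tau>)\<^sup>2"
  have r: "0 < r" "r < 1" using \<tau> one_less_power[OF \<tau>, of 2] by (auto simp: r_def divide_less_eq_1)
  have inv_diff: "absv (1 / x - 1 / y) = absv (x - y) * r" if "absv x = absv \<tau>" "absv y = absv \<tau>" for x y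
  proof -
    have "x \<noteq> 0" "y \<noteq> 0" using that \<tau> by auto
    then have "1 / x - 1 / y = (y - x) / (x * y)" by (simp add: field_simps)
    then show ?thesis using that by (simp add: absv_divide absv_mult r_def power2_eq_square absv_diff_commute)
  qed
  have step: "absv (z (Suc n) - z n) \<le> r ^ n" for n
  proof (induction n)
    case 0
    have "z (Suc 0) - z 0 = - (1 / \<tau>)" by (simp add: z)
    then show ?case using \<tau> by (simp only: absv_minus) (simp add: absv_divide divide_le_eq_1)
  next
    case (Suc n)
    have "z (Suc (Suc n)) - z (Suc n) = 1 / z n - 1 / z (Suc n)"
      using z(2)[of "Suc n"] z(2)[of n] by simp
    then have "absv (z (Suc (Suc n)) - z (Suc n)) = absv (z n - z (Suc n)) * r"
      using inv_diff[OF az az] by simp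
    then show ?case using Suc r by (simp add: absv_diff_commute[of "z n"] mult.commute)
  qed
  have cau: "absv (z (n + k) - z n) \<le> r ^ n" for n k
  proof (induction k)
    case (Suc k)
    have "absv (z (n + Suc k) - z n) \<le> max (absv (z (Suc (n + k)) - z (n + k))) (absv (z (n + k) - z n))"
      using absv_add_le[of "z (Suc (n + k)) - z (n + k)" "z (n + k) - z n"] by simp
    also have "\<dots> \<le> r ^ n"
      using Suc order_trans[OF step[of "n + k"] power_decreasing[of n "n + k" r]] r by simp
    finally show ?case .
  qed (use r in simp)
  have "\<forall>e>0. \<exists>N. \<forall>m\<ge>N. \<forall>n\<ge>N. absv (z m - z n) < e"
  proof (intro allI impI)
    fix e :: real assume "e > 0"
    then obtain N where N: "r ^ N < e" using real_arch_pow_inv r by blast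
    show "\<exists>N. \<forall>m\<ge>N. \<forall>n\<ge>N. absv (z m - z n) < e"
    proof (intro exI[of _ N] allI impI)
      fix m n assume "N \<le> m" "N \<le> n"
      then have "absv (z m - z N) < e" "absv (z n - z N) < e"
        using cau[of N "m - N"] cau[of N "n - N"] N by auto
      then show "absv (z m - z n) < e" using absv_diff_le[of "z m - z N" "z n - z N"] by simp
    qed
  qed
  then obtain l where l: "\<And>e. e > 0 \<Longrightarrow> \<exists>N. \<forall>n\<ge>N. absv (z n - l) < e"
    using complete[unfolded complete_abs_def, rule_format, of z] by auto
  have al: "absv l = absv \<tau>"
  proof -
    obtain N where "absv (z N - l) < absv \<tau>" using l[of "absv \<tau>"] \<tau> by (meson order_refl less_trans zero_less_one)
    then have "absv (z N - (z N - l)) = absv (z N)" using az by (intro absv_diff_eq') simp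
    then show ?thesis using az by simp
  qed
  then have l0: "l \<noteq> 0" using \<tau> by auto
  have "absv (l - \<tau> + 1 / l) = 0"
  proof (rule ccontr)
    assume "\<not> ?thesis"
    then have pos: "0 < absv (l - \<tau> + 1 / l)" by simp
    obtain N where N: "\<And>n. n \<ge> N \<Longrightarrow> absv (z n - l) < absv (l - \<tau> + 1 / l)" using l[OF pos] by blast
    have "l - \<tau> + 1 / l = (1 / l - 1 / z N) - (z (Suc N) - l)" by (simp add: z)
    then have "absv (l - \<tau> + 1 / l) \<le> max (absv (1 / l - 1 / z N)) (absv (z (Suc N) - l))"
      using absv_diff_le by metis
    moreover have "absv (1 / l - 1 / z N) \<le> absv (z N - l)"
      using inv_diff[OF al az] r by (simp add: absv_diff_commute mult_left_le)
    ultimately show False using N[of N] N[of "Suc N"] by simp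
  qed
  then have "l - \<tau> + 1 / l = 0" by simp
  then have "(l - \<tau> + 1 / l) * l = 0" by simp
  then have "l * l - \<tau> * l + 1 = 0" using l0 by (simp add: algebra_simps)
  then show ?thesis using al by blast
qed

text \<open>As the determinant is 1, \<open>1 / l\<close> is an eigenvalue along with
  \<open>l\<close>; their absolute values differ, so the eigenvectors are independent.\<close>

lemma diagonalisable:
  assumes h: "h \<in> SL2" "1 < absv (mat2_tr h)"
  shows "\<exists>P\<in>SL2. \<exists>l. 1 < absv l \<and> cj P h = (l, 0, 0, 1 / l)"
proof -
  obtain l where l: "absv l = absv (mat2_tr h)" "l * l - mat2_tr h * l + 1 = 0"
    using eigenvalue_exists[OF h(2)] by blast
  have l1: "1 < absv l" using l h by simp
  then have l0: "l \<noteq> 0" by auto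
  have "(1 / l) * (1 / l) - mat2_tr h * (1 / l) + 1 = (l * l - mat2_tr h * l + 1) / (l * l)"
    using l0 by (simp add: field_simps)
  then have l': "(1 / l) * (1 / l) - mat2_tr h * (1 / l) + 1 = 0" using l by simp
  obtain v where v: "v \<noteq> (0,0)" "mv h v = vsc l v" using eigenvector_exists[OF l(2) h(1)] by blast
  obtain w where w: "w \<noteq> (0,0)" "mv h w = vsc (1/l) w" using eigenvector_exists[OF l' h(1)] by blast
  have vw: "wedge v w \<noteq> 0"
  proof
    assume "wedge v w = 0"
    then obtain c where c: "w = vsc c v" using v(1) by (rule wedge_eq_0_imp_parallel)
    have "vsc l w = vsc (1/l) w" using v(2) w(2) c by (metis mv_vsc vsc_vsc mult.commute)
    then have "absv l * vn w = absv (1/l) * vn w" by (metis vn_vsc)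
    then have "absv l = absv (1/l)" using w(1) by simp
    then show False using l1 by (smt (verit) absv_divide absv_1 divide_less_eq_1)
  qed
  obtain p q where vp: "v = (p,q)" by (cases v)
  obtain x y where wx: "w = (x,y)" by (cases w)
  obtain a b c d where hm: "h = (a,b,c,d)" by (cases h)
  define e where "e = p * y - q * x"
  have e: "e \<noteq> 0" using vw vp wx by (simp add: e_def)
  \<comment> \<open>The second eigenvector is divided by \<open>e\<close>, the determinant of the
    two, which puts \<open>P\<close> in \<open>SL2\<close>.\<close>
  define P where "P = (p, x / e, q, y / e)"
  have P: "P \<in> SL2" using e by (simp add: P_def SL2_def e_def diff_divide_distrib[symmetric] mult.commute)
  have eqs: "a*p + b*q = l*p" "c*p + d*q = l*q" "a*x + b*y = x/l" "c*x + d*y = y/l"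
    using v(2) w(2) hm vp wx by auto
  have "mat2_mult h P = mat2_mult P (l,0,0,1/l)"
  proof -
    have "a * (x/e) + b * (y/e) = (a*x+b*y)/e" "c * (x/e) + d * (y/e) = (c*x+d*y)/e"
      by (simp_all add: add_divide_distrib)
    then show ?thesis using eqs by (simp add: P_def hm mult.commute)
  qed
  then have "cj P h = (l,0,0,1/l)" unfolding cj_def
    using P by (metis mat2_mult_assoc mat2_inv_left mat2_mult_id(1))
  then show ?thesis using P l1 by blast
qed

text \<open>In an eigenbasis of a hyperbolic \<open>h\<close>, \<open>u\<close> is to have no zero
  entry. It is the product of \<open>u1\<close>, a power of \<open>h\<close> and \<open>u2\<close>:
  \<open>u1\<close> moves the attracting direction off both axes and so has nonzero first column,
  while \<open>u2\<close>, found through the inverse walk, has nonzero first row. Each entry is then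
  led by a nonzero multiple of \<open>l ^ k\<close>.\<close>

lemma generic_elements:
  obtains P h u m n l a b c d where
    "P \<in> SL2" "1 < absv l" "h \<in> set_pmf (conv_pow \<mu> m)" "u \<in> set_pmf (conv_pow \<mu> n)"
    "cj P h = (l,0,0,1/l)" "cj P u = (a,b,c,d)" "a \<noteq> 0" "b \<noteq> 0" "c \<noteq> 0" "d \<noteq> 0"
proof -
  obtain h where h: "h \<in> semi" "1 < absv (mat2_tr h)" using hyperbolic_in_semi by blast
  obtain P l where P: "P \<in> SL2" "1 < absv l" "cj P h = (l,0,0,1/l)"
    using diagonalisable[OF semi_SL2[OF h(1)] h(2)] by blast
  have l0: "l \<noteq> 0" using P(2) by auto
  let ?v = "mv P (1,0)" and ?w = "mv P (0,1)"
  have nz: "?v \<noteq> (0,0)" "?w \<noteq> (0,0)" using P(1) by simp_all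
  obtain u1 where u1: "u1 \<in> semi" "wedge (mv u1 ?v) ?v \<noteq> 0" "wedge (mv u1 ?v) ?w \<noteq> 0"
    using orbit_avoids[OF nz(1) nz] by blast
  interpret I: ne_walk absv "map_pmf mat2_inv_SL \<mu>" by (rule inverse_walk)
  obtain u2' where u2': "u2' \<in> I.semi" "wedge (mv u2' ?w) ?v \<noteq> 0" "wedge (mv u2' ?w) ?w \<noteq> 0"
    using I.orbit_avoids[OF nz(2) nz] by blast
  define u2 where "u2 = mat2_inv_SL u2'"
  have u2: "u2 \<in> semi" "u2' = mat2_inv_SL u2"
    using u2'(1) unfolding u2_def I.semi_def semi_def conv_pow_inv set_map_pmf
    by (metis (no_types, lifting) UN_iff imageE mat2_inv_inv, simp)
  obtain a1 b1 c1 d1 where c1: "cj P u1 = (a1,b1,c1,d1)" by (cases "cj P u1")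
  obtain a2 b2 c2 d2 where c2: "cj P u2 = (a2,b2,c2,d2)" by (cases "cj P u2")
  have W: "wedge (mv g (mv P e)) (mv P e') = wedge (mv (cj P g) e) e'" for g e e'
    using P(1) by (simp add: mv_cj[symmetric] wedge_mv)
  have nz1: "a1 \<noteq> 0" "c1 \<noteq> 0" using u1(2,3) unfolding W c1 by simp_all
  have nz2: "a2 \<noteq> 0" "b2 \<noteq> 0" using u2'(2,3) P(1) unfolding W u2(2) by (simp_all add: cj_inv c2)
  \<comment> \<open>Sizes of the coefficients of \<open>(1 / l) ^ k\<close> relative to those of
    \<open>l ^ k\<close> in the four entries; once the square of \<open>absv l ^ k\<close> exceeds
    \<open>K\<close>, cancellation is impossible.\<close>
  define K where "K = Max {absv (b1*c2) / absv (a1*a2), absv (b1*d2) / absv (a1*b2),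
      absv (d1*c2) / absv (c1*a2), absv (d1*d2) / absv (c1*b2)}"
  obtain k where k: "K < (absv l ^ 2) ^ k"
    using real_arch_pow[of "absv l ^ 2" K] P(2) by (auto simp: power2_eq_square less_1_mult)
  have ne0: "X * l ^ k + Y * (1 / l) ^ k \<noteq> 0" if X: "X \<noteq> 0" and XY: "absv Y / absv X \<le> K" for X Y
  proof
    assume "X * l ^ k + Y * (1 / l) ^ k = 0"
    then have "X * l ^ k = - (Y * (1 / l) ^ k)" by (simp add: eq_neg_iff_add_eq_0)
    then have "absv X * absv l ^ k = absv Y * (1 / absv l) ^ k"
      by (metis absv_minus absv_mult absv_power absv_divide absv_1)
    then have "(absv l ^ 2) ^ k = absv Y / absv X"
      using X l0 by (simp add: field_simps power_divide power2_eq_square power_mult_distrib)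
    then show False using k XY by simp
  qed
  have Kle: "absv (b1*c2) / absv (a1*a2) \<le> K" "absv (b1*d2) / absv (a1*b2) \<le> K"
      "absv (d1*c2) / absv (c1*a2) \<le> K" "absv (d1*d2) / absv (c1*b2) \<le> K"
    by (auto simp: K_def)
  define u where "u = mat2_mult u1 (mat2_mult (mpow h k) u2)"
  have "mpow h k \<in> semi" using h(1) mpow_in_conv_pow unfolding semi_def by blast
  then have "u \<in> semi" unfolding u_def using u1 u2 semi_mult by blast
  moreover have "cj P u = (a1*a2 * l ^ k + b1*c2 * (1/l) ^ k, a1*b2 * l ^ k + b1*d2 * (1/l) ^ k,
      c1*a2 * l ^ k + d1*c2 * (1/l) ^ k, c1*b2 * l ^ k + d1*d2 * (1/l) ^ k)"
    unfolding u_def using P by (simp add: cj_mult cj_mpow mpow_diag c1 c2 mult_ac)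
  moreover obtain m n where "h \<in> set_pmf (conv_pow \<mu> m)" "u \<in> set_pmf (conv_pow \<mu> n)"
    using h(1) \<open>u \<in> semi\<close> unfolding semi_def by blast
  ultimately show thesis
    using that[OF P(1,2) _ _ P(3)] ne0 Kle nz1 nz2 by simp
qed

end

section \<open>Spread families from a hyperbolic element\<close>

context nonarch_field
begin

text \<open>When the coordinate ratios have different absolute values \<open>R < R'\<close>, a
  single term decides the wedge; \<open>Q\<close> bounds \<open>R\<close> from above and
  \<open>1 / Q\<close> bounds \<open>R'\<close> from below.\<close>

lemma chord_ge_of_ratios:
  assumes u: "u = (u1,u2)" "v = (v1,v2)" "u2 \<noteq> 0" "v2 \<noteq> 0"
    and R: "absv u1 = R * absv u2" "absv v1 = R' * absv v2" "R < R'" "1 / Q \<le> R'" "R \<le> Q" "1 \<le> Q"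
  shows "1 / Q\<^sup>2 \<le> chord u v"
proof -
  have p: "0 < absv u2" "0 < absv v2" using u by simp_all
  have R'0: "0 < R'" using R by (meson less_le_trans zero_less_divide_1_iff zero_less_one)
  have "absv (u1 * v2) < absv (u2 * v1)" using p R by (simp add: absv_mult)
  then have w: "absv (wedge u v) = R' * (absv u2 * absv v2)" using u R by (simp add: absv_diff_eq absv_mult)
  have vu: "vn u = max R 1 * absv u2" using u R p by (simp add: max_mult_distrib_right)
  have vv: "vn v = max R' 1 * absv v2" using u R p by (simp add: max_mult_distrib_right)
  have "chord u v = (1 / max R 1) * (R' / max R' 1)" using p unfolding chord_def w vu vv by simp
  moreover have "1 / Q \<le> 1 / max R 1" using R by (intro divide_left_mono) auto
  moreover have "1 / Q \<le> R' / max R' 1" using R R'0 by (auto simp: max_def field_simps)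
  ultimately have "1 / Q * (1 / Q) \<le> chord u v" 
    using mult_mono[of "1 / Q" "1 / max R 1" "1 / Q" "R' / max R' 1"] R(6) by simp
  then show ?thesis by (simp add: power2_eq_square)
qed

end

context ne_walk
begin

text \<open>\<open>t J L i\<close> consists of \<open>L i\<close> letters \<open>h\<close>, then
  \<open>u\<close>, then \<open>L (J - i)\<close> letters \<open>h\<close>. Sliding \<open>u\<close>
  along a fixed number of letters keeps the word length, so all \<open>J + 1\<close> elements lie in
  the support of one convolution power. \<open>L\<close> is left to the applications.\<close>

lemma spread_family:
  obtains P l a b c d m n and t :: "nat \<Rightarrow> nat \<Rightarrow> nat \<Rightarrow> 'k mat2" where
    "P \<in> SL2" "1 < absv l" "a \<noteq> 0" "b \<noteq> 0" "c \<noteq> 0" "d \<noteq> 0"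
    "\<And>J L i. i \<le> J \<Longrightarrow> t J L i \<in> set_pmf (conv_pow \<mu> (m * (J * L) + n))"
    "\<And>J L i k. J = i + k \<Longrightarrow> cj P (t J L i) = ((l^L)^i * a * (l^L)^k, (l^L)^i * b * (1/l^L)^k,
        (1/l^L)^i * c * (l^L)^k, (1/l^L)^i * d * (1/l^L)^k)"
proof -
  obtain P h u m n l a b c d where g:
    "P \<in> SL2" "1 < absv l" "h \<in> set_pmf (conv_pow \<mu> m)" "u \<in> set_pmf (conv_pow \<mu> n)"
    "cj P h = (l,0,0,1/l)" "cj P u = (a,b,c,d)" "a \<noteq> 0" "b \<noteq> 0" "c \<noteq> 0" "d \<noteq> 0"
    by (rule generic_elements)
  define t where "t J L i = mat2_mult (mpow h (L * i)) (mat2_mult u (mpow h (L * (J - i))))" for J L i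
  show thesis
  proof (rule that[of P l a b c d t m n])
    fix J L i :: nat assume i: "i \<le> J"
    have "t J L i \<in> set_pmf (conv_pow \<mu> (m * (L * i) + (n + m * (L * (J - i)))))"
      unfolding t_def by (intro set_conv_pow_mult mpow_in_conv_pow g)
    moreover have "m * (L * i) + (n + m * (L * (J - i))) = m * (J * L) + n"
      using i by (metis (no_types, lifting) add.assoc add.commute distrib_left le_add_diff_inverse mult.commute)
    ultimately show "t J L i \<in> set_pmf (conv_pow \<mu> (m * (J * L) + n))" by simp
  next
    fix J L i k :: nat assume "J = i + k"
    then show "cj P (t J L i) = ((l^L)^i * a * (l^L)^k, (l^L)^i * b * (1/l^L)^k,
        (1/l^L)^i * c * (l^L)^k, (1/l^L)^i * d * (1/l^L)^k)"
      using g unfolding t_def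
      by (simp add: cj_mult cj_mpow mpow_diag power_mult power_one_over)
  qed (use g in auto)
qed

text \<open>For \<open>i < j\<close> and \<open>z = \<Lambda> ^ (j - i)\<close>, the trace of the
  \<open>i\<close>-th element times the inverse of the \<open>j\<close>-th is
  \<open>2 a d - b c (z^2 + z^-2)\<close>; since \<open>b c\<close> is nonzero, the term with
  \<open>z^2\<close> wins for large \<open>L\<close>.\<close>

lemma trace_spread: "trace_spread \<mu>"
  unfolding trace_spread_def
proof (intro allI)
  fix J :: nat and M :: real
  obtain P l a b c d m n and t :: "nat \<Rightarrow> nat \<Rightarrow> nat \<Rightarrow> 'k mat2" where
    g: "P \<in> SL2" "1 < absv l" "a \<noteq> 0" "b \<noteq> 0" "c \<noteq> 0" "d \<noteq> 0"
    and tin: "\<And>J L i. i \<le> J \<Longrightarrow> t J L i \<in> set_pmf (conv_pow \<mu> (m * (J * L) + n))"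
    and tcj: "\<And>J L i k. J = i + k \<Longrightarrow> cj P (t J L i) = ((l^L)^i * a * (l^L)^k, (l^L)^i * b * (1/l^L)^k,
        (1/l^L)^i * c * (l^L)^k, (1/l^L)^i * d * (1/l^L)^k)"
    by (rule spread_family) blast
  define B where "B = absv (b * c)"
  have B: "B > 0" using g by (simp add: B_def)
  \<comment> \<open>Besides \<open>M\<close>, the leading term has to beat the competing terms
    \<open>a d\<close> and \<open>b c\<close>, and the value 1: a trace larger than that of the
    identity shows that the elements are distinct.\<close>
  obtain L where L: "max (max M 1) (max (absv (a*d)) B) / B < absv l ^ L"
    using real_arch_pow[OF g(2)] by blast
  define \<Lambda> where "\<Lambda> = l ^ L"
  have L0: "max (max M 1) (max (absv (a*d)) B) < B * absv \<Lambda>"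
    using L B by (simp add: \<Lambda>_def absv_power field_simps)
  then have \<Lambda>1: "1 < absv \<Lambda>" using B by (smt (verit) max.cobounded2 mult_left_le max.coboundedI2)
  then have \<Lambda>0: "\<Lambda> \<noteq> 0" by auto
  have big: "max (max M 1) (max (absv (a*d)) B) < absv (mat2_tr (mat2_mult (t J L i) (mat2_inv_SL (t J L j))))"
    if ij: "i < j" "j \<le> J" for i j
  proof -
    define k where "k = J - j"
    define e where "e = j - i"
    have J: "J = j + k" "J = i + (e + k)" "j = i + e" and e: "0 < e" using ij by (auto simp: k_def e_def)
    define x x' y y' z z' where "x = \<Lambda>^i" and "x' = (1/\<Lambda>)^i" and "y = \<Lambda>^k" and "y' = (1/\<Lambda>)^k"
      and "z = \<Lambda>^e" and "z' = (1/\<Lambda>)^e"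
    have xx: "x * x' = 1" "y * y' = 1" "z * z' = 1"
      using \<Lambda>0 by (simp_all add: x_def x'_def y_def y'_def z_def z'_def power_one_over)
    have ci: "cj P (t J L i) = (x * a * (z * y), x * b * (z' * y'), x' * c * (z * y), x' * d * (z' * y'))"
      using tcj[OF J(2), of L] by (simp add: x_def x'_def y_def y'_def z_def z'_def \<Lambda>_def power_add)
    have cjj: "cj P (t J L j) = (x * z * a * y, x * z * b * y', x' * z' * c * y, x' * z' * d * y')"
      using tcj[OF J(1), of L] by (simp add: x_def x'_def y_def y'_def z_def z'_def \<Lambda>_def power_add J(3))
    have "mat2_tr (mat2_mult (t J L i) (mat2_inv_SL (t J L j)))
        = mat2_tr (mat2_mult (cj P (t J L i)) (mat2_inv_SL (cj P (t J L j))))"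
      using g(1) by (simp add: cj_mult[symmetric] cj_inv[symmetric] cj_tr)
    also have "\<dots> = (a * d + a * d - b * c * z'^2) - b * c * z^2"
    proof -
      have "mat2_tr (mat2_mult (cj P (t J L i)) (mat2_inv_SL (cj P (t J L j))))
        = a * d * ((x*x')*(y*y')*(z*z')) - b * c * z'^2 * ((x*x')*(y*y')) - b * c * z^2 * ((x*x')*(y*y'))
          + a * d * ((x*x')*(y*y')*(z*z'))"
        unfolding ci cjj by (simp add: algebra_simps power2_eq_square)
      then show ?thesis unfolding xx by simp
    qed
    finally have tr: "mat2_tr (mat2_mult (t J L i) (mat2_inv_SL (t J L j))) = \<dots>" .
    have z1: "absv \<Lambda> \<le> absv z" using e \<Lambda>1 unfolding z_def absv_power
      by (metis One_nat_def Suc_leI less_imp_le power_increasing power_one_right)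
    have zz: "absv z * absv z' = 1" using xx(3) by (metis absv_mult absv_1)
    have z'1: "absv z' \<le> 1" 
    proof -
      have "absv z' = 1 / absv z" using zz z1 \<Lambda>1 by (intro eq_divide_imp) (auto simp: mult.commute)
      then show ?thesis using z1 \<Lambda>1 by (simp add: divide_le_eq_1)
    qed
    have zsq: "B * absv \<Lambda> \<le> absv (b * c * z^2)"
    proof -
      have "absv \<Lambda> \<le> (absv z)^2" 
        using z1 \<Lambda>1 self_le_power[of "absv z" 2] by simp
      then have "B * absv \<Lambda> \<le> B * (absv z)^2" using B by (intro mult_left_mono) auto
      then show ?thesis by (simp add: absv_mult[of "b * c"] absv_power B_def)
    qed
    have "absv (b * c * z'^2) \<le> B" using z'1 B by (simp add: absv_mult[of "b*c"] absv_power B_def power_le_one mult_left_le)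
    moreover have "absv (a * d + a * d) \<le> absv (a * d)" using absv_add_le[of "a*d" "a*d"] by simp
    ultimately have "absv (a * d + a * d - b * c * z'^2) \<le> max (absv (a*d)) B"
      using absv_diff_le[of "a*d+a*d" "b*c*z'^2"] by linarith
    then have lt: "absv (a * d + a * d - b * c * z'^2) < absv (b * c * z^2)" using L0 zsq by linarith
    show ?thesis unfolding tr absv_diff_eq[OF lt] using L0 zsq by linarith
  qed
  have big': "max (max M 1) (max (absv (a*d)) B) < absv (mat2_tr (mat2_mult (t J L i) (mat2_inv_SL (t J L j))))"
    if ij: "i \<noteq> j" "i \<le> J" "j \<le> J" for i j
  proof (cases "i < j")
    case True
    then show ?thesis using big ij by blast
  next
    case False
    have "mat2_mult (t J L i) (mat2_inv_SL (t J L j)) = mat2_inv_SL (mat2_mult (t J L j) (mat2_inv_SL (t J L i)))"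
      by (simp add: mat2_inv_mult)
    then have "mat2_tr (mat2_mult (t J L i) (mat2_inv_SL (t J L j))) = mat2_tr (mat2_mult (t J L j) (mat2_inv_SL (t J L i)))"
      using mat2_tr_inv by metis
    then show ?thesis using big[of j i] False ij by simp
  qed
  have inj: "inj_on (t J L) {..J}"
  proof (rule inj_onI, rule ccontr)
    fix i j assume ij: "i \<in> {..J}" "j \<in> {..J}" "t J L i = t J L j" "i \<noteq> j"
    have "t J L j \<in> SL2" using tin[of j J L] ij(2) slN by blast
    then have "mat2_mult (t J L i) (mat2_inv_SL (t J L j)) = mat2_id" using ij by (simp add: mat2_inv_right)
    then have "1 < absv (mat2_tr (mat2_id :: 'k mat2))" using big'[of i j] ij by simp
    then show False using tr_le_norm[of mat2_id] by simp
  qed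
  show "\<exists>N S. finite S \<and> S \<subseteq> set_pmf (conv_pow \<mu> N) \<and> J \<le> card S \<and>
     (\<forall>t\<in>S. \<forall>t'\<in>S. t \<noteq> t' \<longrightarrow> M < absv (mat2_tr (mat2_mult t (mat2_inv_SL t'))))"
  proof (intro exI conjI ballI impI)
    show "finite (t J L ` {..J})" by simp
    show "t J L ` {..J} \<subseteq> set_pmf (conv_pow \<mu> (m * (J * L) + n))" using tin by blast
    show "J \<le> card (t J L ` {..J})" using card_image[OF inj] by simp
    fix s s' assume "s \<in> t J L ` {..J}" "s' \<in> t J L ` {..J}" "s \<noteq> s'"
    then obtain i j where "s = t J L i" "s' = t J L j" "i \<le> J" "j \<le> J" "i \<noteq> j" by blast
    then show "M < absv (mat2_tr (mat2_mult s (mat2_inv_SL s')))" using big'[of i j] by simp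
  qed
qed

text \<open>In the eigenbasis the inverse of the \<open>i\<close>-th element first rescales the
  coordinates of \<open>v\<close> to sizes \<open>X i\<close> and \<open>Y i\<close>. Unless these
  are comparable, the inverse of \<open>u\<close> brings the ratio of the coordinates between
  \<open>1 / K\<close> and \<open>K\<close>, and the remaining power of \<open>h\<close> multiplies
  it by \<open>A^(2i - 2J)\<close>. For different \<open>i\<close> these multipliers differ by a
  factor above \<open>K^2\<close>, which separates the images.\<close>

lemma point_spread: "point_spread \<mu>"
  unfolding point_spread_def
proof (intro allI)
  fix J :: nat
  obtain P l a b c d m n and t :: "nat \<Rightarrow> nat \<Rightarrow> nat \<Rightarrow> 'k mat2" where
    g: "P \<in> SL2" "1 < absv l" "a \<noteq> 0" "b \<noteq> 0" "c \<noteq> 0" "d \<noteq> 0"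
    and tin: "\<And>J L i. i \<le> J \<Longrightarrow> t J L i \<in> set_pmf (conv_pow \<mu> (m * (J * L) + n))"
    and tcj: "\<And>J L i k. J = i + k \<Longrightarrow> cj P (t J L i) = ((l^L)^i * a * (l^L)^k, (l^L)^i * b * (1/l^L)^k,
        (1/l^L)^i * c * (l^L)^k, (1/l^L)^i * d * (1/l^L)^k)"
    by (rule spread_family) blast
  define hi where "hi = Max {absv a, absv b, absv c, absv d}"
  define lo where "lo = Min {absv a, absv b, absv c, absv d}"
  have lo: "0 < lo" using g by (simp add: lo_def)
  have hl: "lo \<le> absv x" "absv x \<le> hi" if "x \<in> {a,b,c,d}" for x
    using that by (auto simp: hi_def lo_def)
  define K where "K = hi / lo"
  have K1: "1 \<le> K" using hl[of a] lo by (simp add: K_def)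
  have ratio: "absv x \<le> K * absv y" if "x \<in> {a,b,c,d}" "y \<in> {a,b,c,d}" for x y
  proof -
    have "absv x \<le> K * lo" using hl[OF that(1)] lo by (simp add: K_def)
    also have "\<dots> \<le> K * absv y" using hl[OF that(2)] K1 by (intro mult_left_mono) auto
    finally show ?thesis .
  qed
  obtain L where L: "K * K < absv l ^ L" using real_arch_pow[OF g(2)] by blast
  define A where "A = absv l ^ L"
  have KK: "1 \<le> K * K" using K1 using mult_mono[of 1 K 1 K] by simp
  have A: "K * K < A" "1 < A" using L KK by (auto simp: A_def)
  have AL: "absv (l ^ L) = A" "absv (1 / l ^ L) = 1 / A" by (simp_all add: A_def absv_power absv_divide)
  have Apow: "K * K * A ^ i < A ^ j" if "i < j" for i j
  proof -
    have "K * K * A ^ i < A * A ^ i" using A by (intro mult_strict_right_mono) auto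
    also have "\<dots> = A ^ Suc i" by simp
    also have "\<dots> \<le> A ^ j" using that A by (intro power_increasing) auto
    finally show ?thesis .
  qed
  \<comment> \<open>Bounds all the coordinate ratios and their reciprocals; \<eta> below also pays
    for leaving the eigenbasis through \<open>P\<close>.\<close>
  define Q where "Q = K * A ^ (2 * J)"
  have Q1: "1 \<le> Q" unfolding Q_def using mult_mono[of 1 K 1 "A ^ (2 * J)"] K1 A
    by (simp add: one_le_power)
  define \<eta> where "\<eta> = 1 / Q\<^sup>2 / (mat2_norm absv P)\<^sup>2"
  have nP: "0 < mat2_norm absv P" using norm_ge_1[OF g(1)] by simp
  have \<eta>: "0 < \<eta>" using Q1 nP by (simp add: \<eta>_def)
  let ?T = "t J L"
  have TSL: "?T i \<in> SL2" if "i \<le> J" for i using tin[OF that, of L] slN by blast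
  show "\<exists>N S. \<exists>\<eta>>0. finite S \<and> S \<subseteq> set_pmf (conv_pow \<mu> N) \<and>
     (\<forall>v. v \<noteq> (0,0) \<longrightarrow> (\<exists>S'\<subseteq>S. J \<le> card S' \<and>
       (\<forall>t\<in>S'. \<forall>t'\<in>S'. t \<noteq> t' \<longrightarrow> \<eta> \<le> chord (mv (mat2_inv_SL t) v) (mv (mat2_inv_SL t') v))))"
  proof (rule exI[of _ "m * (J * L) + n"], rule exI[of _ "?T ` {..J}"], rule exI[of _ \<eta>], intro conjI allI impI)
    show "0 < \<eta>" by (rule \<eta>)
    show "finite (?T ` {..J})" by simp
    show "?T ` {..J} \<subseteq> set_pmf (conv_pow \<mu> (m * (J * L) + n))" using tin by blast
    fix v :: "'k \<times> 'k" assume v: "v \<noteq> (0,0)"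
    obtain x y where xy: "mv (mat2_inv_SL P) v = (x,y)" by (cases "mv (mat2_inv_SL P) v")
    have xy0: "x \<noteq> 0 \<or> y \<noteq> 0" using v g(1) xy mv_eq_0_iff[of "mat2_inv_SL P" v] by auto
    define X where "X i = absv x / A ^ i" for i
    define Y where "Y i = absv y * A ^ i" for i
    \<comment> \<open>Good indices: the two coordinates are not within a factor \<open>K\<close> of
      each other.\<close>
    define G where "G = {i\<in>{..J}. K * X i < Y i \<or> K * Y i < X i}"
    \<comment> \<open>The quotient of \<open>Y i\<close> by \<open>X i\<close> grows by the factor
      \<open>A^2\<close>, more than \<open>K^2\<close>, at each step, so at most one of the
      \<open>J + 1\<close> indices is bad.\<close>
    have bad: "i = j" if "i \<in> {..J} - G" "j \<in> {..J} - G" for i j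
    proof (rule ccontr)
      assume "i \<noteq> j"
      have *: False if ij: "i \<in> {..J} - G" "j \<in> {..J} - G" "i < j" for i j
      proof -
        have 1: "Y j \<le> K * X j" "X i \<le> K * Y i" using ij by (auto simp: G_def not_less)
        have Ai: "0 < A ^ i" "0 < A ^ j" using A by auto
        have y1: "absv y * (A ^ j * A ^ j) \<le> K * absv x" using 1(1) Ai by (simp add: X_def Y_def field_simps)
        have x1: "absv x \<le> K * absv y * (A ^ i * A ^ i)" using 1(2) Ai by (simp add: X_def Y_def field_simps)
        have "y \<noteq> 0" using x1 xy0 absv_pos_iff[of x] by (auto simp: not_le[symmetric])
        have "absv y * (A ^ j * A ^ j) \<le> K * (K * absv y * (A ^ i * A ^ i))"
          using order_trans[OF y1 mult_left_mono[OF x1, of K]] K1 by simp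
        then have "absv y * (A ^ j * A ^ j) \<le> absv y * (K * K * (A ^ i * A ^ i))" by (simp add: mult_ac)
        then have "A ^ (2 * j) \<le> K * K * A ^ (2 * i)" using \<open>y \<noteq> 0\<close> by (simp add: power_add[symmetric] mult_2)
        then show False using Apow[of "2 * i" "2 * j"] ij(3) by simp
      qed
      show False using *[of i j] *[of j i] that \<open>i \<noteq> j\<close> by (cases "i < j") auto
    qed
    have cG: "J \<le> card G"
    proof -
      have "card ({..J} - G) \<le> 1"
        using bad card_le_Suc0_iff_eq[of "{..J} - G"] by simp
      moreover have "card ({..J} - G) = Suc J - card G"
        by (subst card_Diff_subset) (auto simp: G_def)
      ultimately show ?thesis by linarith
    qed
    define w where "w i = mv (mat2_inv_SL (cj P (?T i))) (x,y)" for i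
    have T_w: "mv (mat2_inv_SL (?T i)) v = mv P (w i)" for i
      using g(1) xy by (simp add: w_def cj_inv[symmetric] mv_cj) (metis mv_inv_right)
    have rat: "\<exists>\<rho>. 1 / K \<le> \<rho> \<and> \<rho> \<le> K \<and> snd (w i) \<noteq> 0 \<and> absv (fst (w i)) = \<rho> * A ^ (2*i) / A ^ (2*J) * absv (snd (w i))"
      if i: "i \<in> G" for i
    proof -
      define k where "k = J - i"
      have J: "J = i + k" using i by (auto simp: k_def G_def)
      define X' where "X' = (1/l^L)^i * x"
      define Y' where "Y' = (l^L)^i * y"
      have aX: "absv X' = X i" "absv Y' = Y i"
        by (simp_all add: X'_def Y'_def X_def Y_def absv_mult absv_power AL absv_divide power_divide A_def)
      have wi: "w i = ((1/l^L)^k * (d * X' - b * Y'), (l^L)^k * (a * Y' - c * X'))"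
        unfolding w_def using tcj[OF J, of L] by (simp add: X'_def Y'_def algebra_simps)
      have Ak: "A ^ k \<noteq> 0" "A > 0" using A by auto
      \<comment> \<open>\<open>p\<close> and \<open>q\<close> are the entries of \<open>u\<close>
        that multiply the dominant coordinate in the two components; \<open>Z\<close> is the
        absolute value of that coordinate.\<close>
      have main: "\<exists>\<rho>. 1 / K \<le> \<rho> \<and> \<rho> \<le> K \<and> snd (w i) \<noteq> 0 \<and> absv (fst (w i)) = \<rho> * A ^ (2*i) / A ^ (2*J) * absv (snd (w i))"
        if pq: "p \<in> {a,b,c,d}" "q \<in> {a,b,c,d}" and Z: "Z > 0" "absv (d * X' - b * Y') = absv p * Z" "absv (a * Y' - c * X') = absv q * Z" for p q Z
      proof (intro exI[of _ "absv p / absv q"] conjI)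
        have q0: "absv q > 0" "absv p > 0" using pq hl lo by (meson less_le_trans)+
        show "1 / K \<le> absv p / absv q" using ratio[OF pq(2,1)] q0 K1 by (simp add: field_simps)
        show "absv p / absv q \<le> K" using ratio[OF pq] q0 by (simp add: field_simps)
        have f: "absv (fst (w i)) = (1 / A) ^ k * (absv p * Z)" "absv (snd (w i)) = A ^ k * (absv q * Z)"
          unfolding wi by (simp_all add: absv_mult absv_power AL Z A_def absv_divide)
        have "absv (snd (w i)) \<noteq> 0" unfolding f using q0 Z Ak by simp
        then show "snd (w i) \<noteq> 0" by auto
        have AJ: "A ^ (2*J) = A ^ (2*i) * A ^ k * A ^ k" by (simp add: J power_add[symmetric] mult_2 add_ac)
        show "absv (fst (w i)) = absv p / absv q * A ^ (2*i) / A ^ (2*J) * absv (snd (w i))"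
          unfolding f AJ using q0 Ak by (simp add: power_divide field_simps)
      qed
      from i have "K * X i < Y i \<or> K * Y i < X i" by (simp add: G_def)
      then show ?thesis
      proof
        assume lt: "K * X i < Y i"
        have X0: "0 \<le> X i" using Ak by (simp add: X_def)
        then have Y0: "0 < Y i" using lt K1 by (smt (verit) mult_nonneg_nonneg)
        have lt1: "absv (e * X') < absv (f * Y')" if "e \<in> {a,b,c,d}" "f \<in> {a,b,c,d}" for e f
        proof -
          have "absv (e * X') \<le> K * absv f * X i" using ratio[OF that] X0 by (simp add: absv_mult aX mult_right_mono)
          also have "\<dots> = absv f * (K * X i)" by simp
          also have "\<dots> < absv f * Y i" using lt hl[OF that(2)] lo by (intro mult_strict_left_mono) auto
          finally show ?thesis by (simp add: absv_mult aX)
        qed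
        show ?thesis
          using absv_diff_eq[OF lt1[of d b]] absv_diff_eq'[OF lt1[of c a]] Y0
          by (intro main[of b a "Y i"]) (simp_all add: absv_mult aX)
      next
        assume lt: "K * Y i < X i"
        have Y0: "0 \<le> Y i" using Ak by (simp add: Y_def)
        then have X0: "0 < X i" using lt K1 by (smt (verit) mult_nonneg_nonneg)
        have lt1: "absv (e * Y') < absv (f * X')" if "e \<in> {a,b,c,d}" "f \<in> {a,b,c,d}" for e f
        proof -
          have "absv (e * Y') \<le> K * absv f * Y i" using ratio[OF that] Y0 by (simp add: absv_mult aX mult_right_mono)
          also have "\<dots> = absv f * (K * Y i)" by simp
          also have "\<dots> < absv f * X i" using lt hl[OF that(2)] lo by (intro mult_strict_left_mono) auto
          finally show ?thesis by (simp add: absv_mult aX)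
        qed
        show ?thesis
          using absv_diff_eq'[OF lt1[of b d]] absv_diff_eq[OF lt1[of a c]] X0
          by (intro main[of d c "X i"]) (simp_all add: absv_mult aX)
      qed
    qed
    have sepw: "1 / Q\<^sup>2 \<le> chord (w i) (w j)" if ij: "i \<in> G" "j \<in> G" "i < j" for i j
    proof -
      obtain \<rho> where \<rho>: "1 / K \<le> \<rho>" "\<rho> \<le> K" "snd (w i) \<noteq> 0" "absv (fst (w i)) = \<rho> * A ^ (2*i) / A ^ (2*J) * absv (snd (w i))"
        using rat[OF ij(1)] by blast
      obtain \<sigma> where \<sigma>: "1 / K \<le> \<sigma>" "\<sigma> \<le> K" "snd (w j) \<noteq> 0" "absv (fst (w j)) = \<sigma> * A ^ (2*j) / A ^ (2*J) * absv (snd (w j))"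
        using rat[OF ij(2)] by blast
      have AJ: "0 < A ^ (2*J)" "0 < A ^ (2*i)" "0 < A ^ (2*j)" "1 \<le> A ^ (2*j)" "A ^ (2*i) \<le> A ^ (2*J)" "1 \<le> A ^ (2*J)"
        using A ij by (auto simp: G_def intro!: power_increasing)
      show ?thesis
      proof (rule chord_ge_of_ratios[OF prod.collapse[symmetric] prod.collapse[symmetric] \<rho>(3) \<sigma>(3) \<rho>(4) \<sigma>(4) _ _ _ Q1])
        have "K * \<rho> * A ^ (2*i) \<le> K * K * A ^ (2*i)" using \<rho>(2) K1 AJ by (intro mult_right_mono mult_left_mono) auto
        also have "\<dots> < A ^ (2*j)" using Apow[of "2*i" "2*j"] ij by simp
        also have "\<dots> \<le> K * \<sigma> * A ^ (2*j)" using \<sigma>(1) K1 AJ by (simp add: field_simps)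
        finally have "\<rho> * A ^ (2*i) < \<sigma> * A ^ (2*j)" using K1 by (simp add: mult.assoc)
        then show "\<rho> * A ^ (2*i) / A ^ (2*J) < \<sigma> * A ^ (2*j) / A ^ (2*J)"
          using AJ by (simp add: divide_strict_right_mono)
        have \<sigma>0: "0 \<le> \<sigma>" using order_trans[OF _ \<sigma>(1)] K1 by simp
        have "1 / K * 1 \<le> \<sigma> * A ^ (2*j)" by (rule mult_mono) (use \<sigma>(1) \<sigma>0 AJ in auto)
        then show "1 / Q \<le> \<sigma> * A ^ (2*j) / A ^ (2*J)"
          using divide_right_mono[of "1 / K * 1" "\<sigma> * A ^ (2*j)" "A ^ (2*J)"] AJ by (simp add: Q_def)
        have "\<rho> * (A ^ (2*i) / A ^ (2*J)) \<le> K * 1"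
          using \<rho> AJ K1 by (intro mult_mono) (auto simp: divide_le_eq_1)
        also have "\<dots> \<le> Q" unfolding Q_def using K1 AJ by (intro mult_left_mono) auto
        finally show "\<rho> * A ^ (2*i) / A ^ (2*J) \<le> Q" by simp
      qed
    qed
    have sep: "\<eta> \<le> chord (mv (mat2_inv_SL (?T i)) v) (mv (mat2_inv_SL (?T j)) v)"
      if ij: "i \<in> G" "j \<in> G" "i \<noteq> j" for i j
    proof -
      have "1 / Q\<^sup>2 \<le> chord (w i) (w j)"
        using sepw[of i j] sepw[of j i] ij by (metis chord_commute linorder_neqE_nat)
      also have "\<dots> = chord (mv (mat2_inv_SL P) (mv P (w i))) (mv (mat2_inv_SL P) (mv P (w j)))"
        using g(1) by simp
      also have "\<dots> \<le> (mat2_norm absv P)\<^sup>2 * chord (mv P (w i)) (mv P (w j))"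
        using chord_mv_le[of "mat2_inv_SL P" "mv P (w i)" "mv P (w j)"] g(1) by (simp del: mv_inv_left)
      finally show ?thesis unfolding T_w \<eta>_def using nP
        by (subst pos_divide_le_eq) (auto simp: mult.commute)
    qed
    have inj: "inj_on ?T G"
    proof (rule inj_onI, rule ccontr)
      fix i j assume ij: "i \<in> G" "j \<in> G" "?T i = ?T j" "i \<noteq> j"
      show False using sep[OF ij(1,2,4)] \<eta> unfolding ij(3) by simp
    qed
    show "\<exists>S'\<subseteq>?T ` {..J}. J \<le> card S' \<and>
       (\<forall>t\<in>S'. \<forall>t'\<in>S'. t \<noteq> t' \<longrightarrow> \<eta> \<le> chord (mv (mat2_inv_SL t) v) (mv (mat2_inv_SL t') v))"
    proof (intro exI[of _ "?T ` G"] conjI ballI impI)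
      show "?T ` G \<subseteq> ?T ` {..J}" by (rule image_mono) (auto simp: G_def)
      show "J \<le> card (?T ` G)" using card_image[OF inj] cG by simp
      fix s s' assume "s \<in> ?T ` G" "s' \<in> ?T ` G" "s \<noteq> s'"
      then obtain i j where "s = ?T i" "s' = ?T j" "i \<in> G" "j \<in> G" "i \<noteq> j" by blast
      then show "\<eta> \<le> chord (mv (mat2_inv_SL s) v) (mv (mat2_inv_SL s') v)" using sep by simp
    qed
  qed
qed

end

section \<open>The Borel structure of the Berkovich line\<close>

context nonarch_field
begin

lemma openin_berk_aff_iff: "openin (berk_aff_top absv) V \<longleftrightarrow> (\<exists>W. open W \<and> V = berk_aff absv \<inter> W)"
  unfolding berk_aff_top_def by (rule openin_open)

lemma topspace_berk_aff [simp]: "topspace (berk_aff_top absv) = berk_aff absv"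
  by (simp add: berk_aff_top_def)

text \<open>\<open>berk_top\<close> feeds a predicate to \<open>topology\<close>, so it describes
  open sets only once \<open>istopology\<close> is established. In a union, a closed subset of one
  compact complement is compact.\<close>

lemma openin_berk_iff:
  "openin (berk_top absv) U \<longleftrightarrow> U \<subseteq> P1an absv \<and> openin (berk_aff_top absv) (Some -` U) \<and>
     (None \<in> U \<longrightarrow> compactin (berk_aff_top absv) (berk_aff absv - Some -` U))"
proof -
  let ?W = "\<lambda>U. U \<subseteq> insert None (Some ` berk_aff absv) \<and>
       openin (berk_aff_top absv) (Some -` U) \<and>
       (None \<in> U \<longrightarrow> compactin (berk_aff_top absv) (berk_aff absv - Some -` U))"
  have "istopology ?W"
    unfolding istopology_def
  proof (intro conjI allI impI)
    fix S T assume ST: "?W S" "?W T"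
    show "S \<inter> T \<subseteq> insert None (Some ` berk_aff absv)" using ST by blast
    show "openin (berk_aff_top absv) (Some -` (S \<inter> T))" using ST by (simp add: openin_Int)
    assume "None \<in> S \<inter> T"
    moreover have "berk_aff absv - Some -` (S \<inter> T) = (berk_aff absv - Some -` S) \<union> (berk_aff absv - Some -` T)" by blast
    ultimately show "compactin (berk_aff_top absv) (berk_aff absv - Some -` (S \<inter> T))"
      using ST by (simp only: compactin_Un Int_iff)
  next
    fix K assume K: "Ball K ?W"
    show "\<Union>K \<subseteq> insert None (Some ` berk_aff absv)" using K by blast
    have "Some -` \<Union>K = \<Union>((\<lambda>S. Some -` S) ` K)" by blast
    moreover have "openin (berk_aff_top absv) (\<Union>((\<lambda>S. Some -` S) ` K))" using K by (intro openin_Union) blast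
    ultimately show o: "openin (berk_aff_top absv) (Some -` \<Union>K)" by simp
    assume "None \<in> \<Union>K"
    then obtain S where S: "S \<in> K" "None \<in> S" by blast
    show "compactin (berk_aff_top absv) (berk_aff absv - Some -` \<Union>K)"
    proof (rule closed_compactin)
      show "compactin (berk_aff_top absv) (berk_aff absv - Some -` S)" using S K by blast
      show "berk_aff absv - Some -` \<Union>K \<subseteq> berk_aff absv - Some -` S" using S by blast
      show "closedin (berk_aff_top absv) (berk_aff absv - Some -` \<Union>K)"
        using o by (metis closedin_def closedin_diff closedin_topspace topspace_berk_aff)
    qed
  qed
  then show ?thesis unfolding berk_top_def P1an_def by (simp add: topology_inverse')
qed

lemma topspace_berk: "topspace (berk_top absv) = P1an absv"
proof
  show "topspace (berk_top absv) \<subseteq> P1an absv"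
    using openin_topspace[of "berk_top absv"] unfolding openin_berk_iff by blast
  have "Some -` P1an absv = berk_aff absv" by (auto simp: P1an_def)
  then have "openin (berk_top absv) (P1an absv)"
    unfolding openin_berk_iff by (simp add: openin_topspace[of "berk_aff_top absv", simplified])
  then show "P1an absv \<subseteq> topspace (berk_top absv)" by (rule openin_subset)
qed

lemma open_sub_Pow: "{U. openin (berk_top absv) U} \<subseteq> Pow (P1an absv)"
  using openin_berk_iff by auto

lemma space_berk_borel [simp]: "space (berk_borel absv) = P1an absv"
  unfolding berk_borel_def using open_sub_Pow by (rule space_measure_of)

lemma sets_berk_borel: "sets (berk_borel absv) = sigma_sets (P1an absv) {U. openin (berk_top absv) U}"
  unfolding berk_borel_def using open_sub_Pow by (rule sets_measure_of)

lemma open_in_borel: "openin (berk_top absv) U \<Longrightarrow> U \<in> sets (berk_borel absv)"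
  unfolding sets_berk_borel by (rule sigma_sets.Basic) simp

lemma openin_Some_image:
  assumes "openin (berk_aff_top absv) V"
  shows "openin (berk_top absv) (Some ` V)"
proof -
  have "V \<subseteq> berk_aff absv" using openin_subset[OF assms] by simp
  then show ?thesis using assms unfolding openin_berk_iff P1an_def
    by (auto simp: inj_vimage_image_eq)
qed

lemma Some_vimage_open_borel:
  assumes "open W"
  shows "Some ` (berk_aff absv \<inter> W) \<in> sets (berk_borel absv)"
  using assms by (intro open_in_borel openin_Some_image) (auto simp: openin_berk_aff_iff)

lemma open_eval: "open S \<Longrightarrow> open {s :: 'k poly \<Rightarrow> real. s f \<in> S}"
  using open_vimage[of S "\<lambda>s. s f"] by (simp add: vimage_def)

lemma None_borel: "{None} \<in> sets (berk_borel absv)"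
proof -
  have "space (berk_borel absv) - Some ` (berk_aff absv \<inter> UNIV) \<in> sets (berk_borel absv)"
    by (intro sets.compl_sets Some_vimage_open_borel) simp
  also have "space (berk_borel absv) - Some ` (berk_aff absv \<inter> UNIV) = {None}" by (auto simp: P1an_def)
  finally show ?thesis .
qed

lemma measurable_eval:
  "(\<lambda>x. case x of None \<Rightarrow> c | Some s \<Rightarrow> s f) \<in> borel_measurable (berk_borel absv)"
proof (rule borel_measurableI)
  fix S :: "real set" assume S: "open S"
  have "(\<lambda>x. case x of None \<Rightarrow> c | Some s \<Rightarrow> s f) -` S \<inter> space (berk_borel absv)
      = Some ` (berk_aff absv \<inter> {s. s f \<in> S}) \<union> (if c \<in> S then {None} else {})"
    by (auto simp: P1an_def split: option.splits)
  also have "\<dots> \<in> sets (berk_borel absv)"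
    using Some_vimage_open_borel[OF open_eval[OF S, of f]] sets.Un[OF Some_vimage_open_borel[OF open_eval[OF S, of f]] None_borel]
    by simp
  finally show "(\<lambda>x. case x of None \<Rightarrow> c | Some s \<Rightarrow> s f) -` S \<inter> space (berk_borel absv) \<in> sets (berk_borel absv)" .
qed

lemma measurable_bnorm [measurable]: "(\<lambda>x. bnorm x v) \<in> borel_measurable (berk_borel absv)"
proof (cases v)
  case (Pair p q)
  have "bnorm x v = (case x of None \<Rightarrow> absv q | Some s \<Rightarrow> s [:-p,q:]) / max (case x of None \<Rightarrow> 0 | Some s \<Rightarrow> s [:0,1:]) 1" for x
    using Pair by (cases x) auto
  then show ?thesis using measurable_eval by simp
qed

lemma measurable_delta [measurable]: "(\<lambda>x. delta x v) \<in> borel_measurable (berk_borel absv)"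
  unfolding delta_def by measurable

lemma measurable_dil [measurable]: "(\<lambda>x. dil (bnorm x) g) \<in> borel_measurable (berk_borel absv)"
  unfolding dil_def by measurable

lemma measurable_sigma_coc:
  assumes "g \<in> SL2"
  shows "sigma_coc absv g \<in> borel_measurable (berk_borel absv)"
proof -
  have "(\<lambda>x. ln (dil (bnorm x) g)) \<in> borel_measurable (berk_borel absv)" by measurable
  then show ?thesis
    by (rule measurable_cong[THEN iffD1, rotated]) (simp add: sigma_eq_ln_dil assms)
qed

text \<open>The formula for the image is continuous where the denominator has nonzero value. The
  remaining points are those sent to infinity, which form a Borel set, and infinity itself, so the
  preimage of an open set is a union of three Borel pieces.\<close>

lemma measurable_berk_act [measurable]: "berk_act absv g \<in> berk_borel absv \<rightarrow>\<^sub>M berk_borel absv"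
  unfolding berk_borel_def[of absv]
proof (subst measurable_cong_sets[OF refl refl], rule measurable_measure_of)
  show "{U. openin (berk_top absv) U} \<subseteq> Pow (P1an absv)" by (rule open_sub_Pow)
  show "berk_act absv g \<in> space (sigma (P1an absv) {U. openin (berk_top absv) U}) \<rightarrow> P1an absv"
    using berk_act_P1an space_berk_borel unfolding berk_borel_def by auto
  fix U assume "U \<in> {U. openin (berk_top absv) U}"
  then have U: "openin (berk_top absv) U" by simp
  obtain a b c d where g: "g = (a,b,c,d)" by (cases g)
  obtain W where W: "open W" "Some -` U = berk_aff absv \<inter> W"
    using U unfolding openin_berk_iff openin_berk_aff_iff by blast
  define \<Phi> where "\<Phi> = (\<lambda>(s::'k poly \<Rightarrow> real) f. s (mob_hom (a,b,c,d) f) / s [:d,c:] ^ degree f)"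
  let ?N = "{s :: 'k poly \<Rightarrow> real. s [:d,c:] \<in> -{0}}"
  have oN: "open ?N" by (rule open_eval) (rule open_Compl, simp)
  have "continuous_on ?N \<Phi>" unfolding \<Phi>_def
    by (intro continuous_on_coordinatewise_then_product continuous_intros
        continuous_on_subset[OF continuous_on_product_coordinates]) auto
  then have o: "open (?N \<inter> \<Phi> -` W)" by (rule continuous_open_preimage[OF _ oN W(1)])
  let ?A = "Some ` (berk_aff absv \<inter> (?N \<inter> \<Phi> -` W))"
  let ?Z = "Some ` berk_aff absv - Some ` (berk_aff absv \<inter> ?N)"
  have "berk_act absv g -` U \<inter> P1an absv
     = ?A \<union> (if None \<in> U then ?Z else {}) \<union> (if berk_act absv g None \<in> U then {None} else {})" (is "?L = ?R")
  proof (rule set_eqI)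
    fix x
    show "x \<in> ?L \<longleftrightarrow> x \<in> ?R"
    proof (cases x)
      case None
      then show ?thesis by (auto simp: P1an_def)
    next
      case (Some s)
      show ?thesis
      proof (cases "s \<in> berk_aff absv \<and> s [:d,c:] \<noteq> 0")
        case True
        then have "\<Phi> s \<in> berk_aff absv" unfolding \<Phi>_def using berk_act_Some_berk by blast
        then have "Some (\<Phi> s) \<in> U \<longleftrightarrow> \<Phi> s \<in> W" using W(2) by blast
        then show ?thesis using Some True by (auto simp: g P1an_def \<Phi>_def)
      next
        case False
        then show ?thesis using Some by (auto simp: g P1an_def)
      qed
    qed
  qed
  moreover have "?R \<in> sets (berk_borel absv)"
  proof (intro sets.Un)
    show "?A \<in> sets (berk_borel absv)" by (rule Some_vimage_open_borel[OF o])
    show "(if None \<in> U then ?Z else {}) \<in> sets (berk_borel absv)"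
      using Some_vimage_open_borel[OF oN] Some_vimage_open_borel[OF open_UNIV] by auto
    show "(if berk_act absv g None \<in> U then {None} else {}) \<in> sets (berk_borel absv)"
      using None_borel by simp
  qed
  ultimately show "berk_act absv g -` U \<inter> space (sigma (P1an absv) {U. openin (berk_top absv) U})
     \<in> sets (sigma (P1an absv) {U. openin (berk_top absv) U})"
    using space_berk_borel unfolding berk_borel_def by simp
qed

text \<open>\<open>f\<close> minus its value at \<open>z\<close> is a multiple of
  \<open>T - z\<close>, and the cofactor is bounded on the disc
  \<open>s [:0,1:] \<le> R\<close>.\<close>

lemma eval_near:
  assumes "0 \<le> R"
  shows "\<exists>C\<ge>0. \<forall>s\<in>berk_aff absv. s [:0,1:] \<le> R \<longrightarrow> \<bar>s f - absv (poly f z)\<bar> \<le> C * s [:-z,1:]"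
proof -
  have "[:-z,1:] dvd (f - [:poly f z:])"
    by (simp add: poly_eq_0_iff_dvd[symmetric])
  then obtain h where h: "f - [:poly f z:] = [:-z,1:] * h" by (auto elim: dvdE)
  define C where "C = (\<Sum>i\<le>degree h. absv (coeff h i) * R ^ i)"
  have "C \<ge> 0" unfolding C_def using assms by (intro sum_nonneg mult_nonneg_nonneg) auto
  moreover have "\<bar>s f - absv (poly f z)\<bar> \<le> C * s [:-z,1:]" if s: "s \<in> berk_aff absv" and le: "s [:0,1:] \<le> R" for s
  proof -
    have "s h = s (\<Sum>i\<le>degree h. monom (coeff h i) i)" by (simp add: poly_as_sum_of_monoms)
    also have "\<dots> \<le> (\<Sum>i\<le>degree h. s (monom (coeff h i) i))" by (rule berk_sum_le[OF s]) simp
    also have "\<dots> \<le> C" unfolding C_def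
    proof (rule sum_mono)
      fix i
      have "s (monom (coeff h i) i) = absv (coeff h i) * s [:0,1:] ^ i"
        by (simp only: monom_altdef berk_smult[OF s] berk_power[OF s])
      also have "\<dots> \<le> absv (coeff h i) * R ^ i"
        using le berk_nonneg[OF s] by (intro mult_left_mono power_mono) auto
      finally show "s (monom (coeff h i) i) \<le> absv (coeff h i) * R ^ i" .
    qed
    finally have hC: "s h \<le> C" .
    have "s f \<le> s (f - [:poly f z:]) + s [:poly f z:]"
      using berk_add_le[OF s, of "f - [:poly f z:]" "[:poly f z:]"] by simp
    moreover have "s [:poly f z:] \<le> s (f - [:poly f z:]) + s f"
      using berk_add_le[OF s, of "- (f - [:poly f z:])" f] berk_minus[OF s, of "f - [:poly f z:]"] by simp
    ultimately have "\<bar>s f - absv (poly f z)\<bar> \<le> s (f - [:poly f z:])"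
      unfolding berk_const[OF s] by linarith
    also have "\<dots> = s [:-z,1:] * s h" unfolding h by (rule berk_mult[OF s])
    also have "\<dots> \<le> C * s [:-z,1:]" using mult_right_mono[OF hC berk_nonneg[OF s, of "[:-z,1:]"]] by (simp add: mult.commute)
    finally show ?thesis .
  qed
  ultimately show ?thesis by blast
qed

text \<open>At infinity the complement of \<open>U\<close> is compact, so \<open>T\<close> is
  bounded on it. At a finite point \<open>U\<close> contains a neighbourhood given by finitely many
  polynomials, whose values \<open>eval_near\<close> controls through the value of
  \<open>T - z\<close>.\<close>

lemma delta_nbhd:
  assumes U: "openin (berk_top absv) U" and v: "v \<noteq> (0,0)" and vU: "pt v \<in> U"
  shows "\<exists>\<epsilon>>0. \<forall>x\<in>P1an absv. delta x v < \<epsilon> \<longrightarrow> x \<in> U"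
proof -
  obtain p q where pq: "v = (p,q)" by (cases v)
  show ?thesis
  proof (cases "q = 0")
    case True
    then have p: "p \<noteq> 0" and N: "None \<in> U" using v vU pq by auto
    let ?K = "berk_aff absv - Some -` U"
    have "compactin (berk_aff_top absv) ?K" using U N unfolding openin_berk_iff by blast
    then have "compact ?K" unfolding berk_aff_top_def by (simp add: compactin_subtopology)
    then have "compact ((\<lambda>s. s [:0,1:]) ` ?K)"
      by (rule compact_continuous_image[rotated]) (rule continuous_on_subset[OF continuous_on_product_coordinates], simp)
    then have "bounded ((\<lambda>s. s [:0,1:]) ` ?K)" by (rule compact_imp_bounded)
    then obtain R where R: "\<And>s. s \<in> ?K \<Longrightarrow> \<bar>s [:0,1:]\<bar> \<le> R"
      unfolding bounded_iff ball_simps real_norm_def by blast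
    show ?thesis
    proof (intro exI[of _ "1 / max R 1"] conjI ballI impI)
      show "0 < 1 / max R 1" by (simp add: less_max_iff_disj)
      fix x assume x: "x \<in> P1an absv" and d: "delta x v < 1 / max R 1"
      show "x \<in> U"
      proof (cases x)
        case None
        then show ?thesis using N by simp
      next
        case (Some s)
        then have s: "s \<in> berk_aff absv" using x by (auto simp: P1an_def)
        have "s [:-p:] = absv p" using berk_const[OF s, of "-p"] by simp
        then have "delta x v = 1 / max (s [:0,1:]) 1" using p by (simp add: delta_def Some pq True)
        then have lt: "1 / max (s [:0,1:]) 1 < 1 / max R 1" using d by simp
        have "max R 1 < max (s [:0,1:]) 1"
        proof (rule ccontr)
          assume "\<not> max R 1 < max (s [:0,1:]) 1"
          then have "max (s [:0,1:]) 1 \<le> max R 1" by linarith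
          then have "1 / max R 1 \<le> 1 / max (s [:0,1:]) 1" by (rule divide_left_mono) simp_all
          then show False using lt by linarith
        qed
        then have "R < s [:0,1:]" by (auto simp: max_def split: if_splits)
        then have "s \<notin> ?K" using R[of s] by force
        then show ?thesis using s Some by blast
      qed
    qed
  next
    case False
    define z where "z = p / q"
    define R where "R = max (absv z) 1"
    have R: "1 \<le> R" "absv z \<le> R" by (auto simp: R_def)
    have vnv: "vn v = absv q * R"
      using False by (simp add: pq R_def z_def absv_divide max_mult_distrib_left)
    obtain W where W: "open W" "Some -` U = berk_aff absv \<inter> W"
      using U unfolding openin_berk_iff openin_berk_aff_iff by blast
    define s0 where "s0 = (\<lambda>f. absv (poly f z))"
    have "s0 \<in> W" using vU W(2) False by (auto simp: pq typeI_def s0_def z_def)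
    then obtain X where X: "s0 \<in> (\<Pi>\<^sub>E i\<in>UNIV. X i)" "\<And>i. open (X i)" "finite {i. X i \<noteq> UNIV}" "(\<Pi>\<^sub>E i\<in>UNIV. X i) \<subseteq> W"
      using product_topology_open_contains_basis[of "\<lambda>_. euclidean" UNIV W s0] W(1) unfolding open_fun_def by auto
    let ?F = "{i. X i \<noteq> UNIV}"
    obtain C where C: "\<And>f. C f \<ge> 0" "\<And>f s. s \<in> berk_aff absv \<Longrightarrow> s [:0,1:] \<le> R \<Longrightarrow> \<bar>s f - absv (poly f z)\<bar> \<le> C f * s [:-z,1:]"
      using eval_near[of R _ z] R by (metis order_trans zero_le_one)
    have "\<exists>e>0. ball (s0 f) e \<subseteq> X f" for f
    proof -
      have "s0 f \<in> X f" using X(1) by auto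
      then show ?thesis using X(2) open_contains_ball by blast
    qed
    then obtain e where e: "\<And>f. 0 < e f" "\<And>f. ball (s0 f) (e f) \<subseteq> X f" by metis
    \<comment> \<open>The bound \<open>1 / R\<close> excludes infinity and forces the value of
      \<open>T\<close> below \<open>R\<close>; then the value of \<open>T - z\<close> is below
      \<open>\<epsilon> R^2\<close>, and the other bounds make each of the finitely many evaluations
      land in its interval. The summand 1 avoids a zero denominator.\<close>
    define \<epsilon> where "\<epsilon> = Min (insert (1 / R) ((\<lambda>f. e f / ((C f + 1) * R\<^sup>2)) ` ?F))"
    have C1: "0 < (C f + 1) * R\<^sup>2" for f using C(1)[of f] R(1) by (intro mult_pos_pos) auto
    have \<epsilon>0: "0 < \<epsilon>" unfolding \<epsilon>_def using X(3) R e(1) C1 by (subst Min_gr_iff) auto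
    have \<epsilon>1: "\<epsilon> \<le> 1 / R" and \<epsilon>2: "\<And>f. f \<in> ?F \<Longrightarrow> \<epsilon> \<le> e f / ((C f + 1) * R\<^sup>2)"
      unfolding \<epsilon>_def using X(3) by (auto intro!: Min_le)
    show ?thesis
    proof (intro exI[of _ \<epsilon>] conjI ballI impI \<epsilon>0)
      fix x assume x: "x \<in> P1an absv" and d: "delta x v < \<epsilon>"
      show "x \<in> U"
      proof (cases x)
        case None
        then have "delta x v = 1 / R" using False by (simp add: delta_def pq vnv[unfolded pq] del: vn.simps)
        then show ?thesis using d \<epsilon>1 by simp
      next
        case (Some s)
        then have s: "s \<in> berk_aff absv" using x by (auto simp: P1an_def)
        have "s (smult q [:-z,1:]) = absv q * s [:-z,1:]" by (rule berk_smult[OF s])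
        then have "s [:-p,q:] = absv q * s [:-z,1:]" using False by (simp add: z_def)
        then have "delta x v = s [:-z,1:] / max (s [:0,1:]) 1 / R"
          using False by (simp add: delta_def Some pq vnv[unfolded pq] del: vn.simps)
        then have d1: "s [:-z,1:] < \<epsilon> * R * max (s [:0,1:]) 1"
        proof -
          have m: "0 < max (s [:0,1:]) 1" by (simp add: less_max_iff_disj)
          have "s [:-z,1:] = delta x v * (R * max (s [:0,1:]) 1)"
            using \<open>delta x v = _\<close> m R by (simp add: less_imp_neq)
          also have "\<dots> < \<epsilon> * (R * max (s [:0,1:]) 1)" using d m R by (intro mult_strict_right_mono mult_pos_pos) auto
          finally show ?thesis by (simp add: mult.assoc)
        qed
        have eR: "\<epsilon> * R \<le> 1" using \<epsilon>1 R by (simp add: field_simps)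
        have sT: "s [:0,1:] \<le> R"
        proof (rule ccontr)
          assume "\<not> s [:0,1:] \<le> R"
          then have l: "R < s [:0,1:]" by simp
          have "s ([:-z,1:] + [:z:]) \<le> max (s [:-z,1:]) (s [:z:])" by (rule berk_ultra[OF s])
          then have "s [:0,1:] \<le> max (s [:-z,1:]) (absv z)" by (simp add: berk_const[OF s])
          then have "s [:0,1:] \<le> s [:-z,1:]" using l R by simp
          also have "\<dots> < \<epsilon> * R * s [:0,1:]" using d1 l R by simp
          also have "\<dots> \<le> 1 * s [:0,1:]" using eR berk_nonneg[OF s] by (intro mult_right_mono) auto
          finally show False by simp
        qed
        then have "max (s [:0,1:]) 1 \<le> R" using R by simp
        then have "\<epsilon> * R * max (s [:0,1:]) 1 \<le> \<epsilon> * R * R" using \<epsilon>0 R by (intro mult_left_mono) auto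
        then have d2: "s [:-z,1:] < \<epsilon> * R\<^sup>2" using d1 by (simp add: power2_eq_square)
        have "s \<in> (\<Pi>\<^sub>E i\<in>UNIV. X i)"
        proof (rule PiE_I)
          fix f
          show "s f \<in> X f"
          proof (cases "f \<in> ?F")
            case True
            have "\<bar>s f - s0 f\<bar> \<le> C f * s [:-z,1:]" unfolding s0_def by (rule C(2)[OF s sT])
            also have "\<dots> \<le> C f * (\<epsilon> * R\<^sup>2)" using d2 C(1) by (intro mult_left_mono) auto
            also have "\<dots> < (C f + 1) * (\<epsilon> * R\<^sup>2)" using \<epsilon>0 R by (intro mult_strict_right_mono mult_pos_pos) auto
            also have "\<dots> = \<epsilon> * ((C f + 1) * R\<^sup>2)" by simp
            also have "\<dots> \<le> e f" using \<epsilon>2[OF True] C1[of f] by (simp add: pos_le_divide_eq)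
            finally have "s f \<in> ball (s0 f) (e f)" by (simp add: dist_real_def abs_minus_commute)
            then show ?thesis using e(2) by blast
          qed simp
        qed simp
        then have "s \<in> W" using X(4) by blast
        then show ?thesis using W(2) s Some by blast
      qed
    qed
  qed
qed

section \<open>Balls, closures and uniqueness of measures\<close>

definition bal :: "'k \<times> 'k \<Rightarrow> nat \<Rightarrow> ('k poly \<Rightarrow> real) option set" where
  "bal w n = {x \<in> P1an absv. delta x w < inverse (real (Suc n))}"

text \<open>Points approximated by \<open>S\<close> at every scale. For countable \<open>S\<close>
  only countably many balls occur, so the set is Borel; if \<open>S\<close> avoids zero and
  \<open>k\<close> is complete, all its points are \<open>k\<close>-points
  (\<open>clos_P1k\<close>).\<close>

definition clos :: "('k \<times> 'k) set \<Rightarrow> ('k poly \<Rightarrow> real) option set" where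
  "clos S = {x \<in> P1an absv. \<forall>n. \<exists>w\<in>S. x \<in> bal w n}"

lemma bal_borel [measurable]: "bal w n \<in> sets (berk_borel absv)"
proof -
  have "{x \<in> space (berk_borel absv). delta x w < inverse (real (Suc n))} \<in> sets (berk_borel absv)" by measurable
  then show ?thesis by (simp add: bal_def)
qed

lemma clos_eq: "clos S = P1an absv \<inter> (\<Inter>n. \<Union>w\<in>S. bal w n)"
  by (auto simp: clos_def)

lemma clos_borel: "countable S \<Longrightarrow> clos S \<in> sets (berk_borel absv)"
proof -
  assume S: "countable S"
  have "P1an absv \<in> sets (berk_borel absv)" using sets.top[of "berk_borel absv"] by simp
  then show ?thesis unfolding clos_eq using S
    by (intro sets.Int sets.countable_INT' sets.countable_UN') auto
qed

text \<open>A direction at distance less than 1 from one in the chart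
  \<open>absv p \<le> absv q\<close> lies in that chart, where \<open>chord\<close> is the absolute
  value of the difference of the quotients; completeness of \<open>k\<close> gives the limit.
  \<open>chord_swap\<close> handles the other chart.\<close>

lemma chord_Cauchy_limit_aux:
  fixes w :: "nat \<Rightarrow> 'k \<times> 'k" and N :: nat
  assumes c: "complete_abs absv" and w: "\<And>n. w n \<noteq> (0,0)"
    and cau: "\<And>e. 0 < e \<Longrightarrow> \<exists>N. \<forall>m\<ge>N. \<forall>n\<ge>N. chord (w m) (w n) < e"
    and N: "\<And>m. N \<le> m \<Longrightarrow> chord (w m) (w N) < 1" "absv (fst (w N)) \<le> absv (snd (w N))"
  shows "\<exists>v. v \<noteq> (0,0) \<and> (\<forall>e>0. \<exists>N. \<forall>n\<ge>N. chord (w n) v < e)"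
proof -
  have big: "absv (fst (w m)) \<le> absv (snd (w m)) \<and> snd (w m) \<noteq> 0" if m: "N \<le> m" for m
  proof -
    obtain p q where pq: "w m = (p,q)" by (cases "w m")
    obtain p' q' where pq': "w N = (p',q')" by (cases "w N")
    have q': "q' \<noteq> 0" "absv p' \<le> absv q'" using N(2) w[of N] pq' absv_pos_iff[of p'] by (auto simp: not_le[symmetric])
    have "absv p \<le> absv q"
    proof (rule ccontr)
      assume n: "\<not> absv p \<le> absv q"
      then have p: "p \<noteq> 0" by auto
      have "absv (q * p') < absv (p * q')"
      proof -
        have "absv q * absv p' \<le> absv q * absv q'" using q' by (intro mult_left_mono) auto
        also have "\<dots> < absv p * absv q'" using n q' by (intro mult_strict_right_mono) auto
        finally show ?thesis by (simp add: absv_mult)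
      qed
      then have "chord (w m) (w N) = 1" using n q' p
        by (simp add: chord_def pq pq' absv_diff_eq' absv_mult max_def)
      then show False using N(1)[OF m] by simp
    qed
    then show ?thesis using w[of m] pq absv_pos_iff[of p] by (auto simp: not_le[symmetric])
  qed
  define z where "z m = fst (w (N + m)) / snd (w (N + m))" for m
  have az: "absv (z m) \<le> 1" for m
    using big[of "N + m"] by (simp add: z_def absv_divide divide_le_eq_1)
  have ch1: "chord (p,q) (y,1) = absv (p / q - y)" if "absv p \<le> absv q" "q \<noteq> 0" "absv y \<le> 1" for p q y
  proof -
    have "p / q - y = (p - q * y) / q" using that by (simp add: field_simps)
    then show ?thesis using that by (simp add: chord_def absv_divide max_def)
  qed
  have ch2: "chord (p,q) (y,r) = absv (p / q - y / r)"
    if "absv p \<le> absv q" "q \<noteq> 0" "absv y \<le> absv r" "r \<noteq> 0" for p q y r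
  proof -
    have "p / q - y / r = (p * r - q * y) / (q * r)" using that by (simp add: field_simps)
    then show ?thesis using that by (simp add: chord_def absv_divide absv_mult max_def)
  qed
  have zz: "absv (z m - z n) = chord (w (N + m)) (w (N + n))" for m n
    using big[of "N + m"] big[of "N + n"] ch2[of "fst (w (N + m))" "snd (w (N + m))" "fst (w (N + n))" "snd (w (N + n))"]
    by (simp add: z_def)
  have "\<forall>e>0. \<exists>N. \<forall>m\<ge>N. \<forall>n\<ge>N. absv (z m - z n) < e"
    unfolding zz using cau by (meson trans_le_add2)
  then obtain l where l: "\<And>e. e > 0 \<Longrightarrow> \<exists>N. \<forall>n\<ge>N. absv (z n - l) < e"
    using c[unfolded complete_abs_def, rule_format, of z] by auto
  have l1: "absv l \<le> 1"
  proof -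
    obtain n where "absv (z n - l) < 1" using l[of 1] by (meson order_refl zero_less_one)
    then show ?thesis using az[of n] absv_diff_le[of "z n" "z n - l"] by simp
  qed
  have "chord (w (N + n)) (l,1) = absv (z n - l)" for n
    using big[of "N + n"] ch1[of "fst (w (N + n))" "snd (w (N + n))" l] l1 by (simp add: z_def)
  then have "\<exists>M. \<forall>n\<ge>M. chord (w n) (l,1) < e" if e0: "e > 0" for e
  proof -
    obtain M where M: "\<And>n. n \<ge> M \<Longrightarrow> absv (z n - l) < e" using l[OF e0] by blast
    have "chord (w n) (l,1) < e" if "n \<ge> N + M" for n
      using M[of "n - N"] that \<open>\<And>n. chord (w (N + n)) (l,1) = absv (z n - l)\<close>[of "n - N"] by simp
    then show ?thesis by blast
  qed
  then show ?thesis by (intro exI[of _ "(l,1)"]) simp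
qed

lemma chord_swap: "chord (prod.swap u) (prod.swap v) = chord u v"
  by (cases u; cases v) (simp add: chord_def absv_diff_commute[of "snd u * fst v"] max.commute mult.commute absv_diff_commute)

lemma chord_Cauchy_limit:
  fixes w :: "nat \<Rightarrow> 'k \<times> 'k"
  assumes c: "complete_abs absv" and w: "\<And>n. w n \<noteq> (0,0)"
    and cau: "\<And>e. 0 < e \<Longrightarrow> \<exists>N. \<forall>m\<ge>N. \<forall>n\<ge>N. chord (w m) (w n) < e"
  shows "\<exists>v. v \<noteq> (0,0) \<and> (\<forall>e>0. \<exists>N. \<forall>n\<ge>N. chord (w n) v < e)"
proof -
  obtain N where N: "\<And>m. N \<le> m \<Longrightarrow> chord (w m) (w N) < 1" using cau[OF zero_less_one] by blast
  show ?thesis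
  proof (cases "absv (fst (w N)) \<le> absv (snd (w N))")
    case True
    then show ?thesis using chord_Cauchy_limit_aux[OF c w cau N] by blast
  next
    case False
    let ?w = "\<lambda>n. prod.swap (w n)"
    have "\<exists>v. v \<noteq> (0,0) \<and> (\<forall>e>0. \<exists>N. \<forall>n\<ge>N. chord (?w n) v < e)"
    proof (rule chord_Cauchy_limit_aux[OF c])
      show "?w n \<noteq> (0,0)" for n using w[of n] by (cases "w n") auto
      show "\<exists>N. \<forall>m\<ge>N. \<forall>n\<ge>N. chord (?w m) (?w n) < e" if "0 < e" for e
        unfolding chord_swap by (rule cau[OF that])
      show "chord (?w m) (?w N) < 1" if "N \<le> m" for m unfolding chord_swap by (rule N[OF that])
      show "absv (fst (?w N)) \<le> absv (snd (?w N))" using False by (cases "w N") simp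
    qed
    then obtain v where v: "v \<noteq> (0,0)" "\<And>e. e > 0 \<Longrightarrow> \<exists>N. \<forall>n\<ge>N. chord (?w n) v < e" by blast
    have "chord (?w n) v = chord (w n) (prod.swap v)" for n
      using chord_swap[of "w n" "prod.swap v"] by simp
    then show ?thesis using v by (intro exI[of _ "prod.swap v"]) (cases v, auto)
  qed
qed

text \<open>Centres of shrinking balls containing \<open>x\<close> are Cauchy, since two of them are
  no further apart than the larger of their distances to \<open>x\<close>. At their limit the norm
  of \<open>x\<close> vanishes.\<close>

lemma clos_P1k:
  assumes c: "complete_abs absv" and S: "(0,0) \<notin> S" and x: "x \<in> clos S"
  shows "\<exists>v. v \<noteq> (0,0) \<and> x = pt v"
proof -
  have xP: "x \<in> P1an absv" using x by (simp add: clos_def)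
  have "\<forall>n. \<exists>w. w \<in> S \<and> x \<in> bal w n" using x unfolding clos_def by blast
  then obtain w where w: "\<And>n. w n \<in> S" "\<And>n. x \<in> bal (w n) n" by metis
  have w0: "w n \<noteq> (0,0)" for n using w(1)[of n] S by metis
  have d: "delta x (w n) < inverse (real (Suc n))" for n using w(2)[of n] by (simp add: bal_def)
  have d': "delta x (w n) < inverse (real (Suc N))" if "N \<le> n" for n N
    using d[of n] that by (smt (verit) le_imp_inverse_le of_nat_0_less_iff of_nat_mono Suc_le_mono zero_less_Suc)
  have "\<exists>v. v \<noteq> (0,0) \<and> (\<forall>e>0. \<exists>N. \<forall>n\<ge>N. chord (w n) v < e)"
  proof (rule chord_Cauchy_limit[OF c w0])
    fix e :: real assume "0 < e"
    then obtain N where N: "inverse (real (Suc N)) < e" using reals_Archimedean by blast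
    show "\<exists>N. \<forall>m\<ge>N. \<forall>n\<ge>N. chord (w m) (w n) < e"
    proof (intro exI[of _ N] allI impI)
      fix m n assume mn: "N \<le> m" "N \<le> n"
      show "chord (w m) (w n) < e"
        using chord_le_max_delta[OF xP w0[of m] w0[of n]] d'[OF mn(1)] d'[OF mn(2)] N by linarith
    qed
  qed
  then obtain v where v: "v \<noteq> (0,0)" "\<And>e. 0 < e \<Longrightarrow> \<exists>N. \<forall>n\<ge>N. chord (w n) v < e" by blast
  have "delta x v < e" if e: "0 < e" for e
  proof -
    obtain N where N: "inverse (real (Suc N)) < e" using reals_Archimedean e by blast
    obtain M where M: "\<forall>n\<ge>M. chord (w n) v < e" using v(2)[OF e] by blast
    let ?n = "max N M"
    show ?thesis using delta_ultra[OF xP w0[of ?n] v(1)] d'[of N ?n] N M by (smt (verit) max.cobounded1 max.cobounded2)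
  qed
  then have "\<not> 0 < delta x v" by blast
  then have "delta x v = 0" using delta_nonneg[OF xP, of v] by linarith
  then have "bnorm x v = 0" using v(1) by (simp add: delta_def)
  then show ?thesis using eq_pt_of_bnorm_0[OF xP v(1)] v(1) by blast
qed

text \<open>This makes the traces of open sets on \<open>clos S\<close> unions of balls indexed by
  \<open>S\<close> and the naturals. The centre \<open>w\<close> is close to the
  \<open>k\<close>-point \<open>x\<close>, so the ball around \<open>w\<close> stays inside a
  \<open>delta\<close>-neighbourhood of \<open>x\<close>.\<close>

lemma open_trace:
  assumes c: "complete_abs absv" and S: "(0,0) \<notin> S" and U: "openin (berk_top absv) U" and x: "x \<in> clos S" "x \<in> U"
  shows "\<exists>w\<in>S. \<exists>n. x \<in> bal w n \<and> bal w n \<subseteq> U"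
proof -
  obtain v where v: "v \<noteq> (0,0)" "x = pt v" using clos_P1k[OF c S x(1)] by blast
  obtain e where e: "e > 0" "\<And>y. y \<in> P1an absv \<Longrightarrow> delta y v < e \<Longrightarrow> y \<in> U"
    using delta_nbhd[OF U v(1)] x(2) v(2) by blast
  obtain n where n: "inverse (real (Suc n)) < e" using reals_Archimedean e by blast
  obtain w where w: "w \<in> S" "x \<in> bal w n" using x(1) unfolding clos_def by blast
  have w0: "w \<noteq> (0,0)" using w S by metis
  have cw: "chord w v < e" using w(2) n v by (simp add: bal_def delta_pt chord_commute)
  have "bal w n \<subseteq> U"
  proof
    fix y assume y: "y \<in> bal w n"
    then have yP: "y \<in> P1an absv" "delta y w < inverse (real (Suc n))" by (simp_all add: bal_def)
    then have "delta y v < e" using delta_ultra[OF yP(1) w0 v(1)] cw n by linarith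
    then show "y \<in> U" using e(2) yP by blast
  qed
  then show ?thesis using w by blast
qed

lemma bal_nested:
  assumes "w \<noteq> (0,0)" "w' \<noteq> (0,0)" "n \<le> n'" "bal w n \<inter> bal w' n' \<noteq> {}"
  shows "bal w' n' \<subseteq> bal w n"
proof
  obtain x where x: "x \<in> bal w n" "x \<in> bal w' n'" using assms by blast
  have le: "inverse (real (Suc n')) \<le> inverse (real (Suc n))" using assms(3) by simp
  have xP: "x \<in> P1an absv" "delta x w < inverse (real (Suc n))" "delta x w' < inverse (real (Suc n))"
    using x less_le_trans[OF _ le] unfolding bal_def by blast+
  then have ch: "chord w' w < inverse (real (Suc n))"
    using chord_le_max_delta[OF xP(1) assms(2,1)] by linarith
  fix y assume "y \<in> bal w' n'"
  then have y: "y \<in> P1an absv" "delta y w' < inverse (real (Suc n))" using less_le_trans[OF _ le] unfolding bal_def by blast+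
  then show "y \<in> bal w n" using delta_ultra[OF y(1) assms(2,1)] ch by (auto simp: bal_def)
qed

text \<open>Ultrametric balls are nested or disjoint, so their traces on \<open>clos S\<close> form
  a pi-system; by \<open>open_trace\<close> and countability of \<open>S\<close> they generate the
  trace of the Borel sets. Both measures are carried by \<open>clos S\<close>.\<close>

lemma measure_eqI_bal:
  assumes c: "complete_abs absv" and S: "countable S" "(0,0) \<notin> S"
    and M: "prob_space M" "sets M = sets (berk_borel absv)" "emeasure M (clos S) = 1"
    and N: "prob_space N" "sets N = sets (berk_borel absv)" "emeasure N (clos S) = 1"
    and eq: "\<And>w n. w \<in> S \<Longrightarrow> emeasure M (bal w n) = emeasure N (bal w n)"
  shows "M = N"
proof -
  let ?Y = "clos S"
  have Y: "?Y \<in> sets (berk_borel absv)" by (rule clos_borel[OF S(1)])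
  have YP: "?Y \<subseteq> P1an absv" by (auto simp: clos_def)
  have full: "emeasure L (A \<inter> ?Y) = emeasure L A"
    if L: "prob_space L" "sets L = sets (berk_borel absv)" "emeasure L ?Y = 1" and A: "A \<in> sets (berk_borel absv)" for L A
  proof -
    interpret prob_space L by fact
    have "AE x in L. x \<in> ?Y" using L Y by (subst AE_in_set_eq_1) (auto simp: emeasure_eq_measure)
    then show ?thesis using A Y L by (intro emeasure_eq_AE) auto
  qed
  define E where "E = insert {} (insert ?Y {bal w n \<inter> ?Y | w n. w \<in> S})"
  have Int: "Int_stable E"
  proof (rule Int_stableI)
    fix A B assume AB: "A \<in> E" "B \<in> E"
    have *: "bal w n \<inter> bal w' n' \<inter> ?Y \<in> E" if "w \<in> S" "w' \<in> S" "n \<le> n'" for w w' n n'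
    proof (cases "bal w n \<inter> bal w' n' = {}")
      case True
      then show ?thesis by (simp add: E_def)
    next
      case False
      have "w \<noteq> (0,0)" "w' \<noteq> (0,0)" using that S(2) by metis+
      then have "bal w n \<inter> bal w' n' = bal w' n'" using bal_nested[OF _ _ that(3) False] by blast
      then show ?thesis using that unfolding E_def by blast
    qed
    have **: "(bal w n \<inter> ?Y) \<inter> (bal w' n' \<inter> ?Y) \<in> E" if "w \<in> S" "w' \<in> S" for w w' n n'
    proof (cases "n \<le> n'")
      case True
      then show ?thesis using *[OF that True] by (simp add: Int_ac)
    next
      case False
      then have "n' \<le> n" by simp
      from *[OF that(2,1) this] show ?thesis by (simp add: Int_ac)
    qed
    show "A \<inter> B \<in> E"
    proof (cases "A = {} \<or> B = {} \<or> A = ?Y \<or> B = ?Y")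
      case True
      have "C \<subseteq> ?Y" if "C \<in> E" for C using that by (auto simp: E_def)
      then have "A \<inter> B \<in> {{}, A, B}" using True AB by (auto simp: inf_absorb1 inf_absorb2)
      moreover have "{} \<in> E" by (simp add: E_def)
      ultimately show ?thesis using AB by (metis insert_iff empty_iff)
    next
      case False
      then obtain w n w' n' where "w \<in> S" "w' \<in> S" "A = bal w n \<inter> ?Y" "B = bal w' n' \<inter> ?Y"
        using AB unfolding E_def by blast
      then show ?thesis using ** by simp
    qed
  qed
  have gen: "(\<inter>) ?Y ` sets (berk_borel absv) = sigma_sets ?Y E"
  proof -
    have "(\<inter>) ?Y ` sets (berk_borel absv) = sigma_sets ?Y ((\<inter>) ?Y ` {U. openin (berk_top absv) U})"
      unfolding sets_berk_borel using Y YP by (intro sigma_sets_Int) (auto simp: sets_berk_borel)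
    also have "\<dots> = sigma_sets ?Y E"
    proof (rule sigma_sets_eqI)
      fix A assume "A \<in> (\<inter>) ?Y ` {U. openin (berk_top absv) U}"
      then obtain U where U: "openin (berk_top absv) U" "A = ?Y \<inter> U" by auto
      define I where "I = {(w,n). w \<in> S \<and> bal w n \<subseteq> U}"
      have A: "A = \<Union>((\<lambda>(w,n). bal w n \<inter> ?Y) ` I)"
      proof
        show "A \<subseteq> \<Union>((\<lambda>(w,n). bal w n \<inter> ?Y) ` I)"
        proof
          fix x assume "x \<in> A"
          then have x: "x \<in> ?Y" "x \<in> U" using U(2) by auto
          then obtain w n where "w \<in> S" "x \<in> bal w n" "bal w n \<subseteq> U" using open_trace[OF c S(2) U(1)] by blast
          then show "x \<in> \<Union>((\<lambda>(w,n). bal w n \<inter> ?Y) ` I)" using x by (intro UN_I[of "(w,n)"]) (auto simp: I_def)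
        qed
        show "\<Union>((\<lambda>(w,n). bal w n \<inter> ?Y) ` I) \<subseteq> A" unfolding U(2) I_def by auto
      qed
      have "I \<subseteq> S \<times> UNIV" by (auto simp: I_def)
      then have cI: "countable I" by (rule countable_subset) (use S in auto)
      show "A \<in> sigma_sets ?Y E" unfolding A
      proof (rule sigma_sets_UNION)
        fix B assume "B \<in> (\<lambda>(w,n). bal w n \<inter> ?Y) ` I"
        then obtain w n where "w \<in> S" "B = bal w n \<inter> ?Y" by (auto simp: I_def)
        then have "B \<in> E" unfolding E_def by blast
        then show "B \<in> sigma_sets ?Y E" by (rule sigma_sets.Basic)
      qed (use cI in simp)
    next
      fix A assume "A \<in> E"
      moreover have "A \<in> (\<inter>) ?Y ` sets (berk_borel absv)" if AE: "A \<in> E"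
      proof -
        consider "A = {}" | "A = ?Y" | w n where "A = bal w n \<inter> ?Y" using AE unfolding E_def by blast
        then show ?thesis
        proof cases
          case 1 then show ?thesis by (intro image_eqI[of _ _ "{}"]) auto
        next
          case 2 then show ?thesis using Y by (intro image_eqI[of _ _ ?Y]) auto
        next
          case 3 then show ?thesis using bal_borel by (intro image_eqI[of _ _ "bal w n"]) auto
        qed
      qed
      moreover have "(\<inter>) ?Y ` sets (berk_borel absv) = sigma_sets ?Y ((\<inter>) ?Y ` {U. openin (berk_top absv) U})"
        unfolding sets_berk_borel using Y YP by (intro sigma_sets_Int) (auto simp: sets_berk_borel)
      ultimately show "A \<in> sigma_sets ?Y ((\<inter>) ?Y ` {U. openin (berk_top absv) U})" by simp
    qed
    finally show ?thesis .
  qed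
  have sR: "sets (restrict_space L ?Y) = sigma_sets ?Y E" if "sets L = sets (berk_borel absv)" for L
    using gen that by (simp add: sets_restrict_space)
  have spM: "space M = P1an absv" "space N = P1an absv" using M N sets_eq_imp_space_eq space_berk_borel by metis+
  have eR: "emeasure (restrict_space L ?Y) (A \<inter> ?Y) = emeasure L A"
    if L: "prob_space L" "sets L = sets (berk_borel absv)" "emeasure L ?Y = 1" and A: "A \<in> sets (berk_borel absv)" for L A
    using full[OF L A] Y L by (subst emeasure_restrict_space) auto
  have RR: "restrict_space M ?Y = restrict_space N ?Y"
  proof (rule measure_eqI_generator_eq[OF Int _ _ sR[OF M(2)] sR[OF N(2)], of "\<lambda>_. ?Y"])
    show "E \<subseteq> Pow ?Y" by (auto simp: E_def)
    fix X assume "X \<in> E"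
    then consider "X = {}" | "X = ?Y" | w n where "w \<in> S" "X = bal w n \<inter> ?Y" unfolding E_def by blast
    then show "emeasure (restrict_space M ?Y) X = emeasure (restrict_space N ?Y) X"
    proof cases
      case 2
      then show ?thesis using eR[OF M Y] eR[OF N Y] M N by simp
    next
      case 3
      then show ?thesis using eR[OF M bal_borel] eR[OF N bal_borel] eq by simp
    qed simp
  next
    show "range (\<lambda>_. ?Y) \<subseteq> E" by (auto simp: E_def)
    show "emeasure (restrict_space M ?Y) ?Y \<noteq> \<infinity>" using eR[OF M Y] M by simp
  qed simp
  show ?thesis
  proof (rule measure_eqI)
    show "sets M = sets N" using M N by simp
    fix A assume "A \<in> sets M"
    then have A: "A \<in> sets (berk_borel absv)" using M by simp
    show "emeasure M A = emeasure N A" using eR[OF M A] eR[OF N A] RR by simp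
  qed
qed

end

section \<open>Uniform contraction\<close>

context ne_walk
begin

lemma dil_escape_walk:
  assumes "0 < c"
  shows "\<exists>n0. \<forall>n f. n0 \<le> n \<longrightarrow> norm_like f \<longrightarrow> measure_pmf.prob (conv_pow \<mu> n) {g. dil f g \<le> M} \<le> c"
  by (rule dil_escape[OF sl trace_spread ne_walk.point_spread[OF inverse_walk] assms])

text \<open>Escape of \<open>dil\<close> holds for all normalised seminorms with one
  \<open>n0\<close>, so it applies to the norms of \<open>x\<close> and of \<open>v\<close>
  uniformly. If both dilations exceed \<open>M\<close>, which is at least 1, so does their product,
  and \<open>1 / M < e\<close>.\<close>

lemma contraction:
  assumes e: "0 < e" and c: "0 < c"
  shows "\<exists>n0. \<forall>n x v. n0 \<le> n \<longrightarrow> x \<in> P1an absv \<longrightarrow> v \<noteq> (0,0) \<longrightarrow>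
     measure_pmf.prob (conv_pow \<mu> n) {g. e \<le> delta (berk_act absv g x) (mv g v)} \<le> c"
proof -
  define M where "M = 1 / e + 1"
  have M: "1 \<le> M" "1 / M < e" using e by (auto simp: M_def field_simps)
  have "0 < c/2" using c by simp
  from dil_escape_walk[OF this, of M] obtain n0 where
    n0: "\<forall>n f. n0 \<le> n \<longrightarrow> norm_like f \<longrightarrow> measure_pmf.prob (conv_pow \<mu> n) {g. dil f g \<le> M} \<le> c/2" by blast
  show ?thesis
  proof (intro exI[of _ n0] allI impI)
    fix n x and v :: "'k \<times> 'k" assume n: "n0 \<le> n" and x: "x \<in> P1an absv" and v: "v \<noteq> (0,0)"
    let ?P = "measure_pmf.prob (conv_pow \<mu> n)"
    have sub: "{g. e \<le> delta (berk_act absv g x) (mv g v)} \<inter> SL2 \<subseteq> {g. dil (bnorm x) g \<le> M} \<union> {g. dil (pnorm v) g \<le> M}"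
    proof
      fix g assume g: "g \<in> {g. e \<le> delta (berk_act absv g x) (mv g v)} \<inter> SL2"
      show "g \<in> {g. dil (bnorm x) g \<le> M} \<union> {g. dil (pnorm v) g \<le> M}"
      proof (rule ccontr)
        assume "\<not> ?thesis"
        then have gt: "M < dil (bnorm x) g" "M < dil (pnorm v) g" by auto
        have "M * 1 \<le> dil (bnorm x) g * dil (pnorm v) g" using gt M by (intro mult_mono) auto
        then have "delta x v / (dil (bnorm x) g * dil (pnorm v) g) \<le> 1 / M"
          using delta_le_1[OF x, of v] delta_nonneg[OF x, of v] M by (intro frac_le) auto
        then have "delta (berk_act absv g x) (mv g v) < e" using g x v M(2) by (simp add: delta_act)
        then show False using g by simp
      qed
    qed
    have "?P {g. e \<le> delta (berk_act absv g x) (mv g v)}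
        = ?P ({g. e \<le> delta (berk_act absv g x) (mv g v)} \<inter> set_pmf (conv_pow \<mu> n))"
      by (simp add: measure_Int_set_pmf)
    also have "\<dots> \<le> ?P ({g. dil (bnorm x) g \<le> M} \<union> {g. dil (pnorm v) g \<le> M})"
      using sub slN[of n] by (intro measure_pmf.finite_measure_mono) (blast, simp)
    also have "\<dots> \<le> ?P {g. dil (bnorm x) g \<le> M} + ?P {g. dil (pnorm v) g \<le> M}"
      by (rule measure_Un_le) auto
    also have "\<dots> \<le> c/2 + c/2" using n0 n norm_like_bnorm[OF x] norm_like_pnorm[OF v] by (intro add_mono) blast+
    finally show "?P {g. e \<le> delta (berk_act absv g x) (mv g v)} \<le> c" by simp
  qed
qed

end

section \<open>The stationary measure\<close>

text \<open>Tonelli for two \<open>pmf\<close>s on arbitrary types, read off the commutation of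
  binds.\<close>

lemma nn_integral_pmf_swap:
  "(\<integral>\<^sup>+x. \<integral>\<^sup>+y. f x y \<partial>measure_pmf B \<partial>measure_pmf A) = (\<integral>\<^sup>+y. \<integral>\<^sup>+x. f x y \<partial>measure_pmf A \<partial>measure_pmf B)"
proof -
  have "(\<integral>\<^sup>+z. case_prod f z \<partial>bind_pmf A (\<lambda>x. bind_pmf B (\<lambda>y. return_pmf (x,y))))
     = (\<integral>\<^sup>+z. case_prod f z \<partial>bind_pmf B (\<lambda>y. bind_pmf A (\<lambda>x. return_pmf (x,y))))"
    by (subst bind_commute_pmf) (rule refl)
  then show ?thesis by simp
qed

lemma nn_integral_pmf_measure_swap:
  fixes f :: "'a \<Rightarrow> 'b \<Rightarrow> ennreal"
  assumes "\<And>g. g \<in> set_pmf p \<Longrightarrow> f g \<in> borel_measurable M"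
  shows "(\<integral>\<^sup>+g. \<integral>\<^sup>+x. f g x \<partial>M \<partial>measure_pmf p) = (\<integral>\<^sup>+x. \<integral>\<^sup>+g. f g x \<partial>measure_pmf p \<partial>M)"
proof -
  have e: "(\<integral>\<^sup>+g. F g \<partial>measure_pmf p) = (\<integral>\<^sup>+g. ennreal (pmf p g) * F g \<partial>count_space (set_pmf p))" for F :: "'a \<Rightarrow> ennreal"
    unfolding nn_integral_measure_pmf
    by (rule nn_integral_count_space_eq) (auto simp: set_pmf_iff)
  have "(\<integral>\<^sup>+g. \<integral>\<^sup>+x. f g x \<partial>M \<partial>measure_pmf p) = (\<integral>\<^sup>+g. \<integral>\<^sup>+x. ennreal (pmf p g) * f g x \<partial>M \<partial>count_space (set_pmf p))"
    unfolding e using assms by (intro nn_integral_cong) (simp add: nn_integral_cmult)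
  also have "\<dots> = (\<integral>\<^sup>+x. \<integral>\<^sup>+g. ennreal (pmf p g) * f g x \<partial>count_space (set_pmf p) \<partial>M)"
  proof -
    have "(\<integral>\<^sup>+g. \<integral>\<^sup>+x. ennreal (pmf p g) * (if g \<in> set_pmf p then f g x else 0) \<partial>M \<partial>count_space (set_pmf p))
      = (\<integral>\<^sup>+x. \<integral>\<^sup>+g. ennreal (pmf p g) * (if g \<in> set_pmf p then f g x else 0) \<partial>count_space (set_pmf p) \<partial>M)"
    proof (rule nn_integral_count_space_nn_integral[symmetric])
      fix g show "(\<lambda>x. ennreal (pmf p g) * (if g \<in> set_pmf p then f g x else 0)) \<in> borel_measurable M"
        using assms[of g] by (cases "g \<in> set_pmf p") auto
    qed simp
    moreover have "(\<integral>\<^sup>+g. \<integral>\<^sup>+x. ennreal (pmf p g) * (if g \<in> set_pmf p then f g x else 0) \<partial>M \<partial>count_space (set_pmf p))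
      = (\<integral>\<^sup>+g. \<integral>\<^sup>+x. ennreal (pmf p g) * f g x \<partial>M \<partial>count_space (set_pmf p))"
      by (rule nn_integral_cong) simp
    moreover have "(\<integral>\<^sup>+g. ennreal (pmf p g) * (if g \<in> set_pmf p then f g x else 0) \<partial>count_space (set_pmf p))
      = (\<integral>\<^sup>+g. ennreal (pmf p g) * f g x \<partial>count_space (set_pmf p))" for x
      by (rule nn_integral_cong) simp
    ultimately show ?thesis by simp
  qed
  finally show ?thesis unfolding e .
qed

context ne_walk
begin

text \<open>The composition law is stated on norms: over a field that is not algebraically closed,
  distinct points may induce the same norm on linear forms, so equality of norms does not give
  equality of points.\<close>

lemma bnorm_act_mult:
  assumes "x \<in> P1an absv" "g \<in> SL2" "h \<in> SL2"
  shows "bnorm (berk_act absv g (berk_act absv h x)) = bnorm (berk_act absv (mat2_mult g h) x)"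
proof
  fix v
  show "bnorm (berk_act absv g (berk_act absv h x)) v = bnorm (berk_act absv (mat2_mult g h) x) v"
    using assms by (simp add: bnorm_berk_act dil_berk_act mat2_inv_mult mv_mult)
qed

text \<open>Sets that see a point only through its norm on linear forms. On them the action composes
  correctly by \<open>bnorm_act_mult\<close>; the balls and their unions used below are of this
  kind.\<close>

definition bnorm_set :: "('k poly \<Rightarrow> real) option set \<Rightarrow> bool" where
  "bnorm_set B \<longleftrightarrow> (\<forall>x\<in>P1an absv. \<forall>y\<in>P1an absv. bnorm x = bnorm y \<longrightarrow> x \<in> B \<longrightarrow> y \<in> B)"

lemma bnorm_set_bal: "bnorm_set (bal w n)"
  by (auto simp: bnorm_set_def bal_def delta_def)

lemma bnorm_set_UN: "(\<And>i. i \<in> I \<Longrightarrow> bnorm_set (B i)) \<Longrightarrow> bnorm_set (\<Union>i\<in>I. B i)"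
  unfolding bnorm_set_def by blast

text \<open>Iterating stationarity uses the composition law of the action, hence
  \<open>bnorm_set B\<close>; the final swap turns the mean over \<open>g\<close> into a probability
  for each starting point.\<close>

lemma stationary_iterate:
  assumes st: "stationary absv \<mu> \<nu>" and B: "B \<in> sets (berk_borel absv)" "bnorm_set B"
  shows "emeasure \<nu> B = (\<integral>\<^sup>+x. emeasure (measure_pmf (conv_pow \<mu> n)) {g. berk_act absv g x \<in> B} \<partial>\<nu>)"
proof -
  have sets: "sets \<nu> = sets (berk_borel absv)" and sp: "space \<nu> = P1an absv"
    and st': "\<And>A. A \<in> sets \<nu> \<Longrightarrow> emeasure \<nu> A = (\<integral>\<^sup>+ g. emeasure \<nu> (berk_act absv g -` A \<inter> space \<nu>) \<partial>measure_pmf \<mu>)"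
    using st by (auto simp: stationary_def)
  have act: "berk_act absv g -` A \<inter> space \<nu> \<in> sets \<nu>" if "A \<in> sets \<nu>" for g A
    using measurable_sets[OF measurable_berk_act[of g], of A] that sets sp by simp
  have Bs: "B \<in> sets \<nu>" using B sets by simp
  have *: "emeasure \<nu> B = (\<integral>\<^sup>+ g. emeasure \<nu> (berk_act absv g -` B \<inter> space \<nu>) \<partial>measure_pmf (conv_pow \<mu> n))"
  proof (induction n)
    case 0
    have "berk_act absv mat2_id -` B \<inter> space \<nu> = B"
    proof -
      have "bnorm (berk_act absv mat2_id x) = bnorm x" if "x \<in> P1an absv" for x
        using that nl_one[OF norm_like_bnorm[OF that]] by (auto simp: bnorm_berk_act dil_def)
      then show ?thesis using B(2) sets.sets_into_space[OF Bs] unfolding bnorm_set_def sp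
        by (auto simp del: berk_act.simps)
    qed
    then show ?case by simp
  next
    case (Suc n)
    have "emeasure \<nu> (berk_act absv g -` B \<inter> space \<nu>)
      = (\<integral>\<^sup>+ h. emeasure \<nu> (berk_act absv (mat2_mult g h) -` B \<inter> space \<nu>) \<partial>measure_pmf \<mu>)"
      if g: "g \<in> set_pmf (conv_pow \<mu> n)" for g
    proof -
      have "emeasure \<nu> (berk_act absv g -` B \<inter> space \<nu>)
        = (\<integral>\<^sup>+ h. emeasure \<nu> (berk_act absv h -` (berk_act absv g -` B \<inter> space \<nu>) \<inter> space \<nu>) \<partial>measure_pmf \<mu>)"
        by (rule st'[OF act[OF Bs]])
      also have "\<dots> = (\<integral>\<^sup>+ h. emeasure \<nu> (berk_act absv (mat2_mult g h) -` B \<inter> space \<nu>) \<partial>measure_pmf \<mu>)"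
      proof (rule nn_integral_cong_AE, unfold AE_measure_pmf_iff, intro ballI)
        fix h assume "h \<in> set_pmf \<mu>"
        then have gh: "g \<in> SL2" "h \<in> SL2" using g slN sl by blast+
        have "berk_act absv h -` (berk_act absv g -` B \<inter> space \<nu>) \<inter> space \<nu> = berk_act absv (mat2_mult g h) -` B \<inter> space \<nu>"
        proof (intro set_eqI iffI)
          fix x assume x: "x \<in> berk_act absv h -` (berk_act absv g -` B \<inter> space \<nu>) \<inter> space \<nu>"
          then have "x \<in> P1an absv" "berk_act absv g (berk_act absv h x) \<in> B" using sp by auto
          then show "x \<in> berk_act absv (mat2_mult g h) -` B \<inter> space \<nu>"
            using B(2) bnorm_act_mult[OF _ gh, of x] unfolding bnorm_set_def sp
            by (simp del: berk_act.simps) (meson berk_act_P1an)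
        next
          fix x assume x: "x \<in> berk_act absv (mat2_mult g h) -` B \<inter> space \<nu>"
          then have "x \<in> P1an absv" "berk_act absv (mat2_mult g h) x \<in> B" using sp by auto
          then show "x \<in> berk_act absv h -` (berk_act absv g -` B \<inter> space \<nu>) \<inter> space \<nu>"
            using B(2) bnorm_act_mult[OF _ gh, of x] unfolding bnorm_set_def sp
            by (simp del: berk_act.simps) (metis berk_act_P1an)
        qed
        then show "emeasure \<nu> (berk_act absv h -` (berk_act absv g -` B \<inter> space \<nu>) \<inter> space \<nu>)
           = emeasure \<nu> (berk_act absv (mat2_mult g h) -` B \<inter> space \<nu>)" by simp
      qed
      finally show ?thesis .
    qed
    then have "emeasure \<nu> B = (\<integral>\<^sup>+ g. \<integral>\<^sup>+ h. emeasure \<nu> (berk_act absv (mat2_mult g h) -` B \<inter> space \<nu>) \<partial>measure_pmf \<mu> \<partial>measure_pmf (conv_pow \<mu> n))"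
      unfolding Suc by (intro nn_integral_cong_AE) (simp add: AE_measure_pmf_iff)
    also have "\<dots> = (\<integral>\<^sup>+ g. emeasure \<nu> (berk_act absv g -` B \<inter> space \<nu>) \<partial>measure_pmf (conv_pow \<mu> (Suc 0 + n)))"
      unfolding conv_pow_add' by (simp add: conv_pow_1 del: conv_pow.simps)
    finally show ?case by simp
  qed
  also have "\<dots> = (\<integral>\<^sup>+ g. \<integral>\<^sup>+x. indicator B (berk_act absv g x) \<partial>\<nu> \<partial>measure_pmf (conv_pow \<mu> n))"
  proof (rule nn_integral_cong)
    fix g
    have "(\<integral>\<^sup>+x. indicator B (berk_act absv g x) \<partial>\<nu>) = (\<integral>\<^sup>+x. indicator (berk_act absv g -` B \<inter> space \<nu>) x \<partial>\<nu>)"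
      by (rule nn_integral_cong) (simp add: indicator_def)
    then show "emeasure \<nu> (berk_act absv g -` B \<inter> space \<nu>) = (\<integral>\<^sup>+x. indicator B (berk_act absv g x) \<partial>\<nu>)"
      using act[OF Bs] by simp
  qed
  also have "\<dots> = (\<integral>\<^sup>+x. \<integral>\<^sup>+g. indicator B (berk_act absv g x) \<partial>measure_pmf (conv_pow \<mu> n) \<partial>\<nu>)"
  proof (rule nn_integral_pmf_measure_swap)
    fix g
    have "(\<lambda>x. indicator B (berk_act absv g x) :: ennreal) \<in> borel_measurable (berk_borel absv)"
      using B(1) by measurable
    then show "(\<lambda>x. indicator B (berk_act absv g x) :: ennreal) \<in> borel_measurable \<nu>"
      using measurable_cong_sets[OF sets refl] by blast
  qed
  also have "\<dots> = (\<integral>\<^sup>+x. emeasure (measure_pmf (conv_pow \<mu> n)) {g. berk_act absv g x \<in> B} \<partial>\<nu>)"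
  proof (rule nn_integral_cong)
    fix x
    have "(\<integral>\<^sup>+g. indicator B (berk_act absv g x) \<partial>measure_pmf (conv_pow \<mu> n))
       = (\<integral>\<^sup>+g. indicator {g. berk_act absv g x \<in> B} g \<partial>measure_pmf (conv_pow \<mu> n))"
      by (rule nn_integral_cong) (simp add: indicator_def)
    then show "(\<integral>\<^sup>+g. indicator B (berk_act absv g x) \<partial>measure_pmf (conv_pow \<mu> n))
       = emeasure (measure_pmf (conv_pow \<mu> n)) {g. berk_act absv g x \<in> B}" by simp
  qed
  finally show ?thesis .
qed

subsection \<open>Coding the increments by natural numbers\<close>

text \<open>The product of discrete \<open>\<sigma>\<close>-algebras over an uncountable type does not make matrix products
  measurable, so the walk is driven by the indices of the countably many increments.\<close>

definition incr :: "nat \<Rightarrow> 'k mat2" where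
  "incr = from_nat_into (set_pmf \<mu>)"

definition code :: "nat pmf" where
  "code = map_pmf (to_nat_on (set_pmf \<mu>)) \<mu>"

definition Om :: "(nat \<Rightarrow> nat) measure" where
  "Om = (\<Pi>\<^sub>M i\<in>(UNIV::nat set). measure_pmf code)"

lemma map_incr_code: "map_pmf incr code = \<mu>"
  unfolding code_def incr_def map_pmf_comp
  by (rule map_pmf_idI) (simp add: countable_set_pmf)

lemma incr_supp [simp]: "incr i \<in> set_pmf \<mu>"
  unfolding incr_def by (rule from_nat_into[OF set_pmf_not_empty])

lemma incr_SL2 [simp]: "incr i \<in> SL2"
  using incr_supp sl by blast

lemma space_Om [simp]: "space Om = UNIV"
  by (simp add: Om_def space_PiM)

lemma seq_Om: "sequence_space (measure_pmf code)"
  by unfold_locales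

lemma prob_space_Om: "prob_space Om"
  unfolding Om_def by (rule prob_space_PiM) (rule measure_pmf.prob_space_axioms)

lemma measurable_coord: "(\<lambda>\<omega>. \<omega> i) \<in> Om \<rightarrow>\<^sub>M count_space UNIV"
proof -
  have "(\<lambda>\<omega>. \<omega> i) \<in> Om \<rightarrow>\<^sub>M measure_pmf code"
    unfolding Om_def by (rule measurable_component_singleton) simp
  then show ?thesis by (simp add: measurable_pmf_measure2)
qed

text \<open>A function of finitely many natural numbers factors through the countable discrete space
  of lists, from which every map is measurable.\<close>

lemma measurable_fin_dep:
  assumes dep: "\<And>\<omega> \<omega>'. (\<And>i. i < n \<Longrightarrow> \<omega> i = \<omega>' i) \<Longrightarrow> f \<omega> = f \<omega>'" and sp: "\<And>\<omega>. f \<omega> \<in> space N"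
  shows "f \<in> Om \<rightarrow>\<^sub>M N"
proof -
  have l: "(\<lambda>\<omega>. map \<omega> [0..<n]) \<in> Om \<rightarrow>\<^sub>M count_space UNIV"
    unfolding measurable_count_space_eq2_countable
  proof (intro conjI ballI)
    fix l :: "nat list"
    have eq: "map \<omega> [0..<n] = l \<longleftrightarrow> length l = n \<and> (\<forall>i\<in>{..<n}. \<omega> i = l ! i)" for \<omega>
    proof
      assume "map \<omega> [0..<n] = l"
      from this[symmetric] show "length l = n \<and> (\<forall>i\<in>{..<n}. \<omega> i = l ! i)" by simp
    next
      assume "length l = n \<and> (\<forall>i\<in>{..<n}. \<omega> i = l ! i)"
      then show "map \<omega> [0..<n] = l" by (intro nth_equalityI) simp_all
    qed
    have "(\<lambda>\<omega>. map \<omega> [0..<n]) -` {l} \<inter> space Om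
       = (if length l = n then {\<omega> \<in> space Om. \<forall>i\<in>{..<n}. \<omega> i = l ! i} else {})"
      unfolding vimage_def singleton_iff eq by (simp add: Int_def)
    moreover have "{\<omega> \<in> space Om. \<forall>i\<in>{..<n}. \<omega> i = l ! i} \<in> sets Om"
    proof (rule sets.sets_Collect_finite_All)
      fix i
      have "(\<lambda>\<omega>. \<omega> i) -` {l ! i} \<inter> space Om \<in> sets Om" by (rule measurable_sets[OF measurable_coord]) simp
      then show "{\<omega> \<in> space Om. \<omega> i = l ! i} \<in> sets Om" by (simp add: vimage_def)
    qed simp
    ultimately show "(\<lambda>\<omega>. map \<omega> [0..<n]) -` {l} \<inter> space Om \<in> sets Om" by simp
  qed simp
  have "(\<lambda>l. f (\<lambda>i. if i < n then l ! i else 0)) \<in> count_space UNIV \<rightarrow>\<^sub>M N" using sp by simp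
  from measurable_compose[OF l this]
  have "(\<lambda>\<omega>. f (\<lambda>i. if i < n then map \<omega> [0..<n] ! i else 0)) \<in> Om \<rightarrow>\<^sub>M N" .
  moreover have "f (\<lambda>i. if i < n then map \<omega> [0..<n] ! i else 0) = f \<omega>" for \<omega>
    by (rule dep) simp
  ultimately show ?thesis by simp
qed

lemma nn_integral_Om_front:
  assumes F: "F \<in> borel_measurable Om"
  shows "(\<integral>\<^sup>+\<omega>. F \<omega> \<partial>Om) = (\<integral>\<^sup>+i. \<integral>\<^sup>+\<omega>. F (case_nat i \<omega>) \<partial>Om \<partial>measure_pmf code)"
proof -
  interpret sequence_space "measure_pmf code" by (rule seq_Om)
  interpret O: prob_space Om by (rule prob_space_Om)
  have m: "(\<lambda>(s,\<omega>). case_nat s \<omega>) \<in> measure_pmf code \<Otimes>\<^sub>M Om \<rightarrow>\<^sub>M Om"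
    unfolding Om_def
    by (rule measurable_PiM_single') (auto split: nat.split simp: space_pair_measure case_prod_beta)
  have "(\<integral>\<^sup>+\<omega>. F \<omega> \<partial>Om) = (\<integral>\<^sup>+\<omega>. F \<omega> \<partial>distr (measure_pmf code \<Otimes>\<^sub>M Om) Om (\<lambda>(s,\<omega>). case_nat s \<omega>))"
    using PiM_iter unfolding Om_def by simp
  also have "\<dots> = (\<integral>\<^sup>+z. F (case z of (s,\<omega>) \<Rightarrow> case_nat s \<omega>) \<partial>(measure_pmf code \<Otimes>\<^sub>M Om))"
    using F m by (intro nn_integral_distr) auto
  also have "\<dots> = (\<integral>\<^sup>+i. \<integral>\<^sup>+\<omega>. F (case_nat i \<omega>) \<partial>Om \<partial>measure_pmf code)"
    using measurable_compose[OF m F] by (subst O.nn_integral_fst[symmetric]) auto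
  finally show ?thesis .
qed

text \<open>Increments enter on the right, so a further step moves the innermost point and the long
  product already formed contracts the displacement: this makes the image points converge. At each
  single time the law is that of the left walk.\<close>

fun rwalk :: "(nat \<Rightarrow> nat) \<Rightarrow> nat \<Rightarrow> 'k mat2" where
  "rwalk \<omega> 0 = mat2_id"
| "rwalk \<omega> (Suc n) = mat2_mult (rwalk \<omega> n) (incr (\<omega> n))"

lemma rwalk_front: "rwalk (case_nat i \<omega>) (Suc n) = mat2_mult (incr i) (rwalk \<omega> n)"
  by (induction n) (simp_all add: mat2_mult_assoc)

lemma rwalk_cong: "(\<And>i. i < n \<Longrightarrow> \<omega> i = \<omega>' i) \<Longrightarrow> rwalk \<omega> n = rwalk \<omega>' n"
  by (induction n) auto

lemma rwalk_semi: "rwalk \<omega> n \<in> semi"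
proof (induction n)
  case (Suc n)
  have "incr (\<omega> n) \<in> semi" using supp_semi incr_supp by blast
  then show ?case using semi_mult[OF Suc] by simp
qed (simp add: semi_id)

lemma nn_integral_conv_pow_front:
  "(\<integral>\<^sup>+g. F g \<partial>measure_pmf (conv_pow \<mu> (Suc n)))
    = (\<integral>\<^sup>+i. \<integral>\<^sup>+g. F (mat2_mult (incr i) g) \<partial>measure_pmf (conv_pow \<mu> n) \<partial>measure_pmf code)"
proof -
  have "(\<integral>\<^sup>+g. F g \<partial>measure_pmf (conv_pow \<mu> (n + Suc 0)))
    = (\<integral>\<^sup>+h. \<integral>\<^sup>+g. F (mat2_mult h g) \<partial>measure_pmf (conv_pow \<mu> n) \<partial>measure_pmf (map_pmf incr code))"
    unfolding conv_pow_add' conv_pow_1 map_incr_code by simp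
  then show ?thesis by simp
qed

lemma rwalk_law:
  "(\<integral>\<^sup>+\<omega>. F (rwalk \<omega> n) \<partial>Om) = (\<integral>\<^sup>+g. F g \<partial>measure_pmf (conv_pow \<mu> n))"
proof (induction n arbitrary: F)
  case 0
  show ?case using prob_space.emeasure_space_1[OF prob_space_Om] by simp
next
  case (Suc n)
  have "(\<integral>\<^sup>+\<omega>. F (rwalk \<omega> (Suc n)) \<partial>Om) = (\<integral>\<^sup>+i. \<integral>\<^sup>+\<omega>. F (rwalk (case_nat i \<omega>) (Suc n)) \<partial>Om \<partial>measure_pmf code)"
    by (rule nn_integral_Om_front, rule measurable_fin_dep[of "Suc n"], subst rwalk_cong) auto
  moreover have "(\<integral>\<^sup>+\<omega>. F (mat2_mult (incr i) (rwalk \<omega> n)) \<partial>Om)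
    = (\<integral>\<^sup>+g. F (mat2_mult (incr i) g) \<partial>measure_pmf (conv_pow \<mu> n))" for i by (rule Suc)
  ultimately show ?case unfolding rwalk_front nn_integral_conv_pow_front by simp
qed

lemma rwalk_joint_law:
  "(\<integral>\<^sup>+\<omega>. F (rwalk \<omega> n) (rwalk \<omega> (n + m)) \<partial>Om)
    = (\<integral>\<^sup>+g. \<integral>\<^sup>+h. F g (mat2_mult g h) \<partial>measure_pmf (conv_pow \<mu> m) \<partial>measure_pmf (conv_pow \<mu> n))"
proof (induction n arbitrary: F)
  case 0
  show ?case using rwalk_law[of "F mat2_id" m] by simp
next
  case (Suc n)
  have cong: "F (rwalk \<omega> (Suc n)) (rwalk \<omega> (Suc n + m)) = F (rwalk \<omega>' (Suc n)) (rwalk \<omega>' (Suc n + m))"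
    if "\<And>i. i < Suc n + m \<Longrightarrow> \<omega> i = \<omega>' i" for \<omega> \<omega>'
    using rwalk_cong[of "Suc n" \<omega> \<omega>'] rwalk_cong[of "Suc n + m" \<omega> \<omega>'] that by simp
  have "(\<integral>\<^sup>+\<omega>. F (rwalk \<omega> (Suc n)) (rwalk \<omega> (Suc n + m)) \<partial>Om)
     = (\<integral>\<^sup>+i. \<integral>\<^sup>+\<omega>. F (rwalk (case_nat i \<omega>) (Suc n)) (rwalk (case_nat i \<omega>) (Suc n + m)) \<partial>Om \<partial>measure_pmf code)"
    by (rule nn_integral_Om_front, rule measurable_fin_dep[of "Suc n + m"], rule cong) auto
  moreover have "(\<integral>\<^sup>+\<omega>. F (mat2_mult (incr i) (rwalk \<omega> n)) (mat2_mult (incr i) (rwalk \<omega> (n + m))) \<partial>Om)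
    = (\<integral>\<^sup>+g. \<integral>\<^sup>+h. F (mat2_mult (incr i) g) (mat2_mult (incr i) (mat2_mult g h))
        \<partial>measure_pmf (conv_pow \<mu> m) \<partial>measure_pmf (conv_pow \<mu> n))" for i
    by (rule Suc)
  ultimately show ?case
    unfolding add_Suc rwalk_front nn_integral_conv_pow_front by (simp add: mat2_mult_assoc)
qed

subsection \<open>The limit point of the right walk\<close>

definition contr_time :: "nat \<Rightarrow> nat" where
  "contr_time k = (SOME n0. \<forall>n x v. n0 \<le> n \<longrightarrow> x \<in> P1an absv \<longrightarrow> v \<noteq> (0,0) \<longrightarrow>
     measure_pmf.prob (conv_pow \<mu> n) {g. (1/2) ^ k \<le> delta (berk_act absv g x) (mv g v)} \<le> (1/2) ^ k)"

lemma contr_time: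
  assumes "contr_time k \<le> n" "x \<in> P1an absv" "v \<noteq> (0,0)"
  shows "measure_pmf.prob (conv_pow \<mu> n) {g. (1/2) ^ k \<le> delta (berk_act absv g x) (mv g v)} \<le> (1/2) ^ k"
proof -
  have "\<exists>n0. \<forall>n x v. n0 \<le> n \<longrightarrow> x \<in> P1an absv \<longrightarrow> v \<noteq> (0,0) \<longrightarrow>
     measure_pmf.prob (conv_pow \<mu> n) {g. (1/2) ^ k \<le> delta (berk_act absv g x) (mv g v)} \<le> (1/2) ^ k"
    by (rule contraction) auto
  from someI_ex[OF this] show ?thesis unfolding contr_time_def[symmetric] using assms by blast
qed

text \<open>The sum makes the times monotone and the summand \<open>k\<close> makes them unbounded;
  the failure probabilities \<open>(1/2) ^ k\<close> are summable, as Borel-Cantelli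
  requires.\<close>

definition nk :: "nat \<Rightarrow> nat" where
  "nk k = k + (\<Sum>j\<le>k. contr_time j)"

lemma nk_ge: "contr_time k \<le> nk k" "k \<le> nk k"
  by (auto simp: nk_def intro: trans_le_add2 member_le_sum)

lemma nk_mono: "nk k \<le> nk (Suc k)"
  by (simp add: nk_def)

abbreviation e0 :: "'k \<times> 'k" where "e0 \<equiv> (1,0)"

definition wp :: "(nat \<Rightarrow> nat) \<Rightarrow> nat \<Rightarrow> 'k \<times> 'k" where
  "wp \<omega> k = mv (rwalk \<omega> (nk k)) e0"

text \<open>The countable set that contains all approximating vectors \<open>wp\<close>; it plays
  the role of \<open>S\<close> in \<open>clos\<close>.\<close>

definition orb :: "('k \<times> 'k) set" where
  "orb = (\<lambda>t. mv t e0) ` semi"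

lemma semi_countable: "countable semi"
  unfolding semi_def by simp

lemma orb_countable: "countable orb"
  unfolding orb_def using semi_countable by simp

lemma orb_nz: "(0,0) \<notin> orb"
proof
  assume "(0,0) \<in> orb"
  then obtain t where "t \<in> semi" "mv t e0 = (0,0)" unfolding orb_def by (metis imageE)
  then show False using semi_SL2 by simp
qed

lemma orb_nz': "w \<in> orb \<Longrightarrow> w \<noteq> (0,0)"
  using orb_nz by blast

lemma wp_orb: "wp \<omega> k \<in> orb"
  unfolding wp_def orb_def using rwalk_semi by blast

lemma wp_nz: "wp \<omega> k \<noteq> (0,0)"
  using wp_orb orb_nz' by blast

lemma wp_measurable: "(\<And>w. F w \<in> space N) \<Longrightarrow> (\<lambda>\<omega>. F (wp \<omega> k)) \<in> Om \<rightarrow>\<^sub>M N"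
proof (rule measurable_fin_dep[of "nk k"])
  fix \<omega> \<omega>' :: "nat \<Rightarrow> nat" assume "\<And>i. i < nk k \<Longrightarrow> \<omega> i = \<omega>' i"
  then have "rwalk \<omega> (nk k) = rwalk \<omega>' (nk k)" by (rule rwalk_cong)
  then show "F (wp \<omega> k) = F (wp \<omega>' k)" by (simp add: wp_def)
qed

definition good :: "(nat \<Rightarrow> nat) set" where
  "good = {\<omega>. \<exists>N. \<forall>k\<ge>N. chord (wp \<omega> k) (wp \<omega> (Suc k)) < (1/2) ^ k}"

lemma measurable_chord_wp: "(\<lambda>\<omega>. chord (wp \<omega> k) (wp \<omega> (Suc k))) \<in> borel_measurable Om"
proof (rule measurable_fin_dep[of "nk (Suc k)"])
  fix \<omega> \<omega>' :: "nat \<Rightarrow> nat" assume "\<And>i. i < nk (Suc k) \<Longrightarrow> \<omega> i = \<omega>' i"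
  then have "wp \<omega> k = wp \<omega>' k" "wp \<omega> (Suc k) = wp \<omega>' (Suc k)"
    using nk_mono[of k] by (auto simp: wp_def intro!: arg_cong[where f="\<lambda>g. mv g e0"] rwalk_cong)
  then show "chord (wp \<omega> k) (wp \<omega> (Suc k)) = chord (wp \<omega>' k) (wp \<omega>' (Suc k))" by simp
qed simp

lemma good_meas: "good \<in> sets Om"
proof -
  have "{\<omega> \<in> space Om. \<exists>N. \<forall>k\<ge>N. chord (wp \<omega> k) (wp \<omega> (Suc k)) < (1/2) ^ k} \<in> sets Om"
    using borel_measurable_less[OF measurable_chord_wp borel_measurable_const] sets.top[of Om]
    by (intro sets.sets_Collect_countable_Ex sets.sets_Collect_countable_All sets.sets_Collect_imp) auto
  then show ?thesis by (simp add: good_def)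
qed

text \<open>At the two times the walk is at \<open>g\<close> and at \<open>g h\<close> with
  \<open>g\<close> and \<open>h\<close> independent, so the distance is that of the images under
  \<open>g\<close> of the points \<open>e0\<close> and \<open>h e0\<close>. Contraction is uniform
  in the second point, which takes care of the random \<open>h\<close>; Borel-Cantelli
  concludes.\<close>

lemma AE_good: "AE \<omega> in Om. \<omega> \<in> good"
proof -
  interpret prob_space Om by (rule prob_space_Om)
  define A where "A k = {\<omega>. (1/2) ^ k \<le> chord (wp \<omega> k) (wp \<omega> (Suc k))}" for k
  have Am: "A k \<in> sets Om" for k
  proof -
    have "{\<omega> \<in> space Om. (1/2) ^ k \<le> chord (wp \<omega> k) (wp \<omega> (Suc k))} \<in> sets Om"
      by (rule borel_measurable_le[OF borel_measurable_const measurable_chord_wp])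
    then show ?thesis by (simp add: A_def)
  qed
  have Ak: "prob (A k) \<le> (1/2) ^ k" for k
  proof -
    let ?F = "\<lambda>g h. indicator {z. (1/2) ^ k \<le> chord (mv (fst z) e0) (mv (snd z) e0)} (g,h) :: ennreal"
    define m where "m = nk (Suc k) - nk k"
    have m: "nk (Suc k) = nk k + m" using nk_mono[of k] by (simp add: m_def)
    have "emeasure Om (A k) = (\<integral>\<^sup>+\<omega>. indicator (A k) \<omega> \<partial>Om)" using Am by simp
    also have "\<dots> = (\<integral>\<^sup>+\<omega>. ?F (rwalk \<omega> (nk k)) (rwalk \<omega> (nk k + m)) \<partial>Om)"
      by (intro nn_integral_cong) (simp add: indicator_def A_def wp_def m)
    also have "\<dots> = (\<integral>\<^sup>+h. \<integral>\<^sup>+g. ?F g (mat2_mult g h) \<partial>measure_pmf (conv_pow \<mu> (nk k)) \<partial>measure_pmf (conv_pow \<mu> m))"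
      by (rule trans[OF rwalk_joint_law[of ?F] nn_integral_pmf_swap])
    also have "\<dots> \<le> (\<integral>\<^sup>+h. ennreal ((1/2) ^ k) \<partial>measure_pmf (conv_pow \<mu> m))"
    proof (rule nn_integral_mono_AE, unfold AE_measure_pmf_iff, intro ballI)
      fix h assume "h \<in> set_pmf (conv_pow \<mu> m)"
      then have h: "h \<in> SL2" using slN by blast
      let ?B = "{g. (1/2) ^ k \<le> delta (berk_act absv g (pt e0)) (mv g (mv h e0))}"
      have "(\<integral>\<^sup>+g. ?F g (mat2_mult g h) \<partial>measure_pmf (conv_pow \<mu> (nk k)))
         = (\<integral>\<^sup>+g. indicator ?B g \<partial>measure_pmf (conv_pow \<mu> (nk k)))"
      proof (rule nn_integral_cong_AE, unfold AE_measure_pmf_iff, intro ballI)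
        fix g assume "g \<in> set_pmf (conv_pow \<mu> (nk k))"
        then have g: "g \<in> SL2" using slN by blast
        have "berk_act absv g (pt e0) = pt (mv g e0)" by (rule berk_act_pt[OF g]) simp
        moreover have "delta (pt (mv g e0)) (mv g (mv h e0)) = chord (mv g e0) (mv g (mv h e0))"
          by (rule delta_pt) (use g in simp)
        ultimately have "delta (berk_act absv g (pt e0)) (mv g (mv h e0)) = chord (mv g e0) (mv g (mv h e0))"
          by (simp only:)
        then show "?F g (mat2_mult g h) = indicator ?B g" by (simp add: indicator_def mv_mult)
      qed
      also have "\<dots> = ennreal (measure_pmf.prob (conv_pow \<mu> (nk k)) ?B)"
        by (simp add: measure_pmf.emeasure_eq_measure)
      also have "\<dots> \<le> ennreal ((1/2) ^ k)"
        using contr_time[OF nk_ge(1), of "pt e0" "mv h e0" k] h by (intro ennreal_leI) (simp del: pt.simps)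
      finally show "(\<integral>\<^sup>+g. ?F g (mat2_mult g h) \<partial>measure_pmf (conv_pow \<mu> (nk k))) \<le> ennreal ((1/2) ^ k)" .
    qed
    also have "\<dots> = ennreal ((1/2) ^ k)" by simp
    finally show ?thesis by (simp add: emeasure_eq_measure)
  qed
  have "AE \<omega> in Om. eventually (\<lambda>k. \<omega> \<in> space Om - A k) sequentially"
  proof (rule borel_cantelli_AE1[OF Am])
    show "emeasure Om (A n) < \<infinity>" for n by (simp add: less_top[symmetric])
    show "summable (\<lambda>n. prob (A n))"
      by (rule summable_comparison_test'[of "\<lambda>k. (1/2::real) ^ k" 0]) (use Ak in \<open>auto simp: summable_geometric\<close>)
  qed
  then show ?thesis
    by eventually_elim (auto simp: good_def A_def eventually_sequentially not_le)
qed

text \<open>In an ultrametric, consecutive distances tending to 0 already make a sequence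
  Cauchy.\<close>

lemma good_limit:
  assumes g: "\<omega> \<in> good"
  shows "\<exists>v. v \<noteq> (0,0) \<and> (\<forall>e>0. \<exists>N. \<forall>n\<ge>N. chord (wp \<omega> n) v < e)"
proof (rule chord_Cauchy_limit[OF complete wp_nz])
  fix e :: real assume e: "0 < e"
  obtain N where N: "\<And>k. k \<ge> N \<Longrightarrow> chord (wp \<omega> k) (wp \<omega> (Suc k)) < (1/2) ^ k" using g by (auto simp: good_def)
  obtain M where M: "(1/2) ^ M < e" using real_arch_pow_inv[OF e, of "1/2"] by auto
  let ?K = "max N M"
  have K: "(1/2::real) ^ ?K < e" by (rule le_less_trans[OF power_decreasing M]) auto
  have d: "chord (wp \<omega> (?K + j)) (wp \<omega> ?K) < e" for j
  proof (induction j)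
    case (Suc j)
    have "(1/2::real) ^ (?K + j) \<le> (1/2) ^ ?K" by (rule power_decreasing) auto
    moreover have "chord (wp \<omega> (?K + j)) (wp \<omega> (Suc (?K + j))) < (1/2) ^ (?K + j)" by (rule N) simp
    ultimately have "chord (wp \<omega> (Suc (?K + j))) (wp \<omega> (?K + j)) < e"
      unfolding chord_commute[of "wp \<omega> (Suc (?K + j))"] using K by linarith
    then show ?case unfolding add_Suc_right
      using Suc chord_ultra[OF wp_nz wp_nz wp_nz, of \<omega> "Suc (?K + j)" \<omega> ?K \<omega> "?K + j"] by linarith
  qed (use e in simp)
  show "\<exists>N. \<forall>m\<ge>N. \<forall>n\<ge>N. chord (wp \<omega> m) (wp \<omega> n) < e"
  proof (intro exI[of _ ?K] allI impI)
    fix m n assume mn: "?K \<le> m" "?K \<le> n"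
    have "chord (wp \<omega> m) (wp \<omega> ?K) < e" "chord (wp \<omega> n) (wp \<omega> ?K) < e"
      using d[of "m - ?K"] d[of "n - ?K"] mn by simp_all
    then show "chord (wp \<omega> m) (wp \<omega> n) < e"
      using chord_ultra[OF wp_nz wp_nz wp_nz, of \<omega> m \<omega> n \<omega> ?K] chord_commute[of "wp \<omega> n" "wp \<omega> ?K"] by linarith
  qed
qed

text \<open>Off the set \<open>good\<close> of full measure the value is the base vector, which
  keeps \<open>Zv\<close> nonzero and \<open>Z\<close> measurable.\<close>

definition Zv :: "(nat \<Rightarrow> nat) \<Rightarrow> 'k \<times> 'k" where
  "Zv \<omega> = (if \<omega> \<in> good then SOME v. v \<noteq> (0,0) \<and> (\<forall>e>0. \<exists>N. \<forall>n\<ge>N. chord (wp \<omega> n) v < e) else e0)"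

definition Z :: "(nat \<Rightarrow> nat) \<Rightarrow> ('k poly \<Rightarrow> real) option" where
  "Z \<omega> = pt (Zv \<omega>)"

lemma Zv_nz: "Zv \<omega> \<noteq> (0,0)"
  and Zv_lim: "\<omega> \<in> good \<Longrightarrow> 0 < e \<Longrightarrow> \<exists>N. \<forall>n\<ge>N. chord (wp \<omega> n) (Zv \<omega>) < e"
  using someI_ex[OF good_limit, of \<omega>] by (auto simp: Zv_def)

lemma Z_clos: "\<omega> \<in> good \<Longrightarrow> Z \<omega> \<in> clos orb"
proof -
  assume g: "\<omega> \<in> good"
  have "\<exists>w\<in>orb. Z \<omega> \<in> bal w n" for n
  proof -
    obtain N where "chord (wp \<omega> N) (Zv \<omega>) < inverse (real (Suc n))"
      using Zv_lim[OF g, of "inverse (real (Suc n))"] by auto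
    then have "Z \<omega> \<in> bal (wp \<omega> N) n"
      by (simp add: bal_def Z_def delta_pt Zv_nz chord_commute del: pt.simps)
    then show ?thesis using wp_orb by blast
  qed
  then show ?thesis by (simp add: clos_def Z_def del: pt.simps)
qed

text \<open>Closeness at a fixed scale is an equivalence relation, so membership of the limit in a set that
  is saturated at some scale is decided by the approximating points.\<close>

definition loc_const :: "('k poly \<Rightarrow> real) option set \<Rightarrow> bool" where
  "loc_const A \<longleftrightarrow> (\<exists>e>0. \<forall>u v. u \<noteq> (0,0) \<longrightarrow> v \<noteq> (0,0) \<longrightarrow> chord u v < e \<longrightarrow> (pt u \<in> A \<longleftrightarrow> pt v \<in> A))"

lemma loc_const_Z:
  assumes "loc_const A" "\<omega> \<in> good"
  shows "\<exists>N. \<forall>k\<ge>N. pt (wp \<omega> k) \<in> A \<longleftrightarrow> Z \<omega> \<in> A"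
proof -
  obtain e where e: "e > 0" "\<And>u v. u \<noteq> (0,0) \<Longrightarrow> v \<noteq> (0,0) \<Longrightarrow> chord u v < e \<Longrightarrow> (pt u \<in> A \<longleftrightarrow> pt v \<in> A)"
    using assms(1) unfolding loc_const_def by blast
  obtain N where "\<forall>k\<ge>N. chord (wp \<omega> k) (Zv \<omega>) < e" using Zv_lim[OF assms(2) e(1)] by blast
  then show ?thesis using e(2)[OF wp_nz Zv_nz] unfolding Z_def by blast
qed

lemma loc_const_bal: "w \<noteq> (0,0) \<Longrightarrow> loc_const (bal w n)"
  unfolding loc_const_def
proof (intro exI[of _ "inverse (real (Suc n))"] conjI allI impI)
  fix u v :: "'k \<times> 'k" assume w: "w \<noteq> (0,0)" and uv: "u \<noteq> (0,0)" "v \<noteq> (0,0)" and c: "chord u v < inverse (real (Suc n))"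
  have "chord v w \<le> max (chord u v) (chord u w)" "chord u w \<le> max (chord u v) (chord v w)"
    using chord_ultra[OF uv(2,1) w] chord_ultra[OF uv w] by (simp_all add: chord_commute)
  then show "pt u \<in> bal w n \<longleftrightarrow> pt v \<in> bal w n"
    using c uv by (auto simp: bal_def delta_pt simp del: pt.simps of_nat_Suc)
qed simp

text \<open>On \<open>good\<close> the limit lies in \<open>clos orb\<close>, so the preimage of an
  open set is a countable union over balls. By \<open>loc_const_bal\<close> each ball event is
  decided by the tail of the approximants, which depend on finitely many increments each.\<close>

lemma measurable_Z: "Z \<in> Om \<rightarrow>\<^sub>M berk_borel absv"
  unfolding berk_borel_def
proof (rule measurable_measure_of[OF open_sub_Pow])
  show "Z \<in> space Om \<rightarrow> P1an absv" by (simp add: Z_def del: pt.simps)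
  fix U assume "U \<in> {U. openin (berk_top absv) U}"
  then have U: "openin (berk_top absv) U" by simp
  define I where "I = {(w,n). w \<in> orb \<and> bal w n \<subseteq> U}"
  have cI: "countable I"
  proof (rule countable_subset)
    show "I \<subseteq> orb \<times> UNIV" by (auto simp: I_def)
    show "countable (orb \<times> (UNIV :: nat set))" using orb_countable by simp
  qed
  define T where "T w n = {\<omega> \<in> space Om. \<exists>N. \<forall>k\<ge>N. pt (wp \<omega> k) \<in> bal w n}" for w n
  have T: "T w n \<in> sets Om" for w n
  proof -
    have "{\<omega> \<in> space Om. pt (wp \<omega> k) \<in> bal w n} \<in> sets Om" for k
    proof -
      have "(\<lambda>\<omega>. pt (wp \<omega> k) \<in> bal w n) \<in> Om \<rightarrow>\<^sub>M count_space UNIV" by (rule wp_measurable) simp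
      from measurable_sets[OF this, of "{True}"] show ?thesis by (simp add: vimage_def del: pt.simps)
    qed
    then show ?thesis unfolding T_def using sets.top[of Om]
      by (intro sets.sets_Collect_countable_Ex sets.sets_Collect_countable_All sets.sets_Collect_imp) auto
  qed
  have TZ: "\<omega> \<in> T w n \<longleftrightarrow> Z \<omega> \<in> bal w n" if w: "w \<in> orb" and g: "\<omega> \<in> good" for w n \<omega>
  proof -
    obtain N where N: "\<forall>k\<ge>N. pt (wp \<omega> k) \<in> bal w n \<longleftrightarrow> Z \<omega> \<in> bal w n"
      using loc_const_Z[OF loc_const_bal[OF orb_nz'[OF w]] g] by blast
    show ?thesis
    proof
      assume "\<omega> \<in> T w n"
      then obtain M where "\<forall>k\<ge>M. pt (wp \<omega> k) \<in> bal w n" by (auto simp: T_def)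
      then show "Z \<omega> \<in> bal w n" using N by (metis linear)
    qed (use N in \<open>auto simp: T_def\<close>)
  qed
  have "Z -` U \<inter> space Om = (good \<inter> (\<Union>i\<in>I. (\<lambda>(w,n). T w n) i)) \<union> (if pt e0 \<in> U then space Om - good else {})"
    (is "?L = ?R")
  proof (rule set_eqI)
    fix \<omega>
    show "\<omega> \<in> ?L \<longleftrightarrow> \<omega> \<in> ?R"
    proof (cases "\<omega> \<in> good")
      case True
      have "Z \<omega> \<in> U \<longleftrightarrow> (\<exists>w n. w \<in> orb \<and> bal w n \<subseteq> U \<and> Z \<omega> \<in> bal w n)"
        using open_trace[OF complete orb_nz U Z_clos[OF True]] by blast
      also have "\<dots> \<longleftrightarrow> (\<exists>w n. w \<in> orb \<and> bal w n \<subseteq> U \<and> \<omega> \<in> T w n)"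
        using TZ[OF _ True] by blast
      also have "\<dots> \<longleftrightarrow> \<omega> \<in> (\<Union>i\<in>I. (\<lambda>(w,n). T w n) i)" unfolding I_def by force
      finally show ?thesis using True by simp
    next
      case False
      then have "Z \<omega> = pt e0" by (simp add: Z_def Zv_def)
      then show ?thesis using False by (simp del: pt.simps)
    qed
  qed
  also have "\<dots> \<in> sets Om"
    using T good_meas cI sets.compl_sets[OF good_meas]
    by (intro sets.Un sets.Int sets.countable_UN') (auto simp del: space_Om pt.simps)
  finally show "Z -` U \<inter> space Om \<in> sets Om" .
qed

definition nu :: "('k poly \<Rightarrow> real) option measure" where
  "nu = distr Om (berk_borel absv) Z"

lemma prob_space_nu: "prob_space nu"
  unfolding nu_def by (rule prob_space.prob_space_distr[OF prob_space_Om measurable_Z])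

lemma sets_nu [measurable_cong]: "sets nu = sets (berk_borel absv)" and space_nu [simp]: "space nu = P1an absv"
  by (simp_all add: nu_def)

lemma AE_nu_clos: "AE x in nu. x \<in> clos orb"
proof -
  have "{x \<in> space (berk_borel absv). x \<in> clos orb} \<in> sets (berk_borel absv)"
    using clos_borel[OF orb_countable] sets.sets_into_space[OF clos_borel[OF orb_countable]]
    by (simp add: Collect_conj_eq inf_absorb2)
  then show ?thesis unfolding nu_def
    by (subst AE_distr_iff[OF measurable_Z]) (use AE_good Z_clos in \<open>auto elim: eventually_mono\<close>)
qed

lemma nu_clos: "emeasure nu (clos orb) = 1"
proof -
  interpret prob_space nu by (rule prob_space_nu)
  show ?thesis using AE_nu_clos clos_borel[OF orb_countable]
    using AE_in_set_eq_1[of "clos orb"] by (simp add: emeasure_eq_measure)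
qed

end

lemma borel_measurable_nn_integral_pmf:
  fixes f :: "'a \<Rightarrow> 'b \<Rightarrow> ennreal"
  assumes "\<And>g. g \<in> set_pmf p \<Longrightarrow> f g \<in> borel_measurable M"
  shows "(\<lambda>x. \<integral>\<^sup>+g. f g x \<partial>measure_pmf p) \<in> borel_measurable M"
proof -
  define q where "q = map_pmf (to_nat_on (set_pmf p)) p"
  define G where "G = from_nat_into (set_pmf p)"
  have p: "p = map_pmf G q" unfolding q_def G_def map_pmf_comp
    by (rule map_pmf_idI[symmetric]) (simp add: countable_set_pmf)
  have G: "f (G i) \<in> borel_measurable M" for i
    unfolding G_def by (rule assms) (rule from_nat_into[OF set_pmf_not_empty])
  have "(\<integral>\<^sup>+g. f g x \<partial>measure_pmf p) = (\<Sum>i. ennreal (pmf q i) * f (G i) x)" for x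
    by (subst p, subst nn_integral_map_pmf) (simp add: nn_integral_measure_pmf nn_integral_count_space_nat)
  then show ?thesis using G by simp
qed

section \<open>Mass of balls under the limit law, uniqueness and stationarity\<close>

context ne_walk
begin

definition LL :: "nat \<Rightarrow> ('k poly \<Rightarrow> real) option set \<Rightarrow> real" where
  "LL n A = measure_pmf.prob (conv_pow \<mu> n) {g. pt (mv g e0) \<in> A}"

text \<open>For a set saturated at some scale the indicators along the approximants are almost
  surely eventually constant, so dominated convergence applies.\<close>

lemma nu_lim:
  assumes A: "A \<in> sets (berk_borel absv)" "loc_const A"
  shows "(\<lambda>k. LL (nk k) A) \<longlonglongrightarrow> measure nu A"
proof -
  interpret prob_space Om by (rule prob_space_Om)
  let ?X = "\<lambda>k. {\<omega>. pt (wp \<omega> k) \<in> A}"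
  have X: "?X k \<in> sets Om" for k
  proof -
    have "(\<lambda>\<omega>. pt (wp \<omega> k) \<in> A) \<in> Om \<rightarrow>\<^sub>M count_space UNIV" by (rule wp_measurable) simp
    from measurable_sets[OF this, of "{True}"] show ?thesis by (simp add: vimage_def del: pt.simps)
  qed
  have ZA: "Z -` A \<inter> space Om \<in> sets Om" by (rule measurable_sets[OF measurable_Z A(1)])
  have LLX: "LL (nk k) A = prob (?X k)" for k
  proof -
    have "ennreal (LL (nk k) A) = (\<integral>\<^sup>+g. indicator {g. pt (mv g e0) \<in> A} g \<partial>measure_pmf (conv_pow \<mu> (nk k)))"
      by (simp add: LL_def measure_pmf.emeasure_eq_measure)
    also have "\<dots> = (\<integral>\<^sup>+\<omega>. indicator {g. pt (mv g e0) \<in> A} (rwalk \<omega> (nk k)) \<partial>Om)"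
      by (rule rwalk_law[symmetric])
    also have "\<dots> = (\<integral>\<^sup>+\<omega>. indicator (?X k) \<omega> \<partial>Om)"
      by (intro nn_integral_cong) (simp add: indicator_def wp_def)
    also have "\<dots> = ennreal (prob (?X k))" using X by (simp add: emeasure_eq_measure)
    finally show ?thesis by (simp add: LL_def)
  qed
  have "(\<lambda>k. \<integral>\<omega>. indicator (?X k) \<omega> \<partial>Om) \<longlonglongrightarrow> (\<integral>\<omega>. indicator (Z -` A \<inter> space Om) \<omega> \<partial>Om :: real)"
  proof (rule integral_dominated_convergence[where w="\<lambda>_. 1"])
    show "AE \<omega> in Om. (\<lambda>k. indicator (?X k) \<omega>) \<longlonglongrightarrow> (indicator (Z -` A \<inter> space Om) \<omega> :: real)"
      using AE_good
    proof eventually_elim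
      case (elim \<omega>)
      obtain N where "\<forall>k\<ge>N. pt (wp \<omega> k) \<in> A \<longleftrightarrow> Z \<omega> \<in> A" using loc_const_Z[OF A(2) elim] by blast
      then have "eventually (\<lambda>k. indicator (?X k) \<omega> = (indicator (Z -` A \<inter> space Om) \<omega> :: real)) sequentially"
        unfolding eventually_sequentially by (intro exI[of _ N]) (simp add: indicator_def)
      then show ?case by (rule tendsto_eventually)
    qed
    show "(\<lambda>\<omega>. indicator (Z -` A \<inter> space Om) \<omega> :: real) \<in> borel_measurable Om" using ZA by (rule borel_measurable_indicator)
    show "(\<lambda>\<omega>. indicator (?X k) \<omega> :: real) \<in> borel_measurable Om" for k using X by (rule borel_measurable_indicator)
  qed (auto simp: indicator_def)
  moreover have "measure nu A = prob (Z -` A \<inter> space Om)"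
    unfolding nu_def by (rule measure_distr[OF measurable_Z A(1)])
  ultimately show ?thesis using X ZA unfolding LLX by simp
qed

text \<open>Contraction brings the image of any starting point close to the image of the base
  vector, and in an ultrametric two points closer than the radius lie in the same balls of that
  radius. The starting point is forgotten, uniformly.\<close>

lemma conv_bal_uniform:
  assumes w: "w \<noteq> (0,0)" and e: "0 < e"
  shows "\<exists>K. \<forall>k\<ge>K. \<forall>x\<in>P1an absv. \<bar>measure_pmf.prob (conv_pow \<mu> (nk k)) {g. berk_act absv g x \<in> bal w m} - measure nu (bal w m)\<bar> < e"
proof -
  have "(\<lambda>k. LL (nk k) (bal w m)) \<longlonglongrightarrow> measure nu (bal w m)"
    by (rule nu_lim[OF bal_borel loc_const_bal[OF w]])
  then have "eventually (\<lambda>k. \<bar>LL (nk k) (bal w m) - measure nu (bal w m)\<bar> < e/2) sequentially"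
    using tendstoD[of _ "measure nu (bal w m)" sequentially "e/2"] e by (simp add: dist_real_def)
  then obtain K1 where K1: "\<And>k. k \<ge> K1 \<Longrightarrow> \<bar>LL (nk k) (bal w m) - measure nu (bal w m)\<bar> < e/2"
    by (auto simp: eventually_sequentially)
  let ?i = "inverse (real (Suc m))"
  have "0 < ?i" "0 < e/3" using e by auto
  from contraction[OF this] obtain n0 where n0: "\<And>n x v. n0 \<le> n \<Longrightarrow> x \<in> P1an absv \<Longrightarrow> v \<noteq> (0,0) \<Longrightarrow>
     measure_pmf.prob (conv_pow \<mu> n) {g. ?i \<le> delta (berk_act absv g x) (mv g v)} \<le> e/3" by blast
  show ?thesis
  proof (intro exI[of _ "max K1 n0"] allI impI ballI)
    fix k x assume k: "max K1 n0 \<le> k" and x: "x \<in> P1an absv"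
    let ?P = "measure_pmf.prob (conv_pow \<mu> (nk k))"
    let ?D = "{g. ?i \<le> delta (berk_act absv g x) (mv g e0)}"
    let ?A = "{g. berk_act absv g x \<in> bal w m}" and ?B = "{g. pt (mv g e0) \<in> bal w m}"
    have nkk: "n0 \<le> nk k" using k nk_ge(2)[of k] by simp
    have D: "?P ?D \<le> e/3" by (rule n0[OF nkk x]) simp
    have same: "g \<in> ?A \<longleftrightarrow> g \<in> ?B" if g: "g \<in> SL2" "g \<notin> ?D" for g
    proof -
      let ?y = "berk_act absv g x"
      have y: "?y \<in> P1an absv" using x by simp
      have nz: "mv g e0 \<noteq> (0,0)" using g(1) by simp
      have d: "delta ?y (mv g e0) < ?i" using g by simp
      have "delta ?y w \<le> max (delta ?y (mv g e0)) (chord (mv g e0) w)" by (rule delta_ultra[OF y nz w])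
      moreover have "chord (mv g e0) w \<le> max (delta ?y (mv g e0)) (delta ?y w)" by (rule chord_le_max_delta[OF y nz w])
      ultimately have "delta ?y w < ?i \<longleftrightarrow> chord (mv g e0) w < ?i" using d by linarith
      then show ?thesis using y nz by (simp add: bal_def delta_pt del: pt.simps)
    qed
    have le: "?P X \<le> ?P Y + ?P ?D" if "\<And>g. g \<in> SL2 \<Longrightarrow> g \<notin> ?D \<Longrightarrow> g \<in> X \<Longrightarrow> g \<in> Y" for X Y
    proof -
      have "?P X = ?P (X \<inter> set_pmf (conv_pow \<mu> (nk k)))" by (simp add: measure_Int_set_pmf)
      also have "\<dots> \<le> ?P (Y \<union> ?D)" using that slN[of "nk k"] by (intro measure_pmf.finite_measure_mono) (blast, simp)
      also have "\<dots> \<le> ?P Y + ?P ?D" by (rule measure_Un_le) auto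
      finally show ?thesis .
    qed
    have "?P ?A \<le> ?P ?B + ?P ?D" "?P ?B \<le> ?P ?A + ?P ?D" using le[of ?A ?B] le[of ?B ?A] same by blast+
    then have "\<bar>?P ?A - LL (nk k) (bal w m)\<bar> \<le> e/3" using D unfolding LL_def by linarith
    then show "\<bar>?P ?A - measure nu (bal w m)\<bar> < e" using K1[of k] k e by linarith
  qed
qed

lemma conv_bal:
  assumes "w \<noteq> (0,0)" "x \<in> P1an absv"
  shows "(\<lambda>k. measure_pmf.prob (conv_pow \<mu> (nk k)) {g. berk_act absv g x \<in> bal w m}) \<longlonglongrightarrow> measure nu (bal w m)"
  using conv_bal_uniform[OF assms(1)] assms(2) by (intro LIMSEQ_I) (metis real_norm_def)

text \<open>\<open>nonconcentration\<close> is uniform in the centre of the ball and survives the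
  limit. Beyond atoms, this uniformity drives the estimates of the exponent.\<close>

lemma nu_unif_nonatomic:
  assumes c: "0 < c"
  shows "\<exists>m. \<forall>w. w \<noteq> (0,0) \<longrightarrow> measure nu (bal w m) \<le> c"
proof -
  from nonconcentration[OF sl point_spread c] obtain n0 \<epsilon> where e: "0 < \<epsilon>" and
    n0: "\<forall>n v w. n0 \<le> n \<longrightarrow> v \<noteq> (0,0) \<longrightarrow> w \<noteq> (0,0) \<longrightarrow>
     measure_pmf.prob (conv_pow \<mu> n) {g. chord (mv g v) w < \<epsilon>} \<le> c" by blast
  obtain m where m: "inverse (real (Suc m)) < \<epsilon>" using reals_Archimedean e by blast
  show ?thesis
  proof (intro exI[of _ m] allI impI)
    fix w :: "'k \<times> 'k" assume w: "w \<noteq> (0,0)"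
    have "(\<lambda>k. LL (nk k) (bal w m)) \<longlonglongrightarrow> measure nu (bal w m)"
      by (rule nu_lim[OF bal_borel loc_const_bal[OF w]])
    moreover have "LL (nk k) (bal w m) \<le> c" if k: "n0 \<le> k" for k
    proof -
      let ?P = "measure_pmf.prob (conv_pow \<mu> (nk k))"
      have "LL (nk k) (bal w m) = ?P ({g. pt (mv g e0) \<in> bal w m} \<inter> set_pmf (conv_pow \<mu> (nk k)))"
        by (simp add: LL_def measure_Int_set_pmf del: pt.simps)
      also have "\<dots> \<le> ?P {g. chord (mv g e0) w < \<epsilon>}"
      proof (rule measure_pmf.finite_measure_mono)
        show "{g. pt (mv g e0) \<in> bal w m} \<inter> set_pmf (conv_pow \<mu> (nk k)) \<subseteq> {g. chord (mv g e0) w < \<epsilon>}"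
        proof
          fix g assume g: "g \<in> {g. pt (mv g e0) \<in> bal w m} \<inter> set_pmf (conv_pow \<mu> (nk k))"
          then have "g \<in> SL2" using slN by blast
          then have "mv g e0 \<noteq> (0,0)" by simp
          then show "g \<in> {g. chord (mv g e0) w < \<epsilon>}" using g m by (simp add: bal_def delta_pt del: pt.simps)
        qed
      qed simp
      also have "\<dots> \<le> c" by (rule n0[rule_format]) (use nk_ge(2)[of k] k w in auto)
      finally show ?thesis .
    qed
    ultimately show "measure nu (bal w m) \<le> c"
      by (intro LIMSEQ_le_const2) auto
  qed
qed

lemma pt_in_bal: "w \<noteq> (0,0) \<Longrightarrow> pt w \<in> bal w m"
  by (simp add: bal_def delta_pt del: pt.simps)

lemma nu_clos_compl: "P1an absv - clos orb \<in> null_sets nu"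
proof -
  interpret prob_space nu by (rule prob_space_nu)
  have "clos orb \<in> sets nu" using clos_borel[OF orb_countable] sets_nu by simp
  from sets.compl_sets[OF this] emeasure_compl[OF this] show ?thesis
    using nu_clos emeasure_space_1 by (simp add: null_sets_def)
qed

lemma nu_no_atom: "emeasure nu {x} = 0"
proof -
  interpret prob_space nu by (rule prob_space_nu)
  show ?thesis
  proof (cases "x \<in> clos orb")
    case True
    then obtain w where w: "w \<noteq> (0,0)" "x = pt w" using clos_P1k[OF complete orb_nz] by blast
    have "prob {x} \<le> 0 + c" if c: "0 < c" for c
    proof -
      obtain m where m: "prob (bal w m) \<le> c" using nu_unif_nonatomic[OF c] w by blast
      have "prob {x} \<le> prob (bal w m)"
        using pt_in_bal[OF w(1), of m] w(2) by (intro finite_measure_mono) (auto simp: sets_nu simp del: pt.simps)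
      then show ?thesis using m by simp
    qed
    then have "prob {x} \<le> 0" by (rule field_le_epsilon)
    then have "prob {x} = 0" by (simp add: antisym)
    then have "emeasure nu {x} = 0" by (simp add: emeasure_eq_measure)
    then show ?thesis by simp
  next
    case False
    have "emeasure nu {x} \<le> emeasure nu (P1an absv - clos orb)" if "x \<in> space nu"
      using False that nu_clos_compl by (intro emeasure_mono) (auto simp: null_sets_def)
    moreover have "emeasure nu (P1an absv - clos orb) = 0" using nu_clos_compl by auto
    moreover have "emeasure nu {x} = 0" if "x \<notin> space nu"
      using that sets.sets_into_space[of "{x}" nu] by (intro emeasure_notin_sets) auto
    ultimately show ?thesis by (cases "x \<in> space nu") auto
  qed
qed

lemma nu_P1k: "AE v in nu. v \<in> P1k absv"
  using AE_nu_clos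
proof eventually_elim
  case (elim x)
  then show ?case using clos_P1k[OF complete orb_nz elim] pt_P1k by blast
qed

text \<open>Stationarity iterated \<open>nk k\<close> times writes the \<nu>-mass of a ball as a
  mean over starting points, which tends to its \<open>nu\<close>-mass by \<open>conv_bal\<close>.
  That \<nu> is carried by \<open>clos orb\<close> must be proved: contraction puts the image of any
  Berkovich point within \<open>1/(m+1)\<close> of \<open>orb\<close> with probability close to
  1.\<close>

lemma stationary_unique:
  assumes st: "stationary absv \<mu> \<nu>"
  shows "\<nu> = nu"
proof (rule measure_eqI_bal[OF complete orb_countable orb_nz])
  have sets: "sets \<nu> = sets (berk_borel absv)" and sp: "space \<nu> = P1an absv" and ps: "prob_space \<nu>"
    using st by (auto simp: stationary_def)
  interpret N: prob_space \<nu> by (rule ps)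
  interpret U: prob_space nu by (rule prob_space_nu)
  show "prob_space \<nu>" by (rule ps)
  show "sets \<nu> = sets (berk_borel absv)" by (rule sets)
  show "prob_space nu" by (rule prob_space_nu)
  show "sets nu = sets (berk_borel absv)" by (rule sets_nu)
  show "emeasure nu (clos orb) = 1" by (rule nu_clos)
  have meas: "(\<lambda>x. measure_pmf.prob (conv_pow \<mu> n) {g. berk_act absv g x \<in> B}) \<in> borel_measurable \<nu>"
    if B: "B \<in> sets (berk_borel absv)" for n B
  proof -
    have "(\<lambda>x. \<integral>\<^sup>+g. indicator B (berk_act absv g x) \<partial>measure_pmf (conv_pow \<mu> n)) \<in> borel_measurable \<nu>"
    proof -
      have "(\<lambda>x. indicator B (berk_act absv g x) :: ennreal) \<in> borel_measurable \<nu>" for g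
      proof -
        have "(\<lambda>x. indicator B (berk_act absv g x) :: ennreal) \<in> borel_measurable (berk_borel absv)"
          using B by measurable
        then show ?thesis using measurable_cong_sets[OF sets refl] by blast
      qed
      then show ?thesis by (rule borel_measurable_nn_integral_pmf)
    qed
    then have "(\<lambda>x. enn2real (\<integral>\<^sup>+g. indicator B (berk_act absv g x) \<partial>measure_pmf (conv_pow \<mu> n))) \<in> borel_measurable \<nu>"
      by (rule borel_measurable_enn2real)
    moreover have "enn2real (\<integral>\<^sup>+g. indicator B (berk_act absv g x) \<partial>measure_pmf (conv_pow \<mu> n))
       = measure_pmf.prob (conv_pow \<mu> n) {g. berk_act absv g x \<in> B}" for x
    proof -
      have "(\<integral>\<^sup>+g. indicator B (berk_act absv g x) \<partial>measure_pmf (conv_pow \<mu> n))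
         = (\<integral>\<^sup>+g. indicator {g. berk_act absv g x \<in> B} g \<partial>measure_pmf (conv_pow \<mu> n))"
        by (rule nn_integral_cong) (simp add: indicator_def)
      then show ?thesis by (simp add: measure_pmf.emeasure_eq_measure)
    qed
    ultimately show ?thesis by simp
  qed
  have iter: "measure \<nu> B = (\<integral>x. measure_pmf.prob (conv_pow \<mu> n) {g. berk_act absv g x \<in> B} \<partial>\<nu>)"
    if B: "B \<in> sets (berk_borel absv)" "bnorm_set B" for n B
  proof -
    have "ennreal (measure \<nu> B) = (\<integral>\<^sup>+x. ennreal (measure_pmf.prob (conv_pow \<mu> n) {g. berk_act absv g x \<in> B}) \<partial>\<nu>)"
      using stationary_iterate[OF st B, of n] by (simp add: N.emeasure_eq_measure measure_pmf.emeasure_eq_measure)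
    also have "\<dots> = ennreal (\<integral>x. measure_pmf.prob (conv_pow \<mu> n) {g. berk_act absv g x \<in> B} \<partial>\<nu>)"
      by (intro nn_integral_eq_integral N.integrable_const_bound[where B=1] meas B) auto
    finally show ?thesis by (simp add: integral_nonneg_AE)
  qed
  show "emeasure \<nu> (bal w m) = emeasure nu (bal w m)" if "w \<in> orb" for w m
  proof -
    have w: "w \<noteq> (0,0)" by (rule orb_nz'[OF that])
    have "(\<lambda>k. \<integral>x. measure_pmf.prob (conv_pow \<mu> (nk k)) {g. berk_act absv g x \<in> bal w m} \<partial>\<nu>)
       \<longlonglongrightarrow> (\<integral>x. measure nu (bal w m) \<partial>\<nu>)"
      by (rule integral_dominated_convergence[where w="\<lambda>_. 1"])
         (use meas[OF bal_borel] conv_bal[OF w] sp in auto)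
    then have "(\<lambda>k. measure \<nu> (bal w m)) \<longlonglongrightarrow> measure nu (bal w m)"
      unfolding iter[OF bal_borel bnorm_set_bal, symmetric] by (simp add: N.prob_space)
    then have "measure \<nu> (bal w m) = measure nu (bal w m)" by (simp add: LIMSEQ_const_iff)
    then show ?thesis by (simp add: N.emeasure_eq_measure U.emeasure_eq_measure)
  qed
  have "AE x in \<nu>. x \<in> (\<Union>w\<in>orb. bal w m)" for m
  proof -
    let ?B = "\<Union>w\<in>orb. bal w m"
    have B: "?B \<in> sets (berk_borel absv)" using orb_countable by (intro sets.countable_UN') auto
    have Bn: "bnorm_set ?B" by (intro bnorm_set_UN bnorm_set_bal)
    have "1 - c \<le> measure \<nu> ?B" if c: "0 < c" for c
    proof -
      have "0 < inverse (real (Suc m))" by simp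
      from contraction[OF this c] obtain n0 where n0: "\<And>n x v. n0 \<le> n \<Longrightarrow> x \<in> P1an absv \<Longrightarrow> v \<noteq> (0,0) \<Longrightarrow>
        measure_pmf.prob (conv_pow \<mu> n) {g. inverse (real (Suc m)) \<le> delta (berk_act absv g x) (mv g v)} \<le> c" by blast
      have ge: "1 - c \<le> measure_pmf.prob (conv_pow \<mu> n0) {g. berk_act absv g x \<in> ?B}" if x: "x \<in> P1an absv" for x
      proof -
        let ?P = "measure_pmf.prob (conv_pow \<mu> n0)"
        let ?D = "{g. inverse (real (Suc m)) \<le> delta (berk_act absv g x) (mv g e0)}"
        have "?P (- ?D) = 1 - ?P ?D" using measure_pmf.prob_compl[of ?D "conv_pow \<mu> n0"] by (simp add: Compl_eq_Diff_UNIV)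
        moreover have "?P ?D \<le> c" by (rule n0) (use x in auto)
        moreover have "?P (- ?D) \<le> ?P {g. berk_act absv g x \<in> ?B}"
        proof -
          have "?P (- ?D) = ?P (- ?D \<inter> set_pmf (conv_pow \<mu> n0))" by (simp add: measure_Int_set_pmf)
          also have "\<dots> \<le> ?P {g. berk_act absv g x \<in> ?B}"
          proof (rule measure_pmf.finite_measure_mono)
            show "- ?D \<inter> set_pmf (conv_pow \<mu> n0) \<subseteq> {g. berk_act absv g x \<in> ?B}"
            proof
              fix g assume g: "g \<in> - ?D \<inter> set_pmf (conv_pow \<mu> n0)"
              then have "mv g e0 \<in> orb" unfolding orb_def semi_def by blast
              moreover have "berk_act absv g x \<in> bal (mv g e0) m" using g x by (simp add: bal_def not_le)
              ultimately show "g \<in> {g. berk_act absv g x \<in> ?B}" by blast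
            qed
          qed simp
          finally show ?thesis .
        qed
        ultimately show ?thesis by linarith
      qed
      have "(\<integral>x. 1 - c \<partial>\<nu>) \<le> (\<integral>x. measure_pmf.prob (conv_pow \<mu> n0) {g. berk_act absv g x \<in> ?B} \<partial>\<nu>)"
      proof (rule integral_mono)
        show "integrable \<nu> (\<lambda>x. measure_pmf.prob (conv_pow \<mu> n0) {g. berk_act absv g x \<in> ?B})"
          by (intro N.integrable_const_bound[where B=1] meas B) auto
      qed (use ge sp in auto)
      then show ?thesis unfolding iter[OF B Bn, of n0, symmetric] by (simp add: N.prob_space)
    qed
    then have "1 \<le> measure \<nu> ?B" by (meson field_le_epsilon le_diff_eq diff_le_eq)
    then have "measure \<nu> ?B = 1" using N.prob_le_1 by (simp add: antisym)
    then show ?thesis using B sets by (subst N.AE_in_set_eq_1) auto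
  qed
  then have "AE x in \<nu>. \<forall>m. x \<in> (\<Union>w\<in>orb. bal w m)" by (simp add: AE_all_countable)
  then have "AE x in \<nu>. x \<in> clos orb"
    using AE_space by eventually_elim (auto simp: clos_eq sp)
  then show "emeasure \<nu> (clos orb) = 1"
    using N.AE_in_set_eq_1[of "clos orb"] clos_borel[OF orb_countable] sets by (simp add: N.emeasure_eq_measure)
qed

text \<open>Makes \<open>nu_lim\<close> applicable to the preimage of a ball under one increment;
  the scale loses the Lipschitz constant of \<open>g\<close>.\<close>

lemma loc_const_act:
  assumes g: "g \<in> SL2" and w: "w \<noteq> (0,0)"
  shows "loc_const (berk_act absv g -` bal w m \<inter> P1an absv)"
proof -
  obtain e where e: "e > 0" "\<And>u v. u \<noteq> (0,0) \<Longrightarrow> v \<noteq> (0,0) \<Longrightarrow> chord u v < e \<Longrightarrow> (pt u \<in> bal w m \<longleftrightarrow> pt v \<in> bal w m)"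
    using loc_const_bal[OF w, of m] unfolding loc_const_def by blast
  have n: "0 < (mat2_norm absv g)\<^sup>2" using norm_ge_1[OF g] by simp
  show ?thesis unfolding loc_const_def
  proof (intro exI[of _ "e / (mat2_norm absv g)\<^sup>2"] conjI allI impI)
    show "0 < e / (mat2_norm absv g)\<^sup>2" using e n by simp
    fix u v :: "'k \<times> 'k" assume uv: "u \<noteq> (0,0)" "v \<noteq> (0,0)" and c: "chord u v < e / (mat2_norm absv g)\<^sup>2"
    have "chord (mv g u) (mv g v) \<le> (mat2_norm absv g)\<^sup>2 * chord u v" by (rule chord_mv_le[OF g])
    also have "\<dots> < e" using c n by (simp add: pos_less_divide_eq mult.commute)
    finally have "pt (mv g u) \<in> bal w m \<longleftrightarrow> pt (mv g v) \<in> bal w m" using e(2) g uv by simp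
    moreover have "berk_act absv g (pt u) = pt (mv g u)" "berk_act absv g (pt v) = pt (mv g v)"
      using berk_act_pt[OF g] uv by blast+
    ultimately show "pt u \<in> berk_act absv g -` bal w m \<inter> P1an absv \<longleftrightarrow> pt v \<in> berk_act absv g -` bal w m \<inter> P1an absv"
      by (simp del: pt.simps)
  qed
qed

lemma act_clos:
  assumes g: "g \<in> semi" and x: "x \<in> clos orb"
  shows "berk_act absv g x \<in> clos orb"
proof -
  have gs: "g \<in> SL2" by (rule semi_SL2[OF g])
  obtain v where v: "v \<noteq> (0,0)" "x = pt v" using clos_P1k[OF complete orb_nz x] by blast
  have act: "berk_act absv g x = pt (mv g v)" unfolding v(2) by (rule berk_act_pt[OF gs v(1)])
  have gv: "mv g v \<noteq> (0,0)" using gs v by simp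
  have n: "1 \<le> (mat2_norm absv g)\<^sup>2" using norm_ge_1[OF gs] by simp
  have "\<exists>w\<in>orb. pt (mv g v) \<in> bal w m" for m
  proof -
    have "0 < inverse (real (Suc m)) / (mat2_norm absv g)\<^sup>2"
      by (intro divide_pos_pos less_le_trans[OF zero_less_one n]) simp
    then obtain j where j: "inverse (real (Suc j)) < inverse (real (Suc m)) / (mat2_norm absv g)\<^sup>2"
      using reals_Archimedean by blast
    obtain w where w: "w \<in> orb" "x \<in> bal w j" using x unfolding clos_def by blast
    have cw: "chord v w < inverse (real (Suc m)) / (mat2_norm absv g)\<^sup>2"
      using w(2) j v by (simp add: bal_def delta_pt del: pt.simps of_nat_Suc)
    have "chord (mv g v) (mv g w) \<le> (mat2_norm absv g)\<^sup>2 * chord v w" by (rule chord_mv_le[OF gs])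
    also have "\<dots> < inverse (real (Suc m))" 
      using cw less_le_trans[OF zero_less_one n] by (simp add: pos_less_divide_eq mult.commute del: of_nat_Suc)
    finally have "pt (mv g v) \<in> bal (mv g w) m" using gv by (simp add: bal_def delta_pt del: pt.simps of_nat_Suc)
    moreover have "mv g w \<in> orb"
    proof -
      obtain t where t: "t \<in> semi" "w = mv t e0" using w(1) unfolding orb_def by blast
      then have "mv g w = mv (mat2_mult g t) e0" by (simp add: mv_mult)
      then show ?thesis unfolding orb_def using semi_mult[OF g t(1)] by blast
    qed
    ultimately show ?thesis by blast
  qed
  then show ?thesis unfolding act clos_def by (simp del: pt.simps)
qed

text \<open>On a ball, the mean over \<open>g\<close> of the \<open>nu\<close>-mass of its preimages
  and its \<open>nu\<close>-mass are limits of the same probabilities for \<open>nk k + 1\<close>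
  steps, with the extra increment split off on the left or on the right. The form with bind serves
  to integrate functions.\<close>

lemma nu_stationary: "stationary absv \<mu> nu"
  and nu_bind: "measure_pmf \<mu> \<bind> (\<lambda>g. distr nu (berk_borel absv) (berk_act absv g)) = nu"
proof -
  interpret U: prob_space nu by (rule prob_space_nu)
  have act_sets: "berk_act absv g -` A \<inter> P1an absv \<in> sets (berk_borel absv)" if "A \<in> sets (berk_borel absv)" for g A
    using measurable_sets[OF measurable_berk_act[of g] that] by simp
  have act_nu: "berk_act absv g \<in> nu \<rightarrow>\<^sub>M berk_borel absv" for g
    using measurable_berk_act measurable_cong_sets[OF sets_nu refl] by blast
  define \<nu>2 where "\<nu>2 = measure_pmf \<mu> \<bind> (\<lambda>g. distr nu (berk_borel absv) (berk_act absv g))"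
  have ps: "prob_space (distr nu (berk_borel absv) (berk_act absv g))" for g
    by (rule U.prob_space_distr[OF act_nu])
  have K: "(\<lambda>g. distr nu (berk_borel absv) (berk_act absv g)) \<in> measure_pmf \<mu> \<rightarrow>\<^sub>M subprob_algebra (berk_borel absv)"
    using ps by (auto simp: space_subprob_algebra prob_space_imp_subprob_space)
  have s2: "sets \<nu>2 = sets (berk_borel absv)" unfolding \<nu>2_def by (rule sets_bind[OF sets_kernel[OF K]]) auto
  have e2: "emeasure \<nu>2 A = (\<integral>\<^sup>+g. emeasure nu (berk_act absv g -` A \<inter> P1an absv) \<partial>measure_pmf \<mu>)"
    if A: "A \<in> sets (berk_borel absv)" for A
    unfolding \<nu>2_def using A act_nu by (subst emeasure_bind[OF _ K A]) (auto simp: emeasure_distr)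
  have "\<nu>2 = nu"
  proof (rule measure_eqI_bal[OF complete orb_countable orb_nz])
    show "prob_space \<nu>2"
    proof
      have "space \<nu>2 = P1an absv" using sets_eq_imp_space_eq[OF s2] by simp
      moreover have "P1an absv \<in> sets (berk_borel absv)" using sets.top[of "berk_borel absv"] by simp
      moreover have "berk_act absv g -` P1an absv \<inter> P1an absv = P1an absv" for g by auto
      ultimately show "emeasure \<nu>2 (space \<nu>2) = 1" using U.emeasure_space_1 by (simp add: e2)
    qed
    show "sets \<nu>2 = sets (berk_borel absv)" by (rule s2)
    show "prob_space nu" by (rule prob_space_nu)
    show "sets nu = sets (berk_borel absv)" by (rule sets_nu)
    show "emeasure nu (clos orb) = 1" by (rule nu_clos)
    have "emeasure nu (berk_act absv g -` clos orb \<inter> P1an absv) = 1" if g: "g \<in> set_pmf \<mu>" for g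
    proof -
      have "AE x in nu. x \<in> berk_act absv g -` clos orb \<inter> P1an absv"
        using AE_nu_clos AE_space by eventually_elim (use act_clos[OF subsetD[OF supp_semi g]] in auto)
      moreover have "berk_act absv g -` clos orb \<inter> P1an absv \<in> sets nu"
        using act_sets[OF clos_borel[OF orb_countable]] sets_nu by simp
      ultimately have "U.prob (berk_act absv g -` clos orb \<inter> P1an absv) = 1" using U.AE_in_set_eq_1 by blast
      then show ?thesis by (simp add: U.emeasure_eq_measure)
    qed
    then have "(\<integral>\<^sup>+g. emeasure nu (berk_act absv g -` clos orb \<inter> P1an absv) \<partial>measure_pmf \<mu>) = (\<integral>\<^sup>+g. 1 \<partial>measure_pmf \<mu>)"
      by (intro nn_integral_cong_AE) (simp add: AE_measure_pmf_iff)
    then show "emeasure \<nu>2 (clos orb) = 1" unfolding e2[OF clos_borel[OF orb_countable]] by simp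
  next
    fix w m assume "w \<in> orb"
    then have w: "w \<noteq> (0,0)" by (rule orb_nz')
    let ?B = "\<lambda>g. berk_act absv g -` bal w m \<inter> P1an absv"
    have "(\<lambda>k. \<integral>g. LL (nk k) (?B g) \<partial>measure_pmf \<mu>) \<longlonglongrightarrow> (\<integral>g. measure nu (?B g) \<partial>measure_pmf \<mu>)"
    proof (rule integral_dominated_convergence[where w="\<lambda>_. 1"])
      show "AE g in measure_pmf \<mu>. (\<lambda>k. LL (nk k) (?B g)) \<longlonglongrightarrow> measure nu (?B g)"
        unfolding AE_measure_pmf_iff
        using sl by (intro ballI nu_lim act_sets bal_borel loc_const_act[OF _ w]) blast
    qed (auto simp: LL_def)
    moreover have "(\<lambda>k. \<integral>g. LL (nk k) (?B g) \<partial>measure_pmf \<mu>) \<longlonglongrightarrow> measure nu (bal w m)"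
    proof (rule LIMSEQ_I)
      fix e :: real assume "0 < e"
      then have "0 < e/2" by simp
      from conv_bal_uniform[OF w this, of m] obtain K where K: "\<And>k x. k \<ge> K \<Longrightarrow> x \<in> P1an absv \<Longrightarrow>
        \<bar>measure_pmf.prob (conv_pow \<mu> (nk k)) {g. berk_act absv g x \<in> bal w m} - measure nu (bal w m)\<bar> < e/2" by blast
      have "norm ((\<integral>g. LL (nk k) (?B g) \<partial>measure_pmf \<mu>) - measure nu (bal w m)) < e" if k: "k \<ge> K" for k
      proof -
        let ?Q = "\<lambda>h. measure_pmf.prob (conv_pow \<mu> (nk k)) {g. berk_act absv g (pt (mv h e0)) \<in> bal w m}"
        have cong: "measure_pmf.prob p A = measure_pmf.prob p B" if "\<And>g. g \<in> set_pmf p \<Longrightarrow> g \<in> A \<longleftrightarrow> g \<in> B" for p :: "'k mat2 pmf" and A B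
        proof -
          have "A \<inter> set_pmf p = B \<inter> set_pmf p" using that by blast
          then show ?thesis by (metis measure_Int_set_pmf)
        qed
        have LLg: "LL (nk k) (?B g) = measure_pmf.prob (conv_pow \<mu> (nk k)) {h. pt (mv (mat2_mult g h) e0) \<in> bal w m}"
          if g: "g \<in> set_pmf \<mu>" for g
          unfolding LL_def
        proof (rule cong)
          fix h assume "h \<in> set_pmf (conv_pow \<mu> (nk k))"
          then have h: "h \<in> SL2" using slN by blast
          have gs: "g \<in> SL2" using g sl by blast
          have "berk_act absv g (pt (mv h e0)) = pt (mv g (mv h e0))" by (rule berk_act_pt[OF gs]) (use h in simp)
          then show "h \<in> {g'. pt (mv g' e0) \<in> ?B g} \<longleftrightarrow> h \<in> {h. pt (mv (mat2_mult g h) e0) \<in> bal w m}"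
            by (simp add: mv_mult del: pt.simps)
        qed
        \<comment> \<open>Here the extra increment acts last; after
          \<open>prob_conv_pow_right\<close> it acts first and only changes the starting point, to
          which the bound with \<open>K\<close> is insensitive.\<close>
        have "(\<integral>g. LL (nk k) (?B g) \<partial>measure_pmf \<mu>)
           = (\<integral>g. measure_pmf.prob (conv_pow \<mu> (nk k)) {h. mat2_mult g h \<in> {h. pt (mv h e0) \<in> bal w m}} \<partial>measure_pmf (conv_pow \<mu> (Suc 0)))"
          unfolding conv_pow_1 by (intro integral_cong_AE) (simp_all add: AE_measure_pmf_iff LLg del: pt.simps)
        also have "\<dots> = measure_pmf.prob (conv_pow \<mu> (nk k + Suc 0)) {h. pt (mv h e0) \<in> bal w m}"
          by (rule prob_conv_pow_left[symmetric])
        also have "\<dots> = measure_pmf.expectation (conv_pow \<mu> (Suc 0)) (\<lambda>h. measure_pmf.prob (conv_pow \<mu> (nk k)) {g. mat2_mult g h \<in> {h. pt (mv h e0) \<in> bal w m}})"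
          unfolding add.commute[of "nk k"] by (rule prob_conv_pow_right)
        also have "\<dots> = measure_pmf.expectation \<mu> ?Q"
          unfolding conv_pow_1
        proof (intro integral_cong_AE, simp, simp, unfold AE_measure_pmf_iff, intro ballI cong)
          fix h g assume "h \<in> set_pmf \<mu>" "g \<in> set_pmf (conv_pow \<mu> (nk k))"
          then have hg: "h \<in> SL2" "g \<in> SL2" using slN sl by blast+
          have "berk_act absv g (pt (mv h e0)) = pt (mv g (mv h e0))" by (rule berk_act_pt[OF hg(2)]) (use hg in simp)
          then show "g \<in> {g. mat2_mult g h \<in> {h. pt (mv h e0) \<in> bal w m}} \<longleftrightarrow> g \<in> {g. berk_act absv g (pt (mv h e0)) \<in> bal w m}"
            by (simp add: mv_mult del: pt.simps)
        qed
        finally have eq: "(\<integral>g. LL (nk k) (?B g) \<partial>measure_pmf \<mu>) = measure_pmf.expectation \<mu> ?Q" .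
        have Qi: "integrable (measure_pmf \<mu>) ?Q" by (rule measure_pmf.integrable_const_bound[where B=1]) auto
        have Qb: "\<bar>?Q h - measure nu (bal w m)\<bar> < e/2" for h by (rule K[OF k]) simp
        have "?Q h \<le> measure nu (bal w m) + e/2" "measure nu (bal w m) - e/2 \<le> ?Q h" for h
          using Qb[of h] by linarith+
        then have "measure_pmf.expectation \<mu> ?Q \<le> measure nu (bal w m) + e/2"
          "measure nu (bal w m) - e/2 \<le> measure_pmf.expectation \<mu> ?Q"
          using Qi by (auto intro!: measure_pmf.integral_le_const measure_pmf.integral_ge_const simp del: pt.simps)
        then show ?thesis unfolding eq using \<open>0 < e\<close> by (simp add: abs_less_iff del: pt.simps)
      qed
      then show "\<exists>no. \<forall>k\<ge>no. norm ((\<integral>g. LL (nk k) (?B g) \<partial>measure_pmf \<mu>) - measure nu (bal w m)) < e" by blast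
    qed
    ultimately have "(\<integral>g. measure nu (?B g) \<partial>measure_pmf \<mu>) = measure nu (bal w m)" by (rule LIMSEQ_unique)
    moreover have "emeasure \<nu>2 (bal w m) = ennreal (\<integral>g. measure nu (?B g) \<partial>measure_pmf \<mu>)"
      unfolding e2[OF bal_borel] U.emeasure_eq_measure
      by (intro nn_integral_eq_integral measure_pmf.integrable_const_bound[where B=1]) auto
    ultimately show "emeasure \<nu>2 (bal w m) = emeasure nu (bal w m)" by (simp add: U.emeasure_eq_measure)
  qed
  then show "stationary absv \<mu> nu"
    using prob_space_nu e2 unfolding stationary_def by (simp add: sets_nu)
  show "measure_pmf \<mu> \<bind> (\<lambda>g. distr nu (berk_borel absv) (berk_act absv g)) = nu"
    using \<open>\<nu>2 = nu\<close> unfolding \<nu>2_def .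
qed

text \<open>A walk started in a closed invariant set \<open>L\<close> never enters a ball that
  misses \<open>L\<close>, so by \<open>conv_bal\<close> such a ball is null. The limit set
  intersects possibly uncountably many \<open>L\<close>, but on \<open>clos orb\<close> countably
  many such balls cover its complement.\<close>

lemma nu_limit_set: "emeasure nu (P1an absv - limit_set absv (gen_group (set_pmf \<mu>))) = 0"
proof -
  let ?\<L> = "{L. L \<noteq> {} \<and> closedin (berk_top absv) L \<and> (\<forall>g\<in>gen_group (set_pmf \<mu>). berk_act absv g ` L \<subseteq> L)}"
  interpret U: prob_space nu by (rule prob_space_nu)
  define I where "I = {(w,m). w \<in> orb \<and> (\<exists>L\<in>?\<L>. bal w m \<inter> L = {})}"
  have cI: "countable I"
  proof (rule countable_subset)
    show "I \<subseteq> orb \<times> UNIV" by (auto simp: I_def)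
    show "countable (orb \<times> (UNIV :: nat set))" using orb_countable by simp
  qed
  have null: "(\<lambda>(w,m). bal w m) i \<in> null_sets nu" if iI: "i \<in> I" for i
  proof -
    obtain w m L where wm: "i = (w,m)" "w \<in> orb" "L \<in> ?\<L>" "bal w m \<inter> L = {}" using iI unfolding I_def by blast
    then obtain x where x: "x \<in> L" by blast
    have "L \<subseteq> P1an absv" using wm(3) closedin_subset[of "berk_top absv" L] topspace_berk by blast
    then have xP: "x \<in> P1an absv" using x by blast
    have "measure_pmf.prob (conv_pow \<mu> n) {g. berk_act absv g x \<in> bal w m} = 0" for n
    proof -
      have "berk_act absv g x \<in> L" if "g \<in> set_pmf (conv_pow \<mu> n)" for g
        using that semi_gen_group wm(3) x by blast
      then have "{g. berk_act absv g x \<in> bal w m} \<inter> set_pmf (conv_pow \<mu> n) = {}" using wm(4) by blast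
      then show ?thesis by (metis measure_Int_set_pmf measure_empty)
    qed
    then have "(\<lambda>k. 0) \<longlonglongrightarrow> measure nu (bal w m)" using conv_bal[OF orb_nz'[OF wm(2)] xP, of m] by simp
    then have "measure nu (bal w m) = 0" by (simp add: LIMSEQ_const_iff)
    then show ?thesis using wm(1) bal_borel by (simp add: null_sets_def U.emeasure_eq_measure sets_nu)
  qed
  have "(\<Union>i\<in>I. (\<lambda>(w,m). bal w m) i) \<in> null_sets nu" by (rule null_sets_UN'[OF cI null])
  moreover have "P1an absv - clos orb \<in> null_sets nu" by (rule nu_clos_compl)
  ultimately have N: "(\<Union>i\<in>I. (\<lambda>(w,m). bal w m) i) \<union> (P1an absv - clos orb) \<in> null_sets nu" by (rule null_sets.Un)
  have sub: "P1an absv - limit_set absv (gen_group (set_pmf \<mu>)) \<subseteq> (\<Union>i\<in>I. (\<lambda>(w,m). bal w m) i) \<union> (P1an absv - clos orb)"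
  proof
    fix x assume x: "x \<in> P1an absv - limit_set absv (gen_group (set_pmf \<mu>))"
    show "x \<in> (\<Union>i\<in>I. (\<lambda>(w,m). bal w m) i) \<union> (P1an absv - clos orb)"
    proof (cases "x \<in> clos orb")
      case True
      obtain L where L: "L \<in> ?\<L>" "x \<notin> L" using x unfolding limit_set_def by blast
      then have op: "openin (berk_top absv) (P1an absv - L)" unfolding topspace_berk[symmetric] by (simp add: closedin_def)
      have "x \<in> P1an absv - L" using x L(2) by blast
      from open_trace[OF complete orb_nz op True this]
      obtain w m where wm: "w \<in> orb" "x \<in> bal w m" "bal w m \<subseteq> P1an absv - L" by metis
      then have "bal w m \<inter> L = {}" by blast
      then have "\<exists>L\<in>?\<L>. bal w m \<inter> L = {}" by (rule bexI[OF _ L(1)])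
      then have "(w,m) \<in> I" unfolding I_def by (intro CollectI case_prodI conjI wm(1))
      then show ?thesis using wm(2) by (intro UnI1 UN_I[of "(w,m)"]) auto
    qed (use x in blast)
  qed
  have "emeasure nu (P1an absv - limit_set absv (gen_group (set_pmf \<mu>)))
     \<le> emeasure nu ((\<Union>i\<in>I. (\<lambda>(w,m). bal w m) i) \<union> (P1an absv - clos orb))"
    using sub null_setsD2[OF N] by (rule emeasure_mono)
  then show ?thesis using null_setsD1[OF N] by simp
qed

end

section \<open>From mean to almost everywhere convergence of ergodic averages\<close>

lemma integral_measure_preserving:
  fixes f :: "'a \<Rightarrow> real"
  assumes "T \<in> M \<rightarrow>\<^sub>M M" "distr M M T = M" "f \<in> borel_measurable M"
  shows "(\<integral>x. f (T x) \<partial>M) = (\<integral>x. f x \<partial>M)"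
  using integral_distr[OF assms(1,3)] assms(2) by simp

lemma integrable_measure_preserving:
  fixes f :: "'a \<Rightarrow> real"
  assumes "T \<in> M \<rightarrow>\<^sub>M M" "distr M M T = M" "integrable M f"
  shows "integrable M (\<lambda>x. f (T x))"
  using integrable_distr[OF assms(1), of f] assms(2,3) by simp

text \<open>The maximum of the Birkhoff sums of lengths 0 to \<open>n\<close>, in the recursive form
  on which Garsia's proof of the maximal inequality operates.\<close>

fun max_birkhoff :: "('a \<Rightarrow> 'a) \<Rightarrow> ('a \<Rightarrow> real) \<Rightarrow> nat \<Rightarrow> 'a \<Rightarrow> real" where
  "max_birkhoff T f 0 x = 0"
| "max_birkhoff T f (Suc n) x = max 0 (f x + max_birkhoff T f n (T x))"

lemma max_birkhoff_nonneg: "0 \<le> max_birkhoff T f n x"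
  by (cases n) auto

lemma max_birkhoff_Suc_ge: "max_birkhoff T f n x \<le> max_birkhoff T f (Suc n) x"
proof (induction n arbitrary: x)
  case (Suc n)
  show ?case using Suc[of "T x"] by simp
qed simp

lemma birkhoff_sum_Suc: "(\<Sum>i<Suc n. f ((T ^^ i) x)) = f x + (\<Sum>i<n. f ((T ^^ i) (T x)))"
  by (subst sum.lessThan_Suc_shift) (simp add: funpow_swap1)

lemma max_birkhoff_ge: "(\<Sum>i<n. f ((T ^^ i) x)) \<le> max_birkhoff T f n x"
proof (induction n arbitrary: x)
  case (Suc n)
  show ?case unfolding birkhoff_sum_Suc using Suc[of "T x"] by simp
qed simp

lemma max_birkhoff_integrable:
  assumes "T \<in> M \<rightarrow>\<^sub>M M" "distr M M T = M" "integrable M f"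
  shows "integrable M (max_birkhoff T f n)"
proof (induction n)
  case (Suc n)
  have "integrable M (\<lambda>x. max 0 (f x + max_birkhoff T f n (T x)))"
    using integrable_measure_preserving[OF assms(1,2) Suc] assms(3) by simp
  then show ?case by (simp add: max_birkhoff.simps[abs_def])
qed simp

text \<open>Garsia's argument for \<open>h\<close>, the restriction of \<open>f\<close> to the
  invariant set \<open>A\<close>. The difference between \<open>F (Suc n)\<close> and its composite
  with \<open>T\<close> has integral zero; it is at most \<open>h\<close> where
  \<open>F (Suc n)\<close> is positive and at most 0 elsewhere. These positivity sets increase to
  \<open>A\<close>.\<close>

lemma maximal_ergodic:
  fixes f :: "'a \<Rightarrow> real"
  assumes fin: "finite_measure M" and T: "T \<in> M \<rightarrow>\<^sub>M M" "distr M M T = M" and f: "integrable M f"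
    and A: "A \<in> sets M" and inv: "\<And>x. x \<in> space M \<Longrightarrow> T x \<in> A \<longleftrightarrow> x \<in> A"
    and pos: "\<And>x. x \<in> A \<Longrightarrow> \<exists>n. 0 < (\<Sum>i<n. f ((T ^^ i) x))"
  shows "0 \<le> (\<integral>x. indicator A x * f x \<partial>M)"
proof -
  define h where "h = (\<lambda>x. indicator A x * f x)"
  define F where "F = max_birkhoff T h"
  have h: "integrable M h" unfolding h_def using integrable_mult_indicator[OF A f] by simp
  have Fi: "integrable M (F n)" for n unfolding F_def by (rule max_birkhoff_integrable[OF T h])
  define E where "E n = {x \<in> space M. 0 < F (Suc n) x}" for n
  have E: "E n \<in> sets M" for n unfolding E_def using borel_measurable_integrable[OF Fi[of "Suc n"]] by measurable
  have Tn: "(T ^^ i) x \<in> space M" if "x \<in> space M" for i x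
    by (induction i) (use that measurable_space[OF T(1)] in auto)
  have ge: "0 \<le> (\<integral>x. indicator (E n) x * h x \<partial>M)" for n
  proof -
    have i1: "integrable M (\<lambda>x. F (Suc n) (T x))" by (rule integrable_measure_preserving[OF T Fi])
    have "0 = (\<integral>x. F (Suc n) x \<partial>M) - (\<integral>x. F (Suc n) (T x) \<partial>M)"
      using integral_measure_preserving[OF T borel_measurable_integrable[OF Fi]] by simp
    also have "\<dots> = (\<integral>x. F (Suc n) x - F (Suc n) (T x) \<partial>M)" using Fi i1 by simp
    also have "\<dots> \<le> (\<integral>x. indicator (E n) x * h x \<partial>M)"
    proof (rule integral_mono)
      show "integrable M (\<lambda>x. F (Suc n) x - F (Suc n) (T x))" using Fi i1 by simp
      show "integrable M (\<lambda>x. indicator (E n) x * h x)" using integrable_mult_indicator[OF E h] by simp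
      fix x assume x: "x \<in> space M"
      have mono: "F n (T x) \<le> F (Suc n) (T x)" unfolding F_def by (rule max_birkhoff_Suc_ge)
      have nn: "0 \<le> F (Suc n) (T x)" unfolding F_def by (rule max_birkhoff_nonneg)
      show "F (Suc n) x - F (Suc n) (T x) \<le> indicator (E n) x * h x"
      proof (cases "x \<in> E n")
        case True
        then have "0 < F (Suc n) x" by (simp add: E_def)
        then have "F (Suc n) x = h x + F n (T x)" unfolding F_def by (simp add: max_def split: if_splits)
        then show ?thesis using True mono by simp
      next
        case False
        then have "F (Suc n) x \<le> 0" using x by (simp add: E_def)
        then show ?thesis using False nn by simp
      qed
    qed
    finally show ?thesis .
  qed
  have inA: "x \<in> A" if "x \<in> E n" for x n
  proof (rule ccontr)
    assume nA: "x \<notin> A"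
    have x: "x \<in> space M" using that by (simp add: E_def)
    have "max_birkhoff T h k y = 0" if "y \<in> space M" "y \<notin> A" for k y
      using that
    proof (induction k arbitrary: y)
      case (Suc k)
      have "h y = 0" using Suc.prems by (simp add: h_def)
      moreover have "T y \<in> space M" "T y \<notin> A" using Suc.prems inv measurable_space[OF T(1)] by auto
      ultimately show ?case using Suc.IH by simp
    qed simp
    then have "F (Suc n) x = 0" unfolding F_def using x nA by blast
    then show False using that by (simp add: E_def)
  qed
  have lim: "(\<lambda>n. indicator (E n) x * h x) \<longlonglongrightarrow> indicator A x * f x" if x: "x \<in> space M" for x
  proof (cases "x \<in> A")
    case True
    have orbA: "(T ^^ i) x \<in> A" for i
      by (induction i) (use True inv Tn[OF x] in auto)
    obtain n where n: "0 < (\<Sum>i<n. f ((T ^^ i) x))" using pos[OF True] by blast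
    have "(\<Sum>i<n. f ((T ^^ i) x)) = (\<Sum>i<n. h ((T ^^ i) x))" using orbA by (simp add: h_def)
    then have n': "0 < F n x" unfolding F_def using n max_birkhoff_ge[where T=T and f=h and n=n and x=x] by simp
    have mono: "F k x \<le> F m x" if "k \<le> m" for k m
      using that unfolding F_def by (rule lift_Suc_mono_le[rotated]) (rule max_birkhoff_Suc_ge)
    have "x \<in> E m" if "n \<le> m" for m using n' mono[of n "Suc m"] that x by (simp add: E_def)
    then have "eventually (\<lambda>m. indicator (E m) x * h x = indicator A x * f x) sequentially"
      unfolding eventually_sequentially using True by (intro exI[of _ n]) (simp add: h_def)
    then show ?thesis by (rule tendsto_eventually)
  next
    case False
    then have "x \<notin> E n" for n using inA by blast
    then show ?thesis using False by simp
  qed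
  have "(\<lambda>n. \<integral>x. indicator (E n) x * h x \<partial>M) \<longlonglongrightarrow> (\<integral>x. indicator A x * f x \<partial>M)"
  proof (rule integral_dominated_convergence[where w="\<lambda>x. norm (f x)"])
    show "(\<lambda>x. indicator A x * f x) \<in> borel_measurable M" using h unfolding h_def by simp
    show "(\<lambda>x. indicator (E n) x * h x) \<in> borel_measurable M" for n
      using integrable_mult_indicator[OF E h, of n] by simp
    show "integrable M (\<lambda>x. norm (f x))" using f by simp
    show "AE x in M. (\<lambda>n. indicator (E n) x * h x) \<longlonglongrightarrow> indicator A x * f x" using lim by simp
    show "AE x in M. norm (indicator (E n) x * h x) \<le> norm (f x)" for n
      by (simp add: h_def indicator_def)
  qed
  then show ?thesis by (rule LIMSEQ_le_const) (use ge in blast)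
qed

text \<open>The set where the averages exceed \<open>c\<close> infinitely often is invariant, so its \<open>f\<close>-mean can be computed
  from any average: it is \<open>\<kappa>\<close> times its measure in the limit and at least \<open>c\<close> times its measure by the
  maximal inequality.\<close>

lemma ergodic_average_upper:
  fixes f :: "'a \<Rightarrow> real"
  assumes P: "prob_space M" and T: "T \<in> M \<rightarrow>\<^sub>M M" "distr M M T = M" and f: "integrable M f"
    and L1: "(\<lambda>n. \<integral>x. \<bar>(\<Sum>i<n. f ((T ^^ i) x)) / real n - \<kappa>\<bar> \<partial>M) \<longlonglongrightarrow> 0" and c: "\<kappa> < c"
  shows "AE x in M. eventually (\<lambda>n. (\<Sum>i<n. f ((T ^^ i) x)) \<le> (c + c - \<kappa>) * real n) sequentially"
proof -
  interpret prob_space M by (rule P)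
  define S where "S n x = (\<Sum>i<n. f ((T ^^ i) x))" for n x
  have S_Suc: "S (Suc n) x = f x + S n (T x)" for n x unfolding S_def by (rule birkhoff_sum_Suc)
  have Tn: "(\<lambda>x. (T ^^ i) x) \<in> M \<rightarrow>\<^sub>M M" for i
    by (induction i) (auto intro: measurable_compose[OF _ T(1)])
  have dTn: "distr M M (\<lambda>x. (T ^^ i) x) = M" for i
  proof (induction i)
    case (Suc i)
    have "distr M M (\<lambda>x. T ((T ^^ i) x)) = distr (distr M M (\<lambda>x. (T ^^ i) x)) M T"
      using distr_distr[OF T(1) Tn[of i]] by (simp add: comp_def)
    then show ?case using Suc T(2) by simp
  qed (simp add: distr_id)
  have fi: "integrable M (\<lambda>x. f ((T ^^ i) x))" for i by (rule integrable_measure_preserving[OF Tn dTn f])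
  have Si: "integrable M (S n)" for n unfolding S_def using fi by simp
  \<comment> \<open>The set where the upper limit of the averages exceeds \<open>c\<close>, written
    with an excess \<open>1/(j+1)\<close> that can be halved to absorb the change caused by one
    step.\<close>
  define A where "A = {x \<in> space M. \<exists>j::nat. \<forall>N. \<exists>n. N \<le> n \<and> (c + 1 / real (Suc j)) * real n < S n x}"
  have A: "A \<in> sets M"
  proof -
    have [measurable]: "S n \<in> borel_measurable M" for n using Si by (rule borel_measurable_integrable)
    show ?thesis unfolding A_def by measurable
  qed
  have Tsp: "T x \<in> space M" if "x \<in> space M" for x using measurable_space[OF T(1) that] .
  \<comment> \<open>Passing between \<open>x\<close> and \<open>T x\<close> changes the sum by a
    bounded term \<open>b\<close> and the length by one; with half of the excess \<open>e\<close>
    the inequality survives for large \<open>n\<close>.\<close>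
  have shift: "\<exists>j::nat. \<forall>N. \<exists>n. N \<le> n \<and> (c + 1 / real (Suc j)) * real n < u n"
    if io: "\<And>N. \<exists>n. N \<le> n \<and> (c + 1 / real (Suc j)) * real n < w n" and d: "\<And>n. w n \<le> u (p n) + b" "\<And>n. p n \<le> n + 1" "\<And>n. n \<le> p n + 1"
    for u w :: "nat \<Rightarrow> real" and b j and p :: "nat \<Rightarrow> nat"
  proof (rule exI[of _ "Suc (2 * j)"], rule allI)
    fix N
    define e where "e = 1 / real (Suc j)"
    have e: "0 < e" by (simp add: e_def)
    have e2: "1 / real (Suc (Suc (2 * j))) = e / 2" by (simp add: e_def field_simps)
    obtain K :: nat where K: "2 * (\<bar>b\<bar> + \<bar>c\<bar> + e) / e < real K" using reals_Archimedean2 by blast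
    obtain n where n: "max (Suc N) K \<le> n" "(c + e) * real n < w n" using io unfolding e_def by blast
    have rn: "2 * (\<bar>b\<bar> + \<bar>c\<bar> + e) < e * real n"
    proof -
      have "2 * (\<bar>b\<bar> + \<bar>c\<bar> + e) < e * real K" using K e by (simp add: field_simps)
      also have "\<dots> \<le> e * real n" using n(1) e by (intro mult_left_mono) auto
      finally show ?thesis .
    qed
    have pn: "\<bar>real (p n) - real n\<bar> \<le> 1" using d(2)[of n] d(3)[of n] by linarith
    have "c * (real (p n) - real n) \<le> \<bar>c\<bar> * 1"
      using pn by (metis abs_ge_self abs_ge_zero abs_mult mult_left_mono order_trans)
    moreover have "e / 2 * real (p n) \<le> e / 2 * (real n + 1)" using pn e by (intro mult_left_mono) auto
    ultimately have "(c + e / 2) * real (p n) \<le> (c + e) * real n - e * real n / 2 + \<bar>c\<bar> + e / 2"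
      by (simp add: algebra_simps)
    also have "\<dots> < w n - b" using n(2) rn e by (simp add: abs_if split: if_splits) 
    also have "\<dots> \<le> u (p n)" using d(1)[of n] by simp
    finally show "\<exists>m. N \<le> m \<and> (c + 1 / real (Suc (Suc (2 * j)))) * real m < u m"
      unfolding e2 using n(1) d(3)[of n] by (intro exI[of _ "p n"]) auto
  qed
  have inv: "T x \<in> A \<longleftrightarrow> x \<in> A" if x: "x \<in> space M" for x
  proof
    assume "T x \<in> A"
    then obtain j where "\<And>N. \<exists>n. N \<le> n \<and> (c + 1 / real (Suc j)) * real n < S n (T x)" by (auto simp: A_def)
    from shift[OF this, of "\<lambda>n. S n x" Suc "- f x"] show "x \<in> A" using x by (simp add: A_def S_Suc)
  next
    assume "x \<in> A"
    then obtain j where j: "\<And>N. \<exists>n. N \<le> n \<and> (c + 1 / real (Suc j)) * real n < S n x" by (auto simp: A_def)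
    have "S n x \<le> S (n - 1) (T x) + \<bar>f x\<bar>" for n
      by (cases n) (auto simp: S_Suc, simp add: S_def)
    then have "\<exists>j::nat. \<forall>N. \<exists>n. N \<le> n \<and> (c + 1 / real (Suc j)) * real n < S n (T x)"
      by (intro shift[OF j, of "\<lambda>n. S n (T x)" "\<lambda>n. n - 1" "\<bar>f x\<bar>"]) auto
    then show "T x \<in> A" using Tsp[OF x] by (simp add: A_def)
  qed
  have max: "0 \<le> (\<integral>x. indicator A x * (f x - c) \<partial>M)"
  proof (rule maximal_ergodic[OF _ T _ A inv])
    show "finite_measure M" by unfold_locales
    show "integrable M (\<lambda>x. f x - c)" using f by simp
    fix x assume "x \<in> A"
    then obtain n j where n: "1 \<le> n" "(c + 1 / real (Suc j)) * real n < S n x" unfolding A_def by blast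
    have "c * real n \<le> (c + 1 / real (Suc j)) * real n" by (intro mult_right_mono) auto
    then have "0 < S n x - c * real n" using n by linarith
    also have "\<dots> = (\<Sum>i<n. f ((T ^^ i) x) - c)" by (simp add: S_def sum_subtractf)
    finally show "\<exists>n. 0 < (\<Sum>i<n. f ((T ^^ i) x) - c)" by blast
  qed
  have invn: "(T ^^ i) x \<in> A \<longleftrightarrow> x \<in> A" if x: "x \<in> space M" for x i
  proof (induction i)
    case (Suc i)
    have "(T ^^ i) x \<in> space M" by (rule measurable_space[OF Tn x])
    then show ?case using inv Suc by simp
  qed simp
  have Af: "integrable M (\<lambda>x. indicator A x * g x)" if "integrable M g" for g :: "'a \<Rightarrow> real"
    using integrable_mult_indicator[OF A that] by simp
  have indi: "integrable M (indicat_real A)" using Af[of "\<lambda>_. 1"] by simp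
  have intA: "(\<integral>x. indicator A x * S n x \<partial>M) = real n * (\<integral>x. indicator A x * f x \<partial>M)" for n
  proof -
    have "(\<integral>x. indicator A x * f ((T ^^ i) x) \<partial>M) = (\<integral>x. indicator A x * f x \<partial>M)" for i
    proof -
      have "(\<integral>x. indicator A x * f ((T ^^ i) x) \<partial>M) = (\<integral>x. indicator A ((T ^^ i) x) * f ((T ^^ i) x) \<partial>M)"
        by (rule Bochner_Integration.integral_cong) (auto simp: indicator_def invn)
      also have "\<dots> = (\<integral>x. indicator A x * f x \<partial>M)"
        by (rule integral_measure_preserving[OF Tn dTn borel_measurable_integrable[OF Af[OF f]]])
      finally show ?thesis .
    qed
    note each = this
    have "(\<integral>x. indicator A x * S n x \<partial>M) = (\<integral>x. (\<Sum>i<n. indicator A x * f ((T ^^ i) x)) \<partial>M)"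
      by (simp only: S_def sum_distrib_left)
    also have "\<dots> = (\<Sum>i<n. (\<integral>x. indicator A x * f ((T ^^ i) x) \<partial>M))"
      by (rule Bochner_Integration.integral_sum) (rule Af[OF fi])
    also have "\<dots> = (\<Sum>i<n. (\<integral>x. indicator A x * f x \<partial>M))" by (simp only: each)
    also have "\<dots> = real n * (\<integral>x. indicator A x * f x \<partial>M)" by (simp only: sum_constant card_lessThan)
    finally show ?thesis .
  qed
  have "\<bar>(\<integral>x. indicator A x * f x \<partial>M) - \<kappa> * prob A\<bar> \<le> (\<integral>x. \<bar>S n x / real n - \<kappa>\<bar> \<partial>M)" if n: "0 < n" for n
  proof -
    have i: "integrable M (\<lambda>x. S n x / real n - \<kappa>)" using Si by simp
    have "(\<integral>x. indicator A x * f x \<partial>M) - \<kappa> * prob A = (\<integral>x. indicator A x * (S n x / real n - \<kappa>) \<partial>M)"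
    proof -
      have "(\<integral>x. indicator A x * (S n x / real n - \<kappa>) \<partial>M) = (\<integral>x. indicator A x * S n x / real n - \<kappa> * indicator A x \<partial>M)"
        by (rule Bochner_Integration.integral_cong) (auto simp: algebra_simps)
      also have "\<dots> = (\<integral>x. indicator A x * S n x \<partial>M) / real n - \<kappa> * prob A"
        using Af[OF Si] A indi by (subst Bochner_Integration.integral_diff) auto
      finally show ?thesis using n by (simp add: intA)
    qed
    also have "\<bar>\<dots>\<bar> \<le> (\<integral>x. \<bar>indicator A x * (S n x / real n - \<kappa>)\<bar> \<partial>M)" by (rule integral_abs_bound)
    also have "\<dots> \<le> (\<integral>x. \<bar>S n x / real n - \<kappa>\<bar> \<partial>M)"
      using Af[OF i] i by (intro integral_mono integrable_abs) (auto simp: indicator_def)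
    finally show ?thesis .
  qed
  then have "eventually (\<lambda>n. \<bar>(\<integral>x. indicator A x * f x \<partial>M) - \<kappa> * prob A\<bar> \<le> (\<integral>x. \<bar>S n x / real n - \<kappa>\<bar> \<partial>M)) sequentially"
    by (auto intro: eventually_sequentiallyI[of 1])
  then have "\<bar>(\<integral>x. indicator A x * f x \<partial>M) - \<kappa> * prob A\<bar> \<le> 0"
    using L1 unfolding S_def by (intro tendsto_lowerbound) auto
  then have fA: "(\<integral>x. indicator A x * f x \<partial>M) = \<kappa> * prob A" by simp
  have "(\<integral>x. indicator A x * (f x - c) \<partial>M) = (\<integral>x. indicator A x * f x - c * indicator A x \<partial>M)"
    by (rule Bochner_Integration.integral_cong) (auto simp: algebra_simps)
  also have "\<dots> = \<kappa> * prob A - c * prob A"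
    using indi Af[OF f] A fA by (subst Bochner_Integration.integral_diff) auto
  finally have "0 \<le> (\<kappa> - c) * prob A" using max by (simp add: algebra_simps)
  then have "prob A = 0" using c measure_nonneg[of M A] by (simp add: zero_le_mult_iff antisym)
  then have "AE x in M. x \<notin> A" using A by (intro AE_not_in) (simp add: null_sets_def emeasure_eq_measure)
  then show ?thesis
    using AE_space
  proof eventually_elim
    case (elim x)
    \<comment> \<open>An excess below \<open>c - \<kappa>\<close> gives the slope
      \<open>c + c - \<kappa>\<close> of the conclusion, as membership in \<open>A\<close> fails for
      this \<open>j\<close>.\<close>
    obtain j :: nat where j: "1 / real (Suc j) < c - \<kappa>" using c reals_Archimedean[of "c - \<kappa>"] by (auto simp: inverse_eq_divide)
    have "\<not> (\<forall>N. \<exists>n. N \<le> n \<and> (c + 1 / real (Suc j)) * real n < S n x)" using elim by (auto simp: A_def)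
    then obtain N where N: "\<And>n. N \<le> n \<Longrightarrow> S n x \<le> (c + 1 / real (Suc j)) * real n" by (auto simp: not_less)
    have "S n x \<le> (c + c - \<kappa>) * real n" if "N \<le> n" for n
    proof -
      have "(c + 1 / real (Suc j)) * real n \<le> (c + c - \<kappa>) * real n" using j by (intro mult_right_mono) auto
      then show ?thesis using N[OF that] by linarith
    qed
    then show ?case unfolding S_def eventually_sequentially by blast
  qed
qed

lemma ergodic_average_AE:
  fixes f :: "'a \<Rightarrow> real"
  assumes P: "prob_space M" and T: "T \<in> M \<rightarrow>\<^sub>M M" "distr M M T = M" and f: "integrable M f"
    and L1: "(\<lambda>n. \<integral>x. \<bar>(\<Sum>i<n. f ((T ^^ i) x)) / real n - \<kappa>\<bar> \<partial>M) \<longlonglongrightarrow> 0"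
  shows "AE x in M. (\<lambda>n. (\<Sum>i<n. f ((T ^^ i) x)) / real n) \<longlonglongrightarrow> \<kappa>"
proof -
  define e where "e j = inverse (real (Suc j)) / 2" for j
  have e: "0 < e j" for j by (simp add: e_def)
  have L1': "(\<lambda>n. \<integral>x. \<bar>(\<Sum>i<n. - f ((T ^^ i) x)) / real n - (- \<kappa>)\<bar> \<partial>M) \<longlonglongrightarrow> 0"
  proof -
    have "\<bar>(\<Sum>i<n. - f ((T ^^ i) x)) / real n - (- \<kappa>)\<bar> = \<bar>(\<Sum>i<n. f ((T ^^ i) x)) / real n - \<kappa>\<bar>" for n x
      by (simp add: sum_negf abs_minus_commute)
    then show ?thesis using L1 by simp
  qed
  have "AE x in M. eventually (\<lambda>n. (\<Sum>i<n. f ((T ^^ i) x)) \<le> (\<kappa> + 2 * e j) * real n) sequentially" for j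
    using ergodic_average_upper[OF P T f L1, of "\<kappa> + e j"] e[of j] by (simp add: algebra_simps)
  moreover have "AE x in M. eventually (\<lambda>n. (\<Sum>i<n. - f ((T ^^ i) x)) \<le> (- \<kappa> + 2 * e j) * real n) sequentially" for j
    using ergodic_average_upper[OF P T integrable_minus[OF f] L1', of "- \<kappa> + e j"] e[of j] by (simp add: algebra_simps)
  ultimately have "AE x in M. \<forall>j. eventually (\<lambda>n. (\<Sum>i<n. f ((T ^^ i) x)) \<le> (\<kappa> + 2 * e j) * real n) sequentially"
    "AE x in M. \<forall>j. eventually (\<lambda>n. (\<Sum>i<n. - f ((T ^^ i) x)) \<le> (- \<kappa> + 2 * e j) * real n) sequentially"
    by (simp_all add: AE_all_countable)
  then show ?thesis
  proof eventually_elim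
    case (elim x)
    show ?case
    proof (rule LIMSEQ_I)
      fix r :: real assume "0 < r"
      then obtain j where j: "2 * e j < r" using reals_Archimedean unfolding e_def by force
      have "eventually (\<lambda>n. norm ((\<Sum>i<n. f ((T ^^ i) x)) / real n - \<kappa>) < r) sequentially"
        using elim(1)[rule_format, of j] elim(2)[rule_format, of j] eventually_gt_at_top[of 0]
      proof eventually_elim
        case (elim n)
        have "(\<Sum>i<n. f ((T ^^ i) x)) / real n \<le> \<kappa> + 2 * e j" using elim by (simp add: pos_divide_le_eq)
        moreover have "\<kappa> - 2 * e j \<le> (\<Sum>i<n. f ((T ^^ i) x)) / real n"
        proof -
          have "(\<kappa> - 2 * e j) * real n \<le> (\<Sum>i<n. f ((T ^^ i) x))" using elim by (simp add: sum_negf algebra_simps)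
          then show ?thesis using elim by (subst pos_le_divide_eq) auto
        qed
        ultimately show ?case using j by (simp add: abs_less_iff)
      qed
      then show "\<exists>no. \<forall>n\<ge>no. norm ((\<Sum>i<n. f ((T ^^ i) x)) / real n - \<kappa>) < r"
        by (simp add: eventually_sequentially)
    qed
  qed
qed

section \<open>The Lyapunov exponent\<close>

lemma lwalk_front: "lwalk \<omega> (Suc n) = mat2_mult (lwalk (\<lambda>i. \<omega> (Suc i)) n) (\<omega> 0)"
  by (induction n) (simp_all add: mat2_mult_assoc)

lemma lwalk_cong: "(\<And>i. i < n \<Longrightarrow> \<omega> i = \<omega>' i) \<Longrightarrow> lwalk \<omega> n = lwalk \<omega>' n"
  by (induction n) auto

context nonarch_field
begin

abbreviation lnorm :: "'k mat2 \<Rightarrow> real" where "lnorm g \<equiv> ln (mat2_norm absv g)"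

lemma lnorm_nonneg: "g \<in> SL2 \<Longrightarrow> 0 \<le> lnorm g"
  using norm_ge_1 by simp

lemma lnorm_mult: "g \<in> SL2 \<Longrightarrow> h \<in> SL2 \<Longrightarrow> lnorm (mat2_mult g h) \<le> lnorm g + lnorm h"
proof -
  assume gh: "g \<in> SL2" "h \<in> SL2"
  have p: "0 < mat2_norm absv g" "0 < mat2_norm absv h" "0 < mat2_norm absv (mat2_mult g h)"
    using norm_ge_1[OF gh(1)] norm_ge_1[OF gh(2)] norm_ge_1[OF SL2_mult[OF gh]] by simp_all
  have "lnorm (mat2_mult g h) \<le> ln (mat2_norm absv g * mat2_norm absv h)"
    using norm_mult_le[of g h] p by (intro ln_mono) auto
  also have "\<dots> = lnorm g + lnorm h" using p by (simp add: ln_mult)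
  finally show ?thesis .
qed

lemma abs_sigma_le: "g \<in> SL2 \<Longrightarrow> x \<in> P1an absv \<Longrightarrow> \<bar>sigma_coc absv g x\<bar> \<le> lnorm g"
  using abs_ln_dil_le[OF norm_like_bnorm] by (simp add: sigma_eq_ln_dil)

text \<open>The direction \<open>u\<close> is the longer of the two images of the basis vectors
  under the inverse of \<open>g\<close>, the repelling direction. Off the ball
  \<open>delta x u\<close> is bounded below and \<open>dil\<close> dominates the norm of
  \<open>x\<close> at \<open>u\<close>; inside the ball the crude bound by twice
  \<open>lnorm g\<close> is used.\<close>

lemma sigma_ge_off_ball:
  assumes g: "g \<in> SL2"
  shows "\<exists>u. u \<noteq> (0,0) \<and> (\<forall>x\<in>P1an absv. lnorm g - sigma_coc absv g x \<le> ln (real (Suc m)) + 2 * lnorm g * indicator (bal u m) x)"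
proof -
  obtain e where e: "e = (1,0) \<or> e = (0,1)" "vn (mv (mat2_inv_SL g) e) = mat2_norm absv g"
    using norm_eq_max_columns[of g] by (metis max_def)
  let ?u = "mv (mat2_inv_SL g) e"
  have n: "0 < mat2_norm absv g" using norm_ge_1[OF g] by simp
  have u: "?u \<noteq> (0,0)" using e(2) n vn_pos_iff by metis
  have "lnorm g - sigma_coc absv g x \<le> ln (real (Suc m)) + 2 * lnorm g * indicator (bal ?u m) x" if x: "x \<in> P1an absv" for x
  proof (cases "x \<in> bal ?u m")
    case True
    have "0 \<le> ln (real (Suc m))" by (rule ln_ge_zero) simp
    then have "lnorm g - sigma_coc absv g x \<le> ln (real (Suc m)) + 2 * lnorm g"
      using abs_sigma_le[OF g x] unfolding abs_le_iff by linarith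
    then show ?thesis using True by (simp del: of_nat_Suc)
  next
    case False
    then have d: "inverse (real (Suc m)) \<le> delta x ?u" using x by (simp add: bal_def not_less)
    have "mat2_norm absv g * inverse (real (Suc m)) \<le> mat2_norm absv g * delta x ?u" using d n by (intro mult_left_mono) auto
    also have "\<dots> = bnorm x ?u" using n e(2) by (simp add: delta_def)
    also have "\<dots> \<le> dil (bnorm x) g" using e(1) by (auto simp: dil_def)
    finally have "ln (mat2_norm absv g * inverse (real (Suc m))) \<le> ln (dil (bnorm x) g)"
      using n by (intro ln_mono) auto
    also have "\<dots> = sigma_coc absv g x" using sigma_eq_ln_dil[OF x g] by simp
    finally show ?thesis using False n by (simp add: ln_mult ln_inverse del: of_nat_Suc)
  qed
  then show ?thesis using u by blast
qed

text \<open>A second moment estimate for a subadditive quantity. Each factor is truncated at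
  \<open>K\<close>: the overshoots \<open>Y2\<close> add up to \<open>real q * b\<close> in the
  mean, and the positive part of the truncated sum is bounded by the parabola
  \<open>(y + \<tau>)^2 / (4 \<tau>)\<close>, whose mean splits into a squared mean and
  \<open>q\<close> variances. The induction runs over all thresholds \<open>c\<close>.\<close>

lemma conv_block_bound:
  fixes \<kappa> :: "'k mat2 pmf"
  assumes sl: "set_pmf \<kappa> \<subseteq> SL2" and int: "integrable (measure_pmf \<kappa>) lnorm" and K: "0 \<le> K" and \<tau>: "0 < \<tau>"
  defines "Y1 \<equiv> \<lambda>g. min (lnorm g) K" and "Y2 \<equiv> \<lambda>g. max 0 (lnorm g - K)"
  defines "a1 \<equiv> measure_pmf.expectation \<kappa> Y1" and "b \<equiv> measure_pmf.expectation \<kappa> Y2"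
  defines "V \<equiv> measure_pmf.expectation \<kappa> (\<lambda>g. (Y1 g)\<^sup>2) - a1\<^sup>2"
  shows "(\<integral>\<^sup>+g. ennreal (max 0 (lnorm g - c)) \<partial>measure_pmf (conv_pow \<kappa> q))
     \<le> ennreal (real q * b + ((real q * a1 - c + \<tau>)\<^sup>2 + real q * V) / (4 * \<tau>))"
proof (induction q arbitrary: c)
  case 0
  have "max 0 (- c) \<le> (\<tau> - c)\<^sup>2 / (4 * \<tau>)"
  proof -
    have "(- c) * (4 * \<tau>) \<le> (\<tau> - c)\<^sup>2" using zero_le_power2[of "\<tau> + c"] by (simp add: power2_eq_square algebra_simps)
    then have "- c \<le> (\<tau> - c)\<^sup>2 / (4 * \<tau>)" using \<tau> by (subst pos_le_divide_eq) auto
    then show ?thesis using \<tau> by simp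
  qed
  then show ?case by (simp add: ennreal_leI)
next
  case (Suc q)
  have nn: "0 \<le> lnorm g" if "g \<in> set_pmf \<kappa>" for g using that sl lnorm_nonneg by blast
  have Y1i: "integrable (measure_pmf \<kappa>) Y1" "integrable (measure_pmf \<kappa>) (\<lambda>g. (Y1 g)\<^sup>2)"
  proof -
    show "integrable (measure_pmf \<kappa>) Y1" unfolding Y1_def using nn K
      by (intro measure_pmf.integrable_const_bound[where B=K]) (auto simp: AE_measure_pmf_iff)
    have "(min (lnorm g) K)\<^sup>2 \<le> K\<^sup>2" if "g \<in> set_pmf \<kappa>" for g using nn[OF that] K by (intro power_mono) auto
    then show "integrable (measure_pmf \<kappa>) (\<lambda>g. (Y1 g)\<^sup>2)" unfolding Y1_def
      by (intro measure_pmf.integrable_const_bound[where B="K\<^sup>2"]) (auto simp: AE_measure_pmf_iff)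
  qed
  have Y2i: "integrable (measure_pmf \<kappa>) Y2" unfolding Y2_def using int by simp
  define D where "D = real q * a1 - c + \<tau>"
  let ?B = "\<lambda>g. real q * b + ((D + Y1 g)\<^sup>2 + real q * V) / (4 * \<tau>)"
  have b0: "0 \<le> b" unfolding b_def Y2_def by (rule integral_nonneg_AE) simp
  have V0: "0 \<le> V"
  proof -
    have "0 \<le> measure_pmf.expectation \<kappa> (\<lambda>g. (Y1 g - a1)\<^sup>2)" by (rule integral_nonneg_AE) simp
    also have "\<dots> = measure_pmf.expectation \<kappa> (\<lambda>g. (Y1 g)\<^sup>2 - 2 * a1 * Y1 g + a1\<^sup>2)"
      by (intro Bochner_Integration.integral_cong) (auto simp: power2_eq_square algebra_simps)
    also have "\<dots> = V" using Y1i by (simp add: V_def a1_def power2_eq_square algebra_simps)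
    finally show ?thesis .
  qed
  have B0: "0 \<le> ?B g" for g using b0 V0 \<tau> by (intro add_nonneg_nonneg divide_nonneg_nonneg mult_nonneg_nonneg) auto
  have "(\<integral>\<^sup>+g. ennreal (max 0 (lnorm g - c)) \<partial>measure_pmf (conv_pow \<kappa> (Suc q)))
     = (\<integral>\<^sup>+h. \<integral>\<^sup>+g. ennreal (max 0 (lnorm (mat2_mult g h) - c)) \<partial>measure_pmf \<kappa> \<partial>measure_pmf (conv_pow \<kappa> q))" by simp
  also have "\<dots> = (\<integral>\<^sup>+g. \<integral>\<^sup>+h. ennreal (max 0 (lnorm (mat2_mult g h) - c)) \<partial>measure_pmf (conv_pow \<kappa> q) \<partial>measure_pmf \<kappa>)"
    by (rule nn_integral_pmf_swap)
  also have "\<dots> \<le> (\<integral>\<^sup>+g. ennreal (?B g + Y2 g) \<partial>measure_pmf \<kappa>)"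
  proof (rule nn_integral_mono_AE, unfold AE_measure_pmf_iff, intro ballI)
    fix g assume g: "g \<in> set_pmf \<kappa>"
    have "(\<integral>\<^sup>+h. ennreal (max 0 (lnorm (mat2_mult g h) - c)) \<partial>measure_pmf (conv_pow \<kappa> q))
      \<le> (\<integral>\<^sup>+h. ennreal (max 0 (lnorm h - (c - Y1 g))) + ennreal (Y2 g) \<partial>measure_pmf (conv_pow \<kappa> q))"
    proof (rule nn_integral_mono_AE, unfold AE_measure_pmf_iff, intro ballI)
      fix h assume h: "h \<in> set_pmf (conv_pow \<kappa> q)"
      have "lnorm (mat2_mult g h) \<le> lnorm g + lnorm h"
        using g h sl set_conv_pow_sub_SL2[OF sl] by (intro lnorm_mult) blast+
      \<comment> \<open>The truncated part of the new factor moves into the threshold, where the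
        induction hypothesis meets it as a shift; the overshoot is added outside.\<close>
      then have "max 0 (lnorm (mat2_mult g h) - c) \<le> max 0 (lnorm h - (c - Y1 g)) + Y2 g"
        unfolding Y1_def Y2_def by linarith
      then show "ennreal (max 0 (lnorm (mat2_mult g h) - c)) \<le> ennreal (max 0 (lnorm h - (c - Y1 g))) + ennreal (Y2 g)"
        by (simp only: ennreal_plus[symmetric] Y2_def max.cobounded1 ennreal_leI)
    qed
    also have "\<dots> = (\<integral>\<^sup>+h. ennreal (max 0 (lnorm h - (c - Y1 g))) \<partial>measure_pmf (conv_pow \<kappa> q)) + ennreal (Y2 g)"
      by (subst nn_integral_add) auto
    also have "\<dots> \<le> ennreal (real q * b + ((real q * a1 - (c - Y1 g) + \<tau>)\<^sup>2 + real q * V) / (4 * \<tau>)) + ennreal (Y2 g)"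
      by (intro add_right_mono Suc.IH)
    also have "real q * a1 - (c - Y1 g) + \<tau> = D + Y1 g" by (simp add: D_def)
    also have "ennreal (?B g) + ennreal (Y2 g) = ennreal (?B g + Y2 g)"
      using B0[of g] by (intro ennreal_plus[symmetric]) (auto simp: Y2_def)
    finally show "(\<integral>\<^sup>+h. ennreal (max 0 (lnorm (mat2_mult g h) - c)) \<partial>measure_pmf (conv_pow \<kappa> q)) \<le> ennreal (?B g + Y2 g)" .
  qed
  also have "\<dots> = ennreal (measure_pmf.expectation \<kappa> (\<lambda>g. ?B g + Y2 g))"
  proof (rule nn_integral_eq_integral)
    have "integrable (measure_pmf \<kappa>) (\<lambda>g. real q * b + (D\<^sup>2 + 2 * D * Y1 g + (Y1 g)\<^sup>2 + real q * V) / (4 * \<tau>) + Y2 g)"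
      using Y1i Y2i by (intro Bochner_Integration.integrable_add integrable_divide) auto
    then show "integrable (measure_pmf \<kappa>) (\<lambda>g. ?B g + Y2 g)" by (simp add: power2_sum add_ac mult_ac)
    show "AE g in measure_pmf \<kappa>. 0 \<le> ?B g + Y2 g"
      by (rule AE_I2) (use B0 in \<open>auto simp: Y2_def intro!: add_nonneg_nonneg\<close>)
  qed
  also have "measure_pmf.expectation \<kappa> (\<lambda>g. ?B g + Y2 g) = real (Suc q) * b + ((real (Suc q) * a1 - c + \<tau>)\<^sup>2 + real (Suc q) * V) / (4 * \<tau>)"
  proof -
    have "measure_pmf.expectation \<kappa> (\<lambda>g. ?B g + Y2 g)
      = measure_pmf.expectation \<kappa> (\<lambda>g. (real q * b + (D\<^sup>2 + real q * V) / (4 * \<tau>)) + (2 * D / (4 * \<tau>)) * Y1 g + (1 / (4 * \<tau>)) * (Y1 g)\<^sup>2 + Y2 g)"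
      by (intro Bochner_Integration.integral_cong) (auto simp: power2_sum add_divide_distrib)
    also have "\<dots> = (real q * b + (D\<^sup>2 + real q * V) / (4 * \<tau>)) + (2 * D / (4 * \<tau>)) * a1
        + (1 / (4 * \<tau>)) * measure_pmf.expectation \<kappa> (\<lambda>g. (Y1 g)\<^sup>2) + b"
      using Y1i Y2i by (simp add: a1_def b_def)
    also have "\<dots> = real (Suc q) * b + ((D + a1)\<^sup>2 + real (Suc q) * V) / (4 * \<tau>)"
      using \<tau> unfolding V_def by (simp add: power2_sum field_simps)
    also have "D + a1 = real (Suc q) * a1 - c + \<tau>" by (simp add: D_def algebra_simps)
    finally show ?thesis .
  qed
  finally show ?case .
qed

lemma conv_block_LLN:
  fixes \<kappa> :: "'k mat2 pmf"
  assumes sl: "set_pmf \<kappa> \<subseteq> SL2" and int: "integrable (measure_pmf \<kappa>) lnorm" and \<eta>: "0 < \<eta>"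
  shows "\<exists>q0. \<forall>q\<ge>q0. (\<integral>\<^sup>+g. ennreal (max 0 (lnorm g - real q * (measure_pmf.expectation \<kappa> lnorm + \<eta>))) \<partial>measure_pmf (conv_pow \<kappa> q))
     \<le> ennreal (real q * \<eta>)"
proof -
  have "(\<lambda>k::nat. measure_pmf.expectation \<kappa> (\<lambda>g. max 0 (lnorm g - real k))) \<longlonglongrightarrow> measure_pmf.expectation \<kappa> (\<lambda>g. 0)"
  proof (rule integral_dominated_convergence[where w="\<lambda>g. \<bar>lnorm g\<bar>"])
    show "AE g in measure_pmf \<kappa>. (\<lambda>k::nat. max 0 (lnorm g - real k)) \<longlonglongrightarrow> 0"
    proof (rule AE_I2)
      fix g
      obtain N :: nat where N: "lnorm g \<le> real N" using real_arch_simple by blast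
      have "eventually (\<lambda>k::nat. max 0 (lnorm g - real k) = 0) sequentially"
        unfolding eventually_sequentially using N by (intro exI[of _ N]) auto
      then show "(\<lambda>k::nat. max 0 (lnorm g - real k)) \<longlonglongrightarrow> 0" by (rule tendsto_eventually)
    qed
  qed (use int in auto)
  then have "eventually (\<lambda>k::nat. measure_pmf.expectation \<kappa> (\<lambda>g. max 0 (lnorm g - real k)) < \<eta>/2) sequentially"
    by (rule order_tendstoD(2)) (use \<eta> in simp)
  then obtain k :: nat where k: "measure_pmf.expectation \<kappa> (\<lambda>g. max 0 (lnorm g - real k)) < \<eta>/2"
    by (meson eventually_happens' sequentially_bot)
  define a1 where "a1 = measure_pmf.expectation \<kappa> (\<lambda>g. min (lnorm g) (real k))"
  define V where "V = measure_pmf.expectation \<kappa> (\<lambda>g. (min (lnorm g) (real k))\<^sup>2) - a1\<^sup>2"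
  define b where "b = measure_pmf.expectation \<kappa> (\<lambda>g. max 0 (lnorm g - real k))"
  have nn: "0 \<le> lnorm g" if "g \<in> set_pmf \<kappa>" for g using that sl lnorm_nonneg by blast
  have a1: "a1 \<le> measure_pmf.expectation \<kappa> lnorm" unfolding a1_def
    using nn by (intro integral_mono int measure_pmf.integrable_const_bound[where B="real k"]) (auto simp: AE_measure_pmf_iff)
  obtain q0 :: nat where q0: "V / (2 * \<eta>\<^sup>2) < real q0" using reals_Archimedean2 by blast
  show ?thesis
  proof (intro exI[of _ "max 1 q0"] allI impI)
    fix q :: nat assume q: "max 1 q0 \<le> q"
    have qp: "0 < real q * \<eta>" using q \<eta> by simp
    have "(\<integral>\<^sup>+g. ennreal (max 0 (lnorm g - real q * (measure_pmf.expectation \<kappa> lnorm + \<eta>))) \<partial>measure_pmf (conv_pow \<kappa> q))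
      \<le> (\<integral>\<^sup>+g. ennreal (max 0 (lnorm g - real q * (a1 + \<eta>))) \<partial>measure_pmf (conv_pow \<kappa> q))"
    proof (intro nn_integral_mono ennreal_leI max.mono order_refl diff_left_mono)
      show "real q * (a1 + \<eta>) \<le> real q * (measure_pmf.expectation \<kappa> lnorm + \<eta>)" using a1 by (intro mult_left_mono) auto
    qed
    \<comment> \<open>With \<open>q \<eta>\<close> in the role of \<tau> the squared mean vanishes,
      and the variance term \<open>V / (4 \<eta>)\<close> that remains does not grow with
      \<open>q\<close>.\<close>
    also have "\<dots> \<le> ennreal (real q * b + ((real q * a1 - real q * (a1 + \<eta>) + real q * \<eta>)\<^sup>2 + real q * V) / (4 * (real q * \<eta>)))"
      using conv_block_bound[OF sl int _ qp, where K="real k" and c="real q * (a1 + \<eta>)" and q=q] by (simp add: a1_def V_def b_def)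
    also have "\<dots> \<le> ennreal (real q * \<eta>)"
    proof (rule ennreal_leI)
      have "real q * a1 - real q * (a1 + \<eta>) + real q * \<eta> = 0" by (simp add: algebra_simps)
      then have "real q * b + ((real q * a1 - real q * (a1 + \<eta>) + real q * \<eta>)\<^sup>2 + real q * V) / (4 * (real q * \<eta>)) = real q * b + V / (4 * \<eta>)"
        using q by simp
      moreover have "V / (4 * \<eta>) \<le> real q * (\<eta> / 2)"
      proof -
        have "V / (2 * \<eta>\<^sup>2) \<le> real q" using q0 q by simp
        then have "V \<le> real q * (2 * \<eta>\<^sup>2)" using \<eta> by (subst (asm) pos_divide_le_eq) auto
        then have "V \<le> real q * (\<eta> / 2) * (4 * \<eta>)" by (simp add: power2_eq_square mult_ac)
        then show ?thesis using \<eta> by (subst pos_divide_le_eq) auto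
      qed
      moreover have "real q * b \<le> real q * (\<eta> / 2)" using k by (intro mult_left_mono) (auto simp: b_def)
      ultimately show "real q * b + ((real q * a1 - real q * (a1 + \<eta>) + real q * \<eta>)\<^sup>2 + real q * V) / (4 * (real q * \<eta>)) \<le> real q * \<eta>"
        by (simp add: algebra_simps)
    qed
    finally show "(\<integral>\<^sup>+g. ennreal (max 0 (lnorm g - real q * (measure_pmf.expectation \<kappa> lnorm + \<eta>))) \<partial>measure_pmf (conv_pow \<kappa> q)) \<le> ennreal (real q * \<eta>)" .
  qed
qed

end

section \<open>The skew product over the left walk\<close>

context ne_walk
begin

definition lw :: "(nat \<Rightarrow> nat) \<Rightarrow> nat \<Rightarrow> 'k mat2" where
  "lw \<omega> n = lwalk (\<lambda>i. incr (\<omega> i)) n"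

lemma lw_Suc: "lw \<omega> (Suc n) = mat2_mult (lw (\<lambda>i. \<omega> (Suc i)) n) (incr (\<omega> 0))"
  unfolding lw_def by (rule lwalk_front)

lemma lw_cong: "(\<And>i. i < n \<Longrightarrow> \<omega> i = \<omega>' i) \<Longrightarrow> lw \<omega> n = lw \<omega>' n"
  unfolding lw_def by (rule lwalk_cong) simp

lemma lw_semi: "lw \<omega> n \<in> semi"
proof (induction n)
  case (Suc n)
  have "incr (\<omega> n) \<in> semi" using supp_semi incr_supp by blast
  then show ?case using semi_mult[OF _ Suc] by (simp add: lw_def)
qed (simp add: semi_id lw_def)

lemma lw_SL2: "lw \<omega> n \<in> SL2"
  by (rule semi_SL2[OF lw_semi])

lemma lw_law: "(\<integral>\<^sup>+\<omega>. F (lw \<omega> n) \<partial>Om) = (\<integral>\<^sup>+g. F g \<partial>measure_pmf (conv_pow \<mu> n))"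
proof (induction n arbitrary: F)
  case 0
  show ?case using prob_space.emeasure_space_1[OF prob_space_Om] by (simp add: lw_def)
next
  case (Suc n)
  have "(\<integral>\<^sup>+\<omega>. F (lw \<omega> (Suc n)) \<partial>Om) = (\<integral>\<^sup>+i. \<integral>\<^sup>+\<omega>. F (lw (case_nat i \<omega>) (Suc n)) \<partial>Om \<partial>measure_pmf code)"
    by (rule nn_integral_Om_front, rule measurable_fin_dep[of "Suc n"], subst lw_cong) auto
  also have "\<dots> = (\<integral>\<^sup>+i. \<integral>\<^sup>+g. F (mat2_mult g (incr i)) \<partial>measure_pmf (conv_pow \<mu> n) \<partial>measure_pmf code)"
    unfolding lw_Suc using Suc[of "\<lambda>g. F (mat2_mult g (incr _))"] by simp
  also have "\<dots> = (\<integral>\<^sup>+h. \<integral>\<^sup>+g. F (mat2_mult g h) \<partial>measure_pmf (conv_pow \<mu> n) \<partial>measure_pmf (map_pmf incr code))"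
    by simp
  also have "\<dots> = (\<integral>\<^sup>+g. F g \<partial>measure_pmf (conv_pow \<mu> (Suc 0 + n)))"
    unfolding conv_pow_add conv_pow_1 map_incr_code by simp
  finally show ?case by simp
qed

lemma lw_measurable: "(\<lambda>\<omega>. lw \<omega> n) \<in> Om \<rightarrow>\<^sub>M count_space semi"
  by (rule measurable_fin_dep[of n]) (auto intro: lw_cong lw_semi)

lemma lw_measurable': "(\<lambda>\<omega>. lw \<omega> n) \<in> Om \<rightarrow>\<^sub>M measure_pmf (conv_pow \<mu> m)"
  by (rule measurable_fin_dep[of n]) (auto intro: lw_cong)

lemma distr_lw: "distr Om (measure_pmf (conv_pow \<mu> n)) (\<lambda>\<omega>. lw \<omega> n) = measure_pmf (conv_pow \<mu> n)"
proof (rule measure_eqI)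
  fix A :: "'k mat2 set"
  have "emeasure (distr Om (measure_pmf (conv_pow \<mu> n)) (\<lambda>\<omega>. lw \<omega> n)) A = (\<integral>\<^sup>+g. indicator A g \<partial>distr Om (measure_pmf (conv_pow \<mu> n)) (\<lambda>\<omega>. lw \<omega> n))"
    by simp
  also have "\<dots> = (\<integral>\<^sup>+\<omega>. indicator A (lw \<omega> n) \<partial>Om)" by (rule nn_integral_distr[OF lw_measurable']) simp
  also have "\<dots> = emeasure (measure_pmf (conv_pow \<mu> n)) A" unfolding lw_law by simp
  finally show "emeasure (distr Om (measure_pmf (conv_pow \<mu> n)) (\<lambda>\<omega>. lw \<omega> n)) A = emeasure (measure_pmf (conv_pow \<mu> n)) A" .
qed simp

lemma integral_lw: "(\<integral>\<omega>. (f (lw \<omega> n) :: real) \<partial>Om) = measure_pmf.expectation (conv_pow \<mu> n) f"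
  using integral_distr[OF lw_measurable'[of n n], of f] unfolding distr_lw by simp

lemma integrable_lw: "integrable Om (\<lambda>\<omega>. f (lw \<omega> n) :: real) \<longleftrightarrow> integrable (measure_pmf (conv_pow \<mu> n)) f"
  using integrable_distr_eq[OF lw_measurable'[of n n], of f] unfolding distr_lw by simp

definition MM :: "((nat \<Rightarrow> nat) \<times> ('k poly \<Rightarrow> real) option) measure" where
  "MM = Om \<Otimes>\<^sub>M nu"

text \<open>The shift of the increments combined with the action of the first one; Birkhoff sums of
  \<open>coc 1\<close> along it are the cocycle of the left walk
  (\<open>coc_birkhoff\<close>).\<close>

definition skew :: "(nat \<Rightarrow> nat) \<times> ('k poly \<Rightarrow> real) option \<Rightarrow> (nat \<Rightarrow> nat) \<times> ('k poly \<Rightarrow> real) option" where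
  "skew z = ((\<lambda>i. fst z (Suc i)), berk_act absv (incr (fst z 0)) (snd z))"

lemma pair_Om_nu: "pair_prob_space Om nu"
  using prob_space_Om prob_space_nu by (simp add: pair_prob_space_def pair_sigma_finite_def prob_space_imp_sigma_finite)

lemma prob_space_MM: "prob_space MM"
proof -
  interpret Q: pair_prob_space Om nu by (rule pair_Om_nu)
  show ?thesis unfolding MM_def by (rule Q.P.prob_space_axioms)
qed

lemma space_MM: "space MM = UNIV \<times> P1an absv"
  by (simp add: MM_def space_pair_measure)

lemma fst_MM: "fst \<in> MM \<rightarrow>\<^sub>M Om" and snd_MM: "snd \<in> MM \<rightarrow>\<^sub>M nu" and snd_MM': "snd \<in> MM \<rightarrow>\<^sub>M berk_borel absv"
proof -
  show "fst \<in> MM \<rightarrow>\<^sub>M Om" "snd \<in> MM \<rightarrow>\<^sub>M nu" unfolding MM_def by simp_all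
  then show "snd \<in> MM \<rightarrow>\<^sub>M berk_borel absv" using measurable_cong_sets[OF refl sets_nu] by blast
qed

lemma measurable_skew: "skew \<in> MM \<rightarrow>\<^sub>M MM"
proof -
  have sh: "(\<lambda>\<omega> i. \<omega> (Suc i)) \<in> Om \<rightarrow>\<^sub>M Om" unfolding Om_def
    by (rule measurable_PiM_single') (auto intro!: measurable_component_singleton)
  have 1: "(\<lambda>z. (\<lambda>i. fst z (Suc i))) \<in> MM \<rightarrow>\<^sub>M Om" by (rule measurable_compose[OF fst_MM sh])
  have c: "(\<lambda>z. fst z 0) \<in> MM \<rightarrow>\<^sub>M count_space UNIV" by (rule measurable_compose[OF fst_MM measurable_coord])
  have "(\<lambda>z. berk_act absv (incr (fst z 0)) (snd z)) \<in> MM \<rightarrow>\<^sub>M berk_borel absv"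
    by (rule measurable_compose_countable[OF measurable_compose[OF snd_MM' measurable_berk_act] c])
  then have 2: "(\<lambda>z. berk_act absv (incr (fst z 0)) (snd z)) \<in> MM \<rightarrow>\<^sub>M nu" using measurable_cong_sets[OF refl sets_nu] by blast
  have "(\<lambda>z. ((\<lambda>i. fst z (Suc i)), berk_act absv (incr (fst z 0)) (snd z))) \<in> MM \<rightarrow>\<^sub>M Om \<Otimes>\<^sub>M nu"
    using 1 2 by (rule measurable_Pair)
  then show ?thesis unfolding skew_def[abs_def] by (simp add: MM_def)
qed

lemma nu_stationary_nn:
  assumes F: "F \<in> borel_measurable nu"
  shows "(\<integral>\<^sup>+i. \<integral>\<^sup>+x. F (berk_act absv (incr i) x) \<partial>nu \<partial>measure_pmf code) = (\<integral>\<^sup>+x. F x \<partial>nu)"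
proof -
  have act_nu: "berk_act absv g \<in> nu \<rightarrow>\<^sub>M berk_borel absv" for g
    using measurable_berk_act measurable_cong_sets[OF sets_nu refl] by blast
  have F': "F \<in> borel_measurable (berk_borel absv)" using F measurable_cong_sets[OF sets_nu refl] by blast
  have ps: "prob_space (distr nu (berk_borel absv) (berk_act absv g))" for g
    by (rule prob_space.prob_space_distr[OF prob_space_nu act_nu])
  have K: "(\<lambda>g. distr nu (berk_borel absv) (berk_act absv g)) \<in> measure_pmf \<mu> \<rightarrow>\<^sub>M subprob_algebra (berk_borel absv)"
    using ps by (auto simp: space_subprob_algebra prob_space_imp_subprob_space)
  have "(\<integral>\<^sup>+x. F x \<partial>nu) = (\<integral>\<^sup>+g. \<integral>\<^sup>+x. F x \<partial>distr nu (berk_borel absv) (berk_act absv g) \<partial>measure_pmf \<mu>)"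
    by (subst nu_bind[symmetric], rule nn_integral_bind[OF F' K])
  also have "\<dots> = (\<integral>\<^sup>+g. \<integral>\<^sup>+x. F (berk_act absv g x) \<partial>nu \<partial>measure_pmf (map_pmf incr code))"
    unfolding map_incr_code using F' by (intro nn_integral_cong nn_integral_distr act_nu) simp
  finally show ?thesis by simp
qed

text \<open>The shifted increments again have law \<open>Om\<close> and are independent of the first
  increment; averaging over the latter, stationarity gives the moved point the law
  \<open>nu\<close>.\<close>

lemma distr_skew: "distr MM MM skew = MM"
proof (rule measure_eqI)
  interpret U: prob_space nu by (rule prob_space_nu)
  fix A assume "A \<in> sets (distr MM MM skew)"
  then have A: "A \<in> sets MM" by simp
  let ?F = "indicator A :: _ \<Rightarrow> ennreal"
  have F: "?F \<in> borel_measurable (Om \<Otimes>\<^sub>M nu)" using A by (simp add: MM_def)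
  have FT: "(\<lambda>z. ?F (skew z)) \<in> borel_measurable (Om \<Otimes>\<^sub>M nu)"
    using measurable_compose[OF measurable_skew, of ?F borel] F by (simp add: MM_def)
  have "emeasure (distr MM MM skew) A = (\<integral>\<^sup>+z. ?F z \<partial>distr MM MM skew)" using A by simp
  also have "\<dots> = (\<integral>\<^sup>+z. ?F (skew z) \<partial>(Om \<Otimes>\<^sub>M nu))"
    using nn_integral_distr[OF measurable_skew, of ?F] A by (simp add: MM_def)
  also have "\<dots> = (\<integral>\<^sup>+\<omega>. \<integral>\<^sup>+x. ?F (skew (\<omega>, x)) \<partial>nu \<partial>Om)" by (rule U.nn_integral_fst[OF FT, symmetric])
  also have "\<dots> = (\<integral>\<^sup>+i. \<integral>\<^sup>+\<omega>. \<integral>\<^sup>+x. ?F (skew (case_nat i \<omega>, x)) \<partial>nu \<partial>Om \<partial>measure_pmf code)"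
    by (rule nn_integral_Om_front) (rule U.borel_measurable_nn_integral_fst[OF FT])
  also have "\<dots> = (\<integral>\<^sup>+i. \<integral>\<^sup>+\<omega>. \<integral>\<^sup>+x. ?F (\<omega>, berk_act absv (incr i) x) \<partial>nu \<partial>Om \<partial>measure_pmf code)"
    by (simp add: skew_def)
  also have "\<dots> = (\<integral>\<^sup>+\<omega>. \<integral>\<^sup>+i. \<integral>\<^sup>+x. ?F (\<omega>, berk_act absv (incr i) x) \<partial>nu \<partial>measure_pmf code \<partial>Om)"
  proof (rule nn_integral_pmf_measure_swap)
    fix i
    have "berk_act absv (incr i) \<in> nu \<rightarrow>\<^sub>M nu"
      using measurable_berk_act measurable_cong_sets[OF sets_nu sets_nu] by blast
    then have "(\<lambda>z. (fst z, berk_act absv (incr i) (snd z))) \<in> Om \<Otimes>\<^sub>M nu \<rightarrow>\<^sub>M Om \<Otimes>\<^sub>M nu" by simp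
    from U.borel_measurable_nn_integral_fst[OF measurable_compose[OF this F]]
    show "(\<lambda>\<omega>. \<integral>\<^sup>+x. ?F (\<omega>, berk_act absv (incr i) x) \<partial>nu) \<in> borel_measurable Om" by simp
  qed
  also have "\<dots> = (\<integral>\<^sup>+\<omega>. \<integral>\<^sup>+x. ?F (\<omega>, x) \<partial>nu \<partial>Om)"
  proof (rule nn_integral_cong)
    fix \<omega> :: "nat \<Rightarrow> nat"
    have "(\<lambda>x. ?F (\<omega>, x)) \<in> borel_measurable nu" by (rule measurable_Pair2[OF F]) simp
    then show "(\<integral>\<^sup>+i. \<integral>\<^sup>+x. ?F (\<omega>, berk_act absv (incr i) x) \<partial>nu \<partial>measure_pmf code) = (\<integral>\<^sup>+x. ?F (\<omega>, x) \<partial>nu)"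
      by (rule nu_stationary_nn)
  qed
  also have "\<dots> = (\<integral>\<^sup>+z. ?F z \<partial>(Om \<Otimes>\<^sub>M nu))" by (rule U.nn_integral_fst[OF F])
  also have "\<dots> = emeasure MM A" using A by (simp add: MM_def)
  finally show "emeasure (distr MM MM skew) A = emeasure MM A" .
qed simp

definition coc :: "nat \<Rightarrow> (nat \<Rightarrow> nat) \<times> ('k poly \<Rightarrow> real) option \<Rightarrow> real" where
  "coc n z = sigma_coc absv (lw (fst z) n) (snd z)"

lemma coc_birkhoff: "x \<in> P1an absv \<Longrightarrow> (\<Sum>i<n. coc 1 ((skew ^^ i) (\<omega>, x))) = coc n (\<omega>, x)"
proof (induction n arbitrary: \<omega> x)
  case 0
  have "mat2_id \<in> SL2" using lw_SL2[of \<omega> 0] by (simp add: lw_def)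
  from abs_sigma_le[OF this 0] show ?case by (simp add: coc_def lw_def mat2_id_def)
next
  case (Suc n)
  have 1: "coc 1 (\<omega>, x) = sigma_coc absv (incr (\<omega> 0)) x" by (simp add: coc_def lw_def)
  have 2: "skew (\<omega>, x) = (\<lambda>i. \<omega> (Suc i), berk_act absv (incr (\<omega> 0)) x)" by (simp add: skew_def)
  show ?case unfolding birkhoff_sum_Suc 1 2 Suc.IH[OF berk_act_P1an[OF Suc.prems]]
    using Suc.prems by (simp add: coc_def lw_Suc sigma_cocycle lw_SL2)
qed

lemma coc_measurable: "coc n \<in> borel_measurable MM"
proof -
  have 1: "(\<lambda>z. sigma_coc absv g (snd z)) \<in> borel_measurable MM" if "g \<in> semi" for g
    by (rule measurable_compose[OF snd_MM' measurable_sigma_coc[OF semi_SL2[OF that]]])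
  have 2: "(\<lambda>z. lw (fst z) n) \<in> MM \<rightarrow>\<^sub>M count_space semi" by (rule measurable_compose[OF fst_MM lw_measurable])
  show ?thesis unfolding coc_def[abs_def] by (rule measurable_compose_countable'[OF 1 2 semi_countable])
qed

lemma
  assumes f: "integrable (measure_pmf (conv_pow \<mu> n)) f"
  shows integrable_lw_MM: "integrable MM (\<lambda>z. f (lw (fst z) n) :: real)"
    and integral_lw_MM: "(\<integral>z. f (lw (fst z) n) \<partial>MM) = measure_pmf.expectation (conv_pow \<mu> n) f"
proof -
  interpret U: prob_space nu by (rule prob_space_nu)
  have d: "distr MM Om fst = Om" unfolding MM_def by (rule U.distr_pair_fst)
  have i: "integrable Om (\<lambda>\<omega>. f (lw \<omega> n))" unfolding integrable_lw[of f n] by (rule f)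
  note m = borel_measurable_integrable[OF i]
  show "integrable MM (\<lambda>z. f (lw (fst z) n))" using integrable_distr_eq[OF fst_MM m] i by (simp add: d)
  show "(\<integral>z. f (lw (fst z) n) \<partial>MM) = measure_pmf.expectation (conv_pow \<mu> n) f"
    using integral_distr[OF fst_MM m] integral_lw[of f n] by (simp add: d)
qed

end

section \<open>Growth rate, positivity and convergence under a logarithmic moment\<close>

locale ne_walk_moment = ne_walk absv \<mu> for absv :: "'k::field \<Rightarrow> real" and \<mu> :: "'k mat2 pmf" +
  assumes moment: "integrable (measure_pmf \<mu>) lnorm"
begin

abbreviation an :: "nat \<Rightarrow> real" where "an n \<equiv> measure_pmf.expectation (conv_pow \<mu> n) lnorm"

lemma lnorm_nonneg_conv: "g \<in> set_pmf (conv_pow \<mu> n) \<Longrightarrow> 0 \<le> lnorm g"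
  using set_conv_pow_sub_SL2[OF sl] lnorm_nonneg by blast

text \<open>Subadditivity of \<open>lnorm\<close>. The extended integral is used because the bound
  is also what proves integrability for all convolution powers.\<close>

lemma nn_integral_an_le: "(\<integral>\<^sup>+g. ennreal (lnorm g) \<partial>measure_pmf (conv_pow \<mu> n)) \<le> ennreal (real n * an 1)"
proof (induction n)
  case 0
  show ?case by (simp add: mat2_id_def)
next
  case (Suc n)
  have a1: "(\<integral>\<^sup>+g. ennreal (lnorm g) \<partial>measure_pmf \<mu>) = ennreal (an 1)"
    using nn_integral_eq_integral[OF moment] lnorm_nonneg_conv[of _ 1] by (simp add: AE_measure_pmf_iff conv_pow_1 del: conv_pow.simps)
  have p: "0 \<le> an 1" by (rule integral_nonneg_AE) (simp add: AE_measure_pmf_iff lnorm_nonneg_conv del: conv_pow.simps One_nat_def)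
  have "(\<integral>\<^sup>+g. ennreal (lnorm g) \<partial>measure_pmf (conv_pow \<mu> (Suc n)))
    = (\<integral>\<^sup>+h. \<integral>\<^sup>+g. ennreal (lnorm (mat2_mult g h)) \<partial>measure_pmf \<mu> \<partial>measure_pmf (conv_pow \<mu> n))" by simp
  also have "\<dots> \<le> (\<integral>\<^sup>+h. \<integral>\<^sup>+g. ennreal (lnorm g) + ennreal (lnorm h) \<partial>measure_pmf \<mu> \<partial>measure_pmf (conv_pow \<mu> n))"
  proof (rule nn_integral_mono_AE, unfold AE_measure_pmf_iff, intro ballI, rule nn_integral_mono_AE, unfold AE_measure_pmf_iff, intro ballI)
    fix h g assume h: "h \<in> set_pmf (conv_pow \<mu> n)" and g: "g \<in> set_pmf \<mu>"
    have G: "g \<in> SL2" "h \<in> SL2" using h g sl set_conv_pow_sub_SL2[OF sl] by blast+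
    show "ennreal (lnorm (mat2_mult g h)) \<le> ennreal (lnorm g) + ennreal (lnorm h)"
      using lnorm_mult[OF G] lnorm_nonneg[OF G(1)] lnorm_nonneg[OF G(2)] by (simp add: ennreal_plus[symmetric] ennreal_leI del: ennreal_plus)
  qed
  also have "\<dots> = ennreal (an 1) + (\<integral>\<^sup>+h. ennreal (lnorm h) \<partial>measure_pmf (conv_pow \<mu> n))"
    by (simp add: nn_integral_add a1 del: conv_pow.simps One_nat_def)
  also have "\<dots> \<le> ennreal (an 1) + ennreal (real n * an 1)" by (intro add_left_mono Suc)
  also have "\<dots> = ennreal (real (Suc n) * an 1)" using p
    by (subst ennreal_plus[symmetric]) (auto simp: algebra_simps simp del: conv_pow.simps One_nat_def)
  finally show ?case .
qed

lemma integrable_conv: "integrable (measure_pmf (conv_pow \<mu> n)) lnorm"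
proof (rule integrableI_bounded)
  have "(\<integral>\<^sup>+g. ennreal (norm (lnorm g)) \<partial>measure_pmf (conv_pow \<mu> n)) = (\<integral>\<^sup>+g. ennreal (lnorm g) \<partial>measure_pmf (conv_pow \<mu> n))"
    by (rule nn_integral_cong_AE) (simp add: AE_measure_pmf_iff lnorm_nonneg_conv)
  also have "\<dots> < \<infinity>" using nn_integral_an_le[of n] by (simp add: le_less_trans)
  finally show "(\<integral>\<^sup>+g. ennreal (norm (lnorm g)) \<partial>measure_pmf (conv_pow \<mu> n)) < \<infinity>" .
qed simp

lemma an_nonneg: "0 \<le> an n"
  by (rule integral_nonneg_AE) (simp add: AE_measure_pmf_iff lnorm_nonneg_conv)

lemma nn_integral_an: "(\<integral>\<^sup>+g. ennreal (lnorm g) \<partial>measure_pmf (conv_pow \<mu> n)) = ennreal (an n)"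
  by (rule nn_integral_eq_integral[OF integrable_conv]) (simp add: AE_measure_pmf_iff lnorm_nonneg_conv)

lemma an_le: "an n \<le> real n * an 1"
  using nn_integral_an_le[of n] an_nonneg[of 1] unfolding nn_integral_an by (subst (asm) ennreal_le_iff) (auto simp del: conv_pow.simps One_nat_def)

lemma coc_le: "z \<in> space MM \<Longrightarrow> \<bar>coc n z\<bar> \<le> lnorm (lw (fst z) n)"
  unfolding coc_def by (rule abs_sigma_le[OF lw_SL2]) (auto simp: space_MM)

lemma integrable_coc: "integrable MM (coc n)"
proof (rule Bochner_Integration.integrable_bound[OF integrable_lw_MM[of n lnorm, OF integrable_conv] coc_measurable], rule AE_I2)
  fix z assume "z \<in> space MM"
  from coc_le[OF this, of n] show "norm (coc n z) \<le> norm (lnorm (lw (fst z) n))" by simp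
qed

text \<open>The mean of the cocycle; that it is the growth rate of the mean log norm is
  \<open>an_limit\<close>.\<close>

definition lyap :: real where "lyap = (\<integral>z. coc 1 z \<partial>MM)"

lemma integral_coc: "(\<integral>z. coc n z \<partial>MM) = real n * lyap"
proof -
  have Tn: "(\<lambda>z. (skew ^^ i) z) \<in> MM \<rightarrow>\<^sub>M MM" for i
    by (induction i) (auto intro: measurable_compose[OF _ measurable_skew])
  have c1: "integrable MM (\<lambda>z. coc 1 ((skew ^^ i) z)) \<and> (\<integral>z. coc 1 ((skew ^^ i) z) \<partial>MM) = lyap" for i
  proof (induction i)
    case (Suc i)
    have m: "(\<lambda>z. coc 1 ((skew ^^ i) z)) \<in> borel_measurable MM" using Suc borel_measurable_integrable by blast
    show ?case
      using integral_measure_preserving[OF measurable_skew distr_skew m]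
        integrable_measure_preserving[OF measurable_skew distr_skew conjunct1[OF Suc]] Suc
      by (simp add: funpow_swap1 del: One_nat_def)
  qed (simp add: lyap_def integrable_coc del: One_nat_def)
  have "(\<integral>z. coc n z \<partial>MM) = (\<integral>z. (\<Sum>i<n. coc 1 ((skew ^^ i) z)) \<partial>MM)"
  proof (rule Bochner_Integration.integral_cong[OF refl])
    fix z assume "z \<in> space MM"
    then have "(\<Sum>i<n. coc 1 ((skew ^^ i) (fst z, snd z))) = coc n (fst z, snd z)" by (intro coc_birkhoff) (auto simp: space_MM)
    then show "coc n z = (\<Sum>i<n. coc 1 ((skew ^^ i) z))" by simp
  qed
  also have "\<dots> = (\<Sum>i<n. \<integral>z. coc 1 ((skew ^^ i) z) \<partial>MM)"
    by (rule Bochner_Integration.integral_sum) (use c1 in blast)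
  also have "\<dots> = real n * lyap" using c1 by (simp del: One_nat_def)
  finally show ?thesis .
qed

definition psi :: "nat \<Rightarrow> ('k poly \<Rightarrow> real) option \<Rightarrow> real" where
  "psi n x = measure_pmf.expectation (conv_pow \<mu> n) (\<lambda>g. sigma_coc absv g x)"

lemma integral_psi: "(\<integral>x. psi n x \<partial>nu) = real n * lyap" and integrable_psi: "integrable nu (psi n)"
proof -
  interpret P: pair_prob_space Om nu by (rule pair_Om_nu)
  have c: "integrable (Om \<Otimes>\<^sub>M nu) (\<lambda>(\<omega>, x). coc n (\<omega>, x))" using integrable_coc[of n] by (simp add: MM_def)
  have psi: "psi n = (\<lambda>x. \<integral>\<omega>. coc n (\<omega>, x) \<partial>Om)"
  proof
    fix x show "psi n x = (\<integral>\<omega>. coc n (\<omega>, x) \<partial>Om)"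
      unfolding psi_def coc_def using integral_lw[of "\<lambda>g. sigma_coc absv g x" n] by simp
  qed
  show "integrable nu (psi n)" using P.integrable_snd[OF c] by (simp add: psi)
  show "(\<integral>x. psi n x \<partial>nu) = real n * lyap"
    unfolding psi using P.integral_snd[OF c] integral_coc[of n] by (simp add: MM_def)
qed

end

context nonarch_field
begin

lemma sigma_pt_sum:
  assumes g: "g \<in> SL2" and uv: "u \<noteq> (0,0)" "v \<noteq> (0,0)" "0 < chord u v"
  shows "sigma_coc absv g (pt u) + sigma_coc absv g (pt v) = ln (chord u v) - ln (chord (mv g u) (mv g v))"
    and "0 < chord (mv g u) (mv g v)"
proof -
  have w: "0 < absv (wedge u v)" using uv by (simp add: chord_def zero_less_divide_iff zero_less_mult_iff)
  have p: "0 < vn u" "0 < vn v" "0 < vn (mv g u)" "0 < vn (mv g v)" using uv g by simp_all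
  have s: "sigma_coc absv g (pt a) = ln (vn (mv g a)) - ln (vn a)" if "a \<noteq> (0,0)" for a
    using that g by (simp add: sigma_eq_ln_dil bnorm_pt dil_pnorm ln_div del: pt.simps)
  show "0 < chord (mv g u) (mv g v)" unfolding chord_mv_eq[OF g] using w p by simp
  show "sigma_coc absv g (pt u) + sigma_coc absv g (pt v) = ln (chord u v) - ln (chord (mv g u) (mv g v))"
    unfolding s[OF uv(1)] s[OF uv(2)] chord_mv_eq[OF g] chord_def[of u v] using w p by (simp add: ln_div ln_mult)
qed

end

context ne_walk_moment
begin

lemma nu_P1an: "measure nu (P1an absv) = 1"
  using prob_space.prob_space[OF prob_space_nu] by simp

lemma bal_P1an: "bal w m \<inter> P1an absv = bal w m"
  by (auto simp: bal_def)

lemma lyap_le_an: "real n * lyap \<le> an n"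
proof -
  have "(\<integral>z. coc n z \<partial>MM) \<le> (\<integral>z. lnorm (lw (fst z) n) \<partial>MM)"
  proof (rule integral_mono[OF integrable_coc integrable_lw_MM[OF integrable_conv]])
    fix z assume "z \<in> space MM"
    from coc_le[OF this, of n] show "coc n z \<le> lnorm (lw (fst z) n)" by simp
  qed
  then show ?thesis by (simp add: integral_coc integral_lw_MM[of n lnorm, OF integrable_conv])
qed

lemma integrable_sigma_nu: "g \<in> SL2 \<Longrightarrow> integrable nu (sigma_coc absv g)"
proof -
  interpret U: prob_space nu by (rule prob_space_nu)
  assume g: "g \<in> SL2"
  have "sigma_coc absv g \<in> borel_measurable nu" using measurable_sigma_coc[OF g] measurable_cong_sets[OF sets_nu refl] by blast
  then show ?thesis using abs_sigma_le[OF g] by (intro U.integrable_const_bound[where B="lnorm g"] AE_I2) auto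
qed

text \<open>The ball of \<open>sigma_ge_off_ball\<close> depends on the random product, but the
  point is independent of it and every ball of this radius has mass at most \<tau>. Integrating over
  the point first therefore costs only \<open>2 * \<tau>\<close> times the log norm.\<close>

lemma an_le_lyap:
  assumes \<tau>: "0 < \<tau>"
  shows "\<exists>C. \<forall>n. an n \<le> real n * lyap + C + 2 * \<tau> * an n"
proof -
  interpret P: pair_prob_space Om nu by (rule pair_Om_nu)
  obtain m where m: "\<And>w. w \<noteq> (0,0) \<Longrightarrow> measure nu (bal w m) \<le> \<tau>" using nu_unif_nonatomic[OF \<tau>] by blast
  let ?C = "ln (real (Suc m))"
  have "an n \<le> real n * lyap + ?C + 2 * \<tau> * an n" for n
  proof -
    let ?h = "\<lambda>\<omega> x. lnorm (lw \<omega> n) - sigma_coc absv (lw \<omega> n) x"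
    have Li: "integrable Om (\<lambda>\<omega>. lnorm (lw \<omega> n))" unfolding integrable_lw[of lnorm n] by (rule integrable_conv)
    have hi: "integrable (Om \<Otimes>\<^sub>M nu) (\<lambda>(\<omega>, x). ?h \<omega> x)"
      using Bochner_Integration.integrable_diff[OF integrable_lw_MM[of n lnorm, OF integrable_conv] integrable_coc[of n]]
      by (simp add: MM_def coc_def case_prod_unfold)
    have "an n - real n * lyap = (\<integral>z. lnorm (lw (fst z) n) - coc n z \<partial>MM)"
      using integrable_lw_MM[of n lnorm, OF integrable_conv] integrable_coc[of n]
      by (simp add: integral_coc integral_lw_MM[of n lnorm, OF integrable_conv])
    also have "\<dots> = (\<integral>\<omega>. \<integral>x. ?h \<omega> x \<partial>nu \<partial>Om)"
      using P.integral_fst[OF hi] by (simp add: MM_def coc_def case_prod_unfold)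
    also have "\<dots> \<le> (\<integral>\<omega>. ?C + 2 * \<tau> * lnorm (lw \<omega> n) \<partial>Om)"
    proof (rule integral_mono)
      show "integrable Om (\<lambda>\<omega>. \<integral>x. ?h \<omega> x \<partial>nu)" using P.integrable_fst[OF hi] by simp
      show "integrable Om (\<lambda>\<omega>. ?C + 2 * \<tau> * lnorm (lw \<omega> n))" using Li by simp
      fix \<omega> :: "nat \<Rightarrow> nat"
      let ?g = "lw \<omega> n"
      have g: "?g \<in> SL2" by (rule lw_SL2)
      obtain u where u: "u \<noteq> (0,0)" "\<forall>x\<in>P1an absv. lnorm ?g - sigma_coc absv ?g x \<le> ?C + 2 * lnorm ?g * indicator (bal u m) x"
        using sigma_ge_off_ball[OF g, of m] by blast
      have b: "bal u m \<in> sets nu" using bal_borel by (simp add: sets_nu)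
      have bi: "integrable nu (indicat_real (bal u m))" using b by (simp add: P.M2.emeasure_eq_measure)
      have "(\<integral>x. ?h \<omega> x \<partial>nu) \<le> (\<integral>x. ?C + 2 * lnorm ?g * indicator (bal u m) x \<partial>nu)"
        using integrable_sigma_nu[OF g] bi u(2) by (intro integral_mono) (auto simp del: of_nat_Suc)
      also have "\<dots> = ?C + 2 * lnorm ?g * measure nu (bal u m)"
        using bi bal_P1an nu_P1an by (simp del: of_nat_Suc)
      also have "\<dots> \<le> ?C + 2 * lnorm ?g * \<tau>"
        using m[OF u(1)] lnorm_nonneg[OF g] by (intro add_left_mono mult_left_mono) auto
      finally show "(\<integral>x. ?h \<omega> x \<partial>nu) \<le> ?C + 2 * \<tau> * lnorm (lw \<omega> n)" by (simp add: mult_ac del: of_nat_Suc)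
    qed
    also have "\<dots> = ?C + 2 * \<tau> * an n"
      using Li integral_lw[of lnorm n] P.M1.prob_space by (simp del: of_nat_Suc)
    finally show ?thesis by simp
  qed
  then show ?thesis by blast
qed

lemma an_limit: "(\<lambda>n. (1 / real n) * an n) \<longlonglongrightarrow> lyap"
proof (rule LIMSEQ_I)
  fix r :: real assume r: "0 < r"
  \<comment> \<open>Since \<open>an n\<close> is at most \<open>n\<close> times \<open>an 1\<close>,
    the error term stays below \<open>3 r n / 4\<close>, leaving \<open>r n / 4\<close> for the
    constant \<open>C\<close>.\<close>
  define \<tau> where "\<tau> = r / (4 * (an 1 + 1))"
  have a1: "0 \<le> an 1" by (rule an_nonneg)
  have \<tau>: "0 < \<tau>" "2 * \<tau> * an 1 < r / 2 + r / 4" using r a1 unfolding \<tau>_def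
    by (simp_all add: field_simps del: conv_pow.simps One_nat_def) (smt (verit) mult_nonneg_nonneg)
  obtain C where C: "\<And>n. an n \<le> real n * lyap + C + 2 * \<tau> * an n" using an_le_lyap[OF \<tau>(1)] by blast
  obtain N :: nat where N: "4 * \<bar>C\<bar> / r < real N" using reals_Archimedean2 by blast
  show "\<exists>N. \<forall>n\<ge>N. norm ((1 / real n) * an n - lyap) < r"
  proof (intro exI[of _ "max 1 N"] allI impI)
    fix n assume n: "max 1 N \<le> n"
    have np: "0 < real n" using n by simp
    have "4 * \<bar>C\<bar> / r < real n" using N n by simp
    then have Cn: "\<bar>C\<bar> < real n * (r / 4)" using r by (simp add: field_simps)
    have "2 * \<tau> * an n \<le> 2 * \<tau> * (real n * an 1)" using an_le[of n] \<tau>(1) by (intro mult_left_mono) auto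
    also have "\<dots> = real n * (2 * \<tau> * an 1)" by (simp add: mult_ac del: conv_pow.simps One_nat_def)
    also have "\<dots> < real n * (r / 2 + r / 4)" using \<tau>(2) np by (intro mult_strict_left_mono) auto
    finally have "an n - real n * lyap < real n * (r / 2 + r / 4) + real n * (r / 4)" using C[of n] Cn by linarith
    also have "\<dots> = real n * r" by (simp add: algebra_simps)
    finally have "(an n - real n * lyap) / real n < r" using np by (simp add: pos_divide_less_eq mult.commute)
    moreover have "0 \<le> (an n - real n * lyap) / real n" using lyap_le_an[of n] by simp
    moreover have "(1 / real n) * an n - lyap = (an n - real n * lyap) / real n" using np by (simp add: field_simps)
    ultimately show "norm ((1 / real n) * an n - lyap) < r" by simp
  qed
qed

lemma integrable_sigma_conv:
  assumes x: "x \<in> P1an absv"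
  shows "integrable (measure_pmf (conv_pow \<mu> n)) (\<lambda>g. sigma_coc absv g x)"
proof (rule Bochner_Integration.integrable_bound[OF integrable_conv[of n]])
  show "AE g in measure_pmf (conv_pow \<mu> n). norm (sigma_coc absv g x) \<le> norm (lnorm g)"
    unfolding AE_measure_pmf_iff
  proof
    fix g assume "g \<in> set_pmf (conv_pow \<mu> n)"
    then have "g \<in> SL2" using set_conv_pow_sub_SL2[OF sl] by blast
    from abs_sigma_le[OF this x] show "norm (sigma_coc absv g x) \<le> norm (lnorm g)" by simp
  qed
qed simp

lemma psi_ge: "x \<in> P1an absv \<Longrightarrow> - an n \<le> psi n x"
proof -
  assume x: "x \<in> P1an absv"
  have "measure_pmf.expectation (conv_pow \<mu> n) (\<lambda>g. - lnorm g) \<le> psi n x" unfolding psi_def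
  proof (rule integral_mono_AE)
    show "AE g in measure_pmf (conv_pow \<mu> n). - lnorm g \<le> sigma_coc absv g x" unfolding AE_measure_pmf_iff
    proof
      fix g assume "g \<in> set_pmf (conv_pow \<mu> n)"
      then have "g \<in> SL2" using set_conv_pow_sub_SL2[OF sl] by blast
      from abs_sigma_le[OF this x] show "- lnorm g \<le> sigma_coc absv g x" by simp
    qed
  qed (use integrable_conv integrable_sigma_conv[OF x] in simp_all)
  then show ?thesis by simp
qed

text \<open>Contraction brings two separated points close together with probability at least 1/2,
  which by \<open>sigma_pt_sum\<close> makes the sum of their cocycles large; on the exceptional
  event the sum is still at least \<open>ln (chord u v)\<close>.\<close>

lemma psi_sum:
  "\<exists>m n. (\<forall>w. w \<noteq> (0,0) \<longrightarrow> measure nu (bal w m) \<le> 1/2) \<and>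
    (\<forall>u v. u \<noteq> (0,0) \<longrightarrow> v \<noteq> (0,0) \<longrightarrow> inverse (real (Suc m)) \<le> chord u v \<longrightarrow> 2 \<le> psi n (pt u) + psi n (pt v))"
proof -
  obtain m where m: "\<And>w. w \<noteq> (0,0) \<Longrightarrow> measure nu (bal w m) \<le> 1/2" using nu_unif_nonatomic[of "1/2"] by auto
  \<comment> \<open>A gain of \<open>2 * K\<close> on an event of probability at least 1/2 has mean
    at least \<open>K\<close>; subtracting the possible loss \<open>ln (real (Suc m))\<close> leaves
    2.\<close>
  define K where "K = 2 + ln (real (Suc m))"
  have K: "0 \<le> K" unfolding K_def by simp
  obtain n where n: "\<And>x v. x \<in> P1an absv \<Longrightarrow> v \<noteq> (0,0) \<Longrightarrow>
     measure_pmf.prob (conv_pow \<mu> n) {g. exp (- (2 * K)) \<le> delta (berk_act absv g x) (mv g v)} \<le> 1/2"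
  proof -
    have "\<exists>n0. \<forall>n x v. n0 \<le> n \<longrightarrow> x \<in> P1an absv \<longrightarrow> v \<noteq> (0,0) \<longrightarrow>
     measure_pmf.prob (conv_pow \<mu> n) {g. exp (- (2 * K)) \<le> delta (berk_act absv g x) (mv g v)} \<le> 1/2"
      by (rule contraction) simp_all
    then show thesis using that by blast
  qed
  have "2 \<le> psi n (pt u) + psi n (pt v)"
    if u: "u \<noteq> (0,0)" and v: "v \<noteq> (0,0)" and c: "inverse (real (Suc m)) \<le> chord u v" for u v
  proof -
    let ?M = "measure_pmf (conv_pow \<mu> n)"
    let ?E = "{g. exp (- (2 * K)) \<le> delta (berk_act absv g (pt u)) (mv g v)}"
    have c0: "0 < chord u v" using c by (rule less_le_trans[rotated]) simp
    have lc: "- ln (real (Suc m)) \<le> ln (chord u v)"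
      using ln_mono[OF c] by (simp add: ln_inverse del: of_nat_Suc)
    have pE: "measure ?M ?E \<le> 1/2" by (rule n[OF pt_P1an v])
    have ei: "integrable ?M (indicat_real ?E)" by (simp add: measure_pmf.emeasure_eq_measure)
    have "2 \<le> - ln (real (Suc m)) + 2 * K - 2 * K * measure ?M ?E"
    proof -
      have "2 * K * measure ?M ?E \<le> 2 * K * (1/2)" using pE K by (intro mult_left_mono) auto
      moreover have "- ln (real (Suc m)) = 2 - K" unfolding K_def by simp
      ultimately show ?thesis by linarith
    qed
    also have "\<dots> = (\<integral>g. - ln (real (Suc m)) + 2 * K - 2 * K * indicator ?E g \<partial>?M)"
      using ei by (simp del: of_nat_Suc)
    also have "\<dots> \<le> (\<integral>g. sigma_coc absv g (pt u) + sigma_coc absv g (pt v) \<partial>?M)"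
    proof (rule integral_mono_AE)
      show "AE g in ?M. - ln (real (Suc m)) + 2 * K - 2 * K * indicator ?E g \<le> sigma_coc absv g (pt u) + sigma_coc absv g (pt v)"
        unfolding AE_measure_pmf_iff
      proof
        fix g assume "g \<in> set_pmf (conv_pow \<mu> n)"
        then have g: "g \<in> SL2" using set_conv_pow_sub_SL2[OF sl] by blast
        have pos: "0 < chord (mv g u) (mv g v)" by (rule sigma_pt_sum(2)[OF g u v c0])
        have d: "delta (berk_act absv g (pt u)) (mv g v) = chord (mv g u) (mv g v)"
          using g u by (simp add: berk_act_pt delta_pt del: pt.simps)
        have "2 * K - 2 * K * indicator ?E g \<le> - ln (chord (mv g u) (mv g v))"
        proof (cases "g \<in> ?E")
          case True
          have "ln (chord (mv g u) (mv g v)) \<le> 0" using pos by simp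
          then show ?thesis using True by simp
        next
          case False
          then have "chord (mv g u) (mv g v) \<le> exp (- (2 * K))" by (simp add: d)
          then have "ln (chord (mv g u) (mv g v)) \<le> ln (exp (- (2 * K)))" using pos by (intro ln_mono) auto
          then show ?thesis using False by simp
        qed
        then show "- ln (real (Suc m)) + 2 * K - 2 * K * indicator ?E g \<le> sigma_coc absv g (pt u) + sigma_coc absv g (pt v)"
          unfolding sigma_pt_sum(1)[OF g u v c0] using lc by linarith
      qed
    qed (use ei integrable_sigma_conv[OF pt_P1an] in \<open>simp_all del: pt.simps of_nat_Suc\<close>)
    also have "\<dots> = psi n (pt u) + psi n (pt v)"
      unfolding psi_def by (rule Bochner_Integration.integral_add[OF integrable_sigma_conv[OF pt_P1an] integrable_sigma_conv[OF pt_P1an]])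
    finally show ?thesis .
  qed
  then show ?thesis using m by blast
qed

text \<open>\<open>psi n\<close> can only be small on one ball of mass at most \<open>1/2\<close>, and it is large by the same amount
  on the complement of that ball.\<close>

lemma lyap_pos: "0 < lyap"
proof -
  interpret U: prob_space nu by (rule prob_space_nu)
  obtain m n where m: "\<forall>w. w \<noteq> (0,0) \<longrightarrow> measure nu (bal w m) \<le> 1/2"
    and n: "\<forall>u v. u \<noteq> (0,0) \<longrightarrow> v \<noteq> (0,0) \<longrightarrow> inverse (real (Suc m)) \<le> chord u v \<longrightarrow> 2 \<le> psi n (pt u) + psi n (pt v)"
    using psi_sum by (elim exE conjE)
  have "1 \<le> (\<integral>x. psi n x \<partial>nu)"
  proof (cases "\<forall>u. u \<noteq> (0,0) \<longrightarrow> 1 \<le> psi n (pt u)")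
    case True
    have "(\<integral>x. 1 \<partial>nu) \<le> (\<integral>x. psi n x \<partial>nu)"
    proof (rule integral_mono_AE)
      show "AE x in nu. 1 \<le> psi n x" using nu_P1k
      proof eventually_elim
        case (elim x)
        then obtain v where "v \<noteq> (0,0)" "x = pt v" using P1k_pt by blast
        then show ?case using True by blast
      qed
    qed (use integrable_psi in simp_all)
    then show ?thesis by (simp add: nu_P1an)
  next
    case False
    then obtain u0 where u0: "u0 \<noteq> (0,0)" "psi n (pt u0) < 1" by (auto simp: not_le simp del: pt.simps)
    let ?B = "bal u0 m"
    \<comment> \<open>\<open>s\<close> is the worst deficit of \<open>psi n\<close> below 1 over the
      \<open>k\<close>-points of the ball. A \<open>k\<close>-point outside is at distance at least
      \<open>1/(m+1)\<close> from each of them, so there \<open>psi n\<close> exceeds 1 by at least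
      \<open>s\<close>.\<close>
    define R where "R = {1 - psi n (pt u) | u. u \<noteq> (0,0) \<and> pt u \<in> ?B}"
    define s where "s = Sup R"
    have inB: "pt u \<in> ?B \<longleftrightarrow> chord u u0 < inverse (real (Suc m))" if "u \<noteq> (0,0)" for u
      using that by (simp add: bal_def delta_pt del: pt.simps of_nat_Suc)
    have bdd: "bdd_above R"
    proof (rule bdd_aboveI)
      fix r assume "r \<in> R"
      then obtain u where "r = 1 - psi n (pt u)" unfolding R_def by blast
      then show "r \<le> 1 + an n" using psi_ge[of "pt u" n] pt_P1an by (simp del: pt.simps)
    qed
    have u0R: "1 - psi n (pt u0) \<in> R" unfolding R_def using u0(1) pt_in_bal[OF u0(1), of m] by blast
    have s0: "0 < s" using cSup_upper[OF u0R bdd] u0(2) unfolding s_def by linarith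
    have inside: "1 - s \<le> psi n (pt u)" if "u \<noteq> (0,0)" "pt u \<in> ?B" for u
    proof -
      have "1 - psi n (pt u) \<in> R" unfolding R_def using that by blast
      from cSup_upper[OF this bdd] show ?thesis unfolding s_def by linarith
    qed
    have outside: "1 + s \<le> psi n (pt v)" if v: "v \<noteq> (0,0)" "pt v \<notin> ?B" for v
    proof -
      have "s \<le> psi n (pt v) - 1" unfolding s_def
      proof (rule cSup_least)
        show "R \<noteq> {}" using u0R by blast
        fix r assume "r \<in> R"
        then obtain u where u: "u \<noteq> (0,0)" "pt u \<in> ?B" "r = 1 - psi n (pt u)" unfolding R_def by blast
        have "chord v u0 \<le> max (chord v u) (chord u u0)" by (rule chord_ultra[OF v(1) u(1) u0(1)])
        then have "inverse (real (Suc m)) \<le> chord u v"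
          using v(2) u(2) unfolding inB[OF v(1)] inB[OF u(1)] chord_commute[of v u] by linarith
        from n[rule_format, OF u(1) v(1) this] show "r \<le> psi n (pt v) - 1" unfolding u(3) by linarith
      qed
      then show ?thesis by linarith
    qed
    have b: "?B \<in> sets nu" using bal_borel by (simp add: sets_nu)
    have bi: "integrable nu (indicat_real ?B)" using b by (simp add: U.emeasure_eq_measure)
    have "1 \<le> 1 + s - 2 * s * measure nu ?B"
    proof -
      have "2 * s * measure nu ?B \<le> 2 * s * (1/2)" using m[rule_format, OF u0(1)] s0 by (intro mult_left_mono) auto
      then show ?thesis by simp
    qed
    also have "\<dots> = (\<integral>x. 1 + s - 2 * s * indicator ?B x \<partial>nu)" using bi bal_P1an nu_P1an by simp
    also have "\<dots> \<le> (\<integral>x. psi n x \<partial>nu)"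
    proof (rule integral_mono_AE)
      show "AE x in nu. 1 + s - 2 * s * indicator ?B x \<le> psi n x" using nu_P1k
      proof eventually_elim
        case (elim x)
        then obtain v where v: "v \<noteq> (0,0)" "x = pt v" using P1k_pt by blast
        show ?case using inside[OF v(1)] outside[OF v(1)] unfolding v(2) by (cases "pt v \<in> ?B") (simp_all del: pt.simps)
      qed
    qed (use integrable_psi bi in simp_all)
    finally show ?thesis .
  qed
  then have "1 \<le> real n * lyap" by (simp add: integral_psi)
  then have "0 < real n * lyap" by linarith
  then show ?thesis by (simp add: zero_less_mult_iff)
qed

text \<open>Cut the walk into independent blocks of a length \<open>m\<close> at which
  \<open>an m / m\<close> is already close to \<open>lyap\<close>: \<open>conv_block_LLN\<close>
  controls the whole blocks. The remainder, shorter than \<open>m\<close>, contributes at most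
  \<open>m\<close> times \<open>an 1\<close>, which is small against
  \<open>n \<eta>\<close>.\<close>

lemma excess_bound:
  assumes \<eta>: "0 < \<eta>"
  shows "\<exists>N. \<forall>n\<ge>N. measure_pmf.expectation (conv_pow \<mu> n) (\<lambda>g. max 0 (lnorm g - real n * (lyap + 2 * \<eta>))) \<le> 2 * real n * \<eta>"
proof -
  have "eventually (\<lambda>n. (1 / real n) * an n < lyap + \<eta>) sequentially"
    by (rule order_tendstoD(2)[OF an_limit]) (use \<eta> in simp)
  then have "eventually (\<lambda>n. (1 / real n) * an n < lyap + \<eta> \<and> 1 \<le> n) sequentially"
    using eventually_ge_at_top[of 1] by (rule eventually_conj)
  from eventually_happens'[OF sequentially_bot this]
  obtain m where m: "(1 / real m) * an m < lyap + \<eta>" "1 \<le> m" by (elim exE conjE)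
  have am: "an m \<le> real m * (lyap + \<eta>)" using m by (simp add: field_simps)
  let ?\<kappa> = "conv_pow \<mu> m"
  have "0 < real m * \<eta>" using m \<eta> by simp
  from conv_block_LLN[OF set_conv_pow_sub_SL2[OF sl, of m] integrable_conv this]
  obtain q0 where q0: "\<And>q. q0 \<le> q \<Longrightarrow> (\<integral>\<^sup>+g. ennreal (max 0 (lnorm g - real q * (an m + real m * \<eta>))) \<partial>measure_pmf (conv_pow \<mu> (m * q)))
     \<le> ennreal (real q * (real m * \<eta>))" unfolding conv_pow_mult by blast
  obtain N1 :: nat where N1: "real m * an 1 / \<eta> < real N1" using reals_Archimedean2 by blast
  show ?thesis
  proof (intro exI[of _ "max N1 (m * q0)"] allI impI)
    fix n assume n: "max N1 (m * q0) \<le> n"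
    define q r where "q = n div m" and "r = n mod m"
    have nqr: "n = m * q + r" "r < m" unfolding q_def r_def using m by auto
    have q: "q0 \<le> q" unfolding q_def using n m by (simp add: less_eq_div_iff_mult_less_eq mult.commute)
    have le: "real q * (an m + real m * \<eta>) \<le> real n * (lyap + 2 * \<eta>)"
    proof -
      have "real q * (an m + real m * \<eta>) \<le> real q * (real m * (lyap + \<eta>) + real m * \<eta>)" using am by (intro mult_left_mono) auto
      also have "\<dots> = real (m * q) * (lyap + 2 * \<eta>)" by (simp add: algebra_simps)
      also have "\<dots> \<le> real n * (lyap + 2 * \<eta>)" using lyap_pos \<eta> nqr by (intro mult_right_mono) auto
      finally show ?thesis .
    qed
    let ?f = "\<lambda>g. max 0 (lnorm g - real n * (lyap + 2 * \<eta>))"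
    let ?k = "\<lambda>h. max 0 (lnorm h - real q * (an m + real m * \<eta>))"
    have "(\<integral>\<^sup>+g. ennreal (?f g) \<partial>measure_pmf (conv_pow \<mu> n))
      = (\<integral>\<^sup>+h. \<integral>\<^sup>+g. ennreal (?f (mat2_mult g h)) \<partial>measure_pmf (conv_pow \<mu> r) \<partial>measure_pmf (conv_pow \<mu> (m * q)))"
      unfolding nqr(1) conv_pow_add by simp
    also have "\<dots> \<le> (\<integral>\<^sup>+h. \<integral>\<^sup>+g. ennreal (?k h) + ennreal (lnorm g) \<partial>measure_pmf (conv_pow \<mu> r) \<partial>measure_pmf (conv_pow \<mu> (m * q)))"
    proof (rule nn_integral_mono_AE, unfold AE_measure_pmf_iff, intro ballI, rule nn_integral_mono_AE, unfold AE_measure_pmf_iff, intro ballI)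
      fix h g assume "h \<in> set_pmf (conv_pow \<mu> (m * q))" "g \<in> set_pmf (conv_pow \<mu> r)"
      then have G: "g \<in> SL2" "h \<in> SL2" using set_conv_pow_sub_SL2[OF sl] by blast+
      have "?f (mat2_mult g h) \<le> ?k h + lnorm g"
        using lnorm_mult[OF G] lnorm_nonneg[OF G(1)] le by linarith
      then show "ennreal (?f (mat2_mult g h)) \<le> ennreal (?k h) + ennreal (lnorm g)"
        using lnorm_nonneg[OF G(1)] by (simp only: ennreal_plus[symmetric] max.cobounded1 ennreal_leI)
    qed
    also have "\<dots> = (\<integral>\<^sup>+h. ennreal (?k h) \<partial>measure_pmf (conv_pow \<mu> (m * q))) + ennreal (an r)"
      by (simp add: nn_integral_add nn_integral_an)
    also have "\<dots> \<le> ennreal (real q * (real m * \<eta>)) + ennreal (an r)" by (intro add_right_mono q0 q)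
    also have "\<dots> = ennreal (real q * (real m * \<eta>) + an r)" using \<eta> an_nonneg[of r] by (intro ennreal_plus[symmetric]) auto
    finally have nn: "(\<integral>\<^sup>+g. ennreal (?f g) \<partial>measure_pmf (conv_pow \<mu> n)) \<le> ennreal (real q * (real m * \<eta>) + an r)" .
    have fi: "integrable (measure_pmf (conv_pow \<mu> n)) ?f" using integrable_conv[of n] by simp
    have nn2: "(\<integral>\<^sup>+g. ennreal (?f g) \<partial>measure_pmf (conv_pow \<mu> n)) = ennreal (measure_pmf.expectation (conv_pow \<mu> n) ?f)"
      by (rule nn_integral_eq_integral[OF fi]) simp
    have pos: "0 \<le> real q * (real m * \<eta>) + an r" using \<eta> an_nonneg[of r] by simp
    have "measure_pmf.expectation (conv_pow \<mu> n) ?f \<le> real q * (real m * \<eta>) + an r"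
      using nn unfolding nn2 ennreal_le_iff[OF pos] .
    also have "\<dots> \<le> real n * \<eta> + real n * \<eta>"
    proof (rule add_mono)
      have "real q * (real m * \<eta>) = real (m * q) * \<eta>" by simp
      also have "\<dots> \<le> real n * \<eta>" using nqr \<eta> by (intro mult_right_mono) auto
      finally show "real q * (real m * \<eta>) \<le> real n * \<eta>" .
      have "real m * an 1 / \<eta> < real n" using N1 n by simp
      then have "real m * an 1 \<le> real n * \<eta>" using \<eta> by (simp add: pos_divide_less_eq del: conv_pow.simps One_nat_def)
      moreover have "an r \<le> real m * an 1"
        by (rule order_trans[OF an_le mult_right_mono[OF _ an_nonneg]]) (use nqr(2) in simp)
      ultimately show "an r \<le> real n * \<eta>" by linarith
    qed
    also have "\<dots> = 2 * real n * \<eta>" by simp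
    finally show "measure_pmf.expectation (conv_pow \<mu> n) ?f \<le> 2 * real n * \<eta>" .
  qed
qed

text \<open>The normalised cocycle minus \<open>lyap\<close> has mean zero, so the mean of its
  absolute value is twice that of its positive part; a bound from above, by the log norm, is
  therefore enough.\<close>

lemma coc_L1: "(\<lambda>n. \<integral>z. \<bar>coc n z / real n - lyap\<bar> \<partial>MM) \<longlonglongrightarrow> 0"
proof (rule LIMSEQ_I)
  interpret M: prob_space MM by (rule prob_space_MM)
  fix r :: real assume r: "0 < r"
  \<comment> \<open>The positive part will have mean at most \<open>4 * \<eta>\<close>, so the
    absolute value has mean at most half of \<open>r\<close>.\<close>
  define \<eta> where "\<eta> = r / 16"
  have \<eta>: "0 < \<eta>" using r by (simp add: \<eta>_def)
  obtain N where N: "\<And>n. N \<le> n \<Longrightarrow> measure_pmf.expectation (conv_pow \<mu> n) (\<lambda>g. max 0 (lnorm g - real n * (lyap + 2 * \<eta>))) \<le> 2 * real n * \<eta>"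
    using excess_bound[OF \<eta>] by blast
  show "\<exists>N. \<forall>n\<ge>N. norm ((\<integral>z. \<bar>coc n z / real n - lyap\<bar> \<partial>MM) - 0) < r"
  proof (intro exI[of _ "max 1 N"] allI impI)
    fix n assume n: "max 1 N \<le> n"
    have np: "0 < real n" using n by simp
    let ?X = "\<lambda>z. coc n z / real n - lyap"
    let ?f = "\<lambda>g. max 0 (lnorm g - real n * (lyap + 2 * \<eta>))"
    have Xi: "integrable MM ?X" using integrable_coc[of n] by simp
    have mi: "integrable MM (\<lambda>z. max 0 (?X z))" using Xi by simp
    have X0: "(\<integral>z. ?X z \<partial>MM) = 0" using integrable_coc[of n] np M.prob_space by (simp add: integral_coc)
    have fi: "integrable (measure_pmf (conv_pow \<mu> n)) ?f" using integrable_conv[of n] by simp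
    note fM = integrable_lw_MM[of n ?f, OF fi]
    have "(\<integral>z. max 0 (?X z) \<partial>MM) \<le> (\<integral>z. 2 * \<eta> + ?f (lw (fst z) n) / real n \<partial>MM)"
    proof (rule integral_mono[OF mi])
      show "integrable MM (\<lambda>z. 2 * \<eta> + ?f (lw (fst z) n) / real n)" using fM by simp
      fix z assume z: "z \<in> space MM"
      have "coc n z / real n \<le> lnorm (lw (fst z) n) / real n" using coc_le[OF z, of n] np by (intro divide_right_mono) auto
      moreover have "lnorm (lw (fst z) n) / real n = (lnorm (lw (fst z) n) - real n * (lyap + 2 * \<eta>)) / real n + lyap + 2 * \<eta>"
        using np by (simp add: field_simps)
      moreover have "(lnorm (lw (fst z) n) - real n * (lyap + 2 * \<eta>)) / real n \<le> ?f (lw (fst z) n) / real n"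
        using np by (intro divide_right_mono) auto
      moreover have "0 \<le> ?f (lw (fst z) n) / real n" by simp
      ultimately show "max 0 (?X z) \<le> 2 * \<eta> + ?f (lw (fst z) n) / real n" using \<eta> by linarith
    qed
    also have "\<dots> = 2 * \<eta> + measure_pmf.expectation (conv_pow \<mu> n) ?f / real n"
      using fM M.prob_space integral_lw_MM[of n ?f, OF fi] by simp
    also have "\<dots> \<le> 2 * \<eta> + 2 * \<eta>"
      using N[of n] n np by (intro add_left_mono) (auto simp: pos_divide_le_eq mult_ac)
    finally have le: "(\<integral>z. max 0 (?X z) \<partial>MM) \<le> 4 * \<eta>" by simp
    have "(\<integral>z. \<bar>?X z\<bar> \<partial>MM) = (\<integral>z. 2 * max 0 (?X z) - ?X z \<partial>MM)"
      by (rule Bochner_Integration.integral_cong) (auto simp: max_def)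
    also have "\<dots> = 2 * (\<integral>z. max 0 (?X z) \<partial>MM)"
      using Bochner_Integration.integral_diff[OF integrable_mult_right[OF mi, of 2] Xi] X0 by simp
    also have "\<dots> < r" using le r unfolding \<eta>_def by linarith
    finally have "(\<integral>z. \<bar>?X z\<bar> \<partial>MM) < r" .
    moreover have "0 \<le> (\<integral>z. \<bar>?X z\<bar> \<partial>MM)" by (rule integral_nonneg_AE) simp
    ultimately show "norm ((\<integral>z. \<bar>?X z\<bar> \<partial>MM) - 0) < r" by simp
  qed
qed

lemma AE_coc: "AE \<omega> in Om. AE x in nu. (\<lambda>n. sigma_coc absv (lw \<omega> n) x / real n) \<longlonglongrightarrow> lyap"
proof -
  interpret P: pair_prob_space Om nu by (rule pair_Om_nu)
  have b: "(\<Sum>i<n. coc 1 ((skew ^^ i) z)) = coc n z" if "z \<in> space MM" for n z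
  proof -
    have "snd z \<in> P1an absv" using that by (auto simp: space_MM)
    from coc_birkhoff[OF this, where n=n and \<omega>="fst z"] show ?thesis by simp
  qed
  have "(\<integral>z. \<bar>(\<Sum>i<n. coc 1 ((skew ^^ i) z)) / real n - lyap\<bar> \<partial>MM) = (\<integral>z. \<bar>coc n z / real n - lyap\<bar> \<partial>MM)" for n
    by (rule Bochner_Integration.integral_cong) (simp_all only: b)
  then have "(\<lambda>n. \<integral>z. \<bar>(\<Sum>i<n. coc 1 ((skew ^^ i) z)) / real n - lyap\<bar> \<partial>MM) \<longlonglongrightarrow> 0" using coc_L1 by (simp only:)
  from ergodic_average_AE[OF prob_space_MM measurable_skew distr_skew integrable_coc this]
  have "AE z in MM. (\<lambda>n. (\<Sum>i<n. coc 1 ((skew ^^ i) z)) / real n) \<longlonglongrightarrow> lyap" .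
  then have "AE z in MM. (\<lambda>n. coc n z / real n) \<longlonglongrightarrow> lyap"
    by (rule AE_mp) (rule AE_I2, simp only: b, blast)
  then have "AE z in Om \<Otimes>\<^sub>M nu. (\<lambda>n. coc n z / real n) \<longlonglongrightarrow> lyap" by (simp only: MM_def)
  from P.AE_pair[OF this] show ?thesis by (simp add: coc_def)
qed

end

text \<open>Carries almost sure statements from coded sequences back to sequences of matrices; the
  two laws are compared on cylinders.\<close>

lemma (in ne_walk) distr_PiM_code:
  "(\<lambda>\<omega> i. to_nat_on (set_pmf \<mu>) (\<omega> i)) \<in> (\<Pi>\<^sub>M i\<in>(UNIV::nat set). measure_pmf \<mu>) \<rightarrow>\<^sub>M Om"
  "distr (\<Pi>\<^sub>M i\<in>(UNIV::nat set). measure_pmf \<mu>) Om (\<lambda>\<omega> i. to_nat_on (set_pmf \<mu>) (\<omega> i)) = Om"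
proof -
  let ?t = "to_nat_on (set_pmf \<mu>)"
  let ?P = "\<Pi>\<^sub>M i\<in>(UNIV::nat set). measure_pmf \<mu>"
  interpret C: product_prob_space "\<lambda>_::nat. measure_pmf code" UNIV by unfold_locales
  interpret G: product_prob_space "\<lambda>_::nat. measure_pmf \<mu>" UNIV by unfold_locales
  have t: "?t \<in> measure_pmf \<mu> \<rightarrow>\<^sub>M measure_pmf code" by simp
  show m: "(\<lambda>\<omega> i. ?t (\<omega> i)) \<in> ?P \<rightarrow>\<^sub>M Om" unfolding Om_def
  proof (rule measurable_PiM_single')
    fix i :: nat
    have "(\<lambda>\<omega>. \<omega> i) \<in> ?P \<rightarrow>\<^sub>M measure_pmf \<mu>" by (rule measurable_component_singleton) simp
    from measurable_compose[OF this t] show "(\<lambda>\<omega>. ?t (\<omega> i)) \<in> ?P \<rightarrow>\<^sub>M measure_pmf code" .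
  qed (simp add: space_PiM)
  show "distr ?P Om (\<lambda>\<omega> i. ?t (\<omega> i)) = Om"
    unfolding Om_def
  proof (rule C.PiM_eq)
    fix J :: "nat set" and F :: "nat \<Rightarrow> nat set"
    assume J: "finite J" "J \<subseteq> UNIV" and F: "\<And>j. j \<in> J \<Longrightarrow> F j \<in> sets (measure_pmf code)"
    let ?E = "prod_emb UNIV (\<lambda>_. measure_pmf code) J (Pi\<^sub>E J F)"
    have E: "?E \<in> sets (Pi\<^sub>M UNIV (\<lambda>_. measure_pmf code))" using J F by (intro sets_PiM_I) auto
    have "(\<lambda>\<omega> i. ?t (\<omega> i)) -` ?E \<inter> space ?P = prod_emb UNIV (\<lambda>_. measure_pmf \<mu>) J (Pi\<^sub>E J (\<lambda>j. ?t -` F j))"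
      by (auto simp: prod_emb_def space_PiM PiE_iff)
    then have "emeasure (distr ?P (Pi\<^sub>M UNIV (\<lambda>_. measure_pmf code)) (\<lambda>\<omega> i. ?t (\<omega> i))) ?E
      = emeasure ?P (prod_emb UNIV (\<lambda>_. measure_pmf \<mu>) J (Pi\<^sub>E J (\<lambda>j. ?t -` F j)))"
      using m E unfolding Om_def by (subst emeasure_distr) auto
    also have "\<dots> = (\<Prod>j\<in>J. emeasure (measure_pmf \<mu>) (?t -` F j))" using J by (intro G.emeasure_PiM_emb) auto
    also have "\<dots> = (\<Prod>j\<in>J. emeasure (measure_pmf code) (F j))" by (simp add: code_def)
    finally show "emeasure (distr ?P (Pi\<^sub>M UNIV (\<lambda>_. measure_pmf code)) (\<lambda>\<omega> i. ?t (\<omega> i))) ?E = (\<Prod>j\<in>J. emeasure (measure_pmf code) (F j))" .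
  qed simp
qed

text \<open>Almost every sequence of matrices has all its terms in the countable support, where
  decoding inverts the code.\<close>

lemma (in ne_walk_moment) AE_lwalk:
  "AE \<omega> in (\<Pi>\<^sub>M i\<in>(UNIV::nat set). measure_pmf \<mu>). AE v in nu. (\<lambda>n. sigma_coc absv (lwalk \<omega> n) v / real n) \<longlonglongrightarrow> lyap"
proof -
  let ?t = "to_nat_on (set_pmf \<mu>)"
  let ?P = "\<Pi>\<^sub>M i\<in>(UNIV::nat set). measure_pmf \<mu>"
  have "AE \<omega> in distr ?P Om (\<lambda>\<omega> i. ?t (\<omega> i)). AE x in nu. (\<lambda>n. sigma_coc absv (lw \<omega> n) x / real n) \<longlonglongrightarrow> lyap"
    unfolding distr_PiM_code(2) by (rule AE_coc)
  from AE_distrD[OF distr_PiM_code(1) this]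
  have 1: "AE \<omega> in ?P. AE x in nu. (\<lambda>n. sigma_coc absv (lw (\<lambda>i. ?t (\<omega> i)) n) x / real n) \<longlonglongrightarrow> lyap" .
  have "AE \<omega> in ?P. \<omega> i \<in> set_pmf \<mu>" for i
    by (rule AE_PiM_component) (auto simp: AE_measure_pmf_iff measure_pmf.prob_space_axioms)
  then have 2: "AE \<omega> in ?P. \<forall>i. \<omega> i \<in> set_pmf \<mu>" by (simp add: AE_all_countable)
  from 1 2 show ?thesis
  proof eventually_elim
    case (elim \<omega>)
    have "incr (?t (\<omega> i)) = \<omega> i" for i
      unfolding incr_def by (rule from_nat_into_to_nat_on[OF countable_set_pmf]) (use elim(2) in blast)
    then have "lw (\<lambda>i. ?t (\<omega> i)) n = lwalk \<omega> n" for n unfolding lw_def by simp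
    then show ?case using elim(1) by simp
  qed
qed

theorem theorem3p1:
  fixes absv :: "'k::field \<Rightarrow> real" and \<mu> :: "'k mat2 pmf"
  assumes "nonarch_abs absv" and "nontrivial_abs absv" and "complete_abs absv"
    and "set_pmf \<mu> \<subseteq> SL2"
    and "non_elementary absv (gen_group (set_pmf \<mu>))"
  shows "\<exists>\<nu>. stationary absv \<mu> \<nu> \<and> (\<forall>\<nu>'. stationary absv \<mu> \<nu>' \<longrightarrow> \<nu>' = \<nu>) \<and>
     (\<forall>x\<in>P1an absv. emeasure \<nu> {x} = 0) \<and>
     emeasure \<nu> (P1an absv - limit_set absv (gen_group (set_pmf \<mu>))) = 0 \<and>
     (AE v in \<nu>. v \<in> P1k absv) \<and>
     ((\<integral>\<^sup>+ g. ennreal (ln (mat2_norm absv g)) \<partial>measure_pmf \<mu>) < \<infinity> \<longrightarrow>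
       (\<exists>lyap::real. lyap > 0 \<and>
          (\<lambda>n. (1 / real n) * measure_pmf.expectation (conv_pow \<mu> n) (\<lambda>g. ln (mat2_norm absv g)))
             \<longlonglongrightarrow> lyap \<and>
          lyap = (\<integral>v. measure_pmf.expectation \<mu> (\<lambda>g. sigma_coc absv g v) \<partial>\<nu>) \<and>
          (AE \<omega> in (\<Pi>\<^sub>M i\<in>(UNIV::nat set). measure_pmf \<mu>).
             AE v in \<nu>. (\<lambda>n. sigma_coc absv (lwalk \<omega> n) v / real n) \<longlonglongrightarrow> lyap)))"
proof -
  interpret W: ne_walk absv \<mu> by unfold_locales (fact assms)+
  have moment_part: "\<exists>lyap::real. lyap > 0 \<and>
      (\<lambda>n. (1 / real n) * measure_pmf.expectation (conv_pow \<mu> n) (\<lambda>g. ln (mat2_norm absv g))) \<longlonglongrightarrow> lyap \<and>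
      lyap = (\<integral>v. measure_pmf.expectation \<mu> (\<lambda>g. sigma_coc absv g v) \<partial>W.nu) \<and>
      (AE \<omega> in (\<Pi>\<^sub>M i\<in>(UNIV::nat set). measure_pmf \<mu>).
         AE v in W.nu. (\<lambda>n. sigma_coc absv (lwalk \<omega> n) v / real n) \<longlonglongrightarrow> lyap)"
    if fin: "(\<integral>\<^sup>+ g. ennreal (ln (mat2_norm absv g)) \<partial>measure_pmf \<mu>) < \<infinity>"
  proof -
    \<comment> \<open>The log norm is nonnegative on \<open>SL2\<close>, so \<open>ennreal\<close>
      cuts nothing off and finiteness of the integral amounts to integrability.\<close>
    have "(\<integral>\<^sup>+ g. ennreal (norm (ln (mat2_norm absv g))) \<partial>measure_pmf \<mu>) = (\<integral>\<^sup>+ g. ennreal (ln (mat2_norm absv g)) \<partial>measure_pmf \<mu>)"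
    proof (rule nn_integral_cong_AE, unfold AE_measure_pmf_iff, rule ballI)
      fix g assume "g \<in> set_pmf \<mu>"
      then have "g \<in> SL2" using assms(4) by blast
      from W.lnorm_nonneg[OF this] show "ennreal (norm (ln (mat2_norm absv g))) = ennreal (ln (mat2_norm absv g))" by simp
    qed
    then have "integrable (measure_pmf \<mu>) (\<lambda>g. ln (mat2_norm absv g))"
      using fin by (intro integrableI_bounded) simp_all
    then interpret L: ne_walk_moment absv \<mu> by unfold_locales
    have "L.lyap = (\<integral>v. measure_pmf.expectation \<mu> (\<lambda>g. sigma_coc absv g v) \<partial>W.nu)"
      using L.integral_psi[of "Suc 0"] by (simp add: L.psi_def conv_pow_1 del: conv_pow.simps)
    then show ?thesis using L.lyap_pos L.an_limit L.AE_lwalk by blast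
  qed
  show ?thesis
    by (rule exI[of _ W.nu])
       (use W.nu_stationary W.stationary_unique W.nu_no_atom W.nu_limit_set W.nu_P1k moment_part in blast)
qed

end
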